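(* Given $\gamma>0$ and $\Delta$, there exist $\beta>0$ and $n_0$ such that for all $n\ge n_0$ the following holds. Suppose that $H$ is a graph with maximum degree $\Delta(H)\le\Delta$, with bandwidth at most $\beta n$, and with a proper vertex $3$-colouring all of whose colour classes have at most $n$ vertices. Then $R(H,H)\le(9+\gamma)n$.
   Context: The Ramsey number $R(G,H)$ is the minimum $N$ such that whenever the edges of $K_N$ are coloured with red and blue, there exists either a red copy of $G$ or a blue copy of $H$ (as subgraphs). The bandwidth of a graph $G$ on $v(G)$ vertices is the smallest $k$ such that $G$ is a subgraph of $P_{v(G)}^k$, the $k$-th power of the path on $v(G)$ vertices (two vertices are adjacent in it when their distance along the path is between $1$ and $k$). *)

theory Defs
  imports Complex_Main "HOL-Library.Ramsey"
begin

record 'a sgraph =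
  verts :: "'a set"
  edges :: "'a set set"

definition finite_simple_graph :: "'a sgraph \<Rightarrow> bool" where
  "finite_simple_graph G \<longleftrightarrow> finite (verts G) \<and> edges G \<subseteq> [verts G]\<^bsup>2\<^esup>"

definition degree :: "'a sgraph \<Rightarrow> 'a \<Rightarrow> nat" where
  "degree G v = card {e \<in> edges G. v \<in> e}"

(* The inserted 0 only matters for the graph without vertices. *)
definition max_degree :: "'a sgraph \<Rightarrow> nat" where
  "max_degree G = Max (insert 0 (degree G ` verts G))"

definition proper_colouring :: "'a sgraph \<Rightarrow> nat \<Rightarrow> ('a \<Rightarrow> nat) \<Rightarrow> bool" where
  "proper_colouring G k c \<longleftrightarrow>
     (\<forall>v\<in>verts G. c v < k) \<and> (\<forall>u v. {u, v} \<in> edges G \<longrightarrow> c u \<noteq> c v)"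

(* G has a (not necessarily induced) subgraph isomorphic to F. *)
definition contains_copy :: "'b sgraph \<Rightarrow> 'a sgraph \<Rightarrow> bool" where
  "contains_copy G F \<longleftrightarrow>
     (\<exists>f. inj_on f (verts F) \<and> f ` verts F \<subseteq> verts G \<and> (\<forall>e\<in>edges F. f ` e \<in> edges G))"

definition path_power :: "nat \<Rightarrow> nat \<Rightarrow> nat sgraph" where
  "path_power m k = \<lparr>verts = {..<m}, edges = {{i, j} | i j. i < j \<and> j < m \<and> j - i \<le> k}\<rparr>"

definition bandwidth :: "'a sgraph \<Rightarrow> nat" where
  "bandwidth G = (LEAST k. contains_copy (path_power (card (verts G)) k) G)"

datatype colour = Red | Blue

(* The graph of the edges of colour i, where K_N has the vertex set {..<N}.
   Values of the colouring outside [{..<N}]^2 are irrelevant. *)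
definition colour_graph :: "nat \<Rightarrow> (nat set \<Rightarrow> colour) \<Rightarrow> colour \<Rightarrow> nat sgraph" where
  "colour_graph N c i = \<lparr>verts = {..<N}, edges = {e \<in> [{..<N}]\<^bsup>2\<^esup>. c e = i}\<rparr>"

definition arrows :: "nat \<Rightarrow> 'a sgraph \<Rightarrow> 'b sgraph \<Rightarrow> bool" where
  "arrows N G H \<longleftrightarrow>
     (\<forall>c. contains_copy (colour_graph N c Red) G \<or> contains_copy (colour_graph N c Blue) H)"

definition ramsey_number :: "'a sgraph \<Rightarrow> 'b sgraph \<Rightarrow> nat" where
  "ramsey_number G H = (LEAST N. arrows N G H)"

text \<open>For finite simple graphs both minima above are attained.\<close>

lemma bandwidth_attained:
  assumes "finite_simple_graph G"
  shows "contains_copy (path_power (card (verts G)) (bandwidth G)) G"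
proof -
  let ?m = "card (verts G)"
  have fin: "finite (verts G)" and E: "edges G \<subseteq> [verts G]\<^bsup>2\<^esup>"
    using assms by (auto simp: finite_simple_graph_def)
  obtain f where f: "bij_betw f (verts G) {..<?m}"
    using fin by (metis ex_bij_betw_finite_nat atLeast0LessThan)
  have "f ` e \<in> edges (path_power ?m ?m)" if "e \<in> edges G" for e
  proof -
    obtain x y where e: "e = {x, y}" "x \<in> verts G" "y \<in> verts G" "x \<noteq> y"
      using nsets2_E[OF subsetD[OF E \<open>e \<in> edges G\<close>]] by metis
    have xy: "f x < ?m" "f y < ?m" "f x \<noteq> f y"
      using f e by (auto simp: bij_betw_def inj_on_def)
    show ?thesis
    proof (cases "f x < f y")
      case True
      then have "f ` e = {f x, f y} \<and> f x < f y \<and> f y < ?m \<and> f y - f x \<le> ?m" using xy e(1) by simp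
      then show ?thesis unfolding path_power_def sgraph.simps by blast
    next
      case False
      then have "f ` e = {f y, f x} \<and> f y < f x \<and> f x < ?m \<and> f x - f y \<le> ?m"
        using xy e(1) by (simp add: insert_commute)
      then show ?thesis unfolding path_power_def sgraph.simps by blast
    qed
  qed
  then have "contains_copy (path_power ?m ?m) G"
    unfolding contains_copy_def using f
    by (intro exI[of _ f]) (simp add: bij_betw_def path_power_def)
  then show ?thesis unfolding bandwidth_def by (rule LeastI)
qed

lemma contains_copy_clique:
  assumes "finite_simple_graph F" "finite R" "card R = card (verts F)"
    "R \<subseteq> verts G" "[R]\<^bsup>2\<^esup> \<subseteq> edges G"
  shows "contains_copy G F"
proof -
  obtain f where f: "bij_betw f (verts F) R"
    using assms by (metis finite_simple_graph_def finite_same_card_bij)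
  have "f ` e \<in> edges G" if "e \<in> edges F" for e
  proof -
    have "e \<in> [verts F]\<^bsup>2\<^esup>"
      using assms(1) that by (auto simp: finite_simple_graph_def)
    then obtain x y where "e = {x, y}" "x \<in> verts F" "y \<in> verts F" "x \<noteq> y"
      by (rule nsets2_E)
    then have "f ` e \<in> [R]\<^bsup>2\<^esup>" using f by (auto simp: bij_betw_def inj_on_def)
    then show ?thesis using assms by blast
  qed
  then show ?thesis using f assms unfolding contains_copy_def bij_betw_def by blast
qed

lemma ramsey_number_arrows:
  assumes G: "finite_simple_graph G" and H: "finite_simple_graph H"
  shows "arrows (ramsey_number G H) G H"
proof -
  obtain r where r: "\<And>(V :: nat set) E. finite V \<Longrightarrow> r \<le> card V \<Longrightarrow>
      \<exists>R\<subseteq>V. card R = card (verts G) \<and> clique R E \<or> card R = card (verts H) \<and> indep R E"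
    using ramsey2[of "card (verts G)" "card (verts H)"] by metis
  have "arrows r G H"
    unfolding arrows_def
  proof
    fix c :: "nat set \<Rightarrow> colour"
    let ?E = "{e. c e = Red}"
    obtain R where R: "R \<subseteq> {..<r}"
      and cases: "card R = card (verts G) \<and> clique R ?E \<or> card R = card (verts H) \<and> indep R ?E"
      using r[of "{..<r}" ?E] by (metis card_lessThan finite_lessThan order_refl)
    have fin: "finite R" using R finite_subset by blast
    from cases show "contains_copy (colour_graph r c Red) G \<or> contains_copy (colour_graph r c Blue) H"
    proof
      assume *: "card R = card (verts G) \<and> clique R ?E"
      then have "[R]\<^bsup>2\<^esup> \<subseteq> edges (colour_graph r c Red)"
        using R by (auto simp: colour_graph_def clique_def elim!: nsets2_E)
      then show ?thesis
        using contains_copy_clique[OF G fin] * R by (simp add: colour_graph_def)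
    next
      assume *: "card R = card (verts H) \<and> indep R ?E"
      then have "c {x, y} = Blue" if "x \<in> R" "y \<in> R" "x \<noteq> y" for x y
        using that by (cases "c {x, y}") (auto simp: indep_def)
      then have "[R]\<^bsup>2\<^esup> \<subseteq> edges (colour_graph r c Blue)"
        using R by (auto simp: colour_graph_def elim!: nsets2_E)
      then show ?thesis
        using contains_copy_clique[OF H fin] * R by (simp add: colour_graph_def)
    qed
  qed
  then show ?thesis unfolding ramsey_number_def by (rule LeastI)
qed

end

theory Submission
  imports Defs "HOL-Library.FuncSet"
begin

text \<open>Regularize the red graph on \<open>(9 + \<gamma>) n\<close> vertices and split almost every part into triples of equal
  clusters that are pairwise dense in one colour.  In the resulting two-coloured cluster graph call two
  edges of one colour equivalent if they are linked by a chain of triangles of that colour.  By LP duality some class carries a fractional triangle packing of size almost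
  \<open>1/9\<close> of all vertices: otherwise every class has a cheap fractional cover, a bounded random
  sample of vertices sees all these covers cheap simultaneously, and a purely combinatorial inequality for
  complete two-coloured structures rules this out.  Finally cut \<open>H\<close>, in bandwidth order, into long
  intervals, send the three colour classes of an interval to the corners of a triangle drawn from the packing,
  walk between consecutive triangles inside the class, and embed greedily.\<close>

section \<open>Cheap covers of all triangle classes cannot coexist\<close>

text \<open>A packing of total weight about N/9 leaves room for N/9 vertices in every corner slot,
  enough for colour classes of size n once N slightly exceeds 9n. It must lie inside one triangle
  class because consecutive stretches of \<open>H\<close> are joined by a walk that moves one corner
  at a time, so that each colour class keeps its slot. The obstacle is that the combinatorial
  inequality wants every pair of points coloured, while some pairs of parts are dense in neither
  colour and some vertices lie in no cluster. A random sample of K vertices avoids all such defects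
  with probability at least 1/2; K is fixed before the regularity parameters, so the defects can be
  made rare enough. The class whose cover is tested depends on the sample itself, but it is
  determined by two sampled vertices, so an exponential moment bound and a union bound over pairs of
  coordinates suffice. Splitting into triples gives each point a monochromatic triangle with itself,
  so that a point always pays at least 1/3 in its own class; this seed drives all estimates of the
  first part.\<close>

lemma colour_other: "a \<noteq> b \<Longrightarrow> c \<noteq> a \<Longrightarrow> c = (b::colour)"
  by (cases a; cases b; cases c) auto

text \<open>The points are sampled vertices, \<open>\<kappa> v v\<close> being the colour inside the cluster triple of
  \<open>v\<close>, so that triangles may repeat points.  \<open>L u v\<close> is the triangle class of the pair and
  \<open>w l\<close> a fractional cover of the class \<open>l\<close>; the last assumption, that all covers are
  cheap, will turn out to be contradictory.\<close>

locale tri_core =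
  fixes V :: "'v set" and \<kappa> :: "'v \<Rightarrow> 'v \<Rightarrow> colour" and L :: "'v \<Rightarrow> 'v \<Rightarrow> 'l"
    and w :: "'l \<Rightarrow> 'v \<Rightarrow> real" and R B :: colour
  assumes fin: "finite V" and ne: "V \<noteq> {}" and RB: "R \<noteq> B"
    and ks: "\<And>u v. \<kappa> u v = \<kappa> v u" and Ls: "\<And>u v. L u v = L v u"
    and Lcol: "\<And>u v x y. \<lbrakk>u \<in> V; v \<in> V; x \<in> V; y \<in> V; L u v = L x y\<rbrakk> \<Longrightarrow> \<kappa> u v = \<kappa> x y"
    and tri: "\<And>u v x. \<lbrakk>u \<in> V; v \<in> V; x \<in> V; \<kappa> u v = \<kappa> v x; \<kappa> u x = \<kappa> v x\<rbrakk> \<Longrightarrow> L u v = L v x"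
    and w0: "\<And>l v. 0 \<le> w l v"
    and cov: "\<And>u v x. \<lbrakk>u \<in> V; v \<in> V; x \<in> V; \<kappa> u v = \<kappa> v x; \<kappa> u x = \<kappa> v x\<rbrakk> \<Longrightarrow>
               1 \<le> w (L u v) u + w (L u v) v + w (L u v) x"
    and small: "\<And>u v. \<lbrakk>u \<in> V; v \<in> V\<rbrakk> \<Longrightarrow> 9 * (\<Sum>x\<in>V. w (L u v) x) < card V"
begin

text \<open>The locale is symmetric in the two colours; interpreting it with \<open>R\<close> and
  \<open>B\<close> exchanged turns each statement about red classes into one about blue
  classes.\<close>

lemma swap: "tri_core V \<kappa> L w B R"
  by (rule tri_core.intro)
    (rule fin ne RB[symmetric] ks Ls w0 | rule Lcol tri cov small; assumption)+

text \<open>Sizes are normalized so that the whole set has measure 9 and covers are compared with 1.\<close>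

definition m :: "'v set \<Rightarrow> real" where "m S = 9 * card S / card V"
definition I :: "('v \<Rightarrow> real) \<Rightarrow> 'v set \<Rightarrow> real" where "I f S = 9 * (\<Sum>x\<in>S. f x) / card V"
definition C :: "colour \<Rightarrow> 'l \<Rightarrow> 'v set" where "C k l = {v \<in> V. \<kappa> v v = k \<and> L v v = l}"
definition Al :: "colour \<Rightarrow> 'v set" where "Al k = {v \<in> V. \<kappa> v v = k}"

section \<open>Normalized sizes and integrals\<close>

lemma cardV: "0 < real (card V)" using fin ne by (simp add: card_gt_0_iff)

lemma notR: "c \<noteq> R \<longleftrightarrow> c = B" using RB colour_other by blast
lemma notB: "c \<noteq> B \<longleftrightarrow> c = R" using RB colour_other by blast

lemma C_sub: "C k l \<subseteq> Al k" "Al k \<subseteq> V" "C k l \<subseteq> V" by (auto simp: C_def Al_def)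

lemma m_nonneg: "0 \<le> m S" by (simp add: m_def)
lemma m_V: "m V = 9" using cardV by (simp add: m_def)
lemma m_empty: "m {} = 0" by (simp add: m_def)
lemma m_mono: "S \<subseteq> T \<Longrightarrow> T \<subseteq> V \<Longrightarrow> m S \<le> m T"
  unfolding m_def using fin by (intro divide_right_mono mult_left_mono)
    (auto intro: card_mono finite_subset)
lemma m_Un: "S \<subseteq> V \<Longrightarrow> T \<subseteq> V \<Longrightarrow> S \<inter> T = {} \<Longrightarrow> m (S \<union> T) = m S + m T"
  unfolding m_def using finite_subset[OF _ fin] by (simp add: card_Un_disjoint add_divide_distrib)
lemma m_diff: "T \<subseteq> S \<Longrightarrow> S \<subseteq> V \<Longrightarrow> m (S - T) = m S - m T"
  using m_Un[of "S - T" T] by (simp add: Un_absorb2 Diff_Int_distrib2 subset_trans[of T S V] subset_trans[of "S - T" S V] Int_commute)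
lemma m_diff_ge: "S \<subseteq> V \<Longrightarrow> T \<subseteq> V \<Longrightarrow> m S - m T \<le> m (S - T)"
  using m_diff[of "S \<inter> T" S] m_mono[of "S \<inter> T" T] by (simp add: Diff_Int)
lemma m_Un_le: "S \<subseteq> V \<Longrightarrow> T \<subseteq> V \<Longrightarrow> m (S \<union> T) \<le> m S + m T"
  using m_diff_ge[of "S \<union> T" T] m_mono[of "S \<union> T - T" S] by force
lemma m_pos_ne: "0 < m S \<Longrightarrow> S \<noteq> {}" by (auto simp: m_empty)

lemma I_nonneg: "(\<And>x. x \<in> S \<Longrightarrow> 0 \<le> f x) \<Longrightarrow> 0 \<le> I f S"
  by (simp add: I_def sum_nonneg)
lemma I_Un: "S \<subseteq> V \<Longrightarrow> T \<subseteq> V \<Longrightarrow> S \<inter> T = {} \<Longrightarrow> I f (S \<union> T) = I f S + I f T"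
  unfolding I_def using finite_subset[OF _ fin]
  by (simp add: sum.union_disjoint add_divide_distrib distrib_left)
lemma I_mono: "S \<subseteq> T \<Longrightarrow> T \<subseteq> V \<Longrightarrow> I (w l) S \<le> I (w l) T"
  unfolding I_def using finite_subset[OF _ fin] w0
  by (intro divide_right_mono mult_left_mono sum_mono2) auto
lemma I_ge: "S \<subseteq> V \<Longrightarrow> (\<And>x. x \<in> S \<Longrightarrow> c \<le> f x) \<Longrightarrow> c * m S \<le> I f S"
proof -
  assume S: "S \<subseteq> V" and c: "\<And>x. x \<in> S \<Longrightarrow> c \<le> f x"
  have "(\<Sum>x\<in>S. c) \<le> (\<Sum>x\<in>S. f x)" using c by (intro sum_mono) auto
  then have "9 * (c * card S) \<le> 9 * (\<Sum>x\<in>S. f x)" by (simp add: mult.commute)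
  then show ?thesis using cardV by (simp add: m_def I_def divide_right_mono mult.left_commute)
qed
lemma I_small: "u \<in> V \<Longrightarrow> v \<in> V \<Longrightarrow> I (w (L u v)) V < 1"
  using small[of u v] cardV by (simp add: I_def)

lemma I_disjoint2: "S \<subseteq> V \<Longrightarrow> T \<subseteq> V \<Longrightarrow> S \<inter> T = {} \<Longrightarrow> I (w l) S + I (w l) T \<le> I (w l) V"
  using I_Un[of S T] I_mono[of "S \<union> T" V] by simp
lemma I_disjoint3: "S \<subseteq> V \<Longrightarrow> T \<subseteq> V \<Longrightarrow> U \<subseteq> V \<Longrightarrow> S \<inter> T = {} \<Longrightarrow> (S \<union> T) \<inter> U = {} \<Longrightarrow>
   I (w l) S + I (w l) T + I (w l) U \<le> I (w l) V"
  using I_disjoint2[of "S \<union> T" U l] by (simp add: I_Un)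
lemma I_disjoint4: "S \<subseteq> V \<Longrightarrow> T \<subseteq> V \<Longrightarrow> U \<subseteq> V \<Longrightarrow> W \<subseteq> V \<Longrightarrow> S \<inter> T = {} \<Longrightarrow> (S \<union> T) \<inter> U = {} \<Longrightarrow> (S \<union> T \<union> U) \<inter> W = {} \<Longrightarrow>
   I (w l) S + I (w l) T + I (w l) U + I (w l) W \<le> I (w l) V"
  using I_disjoint3[of "S \<union> T" U W l] by (simp add: I_Un)

lemma argmin: "finite S \<Longrightarrow> S \<noteq> {} \<Longrightarrow> \<exists>x\<in>S. \<forall>y\<in>S. f x \<le> (f y :: real)"
  using arg_min_if_finite[of S f] by (metis not_le)

lemma finV: "S \<subseteq> V \<Longrightarrow> finite S" using fin finite_subset by blast

lemma argminV: "S \<subseteq> V \<Longrightarrow> S \<noteq> {} \<Longrightarrow> \<exists>x\<in>S. \<forall>y\<in>S. f x \<le> (f y :: real)"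
  using argmin finV by blast

section \<open>Points whose loop triangles share a class\<close>

lemma loop3: "v \<in> C k l \<Longrightarrow> 1/3 \<le> w l v"
  using cov[of v v v] by (simp add: C_def)
lemma edge_loop: "v \<in> C k l \<Longrightarrow> u \<in> V \<Longrightarrow> \<kappa> v u = k \<Longrightarrow> L v u = l"
  using tri[of v v u] by (auto simp: C_def)
lemma cov_loop: "v \<in> C k l \<Longrightarrow> u \<in> V \<Longrightarrow> \<kappa> v u = k \<Longrightarrow> 1 \<le> 2 * w l v + w l u"
  using cov[of v v u] by (auto simp: C_def)
lemma I_C: "v \<in> C k l \<Longrightarrow> I (w l) V < 1"
  using I_small[of v v] by (auto simp: C_def)
text \<open>An edge of colour \<open>k\<close> would form degenerate triangles with the loop at
  either end, and so would have to carry both loop classes.\<close>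

lemma cross_other: "u \<in> C k l \<Longrightarrow> v \<in> C k l' \<Longrightarrow> l \<noteq> l' \<Longrightarrow> \<kappa> u v \<noteq> k"
  using edge_loop[of u k l v] edge_loop[of v k l' u] ks Ls by (auto simp: C_def)
lemma crossR: "u \<in> C R l \<Longrightarrow> v \<in> C R l' \<Longrightarrow> l \<noteq> l' \<Longrightarrow> \<kappa> u v = B"
  using cross_other notR by blast
lemma C_disj: "(k,l) \<noteq> (k',l') \<Longrightarrow> C k l \<inter> C k' l' = {}" by (auto simp: C_def)

text \<open>Each point of the set pays at least 1/3 for its own degenerate triangle, while the whole
  cover costs less than 1.\<close>

lemma C_lt3: "m (C k l) < 3"
proof (cases "C k l = {}")
  case False
  then obtain v where v: "v \<in> C k l" by blast
  have "1/3 * m (C k l) \<le> I (w l) (C k l)" using C_sub loop3 by (intro I_ge) auto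
  also have "\<dots> \<le> I (w l) V" using C_sub by (intro I_mono) auto
  also have "\<dots> < 1" using I_C v by blast
  finally show ?thesis by simp
qed (simp add: m_empty)

text \<open>The witness is the point where the cover of the class is cheapest, with value \<alpha>.
  The class pays at least \<alpha> per unit and each red neighbour in \<open>Al B\<close> at least 1
  - 2\<alpha>. For a class of size at least 2 the resulting bound is worst at \<alpha> =
  1/3.\<close>

lemma big_vertex:
  assumes "2 \<le> m (C R l)"
  shows "\<exists>x\<in>C R l. m {u \<in> Al B. \<kappa> x u = R} < 3 - m (C R l)"
proof -
  let ?a = "m (C R l)"
  have "C R l \<noteq> {}" using assms m_pos_ne[of "C R l"] by linarith
  then obtain x where x: "x \<in> C R l" "\<forall>y\<in>C R l. w l x \<le> w l y" using argminV[OF C_sub(3)] by metis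
  let ?T = "{u \<in> Al B. \<kappa> x u = R}" and ?\<alpha> = "w l x"
  have a: "1/3 \<le> ?\<alpha>" using loop3 x by blast
  have T: "?T \<subseteq> V" using C_sub by blast
  have d: "C R l \<inter> ?T = {}" using RB by (auto simp: C_def Al_def)
  have 1: "?\<alpha> * ?a \<le> I (w l) (C R l)" using x C_sub by (intro I_ge) auto
  have 2: "(1 - 2 * ?\<alpha>) * m ?T \<le> I (w l) ?T" using cov_loop[OF x(1)] T by (intro I_ge) force+
  have 3: "?\<alpha> * ?a + (1 - 2 * ?\<alpha>) * m ?T < 1"
    using 1 2 I_disjoint2[OF C_sub(3) T d, of l] I_C[OF x(1)] by linarith
  have le: "?\<alpha> < 1/2"
  proof (rule ccontr)
    assume "\<not> ?\<alpha> < 1/2"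
    then have "2 * (1/2) \<le> ?a * ?\<alpha>" using assms by (intro mult_mono) auto
    moreover have "I (w l) (C R l) < 1" using I_C[OF x(1)] I_mono[of "C R l" V l] C_sub by simp
    ultimately show False using 1 by (simp add: mult.commute)
  qed
  \<comment> \<open>The product equals
    \<open>(3 - ?a) * (1 - 2 * ?\<alpha>) - (1 - ?\<alpha> * ?a)\<close>; size at least 2 makes both
    factors nonpositive.\<close>
  have "0 \<le> (2 - ?a) * (1 - 3 * ?\<alpha>)" using assms a by (intro mult_nonpos_nonpos) auto
  then have "(3 - ?a) * (1 - 2 * ?\<alpha>) \<ge> 1 - ?\<alpha> * ?a" by (simp add: algebra_simps)
  then have "(1 - 2 * ?\<alpha>) * m ?T < (1 - 2 * ?\<alpha>) * (3 - ?a)" using 3 by (simp add: mult.commute)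
  then have "m ?T < 3 - ?a" using le by (simp add: mult_less_cancel_left_pos)
  then show ?thesis using x by blast
qed

text \<open>Red edges between the two classes make the red cover dearer, blue edges the blue one. If
  r is the red density between them, averaging gives a(1/3 + r/6) < 1 and b(1/3 + (1 - r)/6) < 1.
  Hence 1/a + 1/b > 5/6, which is impossible for a, b at least 2 with a + b at least 5.\<close>

lemma pair_lt5: "m (C R l) + m (C B l') < 5"
proof (rule ccontr)
  assume "\<not> ?thesis"
  moreover have lt3: "m (C R l) < 3" "m (C B l') < 3" using C_lt3 by auto
  ultimately have ab: "m (C R l) + m (C B l') \<ge> 5" "m (C R l) \<ge> 2" "m (C B l') \<ge> 2" by linarith+
  define X Z where "X = C R l" and "Z = C B l'"
  define a b where "a = m X" and "b = m Z"
  have ab: "a + b \<ge> 5" "a \<ge> 2" "b \<ge> 2" "a < 3" "b < 3" using ab lt3 by (auto simp: a_def b_def X_def Z_def)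
  have sub: "X \<subseteq> V" "Z \<subseteq> V" "X \<inter> Z = {}" using C_sub RB by (auto simp: X_def Z_def C_def)
  have ne: "X \<noteq> {}" "Z \<noteq> {}" using m_pos_ne[of X] m_pos_ne[of Z] ab by (auto simp: a_def b_def)
  have cp: "0 < real (card X)" "0 < real (card Z)" using ne finV sub by (auto simp: card_gt_0_iff)
  define red where "red x z = (if \<kappa> x z = R then 1 else (0::real))" for x z
  define r where "r = (\<Sum>x\<in>X. \<Sum>z\<in>Z. red x z) / (card X * card Z)"
  have gen: "p * (1/3 + q/6) < 1"
    if p: "p = m X1" and r': "q = (\<Sum>x\<in>X1. \<Sum>z\<in>Z1. f x z) / (card X1 * card Z1)"
     and pq: "p \<le> 2 * m Z1" and s: "X1 \<subseteq> V" "Z1 \<subseteq> V" "X1 \<inter> Z1 = {}"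
     and c: "0 < real (card X1)" "0 < real (card Z1)"
     and f: "\<And>x z. x \<in> X1 \<Longrightarrow> z \<in> Z1 \<Longrightarrow> f x z = 0 \<or> f x z = 1 \<and> 1 \<le> 2 * w k x + w k z"
     and th: "\<And>x. x \<in> X1 \<Longrightarrow> 1/3 \<le> w k x" and sm: "I (w k) V < 1" for p q X1 Z1 f k
  proof -
    define b where "b = m Z1"
    have p0: "0 \<le> p" "0 \<le> b" using p m_nonneg b_def by auto
    \<comment> \<open>Pointwise form before averaging over pairs: for an edge of the colour at hand,
      p/2 times \<open>2 * w k x + w k z \<ge> 1\<close> is used, and this fits because z has weight
      b, which is at least p/2.\<close>
    have pt: "p * w k x + b * w k z \<ge> p/3 + f x z * (p/6)" if xz: "x \<in> X1" "z \<in> Z1" for x z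
    proof (cases "f x z = 0")
      case True
      have "p * (1/3) \<le> p * w k x" using th xz p0 by (intro mult_left_mono) auto
      moreover have "0 \<le> b * w k z" using p0 w0 by simp
      ultimately show ?thesis using True by simp
    next
      case False
      then have h: "f x z = 1" "1 \<le> 2 * w k x + w k z" using f xz by blast+
      have "p/2 * 1 \<le> p/2 * (2 * w k x + w k z)" using h p0 by (intro mult_left_mono) auto
      moreover have "p/2 * w k z \<le> b * w k z" using pq w0 by (intro mult_right_mono) (auto simp: b_def)
      ultimately show ?thesis using h by (simp add: algebra_simps)
    qed
    let ?s = "\<Sum>x\<in>X1. \<Sum>z\<in>Z1. p * w k x + b * w k z"
    have "(\<Sum>x\<in>X1. \<Sum>z\<in>Z1. p/3 + f x z * (p/6)) \<le> ?s" using pt by (intro sum_mono) auto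
    moreover have "(\<Sum>x\<in>X1. \<Sum>z\<in>Z1. p/3 + f x z * (p/6)) = card X1 * card Z1 * (p * (1/3 + q/6))"
      using c by (simp add: sum.distrib sum_distrib_right[symmetric] sum_divide_distrib[symmetric] r' field_simps)
        (simp add: sum_distrib_left)
    moreover have "?s = card X1 * card Z1 * (I (w k) X1 + I (w k) Z1)"
      by (simp add: sum.distrib sum_distrib_left[symmetric] p b_def m_def I_def)
        (simp add: sum_distrib_left sum_distrib_right sum_divide_distrib field_simps)
    ultimately have "p * (1/3 + q/6) \<le> I (w k) X1 + I (w k) Z1" using c by simp
    then show ?thesis using I_disjoint2[OF s, of k] sm by linarith
  qed
  have g1: "a * (1/3 + r/6) < 1"
  proof (rule gen[where ?Z1.0 = Z and f = red and k = l])
    show "\<And>x z. x \<in> X \<Longrightarrow> z \<in> Z \<Longrightarrow> red x z = 0 \<or> red x z = 1 \<and> 1 \<le> 2 * w l x + w l z"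
      using cov_loop sub by (auto simp: red_def X_def)
  qed (use ab sub cp ne I_C loop3 in \<open>auto simp: a_def b_def r_def X_def Z_def\<close>)
  define blu where "blu z x = 1 - red x z" for x z
  have sw: "(\<Sum>z\<in>Z. \<Sum>x\<in>X. red x z) = (\<Sum>x\<in>X. \<Sum>z\<in>Z. red x z)" by (rule sum.swap)
  have q: "1 - r = (\<Sum>z\<in>Z. \<Sum>x\<in>X. blu z x) / (card Z * card X)"
    using cp by (simp add: blu_def sum_subtractf r_def sw field_simps)
  have g2: "b * (1/3 + (1 - r)/6) < 1"
  proof (rule gen[where ?X1.0 = Z and ?Z1.0 = X and f = blu and k = l'])
    show "\<And>x z. x \<in> Z \<Longrightarrow> z \<in> X \<Longrightarrow> blu x z = 0 \<or> blu x z = 1 \<and> 1 \<le> 2 * w l' x + w l' z"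
      using cov_loop[of _ B l'] sub ks notR by (auto simp: red_def blu_def Z_def)
  qed (use ab sub cp ne I_C loop3 q in \<open>auto simp: a_def b_def X_def Z_def\<close>)
  have p1: "1/3 + r/6 < 1/a" "1/3 + (1 - r)/6 < 1/b" using g1 g2 ab by (simp_all add: field_simps)
  have "(1/3 + r/6) + (1/3 + (1 - r)/6) < 1/a + 1/b" using p1 by (rule add_strict_mono)
  then have "5/6 < 1/a + 1/b" by (simp add: diff_divide_distrib)
  then have "5 * (a * b) < 6 * (a + b)" using ab by (simp add: field_simps)
  moreover have "0 \<le> (a - 2) * (b - 2)" using ab by simp
  ultimately show False using ab by (simp add: algebra_simps)
qed

section \<open>The multipartite structure of the loop classes\<close>

definition labs :: "colour \<Rightarrow> 'l set" where "labs k = (\<lambda>v. L v v) ` Al k"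

lemma labs_ne: "l \<in> labs k \<longleftrightarrow> C k l \<noteq> {}" by (auto simp: labs_def C_def Al_def)
lemma fin_labs: "finite (labs k)" using finV C_sub by (simp add: labs_def)
lemma Al_C: "v \<in> Al k \<Longrightarrow> v \<in> C k (L v v)" by (auto simp: C_def Al_def)
lemma C_Al: "v \<in> C k l \<Longrightarrow> v \<in> Al k \<and> v \<in> V \<and> L v v = l" by (auto simp: C_def Al_def)

lemma third: 
  assumes "card (labs k) \<ge> 3" shows "\<exists>l\<in>labs k. l \<noteq> i \<and> l \<noteq> j"
proof (rule ccontr)
  assume "\<not> ?thesis"
  then have "labs k \<subseteq> {i,j}" by blast
  then have "card (labs k) \<le> card {i,j}" by (intro card_mono) auto
  also have "\<dots> \<le> 2" by (simp add: card_insert_if)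
  finally show False using assms by simp
qed

text \<open>Points of three different red classes span a blue triangle. So the blue edges between
  red classes form a complete multipartite graph with at least three parts, and such a graph is
  connected through its triangles.\<close>

lemma cross_label:
  assumes p: "card (labs R) \<ge> 3"
  shows "\<exists>cb. \<forall>x\<in>Al R. \<forall>y\<in>Al R. L x x \<noteq> L y y \<longrightarrow> L x y = cb"
proof -
  have bl: "\<kappa> x y = B" if "x \<in> Al R" "y \<in> Al R" "L x x \<noteq> L y y" for x y
    using crossR Al_C that by blast
  have H0: "L x y = L x y'" if "x \<in> Al R" "y \<in> Al R" "y' \<in> Al R" "L x x \<noteq> L y y" "L x x \<noteq> L y' y'" "L y y \<noteq> L y' y'" for x y y'
    using tri[of y x y'] bl[of y x] bl[of x y'] bl[of y y'] that C_sub Ls by (metis subset_iff)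
  have th: "\<exists>z\<in>Al R. L z z \<noteq> i \<and> L z z \<noteq> j" for i j
    using third[OF p, of i j] by (auto simp: labs_def)
  \<comment> \<open>If y and y' lie in the same class, the comparison goes through a point of a
    third class.\<close>
  have H: "L x y = L x y'" if "x \<in> Al R" "y \<in> Al R" "y' \<in> Al R" "L x x \<noteq> L y y" "L x x \<noteq> L y' y'" for x y y'
    using th[of "L x x" "L y y"] H0 that by metis
  obtain x0 y0 where 0: "x0 \<in> Al R" "y0 \<in> Al R" "L x0 x0 \<noteq> L y0 y0" using th by metis
  have "L x y = L x0 y0" if xy: "x \<in> Al R" "y \<in> Al R" "L x x \<noteq> L y y" for x y
  proof (cases "L x x = L y0 y0")
    case False
    then show ?thesis using H[OF xy(1), of y y0] H[OF 0(2), of x x0] 0 xy Ls by metis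
  next
    case True
    obtain z where z: "z \<in> Al R" "L z z \<noteq> L x x" "L z z \<noteq> L x0 x0" using th by metis
    then have "L x y = L x z" "L z x = L z x0" "L x0 z = L x0 y0" using H 0 xy by metis+
    then show ?thesis using Ls by metis
  qed
  then show ?thesis by blast
qed

lemma three_cov:
  assumes "x \<in> Al R" "y \<in> Al R" "z \<in> Al R" "L x x \<noteq> L y y" "L x x \<noteq> L z z" "L y y \<noteq> L z z"
  shows "1 \<le> w (L x y) x + w (L x y) y + w (L x y) z"
  using cov[of x y z] crossR Al_C assms C_sub by (metis subset_iff)

text \<open>The size hypotheses are those necessary for a fractional packing of size 1 by triangles
  with corners in different parts. Dually: take the cheapest point x, the cheapest point y outside
  its part, and the lower bound t that holds outside both parts. Layering the cover by these three
  thresholds shows that it costs at least their sum, which is at least 1.\<close>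

lemma multipartite:
  assumes p: "card (labs R) \<ge> 3" and "m (Al R) \<ge> 3"
    and h1: "\<And>i. i \<in> labs R \<Longrightarrow> m (Al R) - m (C R i) \<ge> 2"
    and h2: "\<And>i j. i \<in> labs R \<Longrightarrow> j \<in> labs R \<Longrightarrow> i \<noteq> j \<Longrightarrow> m (Al R) - m (C R i) - m (C R j) \<ge> 1"
  shows False
proof -
  obtain cb where cb: "\<And>x y. x \<in> Al R \<Longrightarrow> y \<in> Al R \<Longrightarrow> L x x \<noteq> L y y \<Longrightarrow> L x y = cb"
    using cross_label[OF p] by blast
  have "Al R \<noteq> {}" using p by (auto simp: labs_def)
  then obtain x where x: "x \<in> Al R" "\<And>v. v \<in> Al R \<Longrightarrow> w cb x \<le> w cb v" using argminV[OF C_sub(2)] by metis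
  define i where "i = L x x"
  have i: "i \<in> labs R" using x by (auto simp: i_def labs_def)
  have ne: "Al R - C R i \<noteq> {}" using third[OF p, of i i] by (auto simp: labs_def C_def Al_def)
  then obtain y where y: "y \<in> Al R - C R i" "\<And>v. v \<in> Al R - C R i \<Longrightarrow> w cb y \<le> w cb v"
    using argminV[of "Al R - C R i"] C_sub by (metis Diff_subset subset_trans)
  define j where "j = L y y"
  have j: "j \<in> labs R" "i \<noteq> j" using y by (auto simp: j_def labs_def i_def C_def Al_def)
  define t where "t = max (w cb y) (1 - w cb x - w cb y)"
  let ?U = "Al R - C R i - C R j"
  have tU: "t \<le> w cb v" if v: "v \<in> ?U" for v
  proof -
    have d: "L v v \<noteq> i" "L v v \<noteq> j" "v \<in> Al R" using v by (auto simp: C_def Al_def)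
    have "1 \<le> w cb x + w cb y + w cb v" using three_cov[of x y v] cb[of x y] x y d j by (auto simp: i_def j_def)
    moreover have "w cb y \<le> w cb v" using y v by blast
    ultimately show ?thesis by (simp add: t_def)
  qed
  have xy: "w cb x \<le> w cb y" using x y by blast
  have sub: "C R i \<subseteq> V" "C R j \<subseteq> V" "?U \<subseteq> V" using C_sub by blast+
  have dj: "C R i \<inter> C R j = {}" "(C R i \<union> C R j) \<inter> ?U = {}" using C_disj j(2) by auto
  have 1: "w cb x * m (C R i) \<le> I (w cb) (C R i)" using sub x C_Al by (intro I_ge) auto
  have 2: "w cb y * m (C R j) \<le> I (w cb) (C R j)"
    using sub(2) C_sub(1)[of R j] dj(1) by (intro I_ge y(2)) auto
  have 3: "t * m ?U \<le> I (w cb) ?U" using sub tU by (intro I_ge) auto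
  have U: "m ?U = m (Al R) - m (C R i) - m (C R j)"
  proof -
    have "C R j \<subseteq> Al R - C R i" "Al R - C R i \<subseteq> V" using C_sub(1)[of R j] C_sub(2) dj(1) by blast+
    then show ?thesis using m_diff[of "C R i" "Al R"] m_diff[of "C R j" "Al R - C R i"] C_sub by simp
  qed
  \<comment> \<open>Summation by parts: each increment between thresholds is multiplied by the
    measure of the region on which it is still paid.\<close>
  let ?r = "m (Al R)"
  have "w cb x * 3 \<le> w cb x * ?r" using assms w0 by (intro mult_left_mono)
  moreover have "(w cb y - w cb x) * 2 \<le> (w cb y - w cb x) * (?r - m (C R i))" using xy h1[OF i] by (intro mult_left_mono) auto
  moreover have "(t - w cb y) * 1 \<le> (t - w cb y) * (?r - m (C R i) - m (C R j))" 
    using h2[OF i j] by (intro mult_left_mono) (auto simp: t_def)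
  ultimately have "w cb x + w cb y + t \<le> w cb x * m (C R i) + w cb y * m (C R j) + t * m ?U"
    unfolding U by (simp add: algebra_simps)
  moreover have "1 \<le> w cb x + w cb y + t" by (simp add: t_def)
  ultimately have "1 \<le> I (w cb) V" using 1 2 3 I_disjoint3[OF sub dj, of cb] by linarith
  moreover have "x \<in> V" "y \<in> V" "L x y = cb" using x(1) y(1) j C_sub(2) cb[of x y] by (auto simp: i_def j_def)
  then have "I (w cb) V < 1" using I_small[of x y] by simp
  ultimately show False by simp
qed

end

section \<open>Two large classes of one colour\<close>

context tri_core begin

lemma C_disj2: "i \<noteq> j \<Longrightarrow> C k i \<inter> C k j = {}" by (auto simp: C_def)

lemma Al_un: "Al R \<union> Al B = V" "Al R \<inter> Al B = {}"
  using notR RB by (auto simp: Al_def)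
lemma m_total: "m (Al R) + m (Al B) = 9"
  using m_Un[of "Al R" "Al B"] Al_un C_sub m_V by metis

lemma m_two: "i \<noteq> i' \<Longrightarrow> m (Al k - C k i - C k i') = m (Al k) - m (C k i) - m (C k i')"
proof -
  assume "i \<noteq> i'"
  then have "C k i' \<subseteq> Al k - C k i" "Al k - C k i \<subseteq> V"
    using C_sub(1)[of k i'] C_sub(2) C_disj[of k i k i'] by blast+
  then show ?thesis using m_diff[of "C k i" "Al k"] m_diff[of "C k i'" "Al k - C k i"] C_sub by simp
qed

lemma m_three: "i \<noteq> j \<Longrightarrow> i \<noteq> k \<Longrightarrow> j \<noteq> k \<Longrightarrow> m (C c i) + m (C c j) + m (C c k) \<le> m (Al c)"
proof -
  assume "i \<noteq> j" "i \<noteq> k" "j \<noteq> k"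
  then have "C c k \<subseteq> Al c - C c i - C c j"
    using C_sub(1)[of c k] C_disj[of c i c k] C_disj[of c j c k] by blast
  then have "m (C c k) \<le> m (Al c - C c i - C c j)" using C_sub(2) by (intro m_mono) auto
  then show ?thesis using m_two[OF \<open>i \<noteq> j\<close>, of c] by linarith
qed

lemma card_ge3:
  assumes "i \<in> labs k" "j \<in> labs k" "i \<noteq> j" "v \<in> Al k - C k i - C k j"
  shows "card (labs k) \<ge> 3"
proof -
  have "{i, j, L v v} \<subseteq> labs k" using assms by (auto simp: labs_def)
  moreover have "L v v \<noteq> i" "L v v \<noteq> j" using assms(4) by (auto simp: C_def Al_def)
  then have "card {i, j, L v v} = 3" using assms(3) by auto
  ultimately show ?thesis using card_mono[OF fin_labs[of k]] by metis
qed

text \<open>A point imposes its loop class on every edge that closes a triangle of its colour with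
  it.\<close>

lemma red_triangle_label:
  assumes "x \<in> C R i" "z \<in> V" "u \<in> V" "\<kappa> x z = R" "\<kappa> x u = R" "\<kappa> z u = R"
  shows "L z u = i"
  using edge_loop[OF assms(1,2,4)] tri[of x z u] assms C_Al[OF assms(1)] by simp

lemma blue_triangle_label:
  assumes "x \<in> V" "y \<in> V" "u \<in> C B j" "\<kappa> x y = B" "\<kappa> u x = B" "\<kappa> u y = B"
  shows "L x y = j"
  using edge_loop[OF assms(3,1,5)] tri[of u x y] assms C_Al[OF assms(3)] by simp

text \<open>A certificate that the cross class \<open>cb\<close> is expensive. Transversal triangles
  through both parts and the rest account for a'; the missing 1 - a' comes from triangles with one
  corner in \<open>Y\<close> and two in \<open>W\<close>. The share n(1 - a') of \<open>Y\<close>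
  and the share (1 - n)/2 times 2 - 2a' of \<open>W\<close> add up to 1 - a' for every threshold
  n.\<close>

lemma final_cover:
  assumes ii: "i \<noteq> i'" "C R i \<noteq> {}" "C R i' \<noteq> {}"
    and cb: "\<And>x y. x \<in> Al R \<Longrightarrow> y \<in> Al R \<Longrightarrow> L x x \<noteq> L y y \<Longrightarrow> L x y = cb"
    and a': "a' = m (Al R) - m (C R i) - m (C R i')" "a' \<le> 1" "1 \<le> m (C R i)" "a' \<le> m (C R i')"
    and Y: "Y \<subseteq> C R i" "1 - a' \<le> m Y" "y0 \<in> C R i" "\<And>y. y \<in> Y \<Longrightarrow> w cb y0 \<le> w cb y"
    and W: "W \<subseteq> Al B" "2 - 2 * a' \<le> m W" "\<And>u. u \<in> W \<Longrightarrow> 1 \<le> 2 * w cb u + w cb y0"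
  shows False
proof -
  let ?v = "w cb"
  obtain x where x: "x \<in> C R i" "\<And>y. y \<in> C R i \<Longrightarrow> ?v x \<le> ?v y" using argminV[OF C_sub(3) ii(2)] by metis
  obtain x' where x': "x' \<in> C R i'" "\<And>y. y \<in> C R i' \<Longrightarrow> ?v x' \<le> ?v y" using argminV[OF C_sub(3) ii(3)] by metis
  \<comment> \<open>The value n may exceed 1, so the lower bound on \<open>W\<close> is truncated at
    0.\<close>
  define n q where "n = ?v y0" and "q = max 0 ((1 - n) / 2)"
  let ?U = "Al R - C R i - C R i'"
  have U: "m ?U = a'" using a' m_two[OF ii(1), of R] by simp
  have a0: "0 \<le> a'" using U m_nonneg by metis
  have sub: "Y \<subseteq> V" "C R i - Y \<subseteq> V" "C R i' \<subseteq> V" "?U \<subseteq> V" "W \<subseteq> V" "C R i \<subseteq> V"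
    using C_sub Y(1) W(1) by blast+
  have Uv: "1 - ?v x - ?v x' \<le> ?v u" if u: "u \<in> ?U" for u
  proof -
    have "L u u \<noteq> i" "L u u \<noteq> i'" "u \<in> Al R" using u by (auto simp: C_def Al_def)
    then have "1 \<le> w (L x x') x + w (L x x') x' + w (L x x') u"
      using three_cov[of x x' u] C_Al[OF x(1)] C_Al[OF x'(1)] ii by auto
    then show ?thesis using cb[of x x'] C_Al[OF x(1)] C_Al[OF x'(1)] ii by simp
  qed
  have xn: "?v x \<le> n" using x(2) Y(3) by (simp add: n_def)
  have 1: "n * m Y \<le> I ?v Y" using sub Y(4) by (intro I_ge) (auto simp: n_def)
  have 2: "?v x * m (C R i - Y) \<le> I ?v (C R i - Y)" using sub x by (intro I_ge) auto
  have 3: "?v x' * m (C R i') \<le> I ?v (C R i')" using sub x' by (intro I_ge) auto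
  have 4: "(1 - ?v x - ?v x') * a' \<le> I ?v ?U" unfolding U[symmetric] using sub Uv by (intro I_ge) auto
  have 5: "q * m W \<le> I ?v W" using sub W(3) w0 by (intro I_ge) (force simp: q_def n_def)+
  have mY: "m (C R i - Y) = m (C R i) - m Y" using m_diff[OF Y(1)] sub by simp
  have "(n - ?v x) * (1 - a') \<le> (n - ?v x) * m Y" using xn Y(2) by (intro mult_left_mono) auto
  moreover have "?v x * 1 \<le> ?v x * m (C R i)" using a' w0 by (intro mult_left_mono)
  ultimately have 12: "n * (1 - a') + ?v x * a' \<le> I ?v Y + I ?v (C R i - Y)"
    using 1 2 unfolding mY by (simp add: algebra_simps)
  have i3: "?v x' * a' \<le> I ?v (C R i')" using 3 mult_left_mono[OF a'(4) w0, of cb x'] by linarith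
  have "q * (2 - 2 * a') \<le> q * m W" using W(2) by (intro mult_left_mono) (auto simp: q_def)
  moreover have "(1 - n) / 2 * (2 - 2 * a') \<le> q * (2 - 2 * a')" using a'(2) by (intro mult_right_mono) (auto simp: q_def)
  moreover have "(1 - n) / 2 * (2 - 2 * a') = (1 - n) * (1 - a')" by (simp add: field_simps)
  ultimately have i5: "(1 - n) * (1 - a') \<le> I ?v W" using 5 by linarith
  have "1 \<le> (I ?v Y + I ?v (C R i - Y)) + I ?v (C R i') + I ?v ?U + I ?v W"
    using 12 i3 4 i5 by (simp add: algebra_simps)
  also have "I ?v Y + I ?v (C R i - Y) = I ?v (C R i)"
    using I_Un[of Y "C R i - Y"] sub Y(1) by (simp add: Un_absorb1)
  also have "I ?v (C R i) + I ?v (C R i') + I ?v ?U + I ?v W \<le> I ?v V"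
    using sub C_disj2[OF ii(1), of R] W(1) C_sub(1)[of R i] C_sub(1)[of R i'] Al_un(2) by (intro I_disjoint4) blast+
  finally have "1 \<le> I ?v V" .
  moreover have "I ?v V < 1" using I_small[of x x'] cb[of x x'] C_Al[OF x(1)] C_Al[OF x'(1)] ii by simp
  ultimately show False by simp
qed

text \<open>The cover of \<open>cb\<close> has to pay a' for the transversal triangles and, on a
  disjoint set, 1/3 for every point whose loop class is \<open>cb\<close>.\<close>

lemma A_cover:
  assumes ii: "i \<noteq> i'" "C R i \<noteq> {}" "C R i' \<noteq> {}"
    and cb: "\<And>x y. x \<in> Al R \<Longrightarrow> y \<in> Al R \<Longrightarrow> L x x \<noteq> L y y \<Longrightarrow> L x y = cb"
    and a': "a' = m (Al R) - m (C R i) - m (C R i')" "a' \<le> m (C R i)" "a' \<le> m (C R i')"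
  shows "a' + m (C B cb) / 3 < 1"
proof -
  let ?v = "w cb"
  obtain x where x: "x \<in> C R i" "\<And>y. y \<in> C R i \<Longrightarrow> ?v x \<le> ?v y" using argminV[OF C_sub(3) ii(2)] by metis
  obtain x' where x': "x' \<in> C R i'" "\<And>y. y \<in> C R i' \<Longrightarrow> ?v x' \<le> ?v y" using argminV[OF C_sub(3) ii(3)] by metis
  let ?U = "Al R - C R i - C R i'" and ?W = "C B cb"
  have U: "m ?U = a'" using a' m_two[OF ii(1), of R] by simp
  have sub: "C R i' \<subseteq> V" "?U \<subseteq> V" "?W \<subseteq> V" "C R i \<subseteq> V"
    using C_sub by blast+
  have Uv: "1 - ?v x - ?v x' \<le> ?v u" if u: "u \<in> ?U" for u
  proof -
    have "L u u \<noteq> i" "L u u \<noteq> i'" "u \<in> Al R" using u by (auto simp: C_def Al_def)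
    then have "1 \<le> w (L x x') x + w (L x x') x' + w (L x x') u"
      using three_cov[of x x' u] C_Al[OF x(1)] C_Al[OF x'(1)] ii by auto
    then show ?thesis using cb[of x x'] C_Al[OF x(1)] C_Al[OF x'(1)] ii by simp
  qed
  have 1: "?v x * m (C R i) \<le> I ?v (C R i)" using sub x by (intro I_ge) auto
  have 3: "?v x' * m (C R i') \<le> I ?v (C R i')" using sub x' by (intro I_ge) auto
  have 4: "(1 - ?v x - ?v x') * a' \<le> I ?v ?U" unfolding U[symmetric] using sub Uv by (intro I_ge) auto
  have 5: "1/3 * m ?W \<le> I ?v ?W" using sub loop3 by (intro I_ge) auto
  have i1: "?v x * a' \<le> I ?v (C R i)" using 1 mult_left_mono[OF a'(2) w0, of cb x] by linarith
  have i3: "?v x' * a' \<le> I ?v (C R i')" using 3 mult_left_mono[OF a'(3) w0, of cb x'] by linarith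
  have "a' + m ?W / 3 \<le> I ?v (C R i) + I ?v (C R i') + I ?v ?U + I ?v ?W"
    using i1 i3 4 5 by (simp add: algebra_simps)
  also have "\<dots> \<le> I ?v V"
    using sub C_disj2[OF ii(1), of R] C_sub(1)[of R i] C_sub(1)[of R i'] C_sub(1)[of B cb] Al_un(2)
    by (intro I_disjoint4) blast+
  also have "\<dots> < 1" using I_small[of x x'] cb[of x x'] C_Al[OF x(1)] C_Al[OF x'(1)] ii by simp
  finally show ?thesis .
qed

text \<open>Let a' be the red measure outside both classes. If a' is at least 1, the multipartite
  bound applies. Otherwise suitable points x and y of the two classes have so few red edges to
  \<open>Al B\<close> that a set of measure more than 3 - a' is blue to both. This set lies in the
  one blue class that is the label of x y, and that class is then too large for
  \<open>A_cover\<close>.\<close>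

lemma two_big:
  assumes ii: "i \<noteq> i'" "2 \<le> m (C R i)" "2 \<le> m (C R i')"
  shows False
proof -
  have ne: "C R i \<noteq> {}" "C R i' \<noteq> {}" using m_pos_ne[of "C R i"] m_pos_ne[of "C R i'"] ii by auto
  then have il: "i \<in> labs R" "i' \<in> labs R" by (auto simp: labs_ne)
  define a' where "a' = m (Al R) - m (C R i) - m (C R i')"
  have a'm: "m (Al R - C R i - C R i') = a'" using m_two[OF ii(1), of R] by (simp add: a'_def)
  have a0: "0 \<le> a'" using a'm m_nonneg by metis
  have p3: "card (labs R) \<ge> 3" if "a' > 0"
  proof -
    have "Al R - C R i - C R i' \<noteq> {}" using m_pos_ne a'm that by metis
    then obtain v where "v \<in> Al R - C R i - C R i'" by blast
    then show ?thesis using card_ge3[OF il ii(1)] by blast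
  qed
  show False
  proof (cases "a' \<ge> 1")
    case True
    show False
    proof (rule multipartite)
      show "card (labs R) \<ge> 3" using p3 True by simp
      show "3 \<le> m (Al R)" using a'_def True ii by linarith
      show "2 \<le> m (Al R) - m (C R k)" for k using a'_def True ii C_lt3[of R k] by linarith
      show "1 \<le> m (Al R) - m (C R k) - m (C R l)" if "k \<noteq> l" for k l
        using that True a'_def ii m_three[of i k l R] m_three[of i' k l R] by (cases "i = k"; cases "i = l"; cases "i' = k"; cases "i' = l") auto
    qed
  next
    case False
    obtain x where x: "x \<in> C R i" "m {u \<in> Al B. \<kappa> x u = R} < 3 - m (C R i)" using big_vertex[OF ii(2)] by blast
    obtain y where y: "y \<in> C R i'" "m {u \<in> Al B. \<kappa> y u = R} < 3 - m (C R i')" using big_vertex[OF ii(3)] by blast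
    let ?T = "{u \<in> Al B. \<kappa> x u = R}" and ?T' = "{u \<in> Al B. \<kappa> y u = R}"
    let ?U = "Al B - (?T \<union> ?T')"
    have s: "?T \<subseteq> V" "?T' \<subseteq> V" "?U \<subseteq> V" using C_sub(2) by blast+
    have "m (Al B) - m (?T \<union> ?T') \<le> m ?U" using C_sub(2) s by (intro m_diff_ge) auto
    then have U: "3 - a' < m ?U" using m_Un_le[OF s(1,2)] x(2) y(2) m_total a'_def by linarith
    have xyB: "\<kappa> x y = B" using crossR x y ii by blast
    have sub: "?U \<subseteq> C B (L x y)"
    proof
      fix u assume u: "u \<in> ?U"
      then have k: "\<kappa> u x = B" "\<kappa> u y = B" "u \<in> C B (L u u)" using notR ks Al_C by auto
      then have "L x y = L u u" using blue_triangle_label[of x y u "L u u"] C_Al x y xyB by blast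
      then show "u \<in> C B (L x y)" using k by simp
    qed
    have big: "3 - a' < m (C B (L x y))" using U m_mono[OF sub] C_sub by force
    \<comment> \<open>Blue classes have measure below 3, so a' is positive; hence a third red class
      exists and with it the common cross label.\<close>
    then have "0 < a'" using C_lt3[of B "L x y"] by linarith
    then obtain cb where cb: "\<And>x y. x \<in> Al R \<Longrightarrow> y \<in> Al R \<Longrightarrow> L x x \<noteq> L y y \<Longrightarrow> L x y = cb"
      using cross_label[OF p3] by blast
    have "L x y = cb" using cb[of x y] C_Al[OF x(1)] C_Al[OF y(1)] ii by simp
    then have "a' + m (C B (L x y)) / 3 < 1" using A_cover[OF ii(1) ne cb a'_def] False ii by auto
    then show False using big a0 by linarith
  qed
qed

lemma Al_le1: "card (labs k) \<le> 1 \<Longrightarrow> m (Al k) < 3"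
proof -
  assume c: "card (labs k) \<le> 1"
  show ?thesis
  proof (cases "labs k = {}")
    case True
    then show ?thesis by (auto simp: labs_def m_empty)
  next
    case False
    then obtain l where "labs k = {l}" using c fin_labs[of k] by (metis card_1_singletonE card_0_eq le_neq_implies_less less_one)
    then have "L v v = l" if "v \<in> Al k" for v using that unfolding labs_def by blast
    then have "Al k \<subseteq> C k l" using Al_C by fast
    then show ?thesis using m_mono[of "Al k" "C k l"] C_sub C_lt3[of k l] by force
  qed
qed

lemma two_max:
  assumes "card (labs k) \<ge> 2"
  obtains l1 l2 where "l1 \<in> labs k" "l2 \<in> labs k" "l1 \<noteq> l2" "m (C k l2) \<le> m (C k l1)"
    "\<And>l. l \<in> labs k \<Longrightarrow> l \<noteq> l1 \<Longrightarrow> m (C k l) \<le> m (C k l2)"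
proof -
  have "labs k \<noteq> {}" using assms by auto
  then obtain l1 where l1: "l1 \<in> labs k" "\<And>l. l \<in> labs k \<Longrightarrow> m (C k l) \<le> m (C k l1)"
    using argmin[OF fin_labs, of k "\<lambda>l. - m (C k l)"] by auto
  have "labs k - {l1} \<noteq> {}"
  proof
    assume "labs k - {l1} = {}"
    then have "labs k \<subseteq> {l1}" by blast
    then have "card (labs k) \<le> 1" using card_mono[of "{l1}" "labs k"] by simp
    then show False using assms by simp
  qed
  then obtain l2 where "l2 \<in> labs k - {l1}" "\<And>l. l \<in> labs k - {l1} \<Longrightarrow> m (C k l) \<le> m (C k l2)"
    using argmin[of "labs k - {l1}" "\<lambda>l. - m (C k l)"] fin_labs by auto
  then show ?thesis using l1 that[of l1 l2] by auto
qed

text \<open>For the multipartite bound the two largest classes are the critical ones.\<close>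

lemma rest_small:
  assumes "card (labs R) \<ge> 3" "m (Al R) \<ge> 3" "m (C R l2) \<le> m (C R l1)"
    "\<And>l. l \<in> labs R \<Longrightarrow> l \<noteq> l1 \<Longrightarrow> m (C R l) \<le> m (C R l2)"
  shows "m (Al R) - m (C R l1) < 2 \<or> m (Al R) - m (C R l1) - m (C R l2) < 1"
proof (rule ccontr)
  assume n: "\<not> ?thesis"
  have h: "m (C R i) \<le> m (C R l1)" if "i \<in> labs R" for i using assms(3) assms(4)[OF that] by (cases "i = l1") auto
  show False
  proof (rule multipartite[OF assms(1,2)])
    show "2 \<le> m (Al R) - m (C R i)" if "i \<in> labs R" for i using n h[OF that] by linarith
    show "1 \<le> m (Al R) - m (C R i) - m (C R j)" if ij: "i \<in> labs R" "j \<in> labs R" "i \<noteq> j" for i j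
    proof (cases "i = l1")
      case True then show ?thesis using n assms(4)[OF ij(2)] ij by auto
    next
      case False then show ?thesis using n assms(4)[OF ij(1)] h[OF ij(2)] by auto
    qed
  qed
qed

lemma Al_two: "labs k = {i, j} \<Longrightarrow> Al k = C k i \<union> C k j"
proof -
  assume l: "labs k = {i, j}"
  have "v \<in> C k i \<union> C k j" if "v \<in> Al k" for v
  proof -
    have "L v v \<in> {i, j}" using that unfolding l[symmetric] labs_def by blast
    then show ?thesis using Al_C[OF that] by auto
  qed
  then show ?thesis using C_sub(1)[of k i] C_sub(1)[of k j] by blast
qed

lemma m_Al_two: "labs k = {i, j} \<Longrightarrow> i \<noteq> j \<Longrightarrow> m (Al k) = m (C k i) + m (C k j)"
  using Al_two m_Un[of "C k i" "C k j"] C_disj[of k i k j] C_sub by auto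

text \<open>With at most one red class, more than 6 is left for blue. This forces at least three
  blue classes, and by the multipartite bound the two largest of them would both have size at least
  2.\<close>

lemma labs_R_ge2: "card (labs R) \<ge> 2"
proof (rule ccontr)
  interpret S: tri_core V \<kappa> L w B R by (rule swap)
  assume "\<not> ?thesis"
  then have r: "m (Al R) < 3" using Al_le1[of R] by simp
  then have s: "m (Al B) > 6" using m_total by linarith
  have "card (labs B) \<ge> 2" using Al_le1[of B] s by fastforce
  then obtain l1 l2 where l: "l1 \<in> labs B" "l2 \<in> labs B" "l1 \<noteq> l2" "m (C B l2) \<le> m (C B l1)"
    "\<And>l. l \<in> labs B \<Longrightarrow> l \<noteq> l1 \<Longrightarrow> m (C B l) \<le> m (C B l2)" using two_max by metis
  have "m (Al B - C B l1 - C B l2) > 0" using m_two[OF l(3), of B] s C_lt3[of B l1] C_lt3[of B l2] by simp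
  then have "card (labs B) \<ge> 3" using card_ge3[OF l(1,2,3)] m_pos_ne by (metis ex_in_conv)
  then have "m (Al B) - m (C B l1) < 2 \<or> m (Al B) - m (C B l1) - m (C B l2) < 1"
    using S.rest_small[of l2 l1] s l by auto
  then have "m (C B l1) \<ge> 2" "m (C B l2) \<ge> 2" using s C_lt3[of B l1] C_lt3[of B l2] by auto
  then show False using S.two_big l(3) by blast
qed

end

section \<open>Exactly two classes in one colour\<close>

context tri_core begin

text \<open>Serves to cut off the cheap part of a class at a prescribed measure although measures
  are discrete: ties at \<alpha> count in the lower bound and not in the upper one.\<close>

lemma quantile:
  assumes "finite Y" "Y \<subseteq> V" "0 < t" "t \<le> m Y"
  obtains \<alpha> where "\<alpha> \<in> f ` Y" "t \<le> m {y \<in> Y. (f y :: real) \<le> \<alpha>}" "m {y \<in> Y. f y < \<alpha>} < t"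
proof -
  define P where "P = {a \<in> f ` Y. t \<le> m {y \<in> Y. f y \<le> a}}"
  have Yne: "Y \<noteq> {}" using assms m_pos_ne[of Y] by auto
  have fP: "finite P" using assms by (simp add: P_def)
  have "Max (f ` Y) \<in> P"
  proof -
    have "{y \<in> Y. f y \<le> Max (f ` Y)} = Y" using assms by auto
    then show ?thesis using assms Yne by (simp add: P_def)
  qed
  then have Pne: "P \<noteq> {}" by blast
  define \<alpha> where "\<alpha> = Min P"
  have aP: "\<alpha> \<in> P" using Min_in[OF fP Pne] by (simp add: \<alpha>_def)
  have "m {y \<in> Y. f y < \<alpha>} < t"
  proof (rule ccontr)
    assume n: "\<not> ?thesis"
    let ?S = "{y \<in> Y. f y < \<alpha>}"
    have ne: "f ` ?S \<noteq> {}" "finite (f ` ?S)" using n assms m_pos_ne[of ?S] by auto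
    define \<beta> where "\<beta> = Max (f ` ?S)"
    have b: "\<beta> \<in> f ` ?S" using Max_in[OF ne(2,1)] by (simp add: \<beta>_def)
    have "?S \<subseteq> {y \<in> Y. f y \<le> \<beta>}" using ne by (auto simp: \<beta>_def)
    moreover have "{y \<in> Y. f y \<le> \<beta>} \<subseteq> V" using assms by blast
    ultimately have "m ?S \<le> m {y \<in> Y. f y \<le> \<beta>}" by (rule m_mono)
    then have "\<beta> \<in> P" using n b by (auto simp: P_def)
    then have "\<alpha> \<le> \<beta>" using fP by (simp add: \<alpha>_def)
    moreover have "\<beta> < \<alpha>" using b by auto
    ultimately show False by simp
  qed
  then show ?thesis using aP that by (auto simp: P_def)
qed

text \<open>In each colour one class is smaller than 2, and the remaining red and blue class
  together have less than 5, which adds up to less than 9.\<close>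

lemma two_versus_two:
  assumes "card (labs R) = 2" "card (labs B) = 2"
  shows False
proof -
  interpret S: tri_core V \<kappa> L w B R by (rule swap)
  obtain i i' where i: "labs R = {i, i'}" "i \<noteq> i'" using assms(1) by (meson card_2_iff)
  obtain j j' where j: "labs B = {j, j'}" "j \<noteq> j'" using assms(2) by (meson card_2_iff)
  have "m (C R i) < 2 \<or> m (C R i') < 2" using two_big[of i i'] i by force
  moreover have "m (C B j) < 2 \<or> m (C B j') < 2" using S.two_big[of j j'] j by force
  moreover have "m (C R i) + m (C R i') + m (C B j) + m (C B j') = 9"
    using m_total m_Al_two[OF i] m_Al_two[OF j] by simp
  ultimately show False
    using pair_lt5[of i j] pair_lt5[of i j'] pair_lt5[of i' j] pair_lt5[of i' j'] by auto
qed

text \<open>The pivot is a point z of the larger blue class with only a small set T of blue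
  neighbours in \<open>Al R\<close>. A point u of \<open>C B j2\<close> can send red edges outside T
  to one red class only, because the red edge z u has one label. If \<open>j2\<close> differs from
  \<open>cb\<close>, then u cannot be blue to two red classes either, so at most two red classes
  reach outside T. If \<open>j2 = cb\<close>, the blue edges at u feed
  \<open>final_cover\<close>.\<close>

lemma two_versus_many_balanced:
  assumes q: "labs B = {j1, j2}" "j1 \<noteq> j2" "m (C B j2) \<le> m (C B j1)" and p: "card (labs R) \<ge> 3"
    and l: "l1 \<in> labs R" "l2 \<in> labs R" "l1 \<noteq> l2" "m (C R l2) \<le> m (C R l1)"
    "\<And>l. l \<in> labs R \<Longrightarrow> l \<noteq> l1 \<Longrightarrow> m (C R l) \<le> m (C R l2)" and a1: "m (C R l1) < 2"
  shows False
proof -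
  interpret S: tri_core V \<kappa> L w B R by (rule swap)
  define a' where "a' = m (Al R) - m (C R l1) - m (C R l2)"
  have b2: "m (C B j2) < 2" using S.two_big[of j1 j2] q by force
  have b1: "m (C B j1) < 3" using C_lt3 .
  have tot: "m (C R l1) + m (C R l2) + a' + m (C B j1) + m (C B j2) = 9"
    using m_total m_Al_two[OF q(1,2)] by (simp add: a'_def)
  have a'1: "a' < 1" using rest_small[OF p _ l(4,5)] tot a1 b1 b2 a'_def by auto
  have a'0: "0 \<le> a'" using m_two[OF l(3), of R] m_nonneg by (metis a'_def)
  have s: "m (C B j1) > 2" "m (C R l2) > 1" "m (C R l1) > 1" using tot a1 a'1 b1 b2 l(4) q(3) by linarith+
  have "2 \<le> m (C B j1)" using s by simp
  then obtain z where z: "z \<in> C B j1" "m {u \<in> Al R. \<kappa> z u = B} < 3 - m (C B j1)"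
    using S.big_vertex by blast
  define T where "T = {u \<in> Al R. \<kappa> z u = B}"
  have T: "m T < 3 - m (C B j1)" "T \<subseteq> V" using z C_sub(2) by (auto simp: T_def)
  have mT: "m (C R i - T) > 0" if "m (C R i) > 1" for i
    using m_diff_ge[OF C_sub(3) T(2), of R i] T(1) s that by linarith
  have nT: "\<kappa> z x = R" if "x \<in> C R i" "x \<notin> T" for x i
    using that C_Al[of x] notB by (auto simp: T_def)
  have zW: "\<kappa> z u = R" if "u \<in> C B j2" for u using S.crossR[OF z(1) that q(2)] .
  have red: "L z u = i" if "u \<in> C B j2" "x \<in> C R i" "x \<notin> T" "\<kappa> x u = R" for u x i
    using red_triangle_label[of x i z u] nT[OF that(2,3)] zW[OF that(1)] C_Al[OF z(1)] C_Al[OF that(1)] ks that by metis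
  obtain cb where cb: "\<And>x y. x \<in> Al R \<Longrightarrow> y \<in> Al R \<Longrightarrow> L x x \<noteq> L y y \<Longrightarrow> L x y = cb"
    using cross_label[OF p] by blast
  show False
  proof (cases "j2 = cb")
    case False
    obtain u where u: "u \<in> C B j2" using q(1) labs_ne[of j2 B] by blast
    have one_blue: False if "x \<in> C R i" "y \<in> C R i'" "i \<noteq> i'" "\<kappa> u x = B" "\<kappa> u y = B" for x y i i'
    proof -
      have "L x y = j2" using blue_triangle_label[of x y u j2] that u C_Al crossR by blast
      moreover have "L x y = cb" using cb[of x y] C_Al[OF that(1)] C_Al[OF that(2)] that(3) by simp
      ultimately show False using False by simp
    qed
    have one_red: False if "x \<in> C R i" "y \<in> C R i'" "i \<noteq> i'" "x \<notin> T" "y \<notin> T" "\<kappa> u x = R" "\<kappa> u y = R" for x y i i'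
      using red[OF u that(1,4)] red[OF u that(2,5)] that ks by metis
    obtain x1 where x1: "x1 \<in> C R l1" "x1 \<notin> T" using mT[OF s(3)] m_pos_ne by (metis Diff_iff ex_in_conv)
    obtain x2 where x2: "x2 \<in> C R l2" "x2 \<notin> T" using mT[OF s(2)] m_pos_ne by (metis Diff_iff ex_in_conv)
    \<comment> \<open>Pigeonhole: of three points outside T in different red classes, two have the
      same colour to u.\<close>
    have "Al R - C R l1 - C R l2 \<subseteq> T"
    proof
      fix v assume v: "v \<in> Al R - C R l1 - C R l2"
      then have vl: "v \<in> C R (L v v)" "L v v \<noteq> l1" "L v v \<noteq> l2" by (auto simp: C_def Al_def)
      show "v \<in> T"
      proof (rule ccontr)
        assume vT: "v \<notin> T"
        show False
          using one_blue[OF x1(1) x2(1)] one_blue[OF x1(1) vl(1)] one_blue[OF x2(1) vl(1)]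
            one_red[OF x1(1) x2(1)] one_red[OF x1(1) vl(1)] one_red[OF x2(1) vl(1)] x1 x2 vT vl l(3) notR
          by metis
      qed
    qed
    then have "a' \<le> m T" using m_mono[OF _ T(2), of "Al R - C R l1 - C R l2"] m_two[OF l(3), of R] unfolding a'_def by linarith
    then show False using tot T a1 b2 l(4) by linarith
  next
    case True
    define v where "v = w cb"
    define X where "X i = C R i - T" for i
    have XV: "X i \<subseteq> V" for i using C_sub(3) by (auto simp: X_def)
    have Xne: "X l1 \<noteq> {}" "X l2 \<noteq> {}" using mT[OF s(3)] mT[OF s(2)] m_pos_ne by (auto simp: X_def)
    obtain x1 where x1: "x1 \<in> X l1" "\<And>y. y \<in> X l1 \<Longrightarrow> v x1 \<le> v y" using argminV[OF XV Xne(1)] by metis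
    obtain x2 where x2: "x2 \<in> X l2" "\<And>y. y \<in> X l2 \<Longrightarrow> v x2 \<le> v y" using argminV[OF XV Xne(2)] by metis
    \<comment> \<open>The threshold point x is taken from the class whose minimum is larger; a blue
      edge from u to either minimum then yields the same inequality.\<close>
    have fin: False if i: "i = l1 \<and> i' = l2 \<or> i = l2 \<and> i' = l1" and x: "x \<in> X i" "\<And>y. y \<in> X i \<Longrightarrow> v x \<le> v y"
      and x': "x' \<in> X i'" "\<And>y. y \<in> X i' \<Longrightarrow> v x' \<le> v y" and le: "v x' \<le> v x" for i i' x x'
    proof -
      have ii: "i \<noteq> i'" using i l(3) by auto
      have c: "m (C R i) > 1" "m (C R i') > 1" "m (C R i) < 2" "m (C R i') < 2" using i s a1 l(4) by auto
      have a'i: "a' = m (Al R) - m (C R i) - m (C R i')" using i by (auto simp: a'_def)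
      have mX: "1 - a' \<le> m (X i)"
        using m_diff_ge[OF C_sub(3) T(2), of R i] T(1) c b2 tot i by (auto simp: X_def)
      have W: "1 \<le> 2 * v u + v x" if u: "u \<in> C B j2" for u
      proof -
        have "(\<forall>y\<in>X i. \<kappa> y u \<noteq> R) \<or> (\<forall>y\<in>X i'. \<kappa> y u \<noteq> R)"
          using red[OF u] ii unfolding X_def by (metis DiffE)
        then show ?thesis
        proof
          assume "\<forall>y\<in>X i. \<kappa> y u \<noteq> R"
          then have "\<kappa> u x = B" using x(1) notR ks by metis
          then show ?thesis using cov_loop[OF u, of x] x(1) XV True by (auto simp: v_def)
        next
          assume "\<forall>y\<in>X i'. \<kappa> y u \<noteq> R"
          then have "\<kappa> u x' = B" using x'(1) notR ks by metis
          then have "1 \<le> 2 * v u + v x'" using cov_loop[OF u, of x'] x'(1) XV True by (auto simp: v_def)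
          then show ?thesis using le by simp
        qed
      qed
      show False
      proof (rule final_cover[OF ii _ _ cb a'i, where Y = "X i" and ?y0.0 = x and W = "C B j2"])
        show "2 - 2 * a' \<le> m (C B j2)" using tot c b1 i a'0 a1 l(4) by auto
      qed (use x x' a'1 c mX W C_sub v_def in \<open>auto simp: X_def\<close>)
    qed
    show False
    proof (cases "v x2 \<le> v x1")
      case True
      then show False using fin[of l1 l2 x1 x2] x1 x2 by blast
    next
      case False
      then show False using fin[of l2 l1 x2 x1] x1 x2 by auto
    qed
  qed
qed

end

context tri_core begin

text \<open>Here the pivot x lies in the large red class \<open>l1\<close>. Points of
  \<open>C B jz\<close> that are blue to x must be red to the other red classes, since a blue
  triangle would put \<open>jz\<close> instead of \<open>cb\<close> on a cross edge; this forces
  \<open>jw = cb\<close>. The cover of the class \<open>l2\<close> then shows that the cheap points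
  of \<open>C R l2\<close> have few red edges to \<open>C B jw\<close>, and their blue edges enter
  \<open>final_cover\<close>.\<close>

lemma two_versus_many_unbalanced:
  assumes q: "labs B = {jz, jw}" "jz \<noteq> jw" and p: "card (labs R) \<ge> 3"
    and l: "l1 \<in> labs R" "l2 \<in> labs R" "l1 \<noteq> l2" "m (C R l2) \<le> m (C R l1)"
    "\<And>l. l \<in> labs R \<Longrightarrow> l \<noteq> l1 \<Longrightarrow> m (C R l) \<le> m (C R l2)" and a1: "2 \<le> m (C R l1)"
    and cb: "\<And>x y. x \<in> Al R \<Longrightarrow> y \<in> Al R \<Longrightarrow> L x x \<noteq> L y y \<Longrightarrow> L x y = cb" and jz: "jz \<noteq> cb"
  shows False
proof -
  interpret S: tri_core V \<kappa> L w B R by (rule swap)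
  define a' where "a' = m (Al R) - m (C R l1) - m (C R l2)"
  let ?a1 = "m (C R l1)" and ?a2 = "m (C R l2)" and ?bz = "m (C B jz)" and ?bw = "m (C B jw)"
  have tot: "?a1 + ?a2 + a' + ?bz + ?bw = 9" using m_total m_Al_two[OF q(1,2)] by (simp add: a'_def)
  have a2: "?a2 < 2" using two_big[OF l(3) a1] by force
  have b: "?bz < 2 \<or> ?bw < 2" using S.two_big[OF q(2)] by force
  have l5: "?a1 + ?bz < 5" "?a1 + ?bw < 5" using pair_lt5 by auto
  have lt3: "?a1 < 3" "?bz < 3" "?bw < 3" using C_lt3 by auto
  have rest: "?a2 + a' > 2" using tot b l5 by linarith
  have "m (Al R) \<ge> 3" using a1 rest a'_def by linarith
  then have a'1: "a' < 1" using rest_small[OF p _ l(4,5)] rest a'_def by auto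
  have a'0: "0 \<le> a'" using m_two[OF l(3), of R] m_nonneg by (metis a'_def)
  obtain x where x: "x \<in> C R l1" "m {u \<in> Al B. \<kappa> x u = R} < 3 - ?a1" using big_vertex[OF a1] by blast
  define T where "T = {u \<in> Al B. \<kappa> x u = R}"
  have T: "m T < 3 - ?a1" "T \<subseteq> V" using x C_sub(2) by (auto simp: T_def)
  have nT: "\<kappa> x u = B" if "u \<in> C B j" "u \<notin> T" for u j
    using that C_Al[of u] notR by (auto simp: T_def)
  have mZ: "?bz - m T \<le> m (C B jz - T)" "?bw - m T \<le> m (C B jw - T)"
    using m_diff_ge[OF C_sub(3) T(2)] by auto
  have "m (C B jz - T) > 0" "m (C B jw - T) > 0" using mZ T(1) tot a2 a'1 lt3 by linarith+
  then obtain z1 u1 where z1: "z1 \<in> C B jz" "z1 \<notin> T" and u1: "u1 \<in> C B jw" "u1 \<notin> T"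
    using m_pos_ne by (metis Diff_iff ex_in_conv)
  have zred: "\<kappa> z y = R" if z: "z \<in> C B jz" "z \<notin> T" and y: "y \<in> C R i" "i \<noteq> l1" for z y i
  proof (rule ccontr)
    assume "\<kappa> z y \<noteq> R"
    then have "L x y = jz"
      using blue_triangle_label[of x y z jz] C_Al[OF x(1)] C_Al[OF y(1)] z nT[OF z] crossR[OF x(1) y(1)] y(2) notR ks by metis
    moreover have "L x y = cb" using cb[of x y] C_Al[OF x(1)] C_Al[OF y(1)] y(2) by simp
    ultimately show False using jz by simp
  qed
  have zw: "\<kappa> z u = R" if "z \<in> C B jz" "u \<in> C B jw" for z u using S.crossR[OF that q(2)] .
  \<comment> \<open>Two red edges from u1 to different red classes would give z1 u1 two labels. So
    one of the edges is blue, and it closes a blue triangle with x.\<close>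
  have jw: "jw = cb"
  proof -
    obtain l3 where l3: "l3 \<in> labs R" "l3 \<noteq> l1" "l3 \<noteq> l2" using third[OF p] by blast
    obtain y y' where y: "y \<in> C R l2" "y' \<in> C R l3" using l(2) l3(1) by (auto simp: labs_ne)
    have "\<not> (\<kappa> y u1 = R \<and> \<kappa> y' u1 = R)"
      using red_triangle_label[OF y(1), of z1 u1] red_triangle_label[OF y(2), of z1 u1] l l3
        zred[OF z1 y(1)] zred[OF z1 y(2)] zw[OF z1(1) u1(1)] C_Al[OF z1(1)] C_Al[OF u1(1)] ks by metis
    then obtain y0 i where y0: "y0 \<in> C R i" "i \<noteq> l1" "\<kappa> y0 u1 = B" using y l l3 notR by metis
    have "L x y0 = jw"
      using blue_triangle_label[of x y0 u1 jw] C_Al[OF x(1)] C_Al[OF y0(1)] u1 nT[OF u1] crossR[OF x(1) y0(1)] y0 ks by metis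
    moreover have "L x y0 = cb" using cb[of x y0] C_Al[OF x(1)] C_Al[OF y0(1)] y0(2) by simp
    ultimately show ?thesis by simp
  qed
  have ne: "C R l1 \<noteq> {}" "C R l2 \<noteq> {}" using l by (auto simp: labs_ne)
  have "a' + ?bw / 3 < 1" using A_cover[OF l(3) ne cb a'_def] a'1 a1 rest jw by auto
  moreover have big: "?a2 + a' + ?bw > 4" using tot l5 by linarith
  ultimately have a'h: "?bw < 3 - 3 * a'" "a' < 1/2" using a2 by linarith+
  define Z where "Z = C B jz - T"
  have mZ1: "1 \<le> m Z" using mZ T(1) tot a2 a'h a'0 by (simp add: Z_def)
  have ZV: "Z \<subseteq> V" using C_sub(3) by (auto simp: Z_def)
  have Zne: "Z \<noteq> {}" using mZ1 m_pos_ne[of Z] by auto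
  \<comment> \<open>From here on a second cover is used, that of the triangle class
    \<open>l2\<close> itself. Its cheapest point z0 on Z has value \<zeta>, and s is what remains to
    be paid in a triangle through z0.\<close>
  define u where "u = w l2"
  let ?Y = "C R l2" and ?W = "C B jw"
  obtain z0 where z0: "z0 \<in> Z" "\<And>z. z \<in> Z \<Longrightarrow> u z0 \<le> u z" using argminV[OF ZV Zne] by metis
  define \<zeta> where "\<zeta> = u z0"
  obtain y2 where y2: "y2 \<in> ?Y" using ne by blast
  have Iu: "I u V < 1" using I_C[OF y2] by (simp add: u_def)
  have IZ: "\<zeta> \<le> I u Z"
  proof -
    have "\<zeta> * 1 \<le> \<zeta> * m Z" using mZ1 w0 by (intro mult_left_mono) (auto simp: \<zeta>_def u_def)
    also have "\<dots> \<le> I u Z" using ZV z0 by (intro I_ge) (auto simp: \<zeta>_def)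
    finally show ?thesis by simp
  qed
  have dj: "Z \<inter> ?Y = {}" "(Z \<union> ?Y) \<inter> ?W = {}" using q(2) RB by (auto simp: Z_def C_def)
  have sum3: "I u Z + I u ?Y + I u ?W < 1" using I_disjoint3[OF ZV C_sub(3) C_sub(3) dj, of l2] Iu by (simp add: u_def)
  have I0: "0 \<le> I u ?Y" "0 \<le> I u ?W" using w0 by (auto simp: u_def intro: I_nonneg)
  define s where "s = 1 - \<zeta>"
  have s0: "0 < s" using IZ sum3 I0 by (simp add: s_def)
  have yz: "s / 2 \<le> u y" if y: "y \<in> ?Y" for y
    using cov_loop[OF y, of z0] zred[of z0 y l2] z0(1) y l(3) ZV ks by (auto simp: u_def s_def \<zeta>_def Z_def)
  have yw: "s \<le> u y + u x'" if y: "y \<in> ?Y" and x': "x' \<in> ?W" "\<kappa> y x' = R" for y x'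
  proof -
    have zz: "z0 \<in> C B jz" "z0 \<notin> T" using z0(1) by (auto simp: Z_def)
    have k: "\<kappa> y z0 = R" "\<kappa> z0 x' = R" using zred[OF zz y] l(3) ks[of y z0] zw[OF zz(1) x'(1)] by auto
    have "L y z0 = l2" using edge_loop[OF y, of z0] k ZV z0 by auto
    moreover have "z0 \<in> V" "y \<in> V" "x' \<in> V" using ZV z0(1) y x' C_sub(3) by auto
    ultimately have "1 \<le> u y + u z0 + u x'" using cov[of y z0 x'] k x' by (simp add: u_def)
    then show ?thesis by (simp add: s_def \<zeta>_def)
  qed
  have YV: "?Y \<subseteq> V" "finite ?Y" using C_sub(3) finV by auto
  \<comment> \<open>The cut is made at 1 - a', the measure that \<open>final_cover\<close> requires
    of its set \<open>Y\<close>.\<close>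
  obtain \<alpha> where \<alpha>: "\<alpha> \<in> u ` ?Y" "1 - a' \<le> m {y \<in> ?Y. u y \<le> \<alpha>}" "m {y \<in> ?Y. u y < \<alpha>} < 1 - a'"
    using quantile[OF YV(2,1), of "1 - a'" u] a'1 rest by auto
  have \<alpha>s: "s / 2 \<le> \<alpha>" using \<alpha>(1) yz by auto
  have IY: "(1 - a') * (s / 2) + (?a2 - 1 + a') * \<alpha> \<le> I u ?Y"
  proof -
    let ?A = "{y \<in> ?Y. u y < \<alpha>}"
    have AY: "?A \<subseteq> ?Y" by blast
    have "s / 2 * m ?A \<le> I u ?A" using YV yz by (intro I_ge) auto
    moreover have "\<alpha> * m (?Y - ?A) \<le> I u (?Y - ?A)" using YV by (intro I_ge) auto
    moreover have "I u ?A + I u (?Y - ?A) = I u ?Y" using I_Un[of ?A "?Y - ?A" u] YV(1) AY by (simp add: Un_absorb1 Diff_subset subset_trans[OF AY] subset_trans[OF Diff_subset])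
    moreover have "m (?Y - ?A) = ?a2 - m ?A" using m_diff[OF AY YV(1)] .
    moreover have "(\<alpha> - s/2) * m ?A \<le> (\<alpha> - s/2) * (1 - a')" using \<alpha>(3) \<alpha>s by (intro mult_left_mono) auto
    ultimately show ?thesis by (simp add: algebra_simps)
  qed
  have key: "\<zeta> + (1 - a') * (s / 2) + (?a2 - 1 + a') * \<alpha> + I u ?W < 1" using IY IZ sum3 by linarith
  have \<alpha>1: "\<alpha> < s"
  proof (rule ccontr)
    assume "\<not> ?thesis"
    then have "(?a2 - 1 + a') * s \<le> (?a2 - 1 + a') * \<alpha>" using rest by (intro mult_left_mono) auto
    moreover have "1 \<le> (1 - a') / 2 + (?a2 - 1 + a')" using rest a'1 by (simp add: field_simps)
    then have "1 * s \<le> ((1 - a') / 2 + (?a2 - 1 + a')) * s" using s0 by (intro mult_right_mono) auto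
    ultimately have "s \<le> (1 - a') * (s / 2) + (?a2 - 1 + a') * \<alpha>" by (simp add: algebra_simps)
    then show False using key I0(2) by (simp add: s_def)
  qed
  have few: "m {x' \<in> ?W. \<kappa> y x' = R} < 2 - ?a2" if y: "y \<in> ?Y" "u y \<le> \<alpha>" for y
  proof -
    let ?T3 = "{x' \<in> ?W. \<kappa> y x' = R}"
    have sub: "?T3 \<subseteq> ?W" "?T3 \<subseteq> V" using C_sub(3) by blast+
    have "(s - \<alpha>) * m ?T3 \<le> I u ?T3" using sub yw[OF y(1)] y(2) by (intro I_ge) force+
    also have "\<dots> \<le> I u ?W" unfolding u_def using sub(1) C_sub(3) by (rule I_mono)
    finally have 1: "(s - \<alpha>) * m ?T3 < s - (1 - a') * (s / 2) - (?a2 - 1 + a') * \<alpha>"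
      using key by (simp add: s_def)
    \<comment> \<open>This product is the difference of the two sides of the next inequality; its
      first factor is positive because \<open>?a2 + a' > 2\<close> and
      \<open>a' < 1\<close>.\<close>
    have "0 \<le> (2 * ?a2 + a' - 3) * (\<alpha> - s / 2)" using rest a'1 \<alpha>s by (intro mult_nonneg_nonneg) auto
    then have "s - (1 - a') * (s / 2) - (?a2 - 1 + a') * \<alpha> \<le> (s - \<alpha>) * (2 - ?a2)"
      by (simp add: algebra_simps diff_divide_distrib)
    then have "(s - \<alpha>) * m ?T3 < (s - \<alpha>) * (2 - ?a2)" using 1 by linarith
    then show ?thesis using \<alpha>1 by (simp add: mult_less_cancel_left_pos)
  qed
  define YL where "YL = {y \<in> ?Y. u y \<le> \<alpha>}"
  have YL: "YL \<subseteq> V" "YL \<noteq> {}" "1 - a' \<le> m YL" using YV \<alpha> m_pos_ne[of YL] a'1 by (auto simp: YL_def)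
  obtain y0 where y0: "y0 \<in> YL" "\<And>y. y \<in> YL \<Longrightarrow> w cb y0 \<le> w cb y" using argminV[OF YL(1,2)] by metis
  let ?T3 = "{x' \<in> ?W. \<kappa> y0 x' = R}"
  have T3: "m ?T3 < 2 - ?a2" using few y0(1) by (auto simp: YL_def)
  have mW: "m (?W - ?T3) = ?bw - m ?T3" using C_sub(3) by (intro m_diff) auto
  show False
  proof (rule final_cover[OF l(3)[symmetric] ne(2,1) cb, where Y = YL and ?y0.0 = y0 and W = "?W - ?T3"])
    show "a' = m (Al R) - m (C R l2) - m (C R l1)" by (simp add: a'_def)
    show "?W - ?T3 \<subseteq> Al B" using C_sub(1) by blast
    show "2 - 2 * a' \<le> m (?W - ?T3)" using mW T3 big a'0 by linarith
    show "1 \<le> 2 * w cb u + w cb y0" if u: "u \<in> ?W - ?T3" for u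
    proof -
      have "\<kappa> u y0 = B" using u notR ks by blast
      then show ?thesis using cov_loop[of u B jw y0] u jw YL(1) y0(1) by auto
    qed
  qed (use y0 YL a'1 a1 rest in \<open>auto simp: YL_def\<close>)
qed

lemma two_versus_many:
  assumes q: "card (labs B) = 2" and p: "card (labs R) \<ge> 3"
  shows False
proof -
  obtain l1 l2 where l: "l1 \<in> labs R" "l2 \<in> labs R" "l1 \<noteq> l2" "m (C R l2) \<le> m (C R l1)"
    "\<And>l. l \<in> labs R \<Longrightarrow> l \<noteq> l1 \<Longrightarrow> m (C R l) \<le> m (C R l2)" using two_max[OF labs_R_ge2] by metis
  obtain j1 j2 where j: "labs B = {j1, j2}" "j1 \<noteq> j2" using q by (meson card_2_iff)
  have j': "labs B = {j2, j1}" "j2 \<noteq> j1" using j by auto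
  obtain cb where cb: "\<And>x y. x \<in> Al R \<Longrightarrow> y \<in> Al R \<Longrightarrow> L x x \<noteq> L y y \<Longrightarrow> L x y = cb"
    using cross_label[OF p] by blast
  show False
  proof (cases "m (C R l1) < 2")
    case True
    then show False using two_versus_many_balanced[OF j _ p l] two_versus_many_balanced[OF j' _ p l] by (meson linear)
  next
    case False
    \<comment> \<open>At least one of the two blue labels differs from \<open>cb\<close> and can
      play the role of \<open>jz\<close>.\<close>
    then have "2 \<le> m (C R l1)" by simp
    then show False using two_versus_many_unbalanced[OF j p l _ cb] two_versus_many_unbalanced[OF j' p l _ cb] j(2) by blast
  qed
qed

end

section \<open>A small linear program, and at least three classes in both colours\<close>

lemma lp_saturated:
  fixes a \<alpha> b p q k :: real
  assumes "0 \<le> a" "a \<le> \<alpha>" "0 \<le> b" "1 \<le> a + b / 2" "3 \<le> 2 * a + \<alpha> + b"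
    and "0 \<le> p" "0 \<le> q" "1 \<le> p + q" "1/3 \<le> k" "1 \<le> 2 * k + p" "1 \<le> 2 * k + q"
  shows "1 \<le> a * p + \<alpha> * q + b * k"
proof -
  \<comment> \<open>The tight case with cover values 1 - t and t. The bound breaks at t = 1/3, where
    the constraints \<open>1/3 \<le> k\<close> and \<open>1 \<le> 2 * k + t\<close> exchange
    roles.\<close>
  have main: "1 \<le> a * (1 - t) + \<alpha> * t + b * k" if t: "1 \<le> 2 * k + t" "0 \<le> t" for t
  proof (cases "t \<le> 1/3")
    case True
    have "b * ((1 - t) / 2) \<le> b * k" using t assms by (intro mult_left_mono) auto
    moreover have "(1 - 3 * t) * 1 \<le> (1 - 3 * t) * (a + b / 2)" using True assms by (intro mult_left_mono) auto
    moreover have "t * 3 \<le> t * (2 * a + \<alpha> + b)" using t True assms by (intro mult_left_mono) auto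
    moreover have "(1 - 3 * t) * (a + b / 2) + t * (2 * a + \<alpha> + b) = a * (1 - t) + \<alpha> * t + b * ((1 - t) / 2)"
      by (simp add: field_simps)
    ultimately have "1 - 3 * t + t * 3 \<le> a * (1 - t) + \<alpha> * t + b * ((1 - t) / 2)"
      by (metis add_mono mult.right_neutral)
    then show ?thesis using \<open>b * ((1 - t) / 2) \<le> b * k\<close> by (metis (no_types) add_left_mono diff_add_cancel mult.commute order_trans)
  next
    case False
    have "b * 1 \<le> b * (3 * k)" using assms by (intro mult_left_mono) auto
    moreover have "0 \<le> (\<alpha> - a) * (t - 1/3)" using False assms by (intro mult_nonneg_nonneg) auto
    then have "2 * a + \<alpha> \<le> 3 * (a * (1 - t) + \<alpha> * t)" by (simp add: field_simps)
    ultimately have "3 * 1 \<le> 3 * (a * (1 - t) + \<alpha> * t + b * k)" using assms by (simp add: algebra_simps)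
    then show ?thesis by simp
  qed
  show ?thesis
  proof (cases "q \<le> p")
    case True
    have "a * (1 - q) \<le> a * p" using assms by (intro mult_left_mono) auto
    then show ?thesis using main[of q] assms by linarith
  next
    case qp: False
    show ?thesis
    proof (cases "p \<le> 1/2")
      case True
      have "\<alpha> * (1 - p) \<le> \<alpha> * q" using assms by (intro mult_left_mono) auto
      moreover have "0 \<le> (\<alpha> - a) * (1 - 2 * p)" using True assms by (intro mult_nonneg_nonneg) auto
      then have "a * (1 - p) + \<alpha> * p \<le> a * p + \<alpha> * (1 - p)" by (simp add: algebra_simps)
      ultimately show ?thesis using main[of p] assms by linarith
    next
      case False
      have "a * (1/2) \<le> a * p" "\<alpha> * (1/2) \<le> \<alpha> * q" using False qp assms by (intro mult_left_mono; simp)+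
      then show ?thesis using main[of "1/2"] assms by simp
    qed
  qed
qed

text \<open>The deficit \<tau> = 1 - (p + q) is added to p, which reduces to the saturated case. Its
  price a \<tau> is paid by a0 n if a is at most a0; otherwise the missing (a - a0) \<tau> is taken
  out of b0 k, since both n and k are at least \<tau>.\<close>

lemma lp_general:
  fixes a \<alpha> a0 b0 p q n k :: real
  assumes "0 \<le> a" "a \<le> \<alpha>" "a < 1" "0 \<le> a0" "0 \<le> b0" "1 \<le> a + b0 / 2" "3 \<le> 2 * a + \<alpha> + b0"
    and "2 < a0 + b0" "4 < \<alpha> + (a0 + b0)"
    and "0 \<le> p" "0 \<le> q" "0 \<le> n" "1 \<le> p + q + n" "1 \<le> p + q + k" "1/3 \<le> k" "1 \<le> 2 * k + p" "1 \<le> 2 * k + q"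
  shows "1 \<le> a * p + \<alpha> * q + a0 * n + b0 * k"
proof (cases "1 \<le> p + q")
  case True
  have "1 \<le> a * p + \<alpha> * q + b0 * k" using assms True by (intro lp_saturated) auto
  moreover have "0 \<le> a0 * n" using assms by simp
  ultimately show ?thesis by linarith
next
  case False
  define \<tau> where "\<tau> = 1 - (p + q)"
  have \<tau>: "0 < \<tau>" "\<tau> \<le> n" "\<tau> \<le> k" using False assms by (auto simp: \<tau>_def)
  have n: "a0 * \<tau> \<le> a0 * n" using assms \<tau> by (intro mult_left_mono) auto
  show ?thesis
  proof (cases "a \<le> a0")
    case True
    have "1 \<le> a * (p + \<tau>) + \<alpha> * q + b0 * k"
      using assms \<tau> by (intro lp_saturated) (auto simp: \<tau>_def)
    moreover have "a * \<tau> \<le> a0 * \<tau>" using True \<tau> by (intro mult_right_mono) auto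
    ultimately show ?thesis using n by (simp add: algebra_simps)
  next
    case False
    define b1 where "b1 = a0 + b0 - a"
    have "1 \<le> a + b1 / 2" using assms by (simp add: b1_def field_simps)
    then have "1 \<le> a * (p + \<tau>) + \<alpha> * q + b1 * k"
      using assms \<tau> by (intro lp_saturated) (auto simp: \<tau>_def b1_def)
    moreover have "(b0 - b1) * \<tau> \<le> (b0 - b1) * k" using False \<tau> by (intro mult_left_mono) (auto simp: b1_def)
    ultimately show ?thesis using n by (simp add: algebra_simps b1_def)
  qed
qed

context tri_core begin

text \<open>Red edges from x to two blue classes would close a red triangle with the red edge
  between these classes and give it the loop class of x instead of \<open>cr\<close>.\<close>

lemma only_one_red:
  assumes cr: "\<And>x y. x \<in> Al B \<Longrightarrow> y \<in> Al B \<Longrightarrow> L x x \<noteq> L y y \<Longrightarrow> L x y = cr"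
    and x: "x \<in> C R i" "i \<noteq> cr" and jj: "j \<noteq> j'"
  shows "(\<forall>z\<in>C B j. \<kappa> x z = B) \<or> (\<forall>z\<in>C B j'. \<kappa> x z = B)"
proof (rule ccontr)
  interpret S: tri_core V \<kappa> L w B R by (rule swap)
  assume "\<not> ?thesis"
  then obtain z z' where z: "z \<in> C B j" "\<kappa> x z = R" "z' \<in> C B j'" "\<kappa> x z' = R" using notR by blast
  have "L z z' = i" using red_triangle_label[of x i z z'] x z S.crossR[OF z(1,3) jj] C_Al[OF z(1)] C_Al[OF z(3)] by blast
  moreover have "L z z' = cr" using cr[of z z'] C_Al[OF z(1)] C_Al[OF z(3)] jj by simp
  ultimately show False using x by simp
qed

text \<open>The variables are the minima of the cover of \<open>cb\<close> on four disjoint classes.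
  The constraints come from transversal triangles, from triangles with a corner in
  \<open>C B cb\<close>, and from the degenerate triangles there.\<close>

lemma C_b_cover:
  assumes cb: "\<And>x y. x \<in> Al R \<Longrightarrow> y \<in> Al R \<Longrightarrow> L x x \<noteq> L y y \<Longrightarrow> L x y = cb"
    and d: "i \<noteq> i'" "i \<noteq> h" "i' \<noteq> h" and ne: "C R i \<noteq> {}" "C R i' \<noteq> {}" "C R h \<noteq> {}" "C B cb \<noteq> {}"
    and bl: "\<And>x z. x \<in> C R i \<Longrightarrow> z \<in> C B cb \<Longrightarrow> \<kappa> x z = B" "\<And>x z. x \<in> C R i' \<Longrightarrow> z \<in> C B cb \<Longrightarrow> \<kappa> x z = B"
  shows "\<exists>p q n k. 0 \<le> p \<and> 0 \<le> q \<and> 0 \<le> n \<and> 1 \<le> p + q + n \<and> 1 \<le> p + q + k \<and> 1/3 \<le> k \<and> 1 \<le> 2 * k + p \<and> 1 \<le> 2 * k + q \<and>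
     m (C R i) * p + m (C R i') * q + m (C R h) * n + m (C B cb) * k < 1"
proof -
  let ?v = "w cb"
  obtain x where x: "x \<in> C R i" "\<And>y. y \<in> C R i \<Longrightarrow> ?v x \<le> ?v y" using argminV[OF C_sub(3) ne(1)] by metis
  obtain y where y: "y \<in> C R i'" "\<And>z. z \<in> C R i' \<Longrightarrow> ?v y \<le> ?v z" using argminV[OF C_sub(3) ne(2)] by metis
  obtain u where u: "u \<in> C R h" "\<And>z. z \<in> C R h \<Longrightarrow> ?v u \<le> ?v z" using argminV[OF C_sub(3) ne(3)] by metis
  obtain z where z: "z \<in> C B cb" "\<And>y. y \<in> C B cb \<Longrightarrow> ?v z \<le> ?v y" using argminV[OF C_sub(3) ne(4)] by metis
  have xy: "L x y = cb" using cb[of x y] C_Al[OF x(1)] C_Al[OF y(1)] d by simp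
  have "?v x * m (C R i) \<le> I ?v (C R i)" "?v y * m (C R i') \<le> I ?v (C R i')"
    "?v u * m (C R h) \<le> I ?v (C R h)" "?v z * m (C B cb) \<le> I ?v (C B cb)"
    using x y u z C_sub(3) by (intro I_ge; blast)+
  moreover have "I ?v (C R i) + I ?v (C R i') + I ?v (C R h) + I ?v (C B cb) \<le> I ?v V"
    using C_sub(3) d RB by (intro I_disjoint4) (auto simp: C_def)
  moreover have "I ?v V < 1" using I_small[of x y] xy C_Al[OF x(1)] C_Al[OF y(1)] by simp
  ultimately have "m (C R i) * ?v x + m (C R i') * ?v y + m (C R h) * ?v u + m (C B cb) * ?v z < 1"
    by (simp add: mult.commute)
  moreover have "1 \<le> ?v x + ?v y + ?v u"
    using three_cov[of x y u] xy C_Al[OF x(1)] C_Al[OF y(1)] C_Al[OF u(1)] d by simp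
  moreover have "1 \<le> ?v x + ?v y + ?v z"
    using cov[of x y z] xy C_Al[OF x(1)] C_Al[OF y(1)] C_Al[OF z(1)] crossR[OF x(1) y(1) d(1)] bl(1)[OF x(1) z(1)] bl(2)[OF y(1) z(1)] by simp
  moreover have "1 \<le> 2 * ?v z + ?v x" "1 \<le> 2 * ?v z + ?v y"
    using cov_loop[OF z(1), of x] cov_loop[OF z(1), of y] C_Al[OF x(1)] C_Al[OF y(1)] bl(1)[OF x(1) z(1)] bl(2)[OF y(1) z(1)] ks[of z] by auto
  moreover have "1/3 \<le> ?v z" using loop3 z by blast
  ultimately show ?thesis using w0 by blast
qed

text \<open>Both bounds are read off this program: the first by lowering n and k to their minimum,
  the second from \<open>lp_general\<close>.\<close>

lemma C_b_bound:
  assumes cb: "\<And>x y. x \<in> Al R \<Longrightarrow> y \<in> Al R \<Longrightarrow> L x x \<noteq> L y y \<Longrightarrow> L x y = cb"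
    and d: "i \<noteq> i'" "i \<noteq> h" "i' \<noteq> h" and ne: "C R i \<noteq> {}" "C R i' \<noteq> {}" "C R h \<noteq> {}" "C B cb \<noteq> {}"
    and bl: "\<And>x z. x \<in> C R i \<Longrightarrow> z \<in> C B cb \<Longrightarrow> \<kappa> x z = B" "\<And>x z. x \<in> C R i' \<Longrightarrow> z \<in> C B cb \<Longrightarrow> \<kappa> x z = B"
  shows "m (C R h) + m (C B cb) \<ge> 1 \<Longrightarrow> min (m (C R i)) (m (C R i')) < 1"
   and "\<lbrakk>a = min (m (C R i)) (m (C R i')); \<alpha> = max (m (C R i)) (m (C R i')); a < 1;
      2 < m (C R h) + m (C B cb); 4 < \<alpha> + (m (C R h) + m (C B cb))\<rbrakk> \<Longrightarrow>
      a + m (C B cb) / 2 < 1 \<or> 2 * a + \<alpha> + m (C B cb) < 3"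
proof -
  let ?i = "m (C R i)" and ?j = "m (C R i')" and ?h = "m (C R h)" and ?b = "m (C B cb)"
  obtain p q n k where c: "0 \<le> p" "0 \<le> q" "0 \<le> n" "1 \<le> p + q + n" "1 \<le> p + q + k" "1/3 \<le> k" "1 \<le> 2 * k + p" "1 \<le> 2 * k + q"
     and s: "?i * p + ?j * q + ?h * n + ?b * k < 1" using C_b_cover[OF assms] by blast
  show "min ?i ?j < 1" if h: "?h + ?b \<ge> 1"
  proof (rule ccontr)
    assume n: "\<not> ?thesis"
    define t where "t = min n k"
    have "1 * p \<le> ?i * p" "1 * q \<le> ?j * q" "1 * t \<le> (?h + ?b) * t"
      by (rule mult_right_mono; use n c h in \<open>simp add: t_def\<close>)+
    moreover have "?h * t \<le> ?h * n" "?b * t \<le> ?b * k"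
      by (rule mult_left_mono; use m_nonneg in \<open>simp add: t_def\<close>)+
    moreover have "1 \<le> p + q + t" using c by (auto simp: t_def)
    ultimately show False using s by (simp add: algebra_simps)
  qed
  assume a: "a = min ?i ?j" "\<alpha> = max ?i ?j" "a < 1" "2 < ?h + ?b" "4 < \<alpha> + (?h + ?b)"
  show "a + ?b / 2 < 1 \<or> 2 * a + \<alpha> + ?b < 3"
  proof (rule ccontr)
    assume "\<not> ?thesis"
    then have nn: "1 \<le> a + ?b / 2" "3 \<le> 2 * a + \<alpha> + ?b" by auto
    show False
    proof (cases "?i \<le> ?j")
      case True
      then have e: "a = ?i" "\<alpha> = ?j" using a by auto
      have "1 \<le> ?i * p + ?j * q + ?h * n + ?b * k"
        using c a nn True m_nonneg unfolding e by (intro lp_general) auto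
      then show False using s by simp
    next
      case False
      then have e: "a = ?j" "\<alpha> = ?i" using a by auto
      have "1 \<le> ?j * q + ?i * p + ?h * n + ?b * k"
        using c a nn False m_nonneg unfolding e by (intro lp_general) auto
      then show False using s by simp
    qed
  qed
qed

lemma big_vertex_class:
  assumes "2 \<le> m (C R i)" "\<And>x z. x \<in> C R i \<Longrightarrow> z \<in> C B j \<Longrightarrow> \<kappa> x z = R"
  shows "m (C R i) + m (C B j) < 3"
proof -
  obtain x where x: "x \<in> C R i" "m {u \<in> Al B. \<kappa> x u = R} < 3 - m (C R i)" using big_vertex assms(1) by blast
  have "m (C B j) \<le> m {u \<in> Al B. \<kappa> x u = R}"
    using assms(2)[OF x(1)] C_sub by (intro m_mono) blast+
  then show ?thesis using x by simp
qed

text \<open>A red point outside \<open>C R cr\<close> is red to at most one blue class, and a blue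
  point outside \<open>C B cb\<close> is blue to at most one red class. Applied alternately, these
  rules propagate the colour at \<open>x1\<close> to all pairs of a red and a blue class except
  \<open>C R cr\<close> with \<open>C B cb\<close>. What remains is arithmetic with six
  sizes.\<close>

lemma three_versus_three_aux:
  assumes cb: "\<And>x y. x \<in> Al R \<Longrightarrow> y \<in> Al R \<Longrightarrow> L x x \<noteq> L y y \<Longrightarrow> L x y = cb"
    and cr: "\<And>x y. x \<in> Al B \<Longrightarrow> y \<in> Al B \<Longrightarrow> L x x \<noteq> L y y \<Longrightarrow> L x y = cr"
    and lR: "labs R = {i1, i2, cr}" "i1 \<noteq> i2" "i1 \<noteq> cr" "i2 \<noteq> cr"
    and lB: "labs B = {j1, j2, cb}" "j1 \<noteq> j2" "j1 \<noteq> cb" "j2 \<noteq> cb"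
    and x1: "x1 \<in> C R i1" "\<And>z. z \<in> C B j1 \<Longrightarrow> \<kappa> x1 z = B"
  shows False
proof -
  interpret S: tri_core V \<kappa> L w B R by (rule swap)
  have ne: "C R i1 \<noteq> {}" "C R i2 \<noteq> {}" "C R cr \<noteq> {}" "C B j1 \<noteq> {}" "C B j2 \<noteq> {}" "C B cb \<noteq> {}"
    using lR(1) lB(1) by (auto simp flip: labs_ne)
  have sR: "(\<forall>z\<in>C B j. \<kappa> x z = B) \<or> (\<forall>z\<in>C B j'. \<kappa> x z = B)" if "x \<in> C R i" "i \<noteq> cr" "j \<noteq> j'" for x i j j'
    using only_one_red[OF cr that] .
  have sB: "(\<forall>z\<in>C R j. \<kappa> x z = R) \<or> (\<forall>z\<in>C R j'. \<kappa> x z = R)" if "x \<in> C B i" "i \<noteq> cb" "j \<noteq> j'" for x i j j'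
    using S.only_one_red[OF cb that] .
  have nc: False if H: "x \<in> C R i" "y \<in> C R i'" "i \<noteq> i'" "\<And>z. z \<in> C B j \<Longrightarrow> \<kappa> x z = B" "\<And>z. z \<in> C B j \<Longrightarrow> \<kappa> y z = B" "j = j1 \<or> j = j2" for x y i i' j
  proof -
    obtain z where z: "z \<in> C B j" using H(6) ne by blast
    have "\<kappa> z x = B" "\<kappa> z y = B" using H(4,5)[OF z] ks by metis+
    then show False using sB[OF z _ H(3)] H lB RB by metis
  qed
  have A2: "\<kappa> x z = B" if x: "x \<in> C R i2" and z: "z \<in> C B j2 \<or> z \<in> C B cb" for x z
  proof -
    have "\<not> (\<forall>z\<in>C B j1. \<kappa> x z = B)" using nc[OF x1(1) x lR(2) x1(2)] by blast
    then show ?thesis using sR[OF x lR(4), of j1 j2] sR[OF x lR(4), of j1 cb] lB z by blast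
  qed
  obtain x2 where x2: "x2 \<in> C R i2" using ne by blast
  have A1: "\<kappa> x z = B" if x: "x \<in> C R i1" and z: "z \<in> C B j1 \<or> z \<in> C B cb" for x z
  proof -
    have "\<not> (\<forall>z\<in>C B j2. \<kappa> x z = B)" using nc[OF x x2 lR(2), of j2] A2[OF x2] by blast
    then show ?thesis using sR[OF x lR(3), of j2 j1] sR[OF x lR(3), of j2 cb] lB z by metis
  qed
  have B1: "\<kappa> z x = R" if z: "z \<in> C B j1" and x: "x \<in> C R i2 \<or> x \<in> C R cr" for x z
  proof -
    have "\<kappa> z x1 = B" using A1[OF x1(1)] z ks by metis
    then show ?thesis using sB[OF z lB(3), of i1 i2] sB[OF z lB(3), of i1 cr] lR x x1(1) RB by metis
  qed
  have B2: "\<kappa> z x = R" if z: "z \<in> C B j2" and x: "x \<in> C R i1 \<or> x \<in> C R cr" for x z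
  proof -
    have "\<kappa> z x2 = B" using A2[OF x2] z ks by metis
    then show ?thesis using sB[OF z lB(4), of i2 i1] sB[OF z lB(4), of i2 cr] lR x x2 RB by metis
  qed
  define a1 a2 a0 b1 b2 b0 where "a1 = m (C R i1)" and "a2 = m (C R i2)" and "a0 = m (C R cr)"
    and "b1 = m (C B j1)" and "b2 = m (C B j2)" and "b0 = m (C B cb)"
  note defs = this
  have tot: "a1 + a2 + a0 + b1 + b2 + b0 = 9"
  proof -
    have u: "Al R = (C R i1 \<union> C R i2) \<union> C R cr" 
    proof -
      have "v \<in> (C R i1 \<union> C R i2) \<union> C R cr" if "v \<in> Al R" for v
      proof -
        have "L v v \<in> {i1, i2, cr}" using that unfolding lR(1)[symmetric] labs_def by blast
        then show ?thesis using Al_C[OF that] by auto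
      qed
      then show ?thesis using C_sub(1) by blast
    qed
    have v: "Al B = (C B j1 \<union> C B j2) \<union> C B cb" 
    proof -
      have "v \<in> (C B j1 \<union> C B j2) \<union> C B cb" if "v \<in> Al B" for v
      proof -
        have "L v v \<in> {j1, j2, cb}" using that unfolding lB(1)[symmetric] labs_def by blast
        then show ?thesis using Al_C[OF that] by auto
      qed
      then show ?thesis using C_sub(1) by blast
    qed
    have "m (Al R) = a1 + a2 + a0" unfolding u using C_sub(3) lR C_disj2
      by (subst m_Un m_Un; (simp add: defs m_Un Int_Un_distrib2)?)+
    moreover have "m (Al B) = b1 + b2 + b0" unfolding v using C_sub(3) lB C_disj2
      by (subst m_Un m_Un; (simp add: defs m_Un Int_Un_distrib2)?)+
    ultimately show ?thesis using m_total by linarith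
  qed
  have r1: "\<kappa> x z = R" if "x \<in> C R i1" "z \<in> C B j2" for x z using B2[of z x] that ks[of z x] by simp
  have r2: "\<kappa> x z = R" if "x \<in> C R i2" "z \<in> C B j1" for x z using B1[of z x] that ks[of z x] by simp
  have r3: "\<kappa> z x = B" if "z \<in> C B j1" "x \<in> C R i1" for x z using A1[of x z] that ks[of x z] by simp
  have r4: "\<kappa> z x = B" if "z \<in> C B j2" "x \<in> C R i2" for x z using A2[of x z] that ks[of x z] by simp
  have c1: "2 \<le> a1 \<Longrightarrow> a1 + b2 < 3" using big_vertex_class[of i1 j2] r1 by (simp add: defs)
  have c2: "2 \<le> a2 \<Longrightarrow> a2 + b1 < 3" using big_vertex_class[of i2 j1] r2 by (simp add: defs)
  have c3: "2 \<le> b1 \<Longrightarrow> b1 + a1 < 3" using S.big_vertex_class[of j1 i1] r3 by (simp add: defs)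
  have c4: "2 \<le> b2 \<Longrightarrow> b2 + a2 < 3" using S.big_vertex_class[of j2 i2] r4 by (simp add: defs)
  have l3: "a1 < 3" "a2 < 3" "a0 < 3" "b1 < 3" "b2 < 3" "b0 < 3" using C_lt3 by (auto simp: defs)
  have l0: "0 \<le> a1" "0 \<le> a2" "0 \<le> a0" "0 \<le> b1" "0 \<le> b2" "0 \<le> b0" using m_nonneg by (auto simp: defs)
  have t: "a1 < 2 \<or> a2 < 2" "b1 < 2 \<or> b2 < 2"
    using two_big[OF lR(2)] S.two_big[OF lB(2)] by (force simp: defs)+
  have l5: "a1 + b1 < 5" "a1 + b2 < 5" "a2 + b1 < 5" "a2 + b2 < 5" using pair_lt5 by (auto simp: defs)
  note Pb = C_b_bound[OF cb lR(2,3,4) ne(1,2,3,6) A1 A2, simplified, folded defs]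
  note Pr = S.C_b_bound[OF cr lB(2,3,4) ne(4,5,6,3) B1 B2, simplified, folded defs]
  \<comment> \<open>Otherwise the other four sizes add up to more than 8, so one of them is at least
    2; the matching bound among c1 to c4 then leaves a red and a blue class with more than 5
    together.\<close>
  have s1: "a0 + b0 \<ge> 1"
    using tot c1 c2 c3 c4 l3 l0 t l5 by (smt (verit))
  have mn: "min a1 a2 < 1" "min b1 b2 < 1" using Pb(1) Pr(1) s1 by auto
  define a \<alpha> b \<beta> where "a = min a1 a2" and "\<alpha> = max a1 a2" and "b = min b1 b2" and "\<beta> = max b1 b2"
  have ab: "a + \<alpha> = a1 + a2" "b + \<beta> = b1 + b2" "\<alpha> + \<beta> < 5" "\<alpha> < 3" "\<beta> < 3" "a < 1" "b < 1" "0 \<le> a" "0 \<le> b"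
    using l5 l3 l0 mn by (auto simp: a_def \<alpha>_def b_def \<beta>_def min_def max_def)
  have s2: "2 < a0 + b0" "4 < \<alpha> + (a0 + b0)" "4 < \<beta> + (b0 + a0)" using tot ab by linarith+
  have "a + b0 / 2 < 1 \<or> 2 * a + \<alpha> + b0 < 3" using Pb(2)[of a \<alpha>] s2 ab by (auto simp: a_def \<alpha>_def)
  moreover have "b + a0 / 2 < 1 \<or> 2 * b + \<beta> + a0 < 3" using Pr(2)[of b \<beta>] s2 ab by (auto simp: b_def \<beta>_def)
  ultimately show False using tot ab by (elim disjE) linarith+
qed

end

section \<open>Reduction to exactly three classes in each colour\<close>

context tri_core begin

lemma no_common_blue:
  assumes cb: "\<And>x y. x \<in> Al R \<Longrightarrow> y \<in> Al R \<Longrightarrow> L x x \<noteq> L y y \<Longrightarrow> L x y = cb"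
    and xy: "x \<in> C R i" "y \<in> C R i'" "i \<noteq> i'" and j: "j \<in> labs B" "j \<noteq> cb"
    and bl: "\<forall>z\<in>C B j. \<kappa> x z = B" "\<forall>z\<in>C B j. \<kappa> y z = B"
  shows False
proof -
  interpret S: tri_core V \<kappa> L w B R by (rule swap)
  obtain z where z: "z \<in> C B j" using j by (auto simp: labs_ne)
  have "\<kappa> z x = B" "\<kappa> z y = B" using bl z ks[of x z] ks[of y z] by auto
  then show False using S.only_one_red[OF cb z j(2) xy(3)] xy RB by auto
qed

text \<open>Each of two red points in different classes is entirely blue to all blue classes but at
  most one, and no class labelled other than \<open>cb\<close> is entirely blue to both. So at most
  two blue labels differ from \<open>cb\<close>.\<close>

lemma labs_three:
  assumes cb: "\<And>x y. x \<in> Al R \<Longrightarrow> y \<in> Al R \<Longrightarrow> L x x \<noteq> L y y \<Longrightarrow> L x y = cb"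
    and cr: "\<And>x y. x \<in> Al B \<Longrightarrow> y \<in> Al B \<Longrightarrow> L x x \<noteq> L y y \<Longrightarrow> L x y = cr"
    and i: "i1 \<in> labs R" "i2 \<in> labs R" "i1 \<noteq> i2" "i1 \<noteq> cr" "i2 \<noteq> cr"
    and j: "j1 \<in> labs B" "j2 \<in> labs B" "j1 \<noteq> j2" "j1 \<noteq> cb" "j2 \<noteq> cb" and c: "card (labs B) \<ge> 3"
  shows "labs B = {j1, j2, cb}"
proof -
  obtain x1 x2 where x: "x1 \<in> C R i1" "x2 \<in> C R i2" using i by (auto simp: labs_ne)
  have "labs B \<subseteq> {j1, j2, cb}"
  proof
    fix j assume jj: "j \<in> labs B"
    show "j \<in> {j1, j2, cb}"
    proof (rule ccontr)
      assume n: "j \<notin> {j1, j2, cb}"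
      have o: "(\<forall>z\<in>C B j. \<kappa> x1 z = B) \<or> (\<forall>z\<in>C B j'. \<kappa> x1 z = B)"
        "(\<forall>z\<in>C B j. \<kappa> x2 z = B) \<or> (\<forall>z\<in>C B j'. \<kappa> x2 z = B)" if "j \<noteq> j'" for j j'
        using only_one_red[OF cr x(1) i(4) that] only_one_red[OF cr x(2) i(5) that] by blast+
      have c: "\<not> ((\<forall>z\<in>C B j. \<kappa> x1 z = B) \<and> (\<forall>z\<in>C B j. \<kappa> x2 z = B))" if "j \<in> labs B" "j \<noteq> cb" for j
        using no_common_blue[OF cb x i(3) that] by blast
      have "j1 \<noteq> j" "j2 \<noteq> j" using n by auto
      then show False
        using o(1)[OF j(3)] o(1)[OF \<open>j1 \<noteq> j\<close>] o(1)[OF \<open>j2 \<noteq> j\<close>]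
          o(2)[OF j(3)] o(2)[OF \<open>j1 \<noteq> j\<close>] o(2)[OF \<open>j2 \<noteq> j\<close>]
          c[OF j(1,4)] c[OF j(2,5)] c[OF jj] n by blast
    qed
  qed
  moreover have "cb \<in> labs B" using third[OF c, of j1 j2] calculation by blast
  ultimately show ?thesis using j by blast
qed

lemma two_avoiding:
  assumes "card (labs k) \<ge> 3"
  obtains i1 i2 where "i1 \<in> labs k" "i2 \<in> labs k" "i1 \<noteq> i2" "i1 \<noteq> c" "i2 \<noteq> c"
  using third[OF assms, of c c] third[OF assms, of c] by metis

lemma three_versus_three:
  assumes "card (labs R) \<ge> 3" "card (labs B) \<ge> 3"
  shows False
proof -
  interpret S: tri_core V \<kappa> L w B R by (rule swap)
  obtain cb where cb: "\<And>x y. x \<in> Al R \<Longrightarrow> y \<in> Al R \<Longrightarrow> L x x \<noteq> L y y \<Longrightarrow> L x y = cb"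
    using cross_label[OF assms(1)] by blast
  obtain cr where cr: "\<And>x y. x \<in> Al B \<Longrightarrow> y \<in> Al B \<Longrightarrow> L x x \<noteq> L y y \<Longrightarrow> L x y = cr"
    using S.cross_label[OF assms(2)] by blast
  obtain i1 i2 where i: "i1 \<in> labs R" "i2 \<in> labs R" "i1 \<noteq> i2" "i1 \<noteq> cr" "i2 \<noteq> cr"
    using two_avoiding[OF assms(1)] by metis
  obtain j1 j2 where j: "j1 \<in> labs B" "j2 \<in> labs B" "j1 \<noteq> j2" "j1 \<noteq> cb" "j2 \<noteq> cb"
    using two_avoiding[OF assms(2)] by metis
  have lB: "labs B = {j1, j2, cb}" using labs_three[OF cb cr i j assms(2)] .
  then have lB': "labs B = {j2, j1, cb}" by auto
  have lR: "labs R = {i1, i2, cr}" using S.labs_three[OF cr cb j i assms(1)] .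
  obtain x where x: "x \<in> C R i1" using i by (auto simp: labs_ne)
  from only_one_red[OF cr x i(4) j(3)] show False
  proof
    assume "\<forall>z\<in>C B j1. \<kappa> x z = B"
    then show False using three_versus_three_aux[OF cb cr lR i(3,4,5) lB j(3,4,5) x] by blast
  next
    assume "\<forall>z\<in>C B j2. \<kappa> x z = B"
    then show False using three_versus_three_aux[OF cb cr lR i(3,4,5) lB' j(3)[symmetric] j(5,4) x] by blast
  qed
qed

theorem contradiction: False
proof -
  interpret S: tri_core V \<kappa> L w B R by (rule swap)
  have "card (labs R) \<ge> 2" "card (labs B) \<ge> 2" using labs_R_ge2 S.labs_R_ge2 by auto
  then consider "card (labs R) = 2" "card (labs B) = 2" | "card (labs R) = 2" "card (labs B) \<ge> 3"
    | "card (labs R) \<ge> 3" "card (labs B) = 2" | "card (labs R) \<ge> 3" "card (labs B) \<ge> 3"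
    by linarith
  then show False
    by cases (use two_versus_two S.two_versus_many two_versus_many three_versus_three in blast)+
qed

end

section \<open>Regularity partitions\<close>

text \<open>The conditional expectation of \<open>f\<close> given \<open>g\<close>, for the uniform
  distribution on \<open>S\<close>.\<close>

definition cmean :: "'s set \<Rightarrow> ('s \<Rightarrow> 'k) \<Rightarrow> ('s \<Rightarrow> real) \<Rightarrow> 's \<Rightarrow> real" where
  "cmean S g f s = (\<Sum>t\<in>{t\<in>S. g t = g s}. f t) / card {t\<in>S. g t = g s}"

text \<open>Not normalized and summed over points, so that parts of unequal size receive their
  proper weight.\<close>

definition energy :: "'s set \<Rightarrow> ('s \<Rightarrow> 'k) \<Rightarrow> ('s \<Rightarrow> real) \<Rightarrow> real" where
  "energy S g f = (\<Sum>s\<in>S. (cmean S g f s)\<^sup>2)"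

lemma cmean_cong: "g s = g t \<Longrightarrow> cmean S g f s = cmean S g f t"
  by (simp add: cmean_def)

text \<open>Averaging over cells is the orthogonal projection onto the functions constant on cells;
  \<open>h\<close> is such a function.\<close>

lemma sum_cmean_mult:
  assumes fin: "finite S" and h: "\<And>s t. s \<in> S \<Longrightarrow> t \<in> S \<Longrightarrow> g s = g t \<Longrightarrow> h s = h t"
  shows "(\<Sum>s\<in>S. cmean S g f s * h s) = (\<Sum>s\<in>S. f s * h s)"
proof -
  have "(\<Sum>s\<in>{x\<in>S. g x = k}. cmean S g f s * h s) = (\<Sum>s\<in>{x\<in>S. g x = k}. f s * h s)"
    if H: "k \<in> g ` S" for k
  proof -
    let ?K = "{x\<in>S. g x = k}"
    obtain s0 where s0: "s0 \<in> S" "g s0 = k" using H by blast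
    have K: "finite ?K" "card ?K > 0" using fin s0 by (auto simp: card_gt_0_iff)
    define c where "c = h s0"
    have hs: "h s = c" if "s \<in> ?K" for s using h[of s s0] that s0 unfolding c_def by auto
    have "(\<Sum>s\<in>?K. cmean S g f s * h s) = (\<Sum>s\<in>?K. (\<Sum>t\<in>?K. f t) / card ?K * c)"
      using hs by (intro sum.cong) (auto simp: cmean_def)
    also have "\<dots> = (\<Sum>t\<in>?K. f t) * c" using K s0 by auto
    also have "\<dots> = (\<Sum>s\<in>?K. f s * h s)"
      unfolding sum_distrib_right using hs by (intro sum.cong) auto
    finally show ?thesis .
  qed
  then show ?thesis
    using sum.image_gen[OF fin, of "\<lambda>s. cmean S g f s * h s" g] sum.image_gen[OF fin, of "\<lambda>s. f s * h s" g]
    by simp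
qed

text \<open>Pythagoras: the means over the fine cells project onto those over the coarse cells, so
  the cross term collapses to the coarse energy.\<close>

lemma energy_refine:
  assumes fin: "finite S" and ref: "\<And>s t. s \<in> S \<Longrightarrow> t \<in> S \<Longrightarrow> g' s = g' t \<Longrightarrow> g s = g t"
  shows "energy S g' f = energy S g f + (\<Sum>s\<in>S. (cmean S g' f s - cmean S g f s)\<^sup>2)"
proof -
  let ?a = "cmean S g' f" and ?b = "cmean S g f"
  have "(\<Sum>s\<in>S. ?a s * ?b s) = (\<Sum>s\<in>S. f s * ?b s)"
    by (rule sum_cmean_mult[OF fin]) (rule cmean_cong, erule (2) ref)
  also have "\<dots> = (\<Sum>s\<in>S. ?b s * ?b s)"
    by (rule sum_cmean_mult[symmetric, OF fin]) (rule cmean_cong)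
  finally have "(\<Sum>s\<in>S. ?a s * ?b s) = energy S g f" by (simp add: energy_def power2_eq_square)
  moreover have "(\<Sum>s\<in>S. (?a s - ?b s)\<^sup>2) = energy S g' f + energy S g f - 2 * (\<Sum>s\<in>S. ?a s * ?b s)"
    by (simp add: energy_def power2_diff sum.distrib sum_subtractf sum_distrib_left mult.assoc)
  ultimately show ?thesis by simp
qed

lemma energy_le:
  assumes "finite S" "\<And>s. s \<in> S \<Longrightarrow> 0 \<le> f s \<and> f s \<le> 1"
  shows "energy S g f \<le> card S"
proof -
  have "(cmean S g f s)\<^sup>2 \<le> 1" for s
  proof -
    let ?K = "{t\<in>S. g t = g s}"
    have "(\<Sum>t\<in>?K. f t) \<le> (\<Sum>t\<in>?K. 1)" by (rule sum_mono) (use assms in auto)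
    moreover have "0 \<le> (\<Sum>t\<in>?K. f t)" by (rule sum_nonneg) (use assms in auto)
    ultimately have "0 \<le> cmean S g f s" "cmean S g f s \<le> 1" by (auto simp: cmean_def divide_le_eq_1)
    then show ?thesis by (simp add: power_le_one)
  qed
  then show ?thesis unfolding energy_def using sum_bounded_above[of S "\<lambda>s. (cmean S g f s)\<^sup>2" 1] by simp
qed

lemma square_sum_le: "finite S \<Longrightarrow> (\<Sum>s\<in>S. f s)\<^sup>2 \<le> card S * (\<Sum>s\<in>S. (f s :: real)\<^sup>2)"
proof (cases "S = {}")
  case False
  assume "finite S"
  then have c: "0 < real (card S)" using False by (simp add: card_gt_0_iff)
  define \<mu> where "\<mu> = (\<Sum>s\<in>S. f s) / card S"
  have "0 \<le> (\<Sum>s\<in>S. (f s - \<mu>)\<^sup>2)" by (simp add: sum_nonneg)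
  also have "\<dots> = (\<Sum>s\<in>S. (f s)\<^sup>2) - 2 * \<mu> * (\<Sum>s\<in>S. f s) + card S * \<mu>\<^sup>2"
    by (simp add: power2_diff sum.distrib sum_subtractf sum_distrib_left sum_distrib_right mult_ac)
  also have "\<dots> = (\<Sum>s\<in>S. (f s)\<^sup>2) - (\<Sum>s\<in>S. f s)\<^sup>2 / card S"
    using c by (simp add: \<mu>_def power2_eq_square field_simps)
  finally show ?thesis using c by (simp add: field_simps)
qed auto

section \<open>Dense pairs and the energy increment\<close>

definition epairs :: "('v \<Rightarrow> 'v \<Rightarrow> bool) \<Rightarrow> 'v set \<Rightarrow> 'v set \<Rightarrow> real" where
  "epairs E X Y = (\<Sum>x\<in>X. \<Sum>y\<in>Y. of_bool (E x y))"

text \<open>One-sided regularity with a fixed density 1/4: the greedy embedding works from a lower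
  bound on large subpairs, and the form is inherited by large subsets.\<close>

definition bidense :: "('v \<Rightarrow> 'v \<Rightarrow> bool) \<Rightarrow> real \<Rightarrow> 'v set \<Rightarrow> 'v set \<Rightarrow> bool" where
  "bidense E \<epsilon> A B \<longleftrightarrow> (\<forall>X Y. X \<subseteq> A \<longrightarrow> Y \<subseteq> B \<longrightarrow> \<epsilon> * real (card A) \<le> card X \<longrightarrow> \<epsilon> * real (card B) \<le> card Y \<longrightarrow>
     1/4 * (card X * card Y) \<le> epairs E X Y)"

definition irregular :: "('v \<Rightarrow> 'v \<Rightarrow> bool) \<Rightarrow> real \<Rightarrow> 'v set \<Rightarrow> 'v set \<Rightarrow> bool" where
  "irregular E \<epsilon> A B \<longleftrightarrow> \<not> bidense E \<epsilon> A B \<and> \<not> bidense (\<lambda>x y. \<not> E x y) \<epsilon> A B"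

definition part :: "'v set \<Rightarrow> ('v \<Rightarrow> 'k) \<Rightarrow> 'k \<Rightarrow> 'v set" where "part V p a = {z\<in>V. p z = a}"

lemma epairs_not: "finite X \<Longrightarrow> finite Y \<Longrightarrow> epairs (\<lambda>x y. \<not> E x y) X Y = card X * card Y - epairs E X Y"
  by (simp add: epairs_def of_bool_not_iff sum_subtractf)

text \<open>Each colour is sparse on some large rectangle, so densities of \<open>E\<close> below
  1/4 and above 3/4 both occur; whatever d is, one of them is at least 1/4 away from it.\<close>

lemma irregular_witness:
  fixes \<epsilon> d :: real
  assumes "irregular E \<epsilon> A B" "finite A" "finite B"
  shows "\<exists>X Y. X \<subseteq> A \<and> Y \<subseteq> B \<and> \<epsilon> * card A \<le> card X \<and> \<epsilon> * card B \<le> card Y \<and>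
     (card X * card Y) / 4 \<le> \<bar>epairs E X Y - d * (card X * card Y)\<bar>"
proof -
  have n: "\<not> bidense E \<epsilon> A B" "\<not> bidense (\<lambda>x y. \<not> E x y) \<epsilon> A B"
    using assms(1) by (auto simp: irregular_def)
  obtain X Y where 1: "X \<subseteq> A" "Y \<subseteq> B" "\<epsilon> * card A \<le> card X" "\<epsilon> * card B \<le> card Y"
     "epairs E X Y < 1/4 * (card X * card Y)"
    using n(1) unfolding bidense_def not_all not_imp not_le by blast
  obtain X' Y' where 2: "X' \<subseteq> A" "Y' \<subseteq> B" "\<epsilon> * card A \<le> card X'" "\<epsilon> * card B \<le> card Y'"
     "epairs (\<lambda>x y. \<not> E x y) X' Y' < 1/4 * (card X' * card Y')"
    using n(2) unfolding bidense_def not_all not_imp not_le by blast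
  have 3: "epairs E X' Y' > 3/4 * (card X' * card Y')"
    using 2(5) epairs_not[of X' Y' E] 2(1,2) finite_subset assms by fastforce
  show ?thesis
  proof (cases "d \<ge> 1/2")
    case True
    then have "1/2 * real (card X * card Y) \<le> d * (card X * card Y)" by (intro mult_right_mono) auto
    then have "(card X * card Y) / 4 \<le> \<bar>epairs E X Y - d * (card X * card Y)\<bar>" using 1(5) by linarith
    then show ?thesis using 1(1-4) by (rule_tac exI[where x = X], rule_tac exI[where x = Y]) auto
  next
    case False
    then have "d * (card X' * card Y') \<le> 1/2 * real (card X' * card Y')" by (intro mult_right_mono) auto
    then have "(card X' * card Y') / 4 \<le> \<bar>epairs E X' Y' - d * (card X' * card Y')\<bar>" using 3 by linarith
    then show ?thesis using 2(1-4) by (rule_tac exI[where x = X'], rule_tac exI[where x = Y']) auto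
  qed
qed

text \<open>Refine by all witness rectangles at once. In an irregular cell the rectangle has
  relative size at least \<epsilon>^2, and Cauchy-Schwarz on it yields a gain of \<epsilon>^2/16 per
  point of the cell. Irregular cells contain more than an \<epsilon> share of all pairs, which gives
  \<epsilon>^3/16.\<close>

lemma energy_step:
  fixes V :: "'v set" and p :: "'v \<Rightarrow> nat" and \<epsilon> :: real
  assumes fin: "finite V" and \<epsilon>: "0 < \<epsilon>" and p: "p ` V \<subseteq> {..<T}"
    and bad: "\<epsilon> * (card V)\<^sup>2 < card {s \<in> V \<times> V. irregular E \<epsilon> (part V p (p (fst s))) (part V p (p (snd s)))}"
  shows "\<exists>p' :: 'v \<Rightarrow> nat. p' ` V \<subseteq> {..<T * 4 ^ (T * T)} \<and> (\<forall>x\<in>V. \<forall>y\<in>V. p' x = p' y \<longrightarrow> p x = p y) \<and>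
    energy (V \<times> V) (map_prod p p) (\<lambda>(x,y). of_bool (E x y)) + \<epsilon> ^ 3 / 16 * (card V)\<^sup>2
      \<le> energy (V \<times> V) (map_prod p' p') (\<lambda>(x,y). of_bool (E x y))"
proof -
  let ?S = "V \<times> V" and ?f = "\<lambda>(x,y). of_bool (E x y) :: real" and ?P = "part V p"
  define d where "d a b = epairs E (?P a) (?P b) / (card (?P a) * card (?P b))" for a b
  have "\<forall>a b. \<exists>XY. irregular E \<epsilon> (?P a) (?P b) \<longrightarrow> fst XY \<subseteq> ?P a \<and> snd XY \<subseteq> ?P b \<and> \<epsilon> * card (?P a) \<le> card (fst XY)
     \<and> \<epsilon> * card (?P b) \<le> card (snd XY) \<and>
     (card (fst XY) * card (snd XY)) / 4 \<le> \<bar>epairs E (fst XY) (snd XY) - d a b * (card (fst XY) * card (snd XY))\<bar>"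
    using irregular_witness[of E \<epsilon> "?P a" "?P b" "d a b" for a b] fin by (auto simp: part_def)
  then obtain W where W: "\<And>a b. irregular E \<epsilon> (?P a) (?P b) \<Longrightarrow> fst (W a b) \<subseteq> ?P a \<and> snd (W a b) \<subseteq> ?P b \<and> \<epsilon> * card (?P a) \<le> card (fst (W a b))
     \<and> \<epsilon> * card (?P b) \<le> card (snd (W a b)) \<and>
     (card (fst (W a b)) * card (snd (W a b))) / 4 \<le> \<bar>epairs E (fst (W a b)) (snd (W a b)) - d a b * (card (fst (W a b)) * card (snd (W a b)))\<bar>"
    by metis
  define X Y where "X a b = fst (W a b)" and "Y a b = snd (W a b)" for a b
  note W = W[folded X_def Y_def]
  define I where "I = {..<T} \<times> {..<T}"
  define F where "F = {..<T} \<times> Pow I \<times> Pow I"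
  have finF: "finite F" by (simp add: F_def I_def)
  have cF: "card F = T * 4 ^ (T * T)"
    by (simp add: F_def I_def card_cartesian_product card_Pow power_mult_distrib[symmetric])
  obtain enc where enc: "bij_betw enc F {..<card F}"
    using ex_bij_betw_finite_nat[OF finF] by (auto simp: atLeast0LessThan)
  \<comment> \<open>The code of x records its old part and its membership in every witness set: T
    values and two subsets of a T by T index set.\<close>
  define q where "q x = (p x, {(a,b)\<in>I. x \<in> X a b}, {(a,b)\<in>I. x \<in> Y a b})" for x
  define p' where "p' x = enc (q x)" for x
  have qF: "q x \<in> F" if "x \<in> V" for x using that p by (auto simp: q_def F_def)
  have p'q: "q x = q y" if "x \<in> V" "y \<in> V" "p' x = p' y" for x y
    using enc qF that by (auto simp: p'_def bij_betw_def inj_on_def)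
  have r: "p' ` V \<subseteq> {..<T * 4 ^ (T * T)}" using enc qF cF by (auto simp: p'_def bij_betw_def)
  have ref: "p x = p y" if "x \<in> V" "y \<in> V" "p' x = p' y" for x y using p'q[OF that] by (simp add: q_def)
  let ?g = "map_prod p p" and ?g' = "map_prod p' p'"
  define \<Delta> where "\<Delta> s = cmean ?S ?g' ?f s - cmean ?S ?g ?f s" for s
  have finS: "finite ?S" using fin by simp
  have en: "energy ?S ?g' ?f = energy ?S ?g ?f + (\<Sum>s\<in>?S. (\<Delta> s)\<^sup>2)"
    unfolding \<Delta>_def
  proof (rule energy_refine[OF finS])
    fix s t assume "s \<in> ?S" "t \<in> ?S" "?g' s = ?g' t"
    then show "?g s = ?g t" using ref[of "fst s" "fst t"] ref[of "snd s" "snd t"] by (auto simp: map_prod_def split: prod.splits)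
  qed
  define bd where "bd s \<longleftrightarrow> irregular E \<epsilon> (?P (p (fst s))) (?P (p (snd s)))" for s
  have cls: "\<epsilon>\<^sup>2 / 16 * card {s \<in> ?S. ?g s = k \<and> bd s} \<le> (\<Sum>s\<in>{s\<in>?S. ?g s = k}. (\<Delta> s)\<^sup>2)" if k: "k \<in> ?g ` ?S" for k
  proof -
    obtain a b where ab: "k = (a,b)" by (cases k)
    obtain x0 y0 where xy0: "x0 \<in> V" "y0 \<in> V" "p x0 = a" "p y0 = b" using k ab by auto
    have K: "{s\<in>?S. ?g s = k} = ?P a \<times> ?P b" by (auto simp: part_def ab)
    show ?thesis
    proof (cases "irregular E \<epsilon> (?P a) (?P b)")
      case False
      then have e: "{s \<in> ?S. ?g s = k \<and> bd s} = {}" by (auto simp: ab bd_def)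
      show ?thesis unfolding e by (simp add: sum_nonneg)
    next
      case True
      note w = W[OF True]
      let ?R = "X a b \<times> Y a b"
      have finP: "finite (?P a)" "finite (?P b)" using fin by (auto simp: part_def)
      have RK: "?R \<subseteq> ?P a \<times> ?P b" using w by auto
      have RS: "?R \<subseteq> ?S" using w by (auto simp: part_def)
      have finR: "finite ?R" using finS RS finite_subset by blast
      have abI: "(a,b) \<in> I" using xy0 p by (auto simp: I_def)
      \<comment> \<open>The witness rectangle is a union of cells of the new partition, so the new
        means sum over it to the true number of edges.\<close>
      have h: "of_bool (s \<in> ?R) = (of_bool (t \<in> ?R) :: real)" if "s \<in> ?S" "t \<in> ?S" "?g' s = ?g' t" for s t
      proof -
        have "p' (fst s) = p' (fst t)" "p' (snd s) = p' (snd t)" using that(3) by (metis fst_map_prod, metis snd_map_prod)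
        then have "q (fst s) = q (fst t)" "q (snd s) = q (snd t)" using that(1,2) p'q by (simp_all add: mem_Times_iff)
        then have "{(a,b)\<in>I. fst s \<in> X a b} = {(a,b)\<in>I. fst t \<in> X a b}" "{(a,b)\<in>I. snd s \<in> Y a b} = {(a,b)\<in>I. snd t \<in> Y a b}"
          unfolding q_def prod.inject by blast+
        then have "fst s \<in> X a b \<longleftrightarrow> fst t \<in> X a b" "snd s \<in> Y a b \<longleftrightarrow> snd t \<in> Y a b" using abI by blast+
        then show ?thesis by (simp add: mem_Times_iff)
      qed
      have "(\<Sum>s\<in>?S. cmean ?S ?g' ?f s * of_bool (s \<in> ?R)) = (\<Sum>s\<in>?S. ?f s * of_bool (s \<in> ?R))"
        by (rule sum_cmean_mult[OF finS h])
      then have s1: "(\<Sum>s\<in>?R. cmean ?S ?g' ?f s) = (\<Sum>s\<in>?R. ?f s)"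
        using RS finS by (simp add: of_bool_def if_distrib sum.If_cases Int_absorb1 cong: if_cong)
      have ep: "(\<Sum>s\<in>A \<times> B. ?f s) = epairs E A B" for A B
        by (simp add: epairs_def sum.cartesian_product)
      have cm: "cmean ?S ?g ?f s = d a b" if "s \<in> ?R" for s
      proof -
        have gs: "?g s = k" using that RK K by auto
        have "{t\<in>?S. ?g t = ?g s} = ?P a \<times> ?P b" unfolding gs K ..
        then show ?thesis unfolding cmean_def d_def by (simp add: ep card_cartesian_product)
      qed
      have s2: "(\<Sum>s\<in>?R. \<Delta> s) = epairs E (X a b) (Y a b) - d a b * (card (X a b) * card (Y a b))"
        unfolding \<Delta>_def by (simp add: sum_subtractf s1 ep cm card_cartesian_product)
      have cR: "real (card ?R) = card (X a b) * card (Y a b)" by (simp add: card_cartesian_product)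
      have "0 < card (?P a)" "0 < card (?P b)" using xy0 finP by (auto simp: card_gt_0_iff part_def)
      then have "0 < \<epsilon> * card (?P a)" "0 < \<epsilon> * card (?P b)" using \<epsilon> by auto
      then have XY0: "0 < card (X a b)" "0 < card (Y a b)" using w by linarith+
      then have cR0: "0 < real (card ?R)" unfolding cR by simp
      have "(card ?R / 4)\<^sup>2 \<le> (\<bar>\<Sum>s\<in>?R. \<Delta> s\<bar>)\<^sup>2"
        using w s2 cR by (intro power_mono) auto
      also have "\<dots> \<le> card ?R * (\<Sum>s\<in>?R. (\<Delta> s)\<^sup>2)" using square_sum_le[OF finR] by simp
      finally have "card ?R * (card ?R / 16) \<le> card ?R * (\<Sum>s\<in>?R. (\<Delta> s)\<^sup>2)" by (simp add: power2_eq_square)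
      then have "card ?R / 16 \<le> (\<Sum>s\<in>?R. (\<Delta> s)\<^sup>2)" using cR0 by (simp only: mult_le_cancel_left_pos)
      also have "\<dots> \<le> (\<Sum>s\<in>{s\<in>?S. ?g s = k}. (\<Delta> s)\<^sup>2)"
        unfolding K using RK finP by (intro sum_mono2) auto
      finally have 1: "card ?R / 16 \<le> (\<Sum>s\<in>{s\<in>?S. ?g s = k}. (\<Delta> s)\<^sup>2)" .
      have "(\<epsilon> * card (?P a)) * (\<epsilon> * card (?P b)) \<le> card (X a b) * card (Y a b)"
        unfolding of_nat_mult using w \<epsilon> by (intro mult_mono) auto
      then have "\<epsilon>\<^sup>2 * (card (?P a) * card (?P b)) \<le> card ?R" unfolding cR by (simp add: power2_eq_square mult_ac)
      moreover have "card {s \<in> ?S. ?g s = k \<and> bd s} \<le> card (?P a \<times> ?P b)"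
        unfolding K[symmetric] using finS by (intro card_mono) auto
      then have "\<epsilon>\<^sup>2 * card {s \<in> ?S. ?g s = k \<and> bd s} \<le> \<epsilon>\<^sup>2 * (card (?P a) * card (?P b))"
        unfolding card_cartesian_product by (intro mult_left_mono) (auto simp flip: of_nat_mult)
      ultimately show ?thesis using 1 by linarith
    qed
  qed
  have "\<epsilon>\<^sup>2 / 16 * card {s \<in> ?S. bd s} \<le> (\<Sum>s\<in>?S. (\<Delta> s)\<^sup>2)"
  proof -
    have "real (card {s \<in> ?S. bd s}) = (\<Sum>s\<in>?S. of_bool (bd s))" using finS by (simp add: sum.If_cases of_bool_def Int_def)
    also have "\<dots> = (\<Sum>k\<in>?g ` ?S. \<Sum>s\<in>{s\<in>?S. ?g s = k}. of_bool (bd s))" by (rule sum.image_gen[OF finS])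
    also have "\<dots> = (\<Sum>k\<in>?g ` ?S. real (card {s\<in>?S. ?g s = k \<and> bd s}))"
      using finS by (intro sum.cong refl) (simp add: sum.If_cases of_bool_def Int_def conj_assoc)
    finally have "\<epsilon>\<^sup>2 / 16 * card {s \<in> ?S. bd s} = (\<Sum>k\<in>?g ` ?S. \<epsilon>\<^sup>2 / 16 * card {s\<in>?S. ?g s = k \<and> bd s})"
      by (simp add: sum_distrib_left)
    also have "\<dots> \<le> (\<Sum>k\<in>?g ` ?S. \<Sum>s\<in>{s\<in>?S. ?g s = k}. (\<Delta> s)\<^sup>2)" using cls by (intro sum_mono)
    also have "\<dots> = (\<Sum>s\<in>?S. (\<Delta> s)\<^sup>2)" by (rule sum.image_gen[OF finS, symmetric])
    finally show ?thesis .
  qed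
  moreover have "\<epsilon>\<^sup>2 / 16 * (\<epsilon> * (card V)\<^sup>2) \<le> \<epsilon>\<^sup>2 / 16 * card {s \<in> ?S. bd s}"
    using bad unfolding bd_def by (intro mult_left_mono) auto
  moreover have "\<epsilon>\<^sup>2 / 16 * (\<epsilon> * (card V)\<^sup>2) = \<epsilon> ^ 3 / 16 * (card V)\<^sup>2" by (simp add: power2_eq_square power3_eq_cube)
  ultimately have "energy ?S ?g ?f + \<epsilon> ^ 3 / 16 * (card V)\<^sup>2 \<le> energy ?S ?g' ?f" using en by linarith
  then show ?thesis using r ref by (intro exI[of _ p'] conjI) blast+
qed

text \<open>The energy is at most the number of pairs, so fewer than about 16/\<epsilon>^3
  refinements can fail. Irregularity is counted in pairs of vertices, which suits parts of unequal
  size and later the random sample.\<close>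

lemma regularity:
  fixes \<epsilon> :: real
  assumes \<epsilon>: "0 < \<epsilon>"
  shows "\<exists>T. \<forall>(V :: 'v set) E (p0 :: 'v \<Rightarrow> nat). finite V \<longrightarrow> p0 ` V \<subseteq> {..<k0} \<longrightarrow>
    (\<exists>p :: 'v \<Rightarrow> nat. p ` V \<subseteq> {..<T} \<and> (\<forall>x\<in>V. \<forall>y\<in>V. p x = p y \<longrightarrow> p0 x = p0 y) \<and>
      card {s \<in> V \<times> V. irregular E \<epsilon> (part V p (p (fst s))) (part V p (p (snd s)))} \<le> \<epsilon> * (card V)\<^sup>2)"
proof -
  let ?en = "\<lambda>(V :: 'v set) E p. energy (V \<times> V) (map_prod p p) (\<lambda>(x,y). of_bool (E x y))"
  let ?good = "\<lambda>(V :: 'v set) E p. card {s \<in> V \<times> V. irregular E \<epsilon> (part V p (p (fst s))) (part V p (p (snd s)))} \<le> \<epsilon> * (card V)\<^sup>2"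
  have step: "\<exists>T. \<forall>(V :: 'v set) E (p0 :: 'v \<Rightarrow> nat). finite V \<longrightarrow> p0 ` V \<subseteq> {..<k0} \<longrightarrow>
    (\<exists>p :: 'v \<Rightarrow> nat. p ` V \<subseteq> {..<T} \<and> (\<forall>x\<in>V. \<forall>y\<in>V. p x = p y \<longrightarrow> p0 x = p0 y) \<and>
      (?good V E p \<or> i * (\<epsilon> ^ 3 / 16 * (card V)\<^sup>2) \<le> ?en V E p))" for i :: nat
  proof (induction i)
    case 0
    have e: "0 \<le> ?en V E p" for V :: "'v set" and E and p :: "'v \<Rightarrow> nat" by (simp add: energy_def sum_nonneg)
    show ?case
      by (intro exI[of _ k0] allI impI, rule_tac x = p0 in exI) (use e in auto)
  next
    case (Suc i)
    then obtain T where T: "\<And>(V :: 'v set) E (p0 :: 'v \<Rightarrow> nat). finite V \<Longrightarrow> p0 ` V \<subseteq> {..<k0} \<Longrightarrow>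
    (\<exists>p :: 'v \<Rightarrow> nat. p ` V \<subseteq> {..<T} \<and> (\<forall>x\<in>V. \<forall>y\<in>V. p x = p y \<longrightarrow> p0 x = p0 y) \<and>
      (?good V E p \<or> i * (\<epsilon> ^ 3 / 16 * (card V)\<^sup>2) \<le> ?en V E p))" by blast
    show ?case
    proof (intro exI[of _ "T * 4 ^ (T * T)"] allI impI)
      fix V :: "'v set" and E and p0 :: "'v \<Rightarrow> nat"
      assume V: "finite V" and p0: "p0 ` V \<subseteq> {..<k0}"
      obtain p :: "'v \<Rightarrow> nat" where p: "p ` V \<subseteq> {..<T}" "\<And>x y. x \<in> V \<Longrightarrow> y \<in> V \<Longrightarrow> p x = p y \<Longrightarrow> p0 x = p0 y"
        "?good V E p \<or> i * (\<epsilon> ^ 3 / 16 * (card V)\<^sup>2) \<le> ?en V E p" using T[OF V p0, of E] by blast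
      show "\<exists>p :: 'v \<Rightarrow> nat. p ` V \<subseteq> {..<T * 4 ^ (T * T)} \<and> (\<forall>x\<in>V. \<forall>y\<in>V. p x = p y \<longrightarrow> p0 x = p0 y) \<and>
        (?good V E p \<or> Suc i * (\<epsilon> ^ 3 / 16 * (card V)\<^sup>2) \<le> ?en V E p)"
      proof (cases "?good V E p")
        case True
        have "{..<T} \<subseteq> {..<T * 4 ^ (T * T)}" by simp
        then have "p ` V \<subseteq> {..<T * 4 ^ (T * T)}" using p(1) by (rule subset_trans[rotated])
        moreover have "\<forall>x\<in>V. \<forall>y\<in>V. p x = p y \<longrightarrow> p0 x = p0 y" using p(2) by blast
        ultimately show ?thesis using True by (intro exI[of _ p] conjI disjI1)
      next
        case False
        then obtain p' :: "'v \<Rightarrow> nat" where p': "p' ` V \<subseteq> {..<T * 4 ^ (T * T)}" "\<And>x y. x \<in> V \<Longrightarrow> y \<in> V \<Longrightarrow> p' x = p' y \<Longrightarrow> p x = p y"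
          "?en V E p + \<epsilon> ^ 3 / 16 * (card V)\<^sup>2 \<le> ?en V E p'"
          using energy_step[OF V \<epsilon> p(1), of E] by (auto simp: not_le)
        have "Suc i * (\<epsilon> ^ 3 / 16 * (card V)\<^sup>2) = i * (\<epsilon> ^ 3 / 16 * (card V)\<^sup>2) + \<epsilon> ^ 3 / 16 * (card V)\<^sup>2"
          by (simp add: algebra_simps)
        then have "Suc i * (\<epsilon> ^ 3 / 16 * (card V)\<^sup>2) \<le> ?en V E p'" using p(3) p'(3) False by linarith
        moreover have "\<forall>x\<in>V. \<forall>y\<in>V. p' x = p' y \<longrightarrow> p0 x = p0 y" using p(2) p'(2) by blast
        ultimately show ?thesis using p'(1) by (intro exI[of _ p'] conjI disjI2)
      qed
    qed
  qed
  obtain i :: nat where i: "i > 16 / \<epsilon> ^ 3" using reals_Archimedean2 by blast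
  have bound: "?good V E p" if "finite V" "?good V E p \<or> i * (\<epsilon> ^ 3 / 16 * (card V)\<^sup>2) \<le> ?en V E p"
    for V :: "'v set" and E and p :: "'v \<Rightarrow> nat"
  proof (cases "V = {}")
    case False
    have "?en V E p \<le> card (V \<times> V)" using that(1) by (intro energy_le) auto
    then have "?en V E p \<le> (card V)\<^sup>2" by (simp add: card_cartesian_product power2_eq_square)
    moreover have "1 < i * (\<epsilon> ^ 3 / 16)" using i \<epsilon> by (simp add: field_simps)
    then have "1 * (real (card V))\<^sup>2 < i * (\<epsilon> ^ 3 / 16) * (real (card V))\<^sup>2" using that(1) False
      by (intro mult_strict_right_mono) (auto simp: card_gt_0_iff)
    ultimately show ?thesis using that(2) by (simp add: mult.assoc)
  qed simp
  obtain T where T: "\<And>(V :: 'v set) E (p0 :: 'v \<Rightarrow> nat). finite V \<Longrightarrow> p0 ` V \<subseteq> {..<k0} \<Longrightarrow>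
    (\<exists>p :: 'v \<Rightarrow> nat. p ` V \<subseteq> {..<T} \<and> (\<forall>x\<in>V. \<forall>y\<in>V. p x = p y \<longrightarrow> p0 x = p0 y) \<and>
      (?good V E p \<or> i * (\<epsilon> ^ 3 / 16 * (card V)\<^sup>2) \<le> ?en V E p))" using step[of i] by blast
  show ?thesis
  proof (intro exI[of _ T] allI impI)
    fix V :: "'v set" and E and p0 :: "'v \<Rightarrow> nat"
    assume V: "finite V" and p0: "p0 ` V \<subseteq> {..<k0}"
    obtain p :: "'v \<Rightarrow> nat" where p: "p ` V \<subseteq> {..<T}" "\<forall>x\<in>V. \<forall>y\<in>V. p x = p y \<longrightarrow> p0 x = p0 y"
      "?good V E p \<or> i * (\<epsilon> ^ 3 / 16 * (card V)\<^sup>2) \<le> ?en V E p" using T[OF V p0, of E] by blast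
    show "\<exists>p :: 'v \<Rightarrow> nat. p ` V \<subseteq> {..<T} \<and> (\<forall>x\<in>V. \<forall>y\<in>V. p x = p y \<longrightarrow> p0 x = p0 y) \<and> ?good V E p"
      using p(1,2) bound[OF V p(3)] by (intro exI[of _ p] conjI)
  qed
qed

section \<open>Monochromatic dense triples\<close>

text \<open>Removing a largest element never raises the average.\<close>

lemma subset_sum_le:
  fixes f :: "'v \<Rightarrow> real"
  assumes "finite X" "k \<le> card X"
  shows "\<exists>X'\<subseteq>X. card X' = k \<and> sum f X' * card X \<le> sum f X * k"
  using assms
proof (induction "card X - k" arbitrary: X)
  case 0
  then show ?case by (intro exI[of _ X]) auto
next
  case (Suc n)
  have ne: "X \<noteq> {}" and k: "k < card X" using Suc by auto
  obtain x where x: "x \<in> X" "\<And>y. y \<in> X \<Longrightarrow> f y \<le> f x"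
    using arg_min_if_finite[OF Suc(3) ne, of "\<lambda>x. - f x"] by (metis neg_less_iff_less not_le)
  have c: "card (X - {x}) = card X - 1" using x Suc by simp
  have p: "n = card (X - {x}) - k" "finite (X - {x})" "k \<le> card (X - {x})" using Suc(2,3) c k by auto
  obtain X' where X': "X' \<subseteq> X - {x}" "card X' = k" "sum f X' * card (X - {x}) \<le> sum f (X - {x}) * k"
    using Suc(1)[OF p] by blast
  have s: "sum f (X - {x}) = sum f X - f x" using x Suc by (simp add: sum_diff1)
  have cr: "real (card (X - {x})) = real (card X) - 1" using c k by (simp add: of_nat_diff)
  have "sum f X \<le> card X * f x" using x(2) by (intro sum_bounded_above) auto
  then have "(sum f X - f x) * card X \<le> sum f X * (real (card X) - 1)" by (simp add: algebra_simps)
  then have "(sum f X - f x) * card X * k \<le> sum f X * (real (card X) - 1) * k" by (intro mult_right_mono) auto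
  moreover have "sum f X' * (real (card X) - 1) * card X \<le> (sum f X - f x) * k * card X"
    using X'(3) unfolding s cr by (intro mult_right_mono) auto
  ultimately have *: "(real (card X) - 1) * (sum f X' * card X) \<le> (real (card X) - 1) * (sum f X * k)"
    by (simp add: algebra_simps)
  show ?case
  proof (cases "card X = 1")
    case True
    then have "k = 0" using k by simp
    then show ?thesis by (intro exI[of _ "{}"]) auto
  next
    case False
    then have "0 < real (card X) - 1" using k by simp
    then have "sum f X' * card X \<le> sum f X * k" using * by (simp only: mult_le_cancel_left_pos)
    then show ?thesis using X' by (intro exI[of _ X']) auto
  qed
qed

lemma epairs_swap: "epairs E X Y = epairs (\<lambda>x y. E y x) Y X"
  unfolding epairs_def by (rule sum.swap)

text \<open>Averaging first over rows and then over columns trims a sparse rectangle to prescribed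
  side lengths.\<close>

lemma exact_low_rectangle:
  fixes c :: real
  assumes "finite X" "finite Y" "0 < j" "j \<le> card X" "0 < k" "k \<le> card Y"
    and "epairs E X Y < c * (card X * card Y)"
  shows "\<exists>X'\<subseteq>X. \<exists>Y'\<subseteq>Y. card X' = j \<and> card Y' = k \<and> epairs E X' Y' < c * (j * k)"
proof -
  obtain X' where X': "X' \<subseteq> X" "card X' = j" "epairs E X' Y * card X \<le> epairs E X Y * j"
    using subset_sum_le[OF assms(1,4), of "\<lambda>x. \<Sum>y\<in>Y. of_bool (E x y)"] by (auto simp: epairs_def)
  obtain Y' where Y': "Y' \<subseteq> Y" "card Y' = k" "epairs E X' Y' * card Y \<le> epairs E X' Y * k"
    using subset_sum_le[OF assms(2,6), of "\<lambda>y. \<Sum>x\<in>X'. of_bool (E x y)"]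
    by (auto simp: epairs_swap[of E] epairs_def[of "\<lambda>x y. E y x"])
  have p: "0 < real j" "0 < real k" "0 < real (card X)" "0 < real (card Y)" using assms by auto
  have "epairs E X' Y' * card Y * card X \<le> epairs E X' Y * k * card X" using Y'(3) by (intro mult_right_mono) auto
  also have "\<dots> = epairs E X' Y * card X * k" by simp
  also have "\<dots> \<le> epairs E X Y * j * k" using X'(3) by (intro mult_right_mono) auto
  also have "\<dots> < c * (card X * card Y) * j * k" using assms(7) p by simp
  finally have "epairs E X' Y' * (card X * card Y) < c * (j * k) * (card X * card Y)" by (simp add: mult_ac)
  then have "epairs E X' Y' < c * (j * k)" using p by (simp add: mult_less_cancel_right_pos)
  then show ?thesis using X' Y' by blast
qed

lemma exact_high_rectangle:
  fixes c :: real
  assumes "finite X" "finite Y" "0 < j" "j \<le> card X" "0 < k" "k \<le> card Y"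
    and "c * (card X * card Y) \<le> epairs E X Y"
  shows "\<exists>X'\<subseteq>X. \<exists>Y'\<subseteq>Y. card X' = j \<and> card Y' = k \<and> c * (j * k) \<le> epairs E X' Y'"
proof (rule ccontr)
  assume n: "\<not> ?thesis"
  obtain X' where X': "X' \<subseteq> X" "card X' = j" "- epairs E X' Y * card X \<le> - epairs E X Y * j"
    using subset_sum_le[OF assms(1,4), of "\<lambda>x. - (\<Sum>y\<in>Y. of_bool (E x y))"] by (auto simp: epairs_def sum_negf)
  obtain Y' where Y': "Y' \<subseteq> Y" "card Y' = k" "- epairs E X' Y' * card Y \<le> - epairs E X' Y * k"
    using subset_sum_le[OF assms(2,6), of "\<lambda>y. - (\<Sum>x\<in>X'. of_bool (E x y))"]
    by (auto simp: epairs_swap[of E] epairs_def[of "\<lambda>x y. E y x"] sum_negf)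
  have p: "0 < real j" "0 < real k" "0 < real (card X)" "0 < real (card Y)" using assms by auto
  have "c * (card X * card Y) * j * k \<le> epairs E X Y * j * k" using assms(7) by (intro mult_right_mono) auto
  also have "\<dots> \<le> epairs E X' Y * card X * k" using X'(3) by (intro mult_right_mono) auto
  also have "\<dots> = epairs E X' Y * k * card X" by simp
  also have "\<dots> \<le> epairs E X' Y' * card Y * card X" using Y'(3) by (intro mult_right_mono) auto
  finally have "c * (j * k) * (card X * card Y) \<le> epairs E X' Y' * (card X * card Y)" by (simp add: mult_ac)
  then have "c * (j * k) \<le> epairs E X' Y'" using p by (simp add: mult_le_cancel_right_pos)
  then show False using n X' Y' by blast
qed

lemma epairs_Un1: "finite X \<Longrightarrow> finite X' \<Longrightarrow> X \<inter> X' = {} \<Longrightarrow> epairs E (X \<union> X') Y = epairs E X Y + epairs E X' Y"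
  by (simp add: epairs_def sum.union_disjoint)
lemma epairs_Un2: "finite Y \<Longrightarrow> finite Y' \<Longrightarrow> Y \<inter> Y' = {} \<Longrightarrow> epairs E X (Y \<union> Y') = epairs E X Y + epairs E X Y'"
  unfolding epairs_def by (simp only: sum.union_disjoint sum.distrib)
lemma epairs_le: "epairs E X Y \<le> card X * card Y"
proof -
  have "(\<Sum>y\<in>Y. of_bool (E x y)) \<le> real (card Y) * 1" for x
    by (rule sum_bounded_above) simp
  then have "epairs E X Y \<le> (\<Sum>x\<in>X. real (card Y) * 1)" unfolding epairs_def
    by (rule sum_mono)
  then show ?thesis by simp
qed

lemma bidense_subset:
  fixes \<epsilon> \<epsilon>' :: real
  assumes "bidense E \<epsilon>' A B" "A' \<subseteq> A" "B' \<subseteq> B" "\<epsilon>' * card A \<le> \<epsilon> * card A'" "\<epsilon>' * card B \<le> \<epsilon> * card B'"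
  shows "bidense E \<epsilon> A' B'"
  unfolding bidense_def
proof (intro allI impI)
  fix X Y assume *: "X \<subseteq> A'" "Y \<subseteq> B'" "\<epsilon> * real (card A') \<le> card X" "\<epsilon> * real (card B') \<le> card Y"
  then have "X \<subseteq> A" "Y \<subseteq> B" "\<epsilon>' * real (card A) \<le> card X" "\<epsilon>' * real (card B) \<le> card Y" using assms by auto
  then show "1/4 * (card X * card Y) \<le> epairs E X Y" using assms(1) unfolding bidense_def by blast
qed

lemma bidense_sym:
  assumes "\<And>x y. E x y = E y x" "bidense E \<epsilon> A B" shows "bidense E \<epsilon> B A"
proof -
  have "(\<lambda>x y. E y x) = E" using assms(1) by blast
  then show ?thesis using assms(2) epairs_swap[of E] unfolding bidense_def by (metis mult.commute)
qed

text \<open>If the pair is not yet bidense, cutting out a sparse rectangle leaves a denser one; the density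
  cannot increase forever.\<close>

lemma density_increment:
  fixes \<epsilon> :: real
  assumes \<epsilon>: "0 < \<epsilon>" "\<epsilon> \<le> 1/4"
  shows "\<exists>\<nu>>(0::real). \<exists>m0. \<forall>E (A :: 'v set) B m (d::real). finite A \<longrightarrow> finite B \<longrightarrow> card A = m \<longrightarrow> card B = m \<longrightarrow> m0 \<le> real m \<longrightarrow>
     1/2 \<le> d \<longrightarrow> 1 < d + real i * (\<epsilon>\<^sup>2/4) \<longrightarrow> d * (m * m) \<le> epairs E A B \<longrightarrow>
     (\<exists>X\<subseteq>A. \<exists>Y\<subseteq>B. card X = card Y \<and> \<nu> * m \<le> card X \<and> bidense E \<epsilon> X Y)"
\<comment> \<open>The counter i bounds the number of increments of \<epsilon>^2/4 still possible
  before the density would exceed 1.\<close>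
proof (induction i)
  case 0
  have False if "(1::real) \<le> real m" "1 < d" "d * (m * m) \<le> epairs E A B" "card A = m" "card B = m" for E and A B :: "'v set" and m :: nat and d :: real
  proof -
    have "1 * real (m * m) < d * (m * m)" using that by (intro mult_strict_right_mono) auto
    then show False using epairs_le[of E A B] that(3) unfolding that(4,5) of_nat_mult by linarith
  qed
  then have F: False if "(1::real) \<le> real m" "1 < d + real 0 * (\<epsilon>\<^sup>2/4)" "d * (m * m) \<le> epairs E A B" "card A = m" "card B = m" for E and A B :: "'v set" and m :: nat and d :: real
    using that by simp
  show ?case
  proof (rule exI[of _ 1], intro conjI exI[of _ "1::real"] allI impI)
    fix E and A B :: "'v set" and m :: nat and d :: real
    assume a: "card A = m" "card B = m" "1 \<le> real m" "1 < d + real 0 * (\<epsilon>\<^sup>2/4)" "d * (m * m) \<le> epairs E A B"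
    show "\<exists>X\<subseteq>A. \<exists>Y\<subseteq>B. card X = card Y \<and> 1 * real m \<le> real (card X) \<and> bidense E \<epsilon> X Y"
      using F[OF a(3,4,5,1,2)] by (rule FalseE)
  qed simp
next
  case (Suc i)
  then obtain \<nu> m0 where \<nu>: "\<nu> > (0::real)" and IH: "\<And>E (A :: 'v set) B m (d::real). finite A \<Longrightarrow> finite B \<Longrightarrow> card A = m \<Longrightarrow> card B = m \<Longrightarrow> m0 \<le> real m \<Longrightarrow>
     1/2 \<le> d \<Longrightarrow> 1 < d + real i * (\<epsilon>\<^sup>2/4) \<Longrightarrow> d * (m * m) \<le> epairs E A B \<Longrightarrow>
     (\<exists>X\<subseteq>A. \<exists>Y\<subseteq>B. card X = card Y \<and> \<nu> * m \<le> card X \<and> bidense E \<epsilon> X Y)" by blast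
  have pos: "0 < min 1 (\<epsilon> * \<nu>)" using \<nu> \<epsilon> by simp
  show ?case
  proof (rule exI[of _ "min 1 (\<epsilon> * \<nu>)"], rule conjI[OF pos], rule exI[of _ "max 4 (m0 / \<epsilon>)"], intro allI impI)
    fix E and A B :: "'v set" and m :: nat and d :: real
    assume fin: "finite A" "finite B" and c: "card A = m" "card B = m" and m: "max 4 (m0 / \<epsilon>) \<le> real m"
      and d: "1/2 \<le> d" "1 < d + real (Suc i) * (\<epsilon>\<^sup>2/4)" and e: "d * (m * m) \<le> epairs E A B"
    show "\<exists>X\<subseteq>A. \<exists>Y\<subseteq>B. card X = card Y \<and> min 1 (\<epsilon> * \<nu>) * m \<le> card X \<and> bidense E \<epsilon> X Y"
    proof (cases "bidense E \<epsilon> A B")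
      case True
      have "min 1 (\<epsilon> * \<nu>) * m \<le> 1 * real m" by (intro mult_right_mono) auto
      then have "card A = card B \<and> min 1 (\<epsilon> * \<nu>) * m \<le> card A \<and> bidense E \<epsilon> A B" using True c by simp
      then show ?thesis by blast
    next
      case False
      then obtain X0 Y0 where 0: "X0 \<subseteq> A" "Y0 \<subseteq> B" "\<epsilon> * m \<le> card X0" "\<epsilon> * m \<le> card Y0" "epairs E X0 Y0 < 1/4 * (card X0 * card Y0)"
        unfolding bidense_def not_all not_imp not_le c by blast
      \<comment> \<open>All rectangles get the same side length k; \<open>2 * k \<le> m\<close>
        makes the complements at least as long.\<close>
      define k where "k = nat \<lceil>\<epsilon> * m\<rceil>"
      have m4: "4 \<le> real m" "m0 \<le> \<epsilon> * m" using m \<epsilon> by (auto simp: field_simps)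
      have k1: "\<epsilon> * m \<le> k" "real k < \<epsilon> * m + 1" using \<epsilon> by (auto simp: k_def) linarith+
      have "0 < \<epsilon> * m" using \<epsilon> m4 by simp
      then have k0: "0 < k" using k1 by linarith
      have "\<epsilon> * m \<le> 1/4 * m" using \<epsilon> by (intro mult_right_mono) auto
      then have k2: "2 * k \<le> m" using k1 m4 by linarith
      have kX: "k \<le> card X0" "k \<le> card Y0" using 0 by (auto simp: k_def nat_le_iff ceiling_le_iff)
      obtain X Y where XY: "X \<subseteq> X0" "Y \<subseteq> Y0" "card X = k" "card Y = k" "epairs E X Y < 1/4 * (k * k)"
        using exact_low_rectangle[OF _ _ k0 kX(1) k0 kX(2) 0(5)] fin 0 finite_subset by metis
      have sub: "X \<subseteq> A" "Y \<subseteq> B" using XY 0 by auto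
      have finXY: "finite X" "finite Y" "finite (A - X)" "finite (B - Y)" using sub fin finite_subset by auto
      have cc: "card (A - X) = m - k" "card (B - Y) = m - k" using sub c XY finXY by (auto simp: card_Diff_subset)
      have ccr: "real (card (A - X)) = real m - k" "real (card (B - Y)) = real m - k" using cc k2 by auto
      have split: "epairs E A B = epairs E X Y + epairs E X (B - Y) + epairs E (A - X) Y + epairs E (A - X) (B - Y)"
      proof -
        have AB: "X \<union> (A - X) = A" "Y \<union> (B - Y) = B" using sub by auto
        have "epairs E A B = epairs E X B + epairs E (A - X) B"
          using epairs_Un1[of X "A - X" E B] finXY unfolding AB by simp
        moreover have "epairs E P B = epairs E P Y + epairs E P (B - Y)" for P
          using epairs_Un2[of Y "B - Y" E P] finXY unfolding AB by simp
        ultimately show ?thesis by simp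
      qed
      define d' where "d' = d + \<epsilon>\<^sup>2/4"
      \<comment> \<open>If the three remaining rectangles all had density below d', the whole pair
        would have density below d: the rectangle cut out holds at least an \<epsilon>^2 share of
        the pairs and its density is at least 1/4 less than d.\<close>
      have "\<exists>P Q. P \<subseteq> A \<and> Q \<subseteq> B \<and> k \<le> card P \<and> k \<le> card Q \<and> d' * (card P * card Q) \<le> epairs E P Q"
      proof (rule ccontr)
        assume n: "\<not> ?thesis"
        have n': "epairs E P Q < d' * (card P * card Q)" if "P \<subseteq> A" "Q \<subseteq> B" "k \<le> card P" "k \<le> card Q" for P Q
          using n that not_le by blast
        have "epairs E X (B - Y) < d' * (card X * card (B - Y))" "epairs E (A - X) Y < d' * (card (A - X) * card Y)"
          "epairs E (A - X) (B - Y) < d' * (card (A - X) * card (B - Y))"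
          using n'[of X "B - Y"] n'[of "A - X" Y] n'[of "A - X" "B - Y"] XY(3,4) cc k2 sub by auto
        then have "epairs E A B < 1/4 * (k * k) + d' * (k * (real m - k)) + d' * ((real m - k) * k) + d' * ((real m - k) * (real m - k))"
          using XY(5) unfolding split of_nat_mult ccr XY(3,4) by linarith
        then have "d * (m * m) < 1/4 * (k * k) + d' * (real m * m - real k * k)" using e by (simp add: algebra_simps)
        then have "(d - 1/4) * (real k * k) + \<epsilon>\<^sup>2/4 * (real k * k) < \<epsilon>\<^sup>2/4 * (real m * m)" by (simp add: d'_def algebra_simps)
        moreover have "1/4 * (real k * k) \<le> (d - 1/4) * (real k * k)" using d by (intro mult_right_mono) auto
        moreover have "0 \<le> \<epsilon>\<^sup>2/4 * (real k * k)" by simp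
        ultimately have "real k * k < \<epsilon>\<^sup>2 * (real m * m)" by linarith
        moreover have "(\<epsilon> * m) * (\<epsilon> * m) \<le> real k * k" using k1 \<epsilon> by (intro mult_mono) auto
        ultimately show False by (simp add: power2_eq_square mult_ac)
      qed
      then obtain P Q where PQ: "P \<subseteq> A" "Q \<subseteq> B" "k \<le> card P" "k \<le> card Q" "d' * (card P * card Q) \<le> epairs E P Q" by blast
      obtain P' Q' where P': "P' \<subseteq> P" "Q' \<subseteq> Q" "card P' = k" "card Q' = k" "d' * (k * k) \<le> epairs E P' Q'"
        using exact_high_rectangle[OF _ _ k0 PQ(3) k0 PQ(4,5)] PQ fin finite_subset by metis
      have d': "1/2 \<le> d'" "1 < d' + real i * (\<epsilon>\<^sup>2/4)" 
      proof -
        have "0 \<le> \<epsilon>\<^sup>2 / 4" by simp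
        then show "1/2 \<le> d'" using d(1) unfolding d'_def by linarith
        show "1 < d' + real i * (\<epsilon>\<^sup>2/4)" using d(2) by (simp add: d'_def field_simps)
      qed
      have "finite P'" "finite Q'" using P' PQ fin finite_subset by metis+
      moreover have "m0 \<le> real k" using m4 k1 by linarith
      ultimately obtain X' Y' where X': "X' \<subseteq> P'" "Y' \<subseteq> Q'" "card X' = card Y'" "\<nu> * k \<le> card X'" "bidense E \<epsilon> X' Y'"
        using IH[OF _ _ P'(3,4) _ d' P'(5)] by blast
      have "min 1 (\<epsilon> * \<nu>) * m \<le> \<epsilon> * \<nu> * m" by (intro mult_right_mono) auto
      also have "\<dots> = \<nu> * (\<epsilon> * m)" by simp
      also have "\<dots> \<le> \<nu> * k" using k1 \<nu> by (intro mult_left_mono) auto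
      finally have "min 1 (\<epsilon> * \<nu>) * m \<le> card X'" using X' by linarith
      then show ?thesis using X' P' PQ by (meson subset_trans)
    qed
  qed
qed

text \<open>One of the two colours has density at least 1/2 and can start the increment.\<close>

lemma dense_pair:
  fixes \<epsilon> :: real
  assumes \<epsilon>: "0 < \<epsilon>" "\<epsilon> \<le> 1/4"
  shows "\<exists>\<nu>>(0::real). \<exists>m0. \<forall>E (A :: 'v set) B m. finite A \<longrightarrow> finite B \<longrightarrow> card A = m \<longrightarrow> card B = m \<longrightarrow> m0 \<le> real m \<longrightarrow>
     (\<exists>X\<subseteq>A. \<exists>Y\<subseteq>B. card X = card Y \<and> \<nu> * m \<le> card X \<and> (bidense E \<epsilon> X Y \<or> bidense (\<lambda>x y. \<not> E x y) \<epsilon> X Y))"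
proof -
  obtain i :: nat where i: "i > 2 / \<epsilon>\<^sup>2" using reals_Archimedean2 by blast
  have i1: "1 < 1/2 + real i * (\<epsilon>\<^sup>2/4)" using i \<epsilon> by (simp add: field_simps)
  obtain \<nu> m0 where \<nu>: "\<nu> > (0::real)" and D: "\<forall>E (A :: 'v set) B m (d::real). finite A \<longrightarrow> finite B \<longrightarrow> card A = m \<longrightarrow> card B = m \<longrightarrow> m0 \<le> real m \<longrightarrow>
     1/2 \<le> d \<longrightarrow> 1 < d + real i * (\<epsilon>\<^sup>2/4) \<longrightarrow> d * (m * m) \<le> epairs E A B \<longrightarrow>
     (\<exists>X\<subseteq>A. \<exists>Y\<subseteq>B. card X = card Y \<and> \<nu> * m \<le> card X \<and> bidense E \<epsilon> X Y)"
    using density_increment[OF \<epsilon>, of i] by (elim exE conjE) (rule that)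
  note * = D[rule_format]
  show ?thesis
  proof (rule exI[of _ \<nu>], rule conjI[OF \<nu>], rule exI[of _ m0], intro allI impI)
    fix E and A B :: "'v set" and m
    assume a: "finite A" "finite B" "card A = m" "card B = m" "m0 \<le> real m"
    have "1/2 * real (m * m) \<le> epairs E A B \<or> 1/2 * real (m * m) \<le> epairs (\<lambda>x y. \<not> E x y) A B"
      using epairs_not[OF a(1,2), of E] a(3,4) by auto
    then show "\<exists>X\<subseteq>A. \<exists>Y\<subseteq>B. card X = card Y \<and> \<nu> * m \<le> card X \<and> (bidense E \<epsilon> X Y \<or> bidense (\<lambda>x y. \<not> E x y) \<epsilon> X Y)"
      using *[OF a order_refl i1, of E] *[OF a order_refl i1, of "\<lambda>x y. \<not> E x y"] by blast
  qed
qed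

text \<open>The pairs are treated one after the other. Making the rest of the list dense shrinks the
  sets by a factor \<nu>, so the first pair is made dense with the smaller parameter \<epsilon>
  \<nu>, which survives the shrinking.\<close>

lemma all_pairs:
  fixes \<epsilon> :: real
  assumes "\<forall>(i,j)\<in>set ps. i < r \<and> j < r \<and> i \<noteq> j" "0 < \<epsilon>" "\<epsilon> \<le> 1/4"
  shows "\<exists>\<nu>>(0::real). \<nu> \<le> 1 \<and> (\<exists>m0::real. \<forall>E (A :: nat \<Rightarrow> 'v set) m. (\<forall>i<r. finite (A i) \<and> card (A i) = m) \<longrightarrow> m0 \<le> real m \<longrightarrow>
     (\<exists>A' m'. (\<forall>i<r. A' i \<subseteq> A i \<and> card (A' i) = m') \<and> \<nu> * real m \<le> real m' \<and>
       (\<forall>(i,j)\<in>set ps. bidense E \<epsilon> (A' i) (A' j) \<or> bidense (\<lambda>x y. \<not> E x y) \<epsilon> (A' i) (A' j))))"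
  using assms
proof (induction ps arbitrary: \<epsilon>)
  case Nil
  show ?case
  proof (rule exI[of _ 1], intro conjI, simp, simp, rule exI[of _ 0], intro allI impI)
    fix E and A :: "nat \<Rightarrow> 'v set" and m
    assume "\<forall>i<r. finite (A i) \<and> card (A i) = m"
    then show "\<exists>A' m'. (\<forall>i<r. A' i \<subseteq> A i \<and> card (A' i) = m') \<and> 1 * real m \<le> real m' \<and>
       (\<forall>(i,j)\<in>set []. bidense E \<epsilon> (A' i) (A' j) \<or> bidense (\<lambda>x y. \<not> E x y) \<epsilon> (A' i) (A' j))"
      by (intro exI[of _ A] exI[of _ m]) auto
  qed
next
  case (Cons ij ps)
  obtain i j where ij: "ij = (i,j)" "i < r" "j < r" "i \<noteq> j" using Cons.prems(1) by (cases ij) auto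
  obtain \<nu> m0 where \<nu>: "0 < \<nu>" "\<nu> \<le> 1" and IH: "\<forall>E (A :: nat \<Rightarrow> 'v set) m. (\<forall>i<r. finite (A i) \<and> card (A i) = m) \<longrightarrow> m0 \<le> real m \<longrightarrow>
     (\<exists>A' m'. (\<forall>i<r. A' i \<subseteq> A i \<and> card (A' i) = m') \<and> \<nu> * real m \<le> real m' \<and>
       (\<forall>(i,j)\<in>set ps. bidense E \<epsilon> (A' i) (A' j) \<or> bidense (\<lambda>x y. \<not> E x y) \<epsilon> (A' i) (A' j)))"
    using Cons.IH[of \<epsilon>] Cons.prems by auto
  have e1: "0 < \<epsilon> * \<nu>" using Cons.prems \<nu> by simp
  have "\<epsilon> * \<nu> \<le> \<epsilon> * 1" using Cons.prems(2) \<nu> by (intro mult_left_mono) auto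
  then have e2: "\<epsilon> * \<nu> \<le> 1/4" using Cons.prems(3) by linarith
  obtain \<nu>1 m1 where \<nu>1: "\<nu>1 > (0::real)" and D: "\<forall>E (A :: 'v set) B m. finite A \<longrightarrow> finite B \<longrightarrow> card A = m \<longrightarrow> card B = m \<longrightarrow> m1 \<le> real m \<longrightarrow>
     (\<exists>X\<subseteq>A. \<exists>Y\<subseteq>B. card X = card Y \<and> \<nu>1 * m \<le> card X \<and> (bidense E (\<epsilon> * \<nu>) X Y \<or> bidense (\<lambda>x y. \<not> E x y) (\<epsilon> * \<nu>) X Y))"
    using dense_pair[OF e1 e2] by (elim exE conjE) (rule that)
  show ?case
  proof (rule exI[of _ "min 1 (\<nu> * \<nu>1)"], intro conjI, use \<nu> \<nu>1 in simp, simp, rule exI[of _ "max m1 (m0 / \<nu>1)"], intro allI impI)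
    fix E and A :: "nat \<Rightarrow> 'v set" and m
    assume A: "\<forall>i<r. finite (A i) \<and> card (A i) = m" and m: "max m1 (m0 / \<nu>1) \<le> real m"
    obtain X Y where XY: "X \<subseteq> A i" "Y \<subseteq> A j" "card X = card Y" "\<nu>1 * m \<le> card X"
      "bidense E (\<epsilon> * \<nu>) X Y \<or> bidense (\<lambda>x y. \<not> E x y) (\<epsilon> * \<nu>) X Y"
      using D[rule_format, of "A i" "A j" m E] A ij m by auto
    define k where "k = card X"
    have "card X \<le> card (A i)" using XY(1) A ij by (intro card_mono) auto
    then have km: "k \<le> m" using A ij by (simp add: k_def)
    have "\<exists>B. \<forall>l<r. B l \<subseteq> A l \<and> card (B l) = k"
    proof -
      have "\<forall>l. \<exists>S. l < r \<longrightarrow> S \<subseteq> A l \<and> card S = k" using A km obtain_subset_with_card_n by metis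
      then show ?thesis by metis
    qed
    then obtain B where B: "\<And>l. l < r \<Longrightarrow> B l \<subseteq> A l \<and> card (B l) = k" by blast
    define C where "C l = (if l = i then X else if l = j then Y else B l)" for l
    have C: "C l \<subseteq> A l" "card (C l) = k" "finite (C l)" if "l < r" for l
    proof -
      show s: "C l \<subseteq> A l" using B[OF that] XY by (auto simp: C_def)
      show "card (C l) = k" using B[OF that] XY by (auto simp: C_def k_def)
      show "finite (C l)" using s A that finite_subset by blast
    qed
    have "m0 / \<nu>1 \<le> real m" using m by simp
    then have "m0 \<le> \<nu>1 * m" using \<nu>1 by (simp add: field_simps)
    then have "m0 \<le> real k" using XY(4) by (simp add: k_def)
    then obtain A' m' where A': "\<forall>i<r. A' i \<subseteq> C i \<and> card (A' i) = m'" "\<nu> * real k \<le> real m'"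
       "\<forall>(i,j)\<in>set ps. bidense E \<epsilon> (A' i) (A' j) \<or> bidense (\<lambda>x y. \<not> E x y) \<epsilon> (A' i) (A' j)"
      using IH[rule_format, of C k E] C by blast
    have CX: "C i = X" "C j = Y" using ij by (auto simp: C_def)
    have sub: "A' i \<subseteq> X" "A' j \<subseteq> Y" using A'(1) ij CX by auto
    have cc: "card (A' i) = m'" "card (A' j) = m'" "card X = k" "card Y = k" using A'(1) ij XY by (auto simp: k_def)
    have "\<epsilon> * \<nu> * k \<le> \<epsilon> * m'" using A'(2) Cons.prems(2) by (simp add: mult.assoc)
    then have new: "bidense E \<epsilon> (A' i) (A' j) \<or> bidense (\<lambda>x y. \<not> E x y) \<epsilon> (A' i) (A' j)"
      using XY(5) bidense_subset[OF _ sub, of _ "\<epsilon> * \<nu>" \<epsilon>] cc by auto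
    have "min 1 (\<nu> * \<nu>1) * real m \<le> \<nu> * \<nu>1 * m" by (intro mult_right_mono) auto
    also have "\<dots> = \<nu> * (\<nu>1 * m)" by simp
    also have "\<dots> \<le> \<nu> * k" using XY(4) \<nu> by (intro mult_left_mono) (auto simp: k_def)
    finally have sz: "min 1 (\<nu> * \<nu>1) * real m \<le> real m'" using A'(2) by linarith
    have "\<forall>i<r. A' i \<subseteq> A i \<and> card (A' i) = m'" using A'(1) C by blast
    then show "\<exists>A' m'. (\<forall>i<r. A' i \<subseteq> A i \<and> card (A' i) = m') \<and> min 1 (\<nu> * \<nu>1) * real m \<le> real m' \<and>
       (\<forall>(i,j)\<in>set (ij # ps). bidense E \<epsilon> (A' i) (A' j) \<or> bidense (\<lambda>x y. \<not> E x y) \<epsilon> (A' i) (A' j))"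
      using sz A'(3) new ij by (intro exI[of _ A'] exI[of _ m']) auto
  qed
qed

lemma disjoint_blocks:
  assumes "finite W" "r * q \<le> card W"
  shows "\<exists>A :: nat \<Rightarrow> 'v set. (\<forall>i<r. A i \<subseteq> W \<and> card (A i) = q) \<and> (\<forall>i<r. \<forall>j<r. i \<noteq> j \<longrightarrow> A i \<inter> A j = {})"
  using assms
proof (induction r arbitrary: W)
  case (Suc r)
  obtain S where S: "S \<subseteq> W" "card S = q" using obtain_subset_with_card_n[of q W] Suc.prems by auto
  have "card (W - S) = card W - q" using S Suc.prems finite_subset by (metis card_Diff_subset)
  then have rq: "finite (W - S)" "r * q \<le> card (W - S)" using Suc.prems by auto
  obtain A :: "nat \<Rightarrow> 'v set" where A: "\<forall>i<r. A i \<subseteq> W - S \<and> card (A i) = q" "\<forall>i<r. \<forall>j<r. i \<noteq> j \<longrightarrow> A i \<inter> A j = {}"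
    using Suc.IH[OF rq] by (elim exE conjE) (rule that)
  show ?case
  proof (intro exI[of _ "\<lambda>i. if i = r then S else A i"] conjI allI impI)
    fix i assume "i < Suc r"
    then show "(if i = r then S else A i) \<subseteq> W" "card (if i = r then S else A i) = q" using A(1) S by (auto simp: less_Suc_eq)
  next
    fix i j assume "i < Suc r" "j < Suc r" "i \<noteq> j"
    then consider "i = r" "j < r" | "j = r" "i < r" | "i < r" "j < r" by linarith
    then show "(if i = r then S else A i) \<inter> (if j = r then S else A j) = {}"
    proof cases
      case 1 then show ?thesis using A(1) by auto
    next
      case 2 then show ?thesis using A(1) by auto
    next
      case 3
      then have "A i \<inter> A j = {}" using A(2) \<open>i \<noteq> j\<close> by blast
      then show ?thesis using 3 by simp
    qed
  qed
qed auto

text \<open>Disjoint blocks, as many as Ramsey's theorem for triangles asks for, are thinned until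
  each pair is dense in one of the colours; three of them then agree.\<close>

lemma mono_triple:
  fixes \<epsilon> :: real
  assumes \<epsilon>: "0 < \<epsilon>" "\<epsilon> \<le> 1/4"
  shows "\<exists>\<nu>>(0::real). \<exists>m0::nat. \<forall>E (W :: 'v set). finite W \<longrightarrow> m0 \<le> card W \<longrightarrow> (\<forall>x y. E x y = E y x) \<longrightarrow>
    (\<exists>t :: nat \<Rightarrow> 'v set. \<exists>m>0. (\<forall>a<3. t a \<subseteq> W \<and> card (t a) = m) \<and> \<nu> * card W \<le> m \<and>
      (\<forall>a<3. \<forall>b<3. a \<noteq> b \<longrightarrow> t a \<inter> t b = {}) \<and>
      ((\<forall>a<3. \<forall>b<3. a \<noteq> b \<longrightarrow> bidense E \<epsilon> (t a) (t b)) \<or>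
       (\<forall>a<3. \<forall>b<3. a \<noteq> b \<longrightarrow> bidense (\<lambda>x y. \<not> E x y) \<epsilon> (t a) (t b))))"
proof -
  obtain r where r: "\<And>(V :: nat set) E. finite V \<Longrightarrow> r \<le> card V \<Longrightarrow>
      \<exists>R\<subseteq>V. card R = 3 \<and> clique R E \<or> card R = 3 \<and> indep R E"
    using ramsey2[of 3 3] by metis
  define ps where "ps = filter (\<lambda>(i,j). i \<noteq> j) (List.product [0..<r] [0..<r])"
  have ps: "set ps = {(i,j). i < r \<and> j < r \<and> i \<noteq> j}" by (auto simp: ps_def)
  have ps': "\<forall>(i,j)\<in>set ps. i < r \<and> j < r \<and> i \<noteq> j" by (auto simp: ps)
  obtain \<nu> m0 where \<nu>: "0 < \<nu>" and P: "\<forall>E (A :: nat \<Rightarrow> 'v set) m. (\<forall>i<r. finite (A i) \<and> card (A i) = m) \<longrightarrow> m0 \<le> real m \<longrightarrow>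
     (\<exists>A' m'. (\<forall>i<r. A' i \<subseteq> A i \<and> card (A' i) = m') \<and> \<nu> * real m \<le> real m' \<and>
       (\<forall>(i,j)\<in>set ps. bidense E \<epsilon> (A' i) (A' j) \<or> bidense (\<lambda>x y. \<not> E x y) \<epsilon> (A' i) (A' j)))"
    using all_pairs[OF ps' \<epsilon>] by (elim exE conjE) (rule that)
  have r0: "0 < r"
  proof (rule ccontr)
    assume "\<not> 0 < r"
    then obtain R :: "nat set" where "R \<subseteq> {}" "card R = 3" using r[of "{}"] by auto
    then show False by simp
  qed
  obtain M :: nat where M: "m0 \<le> real M" using real_arch_simple by blast
  define n0 where "n0 = 2 * r * (M + 1)"
  show ?thesis
  proof (rule exI[of _ "\<nu> / (2 * r)"], intro conjI, use \<nu> r0 in simp, rule exI[of _ n0], intro allI impI)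
    fix E :: "'v \<Rightarrow> 'v \<Rightarrow> bool" and W :: "'v set"
    assume W: "finite W" "n0 \<le> card W" and sym: "\<forall>x y. E x y = E y x"
    define q where "q = card W div r"
    have "2 * (M + 1) \<le> q" unfolding q_def using div_le_mono[OF W(2), of r] r0 by (simp add: n0_def mult.assoc)
    then have Mq: "M \<le> q" "2 \<le> q" by auto
    then have q: "m0 \<le> real q" "2 \<le> q" using M of_nat_mono[OF Mq(1), where ?'a = real] by linarith+
    have "card W < r * (q + 1)" unfolding q_def using r0
      by (metis Suc_eq_plus1 dividend_less_times_div mult.commute mult_Suc_right add.commute)
    also have "\<dots> \<le> r * (2 * q)" using q(2) by (intro mult_left_mono) auto
    finally have cW: "real (card W) \<le> 2 * r * q" by (simp flip: of_nat_mult)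
    have "r * q \<le> card W" by (simp add: q_def)
    then obtain A :: "nat \<Rightarrow> 'v set" where A: "\<forall>i<r. A i \<subseteq> W \<and> card (A i) = q" "\<forall>i<r. \<forall>j<r. i \<noteq> j \<longrightarrow> A i \<inter> A j = {}"
      using disjoint_blocks[OF W(1)] by blast
    have "\<forall>i<r. finite (A i) \<and> card (A i) = q" using A(1) W finite_subset by blast
    then obtain A' m' where A': "\<forall>i<r. A' i \<subseteq> A i \<and> card (A' i) = m'" "\<nu> * real q \<le> real m'"
       "\<forall>(i,j)\<in>set ps. bidense E \<epsilon> (A' i) (A' j) \<or> bidense (\<lambda>x y. \<not> E x y) \<epsilon> (A' i) (A' j)"
      using P[rule_format, of A q E] q by blast
    \<comment> \<open>An edge is decided by its increasing order, as \<open>bidense\<close> speaks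
      of ordered pairs; the symmetry of \<open>E\<close> supplies the other order.\<close>
    let ?G = "{{i,j} | i j. i < j \<and> bidense E \<epsilon> (A' i) (A' j)}"
    obtain R where R: "R \<subseteq> {..<r}" "card R = 3" "clique R ?G \<or> indep R ?G"
      using r[of "{..<r}" ?G] by auto
    have finR: "finite R" using R finite_subset by blast
    obtain h :: "nat \<Rightarrow> nat" where h: "bij_betw h {..<3} R" using ex_bij_betw_nat_finite[OF finR] R(2) by (auto simp: atLeast0LessThan)
    have hR: "h a \<in> R" "h a < r" if "a < 3" for a using h R that by (auto simp: bij_betw_def)
    have hne: "h a \<noteq> h b" if "a < 3" "b < 3" "a \<noteq> b" for a b using h that by (auto simp: bij_betw_def inj_on_def)
    define t where "t a = A' (h a)" for a
    have 1: "t a \<subseteq> W" "card (t a) = m'" if "a < 3" for a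
    proof -
      have "A' (h a) \<subseteq> A (h a)" "card (A' (h a)) = m'" "A (h a) \<subseteq> W" using A'(1) A(1) hR(2)[OF that] by auto
      then show "t a \<subseteq> W" "card (t a) = m'" by (auto simp: t_def)
    qed
    have 2: "t a \<inter> t b = {}" if "a < 3" "b < 3" "a \<noteq> b" for a b
      using A'(1) A(2) hR(2)[OF that(1)] hR(2)[OF that(2)] hne[OF that] unfolding t_def by blast
    have "\<nu> / (2 * r) * card W \<le> \<nu> / (2 * r) * (2 * r * q)" using cW \<nu> by (intro mult_left_mono) auto
    also have "\<dots> = \<nu> * q" using r0 by simp
    finally have 3: "\<nu> / (2 * r) * card W \<le> m'" using A'(2) by linarith
    have "0 < \<nu> * real q" using \<nu> q by simp
    then have 4: "0 < m'" using A'(2) by linarith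
    have symE: "E x y = E y x" "(\<not> E x y) = (\<not> E y x)" for x y using sym by blast+
    have bs: "bidense E \<epsilon> C D \<Longrightarrow> bidense E \<epsilon> D C"
      "bidense (\<lambda>x y. \<not> E x y) \<epsilon> C D \<Longrightarrow> bidense (\<lambda>x y. \<not> E x y) \<epsilon> D C" for C D
      using bidense_sym[of E \<epsilon> C D] bidense_sym[of "\<lambda>x y. \<not> E x y" \<epsilon> C D] symE by blast+
    have ord: "{i,j} \<in> ?G \<longleftrightarrow> bidense E \<epsilon> (A' i) (A' j)" if "i < j" for i j
      using that by (auto simp: doubleton_eq_iff)
    have "(\<forall>a<3. \<forall>b<3. a \<noteq> b \<longrightarrow> bidense E \<epsilon> (t a) (t b)) \<or>
       (\<forall>a<3. \<forall>b<3. a \<noteq> b \<longrightarrow> bidense (\<lambda>x y. \<not> E x y) \<epsilon> (t a) (t b))"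
      using R(3)
    proof
      assume c: "clique R ?G"
      have "bidense E \<epsilon> (A' i) (A' j)" if "i \<in> R" "j \<in> R" "i \<noteq> j" for i j
      proof (cases "i < j")
        case True
        then show ?thesis using c that ord[OF True] by (auto simp only: clique_def)
      next
        case False
        then have ji: "j < i" using that by simp
        have "{j,i} \<in> ?G" using c that by (auto simp only: clique_def)
        then show ?thesis using ord[OF ji] bs(1) by blast
      qed
      then show ?thesis using hR hne unfolding t_def by blast
    next
      assume c: "indep R ?G"
      have either: "bidense E \<epsilon> (A' i) (A' j) \<or> bidense (\<lambda>x y. \<not> E x y) \<epsilon> (A' i) (A' j)" if "i \<in> R" "j \<in> R" "i \<noteq> j" for i j
        using A'(3) that R(1) unfolding ps by blast
      have "bidense (\<lambda>x y. \<not> E x y) \<epsilon> (A' i) (A' j)" if "i \<in> R" "j \<in> R" "i \<noteq> j" for i j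
      proof (cases "i < j")
        case True
        have "{i,j} \<notin> ?G" using c that by (auto simp only: indep_def)
        then show ?thesis using ord[OF True] either[OF that] by blast
      next
        case False
        then have ji: "j < i" using that by simp
        have "{j,i} \<notin> ?G" using c that by (auto simp only: indep_def)
        then have "bidense (\<lambda>x y. \<not> E x y) \<epsilon> (A' j) (A' i)" using ord[OF ji] either[of j i] that by blast
        then show ?thesis by (rule bs(2))
      qed
      then show ?thesis using hR hne unfolding t_def by blast
    qed
    then show "\<exists>t :: nat \<Rightarrow> 'v set. \<exists>m>0. (\<forall>a<3. t a \<subseteq> W \<and> card (t a) = m) \<and> \<nu> / (2 * r) * card W \<le> m \<and>
      (\<forall>a<3. \<forall>b<3. a \<noteq> b \<longrightarrow> t a \<inter> t b = {}) \<and>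
      ((\<forall>a<3. \<forall>b<3. a \<noteq> b \<longrightarrow> bidense E \<epsilon> (t a) (t b)) \<or>
       (\<forall>a<3. \<forall>b<3. a \<noteq> b \<longrightarrow> bidense (\<lambda>x y. \<not> E x y) \<epsilon> (t a) (t b)))"
      using 1 2 3 4 by (intro exI[of _ t] exI[of _ m'] conjI) auto
  qed
qed

section \<open>Greedy embedding\<close>

lemma epairs_card: "finite Y \<Longrightarrow> epairs E X Y = (\<Sum>x\<in>X. real (card {y\<in>Y. E x y}))"
  by (simp add: epairs_def of_bool_def sum.If_cases Int_def)

text \<open>Too many exceptional vertices would form a large subpair with \<open>Y\<close> of
  density below 1/4.\<close>

lemma few_bad_vertices:
  fixes \<epsilon> :: real
  assumes "bidense E \<epsilon> A B" "finite A" "finite B" "Y \<subseteq> B" "\<epsilon> * card B \<le> card Y" "0 < \<epsilon>" "A \<noteq> {}"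
  shows "card {u\<in>A. real (card {v\<in>Y. E u v}) < 1/4 * card Y} < \<epsilon> * card A"
proof (rule ccontr)
  let ?X = "{u\<in>A. real (card {v\<in>Y. E u v}) < 1/4 * card Y}"
  assume n: "\<not> ?thesis"
  have finX: "finite ?X" "finite Y" using assms finite_subset by auto
  have "0 < \<epsilon> * card A" using assms by (simp add: card_gt_0_iff)
  then have "0 < card ?X" using n by linarith
  then have ne: "?X \<noteq> {}" by (metis card.empty less_irrefl)
  have "epairs E ?X Y < (\<Sum>x\<in>?X. 1/4 * real (card Y))"
    unfolding epairs_card[OF finX(2)] using finX(1) ne by (rule sum_strict_mono) auto
  then have "epairs E ?X Y < 1/4 * (card ?X * card Y)" by simp
  moreover have "1/4 * (card ?X * card Y) \<le> epairs E ?X Y"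
    using assms(1,4,5) n unfolding bidense_def by auto
  ultimately show False by simp
qed

lemma card_le_Suc_diff: "card X \<le> card (X - {u}) + 1"
  by (cases "u \<in> X") (auto simp: card_Diff_singleton_if)

text \<open>The assumption \<open>load\<close> keeps an \<eta> share of each cluster free for
  vertices without embedded neighbours. In \<open>room\<close>, each of at most \<Delta> neighbours
  cuts the candidates to a quarter, b bounds the candidates used up meanwhile, and the term with
  \<epsilon> pays for exceptional vertices and keeps the candidate sets large enough for density to
  apply.\<close>

locale embedding_problem =
  fixes E :: "'v \<Rightarrow> 'v \<Rightarrow> bool" and S :: "'k \<Rightarrow> 'v set" and \<phi> :: "nat \<Rightarrow> 'k"
    and adj :: "nat \<Rightarrow> nat \<Rightarrow> bool" and m b \<Delta> :: nat and \<epsilon> \<eta> :: real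
  assumes adj_sym: "\<And>x y. adj x y \<Longrightarrow> adj y x" and adj_irrefl: "\<And>x. \<not> adj x x"
    and adj_near: "\<And>x y. adj x y \<Longrightarrow> x \<le> y + b"
    and deg: "\<And>x. x < m \<Longrightarrow> card {y. y < m \<and> adj x y} \<le> \<Delta>"
    and E_sym: "\<And>u v. E u v \<Longrightarrow> E v u"
    and finS: "\<And>x. x < m \<Longrightarrow> finite (S (\<phi> x))"
    and disj: "\<And>x y. x < m \<Longrightarrow> y < m \<Longrightarrow> \<phi> x \<noteq> \<phi> y \<Longrightarrow> S (\<phi> x) \<inter> S (\<phi> y) = {}"
    and dense: "\<And>x y. x < m \<Longrightarrow> y < m \<Longrightarrow> adj x y \<Longrightarrow> bidense E \<epsilon> (S (\<phi> x)) (S (\<phi> y))"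
    and load: "\<And>x. x < m \<Longrightarrow> card {y. y < m \<and> \<phi> y = \<phi> x} \<le> (1 - \<eta>) * card (S (\<phi> x))"
    and room: "\<And>x. x < m \<Longrightarrow> b + (\<Delta> + 1) * \<epsilon> * card (S (\<phi> x)) < (1/4) ^ \<Delta> * \<eta> * card (S (\<phi> x))"
    and eps: "0 < \<epsilon>" and eta: "0 \<le> \<eta>"
begin

definition nb where "nb t y = {x. x < t \<and> adj y x}"
definition cand where "cand \<psi> t y = {v \<in> S (\<phi> y). v \<notin> \<psi> ` {..<t} \<and> (\<forall>x\<in>nb t y. E (\<psi> x) v)}"

text \<open>A vertex \<open>y\<close> gets its first embedded neighbour at a time at least \<open>y - b\<close>, so at time
  \<open>t\<close> it has lost at most \<open>t + b - y\<close> candidates because they were used.\<close>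

definition good where "good \<psi> t \<longleftrightarrow> inj_on \<psi> {..<t} \<and> (\<forall>x<t. \<psi> x \<in> S (\<phi> x)) \<and>
  (\<forall>x<t. \<forall>y<t. adj x y \<longrightarrow> E (\<psi> x) (\<psi> y)) \<and>
  (\<forall>y. t \<le> y \<longrightarrow> y < m \<longrightarrow> nb t y \<noteq> {} \<longrightarrow>
     (1/4) ^ card (nb t y) * \<eta> * card (S (\<phi> y)) \<le> card (cand \<psi> t y) + (real (t + b) - y))"

lemma fin_nb: "finite (nb t y)" by (simp add: nb_def)
lemma card_nb: "y < m \<Longrightarrow> t \<le> m \<Longrightarrow> card (nb t y) \<le> \<Delta>"
  using deg[of y] card_mono[of "{x. x < m \<and> adj y x}" "nb t y"] by (fastforce simp: nb_def)

text \<open>Candidates are lost only by being used, and since clusters are disjoint, only vertices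
  assigned to the same cluster can have used them.\<close>

lemma cand_untouched:
  assumes "\<And>x. x < t \<Longrightarrow> \<psi> x \<in> S (\<phi> x)" "t \<le> m" "y < m" "nb t y = {}"
  shows "\<eta> * card (S (\<phi> y)) \<le> card (cand \<psi> t y)"
proof -
  let ?F = "{x. x < m \<and> \<phi> x = \<phi> y}"
  have "S (\<phi> y) - cand \<psi> t y \<subseteq> \<psi> ` ?F"
  proof
    fix v assume "v \<in> S (\<phi> y) - cand \<psi> t y"
    then obtain x where x: "x < t" "v = \<psi> x" "v \<in> S (\<phi> y)" using assms(4) by (auto simp: cand_def)
    then have "\<phi> x = \<phi> y" using disj[of x y] assms by fastforce
    then show "v \<in> \<psi> ` ?F" using x assms by auto
  qed
  then have "card (S (\<phi> y) - cand \<psi> t y) \<le> card (\<psi> ` ?F)" by (intro card_mono) auto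
  also have "\<dots> \<le> card ?F" by (intro card_image_le) auto
  finally have 1: "real (card (S (\<phi> y) - cand \<psi> t y)) \<le> (1 - \<eta>) * card (S (\<phi> y))" using load[OF assms(3)] by linarith
  have sub: "cand \<psi> t y \<subseteq> S (\<phi> y)" by (auto simp: cand_def)
  have f: "finite (S (\<phi> y))" using finS assms by blast
  have "card (S (\<phi> y)) = card (cand \<psi> t y) + card (S (\<phi> y) - cand \<psi> t y)"
    using card_mono[OF f sub] finite_subset[OF sub f] sub by (simp add: card_Diff_subset)
  then have "real (card (S (\<phi> y))) = card (cand \<psi> t y) + real (card (S (\<phi> y) - cand \<psi> t y))" by simp
  then show ?thesis using 1 by (simp add: algebra_simps)
qed

lemma cand_large:
  assumes g: "good \<psi> t" and t: "t \<le> y" "y < m"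
  shows "(1/4) ^ \<Delta> * \<eta> * card (S (\<phi> y)) - b \<le> card (cand \<psi> t y)"
proof (cases "nb t y = {}")
  case True
  have "\<eta> * card (S (\<phi> y)) \<le> card (cand \<psi> t y)" using g t True by (intro cand_untouched) (auto simp: good_def)
  moreover have "(1/4) ^ \<Delta> * (\<eta> * card (S (\<phi> y))) \<le> 1 * (\<eta> * card (S (\<phi> y)))"
    using eta by (intro mult_right_mono) (auto simp: power_le_one)
  ultimately show ?thesis by (simp add: mult.assoc)
next
  case False
  have "(1/4::real) ^ \<Delta> \<le> (1/4) ^ card (nb t y)" using card_nb[of y t] t by (intro power_decreasing) auto
  then have "(1/4) ^ \<Delta> * (\<eta> * card (S (\<phi> y))) \<le> (1/4) ^ card (nb t y) * (\<eta> * card (S (\<phi> y)))"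
    using eta by (intro mult_right_mono) auto
  then show ?thesis using g t False unfolding good_def by (fastforce simp: mult.assoc)
qed

text \<open>The image u of t has to avoid, for each of its at most \<Delta> later neighbours, the
  few points that see less than a quarter of its candidates. Every other later vertex loses at most
  the candidate u, which is absorbed as the slack grows by 1.\<close>

lemma step:
  assumes g: "good \<psi> t" and t: "t < m"
  shows "\<exists>\<psi>'. good \<psi>' (Suc t)"
proof -
  let ?S = "S (\<phi> t)" and ?C = "cand \<psi> t t"
  let ?later = "{y. t < y \<and> y < m \<and> adj t y}"
  define bad where "bad y = {u\<in>?S. real (card {v\<in>cand \<psi> t y. E u v}) < 1/4 * card (cand \<psi> t y)}" for y
  have fS: "finite ?S" using finS t by blast
  have Ssz: "0 \<le> \<epsilon> * real (card (S (\<phi> y)))" for y using eps by simp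
  have big: "\<Delta> * (\<epsilon> * card (S (\<phi> y))) + \<epsilon> * card (S (\<phi> y)) < card (cand \<psi> t y)" if "t \<le> y" "y < m" for y
    using cand_large[OF g that] room[OF that(2)] by (simp add: algebra_simps)
  have Sne: "?S \<noteq> {}" using room[OF t] by auto
  have bad: "card (bad y) < \<epsilon> * card ?S" if y: "y \<in> ?later" for y
  proof -
    have "0 \<le> \<Delta> * (\<epsilon> * card (S (\<phi> y)))" using eps by simp
    then have "\<epsilon> * card (S (\<phi> y)) \<le> card (cand \<psi> t y)" using big[of y] y by simp
    then show ?thesis unfolding bad_def using y t eps Sne finS dense
      by (intro few_bad_vertices[where B = "S (\<phi> y)"]) (auto simp: cand_def)
  qed
  have finl: "finite ?later" by simp
  have cl: "card ?later \<le> \<Delta>" using deg[OF t] card_mono[of "{y. y < m \<and> adj t y}" ?later] by fastforce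
  have "real (card (\<Union>y\<in>?later. bad y)) \<le> (\<Sum>y\<in>?later. real (card (bad y)))"
    using card_UN_le[OF finl, of bad] by (simp flip: of_nat_sum)
  also have "\<dots> \<le> card ?later * (\<epsilon> * card ?S)" using bad by (intro sum_bounded_above) (auto intro: less_imp_le)
  also have "\<dots> \<le> \<Delta> * (\<epsilon> * card ?S)" using cl Ssz[of t] by (intro mult_right_mono) auto
  also have "\<dots> < card ?C" using big[of t] t Ssz[of t] by auto
  finally have "card (\<Union>y\<in>?later. bad y) < card ?C" by simp
  moreover have "finite (\<Union>y\<in>?later. bad y)" using fS by (auto simp: bad_def)
  ultimately have "\<not> ?C \<subseteq> (\<Union>y\<in>?later. bad y)" using card_mono not_le by blast
  then obtain u where u: "u \<in> ?C" "\<And>y. y \<in> ?later \<Longrightarrow> u \<notin> bad y" by blast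
  have uS: "u \<in> ?S" "u \<notin> \<psi> ` {..<t}" "\<And>x. x \<in> nb t t \<Longrightarrow> E (\<psi> x) u" using u(1) by (auto simp: cand_def)
  define \<psi>' where "\<psi>' = \<psi>(t := u)"
  have img: "\<psi>' ` {..<Suc t} = insert u (\<psi> ` {..<t})" by (auto simp: \<psi>'_def lessThan_Suc)
  have old: "\<psi>' x = \<psi> x" if "x < t" for x using that by (simp add: \<psi>'_def)
  have 1: "inj_on \<psi>' {..<Suc t}"
  proof -
    have "inj_on \<psi>' {..<t}" using g old by (simp add: good_def inj_on_def)
    moreover have "\<psi>' t \<notin> \<psi>' ` {..<t}" using uS(2) old by (auto simp: \<psi>'_def)
    ultimately show ?thesis by (simp add: lessThan_Suc)
  qed
  have 2: "\<psi>' x \<in> S (\<phi> x)" if "x < Suc t" for x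
    using that g uS(1) by (auto simp: good_def \<psi>'_def less_Suc_eq)
  have 3: "E (\<psi>' x) (\<psi>' y)" if xy: "x < Suc t" "y < Suc t" "adj x y" for x y
  proof -
    consider "x < t" "y < t" | "x < t" "y = t" | "x = t" "y < t" using xy adj_irrefl by (auto simp: less_Suc_eq)
    then show ?thesis
    proof cases
      case 1 then show ?thesis using g xy old by (simp add: good_def)
    next
      case 2 then show ?thesis using uS(3)[of x] adj_sym[OF xy(3)] old by (simp add: nb_def \<psi>'_def)
    next
      case 3 then show ?thesis using uS(3)[of y] xy(3) old E_sym by (simp add: nb_def \<psi>'_def)
    qed
  qed
  have 4: "(1/4) ^ card (nb (Suc t) y) * \<eta> * card (S (\<phi> y)) \<le> card (cand \<psi>' (Suc t) y) + (real (Suc t + b) - y)"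
    if y: "Suc t \<le> y" "y < m" "nb (Suc t) y \<noteq> {}" for y
  proof -
    have finC: "finite (cand \<psi> t y)" using finS[OF y(2)] by (simp add: cand_def)
    show ?thesis
    proof (cases "adj y t")
      case True
      have nbS: "nb (Suc t) y = insert t (nb t y)" using True by (auto simp: nb_def less_Suc_eq)
      have cn: "card (nb (Suc t) y) = Suc (card (nb t y))" unfolding nbS using fin_nb by (simp add: nb_def)
      have yl: "y \<in> ?later" using y True adj_sym by auto
      \<comment> \<open>Because of the bandwidth the slack is nonnegative when y gets an embedded
        neighbour, so dividing it by 4 does no harm.\<close>
      have near: "0 \<le> real (t + b) - y" using adj_near[OF True] by simp
      have "{v\<in>cand \<psi> t y. E u v} - {u} \<subseteq> cand \<psi>' (Suc t) y"
        unfolding cand_def img nbS by (auto simp: \<psi>'_def nb_def)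
      then have "card ({v\<in>cand \<psi> t y. E u v} - {u}) \<le> card (cand \<psi>' (Suc t) y)"
        using finS[OF y(2)] by (intro card_mono) (simp add: cand_def)
      moreover have "card {v\<in>cand \<psi> t y. E u v} \<le> card ({v\<in>cand \<psi> t y. E u v} - {u}) + 1"
        by (rule card_le_Suc_diff)
      moreover have "1/4 * card (cand \<psi> t y) \<le> card {v\<in>cand \<psi> t y. E u v}"
        using u(2)[OF yl] uS(1) by (auto simp: bad_def)
      ultimately have A: "1/4 * card (cand \<psi> t y) \<le> real (card (cand \<psi>' (Suc t) y)) + 1" by linarith
      have "(1/4) ^ card (nb t y) * \<eta> * card (S (\<phi> y)) \<le> card (cand \<psi> t y) + (real (t + b) - y)"
      proof (cases "nb t y = {}")
        case True
        have "\<eta> * card (S (\<phi> y)) \<le> card (cand \<psi> t y)" using g y True by (intro cand_untouched) (auto simp: good_def)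
        then show ?thesis using True near by simp
      next
        case False
        then show ?thesis using g y unfolding good_def by (meson Suc_leD)
      qed
      then show ?thesis unfolding cn using A near by simp
    next
      case False
      have nbS: "nb (Suc t) y = nb t y" using False by (auto simp: nb_def less_Suc_eq)
      have "cand \<psi> t y - {u} \<subseteq> cand \<psi>' (Suc t) y"
        unfolding cand_def img nbS by (auto simp: \<psi>'_def nb_def)
      then have "card (cand \<psi> t y - {u}) \<le> card (cand \<psi>' (Suc t) y)"
        using finS[OF y(2)] by (intro card_mono) (simp add: cand_def)
      moreover have "card (cand \<psi> t y) \<le> card (cand \<psi> t y - {u}) + 1"
        by (rule card_le_Suc_diff)
      ultimately have "card (cand \<psi> t y) \<le> card (cand \<psi>' (Suc t) y) + 1" by linarith
      moreover have "(1/4) ^ card (nb t y) * \<eta> * card (S (\<phi> y)) \<le> card (cand \<psi> t y) + (real (t + b) - y)"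
        using g y unfolding good_def nbS by (meson Suc_leD)
      ultimately show ?thesis unfolding nbS by simp
    qed
  qed
  show ?thesis using 1 2 3 4 unfolding good_def by (intro exI[of _ \<psi>']) blast
qed

lemma embedding_exists:
  "\<exists>\<psi>. inj_on \<psi> {..<m} \<and> (\<forall>x<m. \<psi> x \<in> S (\<phi> x)) \<and> (\<forall>x<m. \<forall>y<m. adj x y \<longrightarrow> E (\<psi> x) (\<psi> y))"
proof -
  have "\<exists>\<psi>. good \<psi> t" if "t \<le> m" for t
    using that
  proof (induction t)
    case 0
    show ?case by (auto simp: good_def nb_def)
  next
    case (Suc t)
    then show ?case using step by auto
  qed
  then obtain \<psi> where "good \<psi> m" by blast
  then show ?thesis unfolding good_def by blast
qed

end

section \<open>Fractional packings and covers\<close>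

lemma pos_part_square: "(max 0 (t + d))\<^sup>2 \<le> (max 0 t)\<^sup>2 + 2 * d * max 0 t + (d :: real)\<^sup>2"
proof -
  have "max 0 (t + d) \<le> \<bar>max 0 t + d\<bar>" by auto
  then have "(max 0 (t + d))\<^sup>2 \<le> (\<bar>max 0 t + d\<bar>)\<^sup>2" by (intro power_mono) auto
  then show ?thesis by (simp add: power2_sum algebra_simps)
qed

text \<open>The packing maximizes its size minus a quadratic penalty for overloading; the overloads at the
  maximum, suitably scaled, form the fractional cover.  Working on a fine grid makes the maximum exist
  trivially.\<close>

lemma packing_cover_duality:
  fixes p :: "'k \<Rightarrow> real" and T :: "'k set set" and \<epsilon> :: real
  assumes finX: "finite X" and T: "\<And>\<tau>. \<tau> \<in> T \<Longrightarrow> \<tau> \<subseteq> X \<and> card \<tau> = 3"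
    and p: "\<And>x. x \<in> X \<Longrightarrow> 0 < p x" and \<epsilon>: "0 < \<epsilon>" "\<epsilon> \<le> 1"
  shows "\<exists>\<rho> w. (\<forall>\<tau>\<in>T. (0::real) \<le> \<rho> \<tau>) \<and> (\<forall>x\<in>X. (\<Sum>\<tau>\<in>{\<tau>\<in>T. x \<in> \<tau>}. \<rho> \<tau>) \<le> (1 + 2 * \<epsilon>) * p x) \<and>
     (\<forall>x. 0 \<le> w x \<and> w x \<le> 1) \<and> (\<forall>\<tau>\<in>T. 1 \<le> (\<Sum>x\<in>\<tau>. w x)) \<and>
     (\<Sum>x\<in>X. p x * w x) \<le> (1 + \<epsilon>) * (\<Sum>\<tau>\<in>T. \<rho> \<tau>)"
proof (cases "T = {}")
  case True
  show ?thesis by (rule exI[of _ "\<lambda>_. 0"], rule exI[of _ "\<lambda>_. 0"]) (use True p \<epsilon> in \<open>auto intro!: mult_nonneg_nonneg less_imp_le\<close>)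
next
  case False
  have finT: "finite T" using T finX by (meson Pow_iff finite_Pow_iff finite_subset subsetI)
  have Xne: "X \<noteq> {}" using False T by fastforce
  define p0 where "p0 = Min (p ` X)"
  define p1 where "p1 = Max (p ` X)"
  have p01: "0 < p0" "\<And>x. x \<in> X \<Longrightarrow> p0 \<le> p x" "\<And>x. x \<in> X \<Longrightarrow> p x \<le> p1"
    using finX Xne p by (auto simp: p0_def p1_def)
  define \<xi> where "\<xi> = \<epsilon> / 3"
  have \<xi>: "0 < \<xi>" "\<xi> \<le> 1/3" using \<epsilon> by (auto simp: \<xi>_def)
  \<comment> \<open>The mesh of the grid: the quadratic error of changing one coordinate by d is at
    most 3 d^2 / (2 \<epsilon> p0) = d^2 \<xi> / h, which is a \<xi> share of a single step.\<close>
  define h where "h = \<xi> * (2 * \<epsilon> * p0) / 3"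
  have h: "0 < h" using \<xi> \<epsilon> p01 by (simp add: h_def)
  \<comment> \<open>The grid is so long that a triangle at its upper end loads each corner to at
    least 1 + \<epsilon> times its capacity.\<close>
  obtain M :: nat where M: "(1 + \<epsilon>) * p1 / h < M" using reals_Archimedean2 by blast
  then have Mh: "(1 + \<epsilon>) * p1 \<le> h * M" using h by (simp add: field_simps)
  define Ld where "Ld n x = h * (\<Sum>\<tau>\<in>{\<tau>\<in>T. x \<in> \<tau>}. real (n \<tau>))" for n x
  define t where "t n x = max 0 (Ld n x - p x)" for n x
  define F where "F n = h * (\<Sum>\<tau>\<in>T. real (n \<tau>)) - (\<Sum>x\<in>X. (t n x)\<^sup>2 / (2 * \<epsilon> * p x))" for n :: "'k set \<Rightarrow> nat"
  define G where "G = PiE T (\<lambda>_. {..M})"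
  have finG: "finite G" unfolding G_def by (intro finite_PiE finT) auto
  have Gne: "G \<noteq> {}" unfolding G_def by (simp add: PiE_eq_empty_iff)
  obtain n where n: "n \<in> G" "\<And>n'. n' \<in> G \<Longrightarrow> F n' \<le> F n"
    using arg_min_if_finite[OF finG Gne, of "\<lambda>n. - F n"] by (metis neg_le_iff_le not_le)
  \<comment> \<open>The derivative of the penalty with respect to the load at x; these prices will
    be the dual solution.\<close>
  define v where "v x = t n x / (\<epsilon> * p x)" for x
  have v0: "0 \<le> v x" if "x \<in> X" for x using that p[of x] \<epsilon> by (simp add: v_def t_def)
  have Ld0: "0 \<le> Ld n x" for x using h by (simp add: Ld_def sum_nonneg)
  \<comment> \<open>Approximate first-order optimality: changing a single coordinate brings no
    profit.\<close>
  have change: "d * (1 - (\<Sum>x\<in>\<tau>. v x)) \<le> d\<^sup>2 * \<xi> / h"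
    if \<tau>: "\<tau> \<in> T" and k: "k \<le> M" and d: "d = h * (real k - real (n \<tau>))" for \<tau> k d
  proof -
    let ?n = "n(\<tau> := k)"
    have "?n \<in> G" using n(1) \<tau> k unfolding G_def by (auto simp: PiE_iff extensional_def)
    then have le: "F ?n \<le> F n" by (rule n(2))
    have su: "(\<Sum>\<sigma>\<in>S. real (?n \<sigma>)) = (\<Sum>\<sigma>\<in>S. real (n \<sigma>)) + (if \<tau> \<in> S then real k - real (n \<tau>) else 0)" if fS: "finite S" for S
    proof -
      have e: "(\<Sum>\<sigma>\<in>S - {\<tau>}. real (?n \<sigma>)) = (\<Sum>\<sigma>\<in>S - {\<tau>}. real (n \<sigma>))" by (intro sum.cong) auto
      show ?thesis
      proof (cases "\<tau> \<in> S")
        case True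
        have 1: "(\<Sum>\<sigma>\<in>S. real (?n \<sigma>)) = real (?n \<tau>) + (\<Sum>\<sigma>\<in>S - {\<tau>}. real (?n \<sigma>))" by (rule sum.remove[OF fS True])
        have 2: "(\<Sum>\<sigma>\<in>S. real (n \<sigma>)) = real (n \<tau>) + (\<Sum>\<sigma>\<in>S - {\<tau>}. real (n \<sigma>))" by (rule sum.remove[OF fS True])
        show ?thesis unfolding 1 2 e using True by simp
      next
        case False
        then have *: "S - {\<tau>} = S" by simp
        show ?thesis using e unfolding * by (simp only: if_not_P[OF False] add_0_right)
      qed
    qed
    have Lu: "Ld ?n x = Ld n x + (if x \<in> \<tau> then d else 0)" for x
      using su[of "{\<sigma>\<in>T. x \<in> \<sigma>}"] finT \<tau> by (auto simp: Ld_def d algebra_simps)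
    have "(t ?n x)\<^sup>2 / (2 * \<epsilon> * p x) \<le> (t n x)\<^sup>2 / (2 * \<epsilon> * p x) + (if x \<in> \<tau> then (2 * d * t n x + d\<^sup>2) / (2 * \<epsilon> * p x) else 0)"
      if x: "x \<in> X" for x
    proof (cases "x \<in> \<tau>")
      case True
      have "(t ?n x)\<^sup>2 \<le> (t n x)\<^sup>2 + (2 * d * t n x + d\<^sup>2)"
        using pos_part_square[of "Ld n x - p x" d] True by (simp add: t_def Lu algebra_simps)
      then have "(t ?n x)\<^sup>2 / (2 * \<epsilon> * p x) \<le> ((t n x)\<^sup>2 + (2 * d * t n x + d\<^sup>2)) / (2 * \<epsilon> * p x)"
        using p[OF x] \<epsilon> by (intro divide_right_mono) auto
      then show ?thesis using True by (simp add: add_divide_distrib)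
    qed (simp add: t_def Lu)
    then have "(\<Sum>x\<in>X. (t ?n x)\<^sup>2 / (2 * \<epsilon> * p x)) \<le>
       (\<Sum>x\<in>X. (t n x)\<^sup>2 / (2 * \<epsilon> * p x) + (if x \<in> \<tau> then (2 * d * t n x + d\<^sup>2) / (2 * \<epsilon> * p x) else 0))"
      by (rule sum_mono)
    also have "\<dots> = (\<Sum>x\<in>X. (t n x)\<^sup>2 / (2 * \<epsilon> * p x)) + (\<Sum>x\<in>\<tau>. (2 * d * t n x + d\<^sup>2) / (2 * \<epsilon> * p x))"
    proof -
      have "X \<inter> {x. x \<in> \<tau>} = \<tau>" using T[OF \<tau>] by auto
      then show ?thesis using finX by (simp add: sum.distrib sum.If_cases)
    qed
    finally have fin': "(\<Sum>x\<in>X. (t ?n x)\<^sup>2 / (2 * \<epsilon> * p x)) \<le>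
       (\<Sum>x\<in>X. (t n x)\<^sup>2 / (2 * \<epsilon> * p x)) + (\<Sum>x\<in>\<tau>. (2 * d * t n x + d\<^sup>2) / (2 * \<epsilon> * p x))" .
    have "h * (\<Sum>\<sigma>\<in>T. real (?n \<sigma>)) = h * (\<Sum>\<sigma>\<in>T. real (n \<sigma>)) + d"
      unfolding su[OF finT] d using \<tau> by (simp only: if_P distrib_left)
    then have pen: "d \<le> (\<Sum>x\<in>\<tau>. (2 * d * t n x + d\<^sup>2) / (2 * \<epsilon> * p x))"
      using le fin' unfolding F_def by linarith
    have "(\<Sum>x\<in>\<tau>. (2 * d * t n x + d\<^sup>2) / (2 * \<epsilon> * p x)) \<le> (\<Sum>x\<in>\<tau>. d * v x + d\<^sup>2 / (2 * \<epsilon> * p0))"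
    proof (rule sum_mono)
      fix x assume "x \<in> \<tau>"
      then have x: "x \<in> X" using T \<tau> by blast
      have "d\<^sup>2 / (2 * \<epsilon> * p x) \<le> d\<^sup>2 / (2 * \<epsilon> * p0)"
        using p01 x \<epsilon> by (intro divide_left_mono mult_left_mono mult_pos_pos) (auto simp: p)
      moreover have "(2 * d * t n x + d\<^sup>2) / (2 * \<epsilon> * p x) = d * v x + d\<^sup>2 / (2 * \<epsilon> * p x)"
        using p[OF x] \<epsilon> by (simp add: v_def field_simps)
      ultimately show "(2 * d * t n x + d\<^sup>2) / (2 * \<epsilon> * p x) \<le> d * v x + d\<^sup>2 / (2 * \<epsilon> * p0)" by simp
    qed
    also have "\<dots> = d * (\<Sum>x\<in>\<tau>. v x) + 3 * (d\<^sup>2 / (2 * \<epsilon> * p0))"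
      using T[OF \<tau>] by (simp add: sum.distrib sum_distrib_left)
    also have "3 * (d\<^sup>2 / (2 * \<epsilon> * p0)) = d\<^sup>2 * \<xi> / h"
      using \<xi> \<epsilon> p01 by (simp add: h_def field_simps)
    finally show ?thesis using pen by (simp add: algebra_simps)
  qed
  have nM: "n \<tau> \<le> M" if "\<tau> \<in> T" for \<tau> using n(1) that by (auto simp: G_def PiE_iff)
  \<comment> \<open>Obtained by raising the coordinate one step; at the upper end of the grid a
    single corner already has price at least 1.\<close>
  have lower: "1 - \<xi> \<le> (\<Sum>x\<in>\<tau>. v x)" if \<tau>: "\<tau> \<in> T" for \<tau>
  proof (cases "n \<tau> < M")
    case True
    have "h * (1 - (\<Sum>x\<in>\<tau>. v x)) \<le> h\<^sup>2 * \<xi> / h" using change[OF \<tau>, of "n \<tau> + 1" h] True by simp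
    then have "h * (1 - (\<Sum>x\<in>\<tau>. v x)) \<le> h * \<xi>" using h by (simp add: power2_eq_square)
    then show ?thesis using h by simp
  next
    case False
    then have nt: "n \<tau> = M" using nM[OF \<tau>] by simp
    have "\<tau> \<noteq> {}" using T[OF \<tau>] by auto
    then obtain x where x: "x \<in> \<tau>" "x \<in> X" using T[OF \<tau>] by blast
    have "real (n \<tau>) \<le> (\<Sum>\<tau>\<in>{\<tau>\<in>T. x \<in> \<tau>}. real (n \<tau>))" using \<tau> x finT by (intro member_le_sum) auto
    then have "h * M \<le> Ld n x" unfolding Ld_def nt using h by (intro mult_left_mono) auto
    moreover have "(1 + \<epsilon>) * p x \<le> (1 + \<epsilon>) * p1" using p01 x \<epsilon> by (intro mult_left_mono) auto
    ultimately have "\<epsilon> * p x \<le> t n x" using Mh by (simp add: t_def algebra_simps)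
    then have "1 \<le> v x" using p[OF x(2)] \<epsilon> by (simp add: v_def)
    also have "\<dots> \<le> (\<Sum>x\<in>\<tau>. v x)" using T[OF \<tau>] finX v0 x by (intro member_le_sum) (auto intro: finite_subset)
    finally show ?thesis using \<xi> by simp
  qed
  have upper: "(\<Sum>x\<in>\<tau>. v x) \<le> 1 + \<xi>" if \<tau>: "\<tau> \<in> T" "n \<tau> > 0" for \<tau>
  proof -
    have "(- h) * (1 - (\<Sum>x\<in>\<tau>. v x)) \<le> (- h)\<^sup>2 * \<xi> / h"
      using change[OF \<tau>(1), of "n \<tau> - 1" "- h"] \<tau>(2) nM[OF \<tau>(1)] by (simp add: of_nat_diff)
    then have "h * ((\<Sum>x\<in>\<tau>. v x) - 1) \<le> h * \<xi>" using h by (simp add: power2_eq_square algebra_simps)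
    then show ?thesis using h by simp
  qed
  have v1: "v x \<le> 1 + \<xi>" if x: "x \<in> X" for x
  proof (cases "\<exists>\<tau>\<in>T. x \<in> \<tau> \<and> n \<tau> > 0")
    case True
    then obtain \<tau> where \<tau>: "\<tau> \<in> T" "x \<in> \<tau>" "n \<tau> > 0" by blast
    have "v x \<le> (\<Sum>x\<in>\<tau>. v x)" using T[OF \<tau>(1)] finX v0 \<tau>(2) by (intro member_le_sum) (auto intro: finite_subset)
    then show ?thesis using upper[OF \<tau>(1,3)] by simp
  next
    case False
    then have "Ld n x = 0" by (auto simp: Ld_def intro!: sum.neutral)
    then show ?thesis using p[OF x] \<xi> by (simp add: v_def t_def)
  qed
  define \<rho> where "\<rho> \<tau> = h * real (n \<tau>)" for \<tau>
  have Lsum: "Ld n x = (\<Sum>\<tau>\<in>{\<tau>\<in>T. x \<in> \<tau>}. \<rho> \<tau>)" for x by (simp add: Ld_def \<rho>_def sum_distrib_left)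
  have loads: "Ld n x \<le> (1 + 2 * \<epsilon>) * p x" if x: "x \<in> X" for x
  proof -
    have "Ld n x - p x \<le> t n x" by (simp add: t_def)
    also have "t n x = \<epsilon> * p x * v x" using p[OF x] \<epsilon> by (simp add: v_def)
    also have "\<dots> \<le> \<epsilon> * p x * 2" using p[OF x] \<epsilon> v1[OF x] \<xi> by (intro mult_left_mono) auto
    finally show ?thesis by (simp add: algebra_simps)
  qed
  \<comment> \<open>Complementary slackness: a positive price means a load above capacity, and a
    triangle in use has total price at most 1 + \<xi>.\<close>
  have tot: "(\<Sum>x\<in>X. p x * v x) \<le> (1 + \<xi>) * (\<Sum>\<tau>\<in>T. \<rho> \<tau>)"
  proof -
    have "(\<Sum>x\<in>X. p x * v x) \<le> (\<Sum>x\<in>X. Ld n x * v x)"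
    proof (rule sum_mono)
      fix x assume x: "x \<in> X"
      show "p x * v x \<le> Ld n x * v x"
      proof (cases "v x = 0")
        case False
        then have "Ld n x > p x" by (auto simp: v_def t_def max_def split: if_splits)
        then show ?thesis using v0[OF x] by (intro mult_right_mono) auto
      qed simp
    qed
    also have "\<dots> = (\<Sum>x\<in>X. \<Sum>\<tau>\<in>T. if x \<in> \<tau> then \<rho> \<tau> * v x else 0)"
      using finT by (simp add: Lsum sum_distrib_right sum.If_cases Int_def)
    also have "\<dots> = (\<Sum>\<tau>\<in>T. \<Sum>x\<in>X. if x \<in> \<tau> then \<rho> \<tau> * v x else 0)" by (rule sum.swap)
    also have "\<dots> = (\<Sum>\<tau>\<in>T. \<rho> \<tau> * (\<Sum>x\<in>\<tau>. v x))"
    proof (rule sum.cong[OF refl])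
      fix \<tau> assume "\<tau> \<in> T"
      then have "X \<inter> {x. x \<in> \<tau>} = \<tau>" using T by auto
      then show "(\<Sum>x\<in>X. if x \<in> \<tau> then \<rho> \<tau> * v x else 0) = \<rho> \<tau> * (\<Sum>x\<in>\<tau>. v x)"
        using finX by (simp add: sum.If_cases sum_distrib_left)
    qed
    also have "\<dots> \<le> (\<Sum>\<tau>\<in>T. \<rho> \<tau> * (1 + \<xi>))"
    proof (rule sum_mono)
      fix \<tau> assume \<tau>: "\<tau> \<in> T"
      show "\<rho> \<tau> * (\<Sum>x\<in>\<tau>. v x) \<le> \<rho> \<tau> * (1 + \<xi>)"
      proof (cases "n \<tau> > 0")
        case True
        show ?thesis using upper[OF \<tau> True] h by (intro mult_left_mono) (auto simp: \<rho>_def)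
      qed (simp add: \<rho>_def)
    qed
    also have "\<dots> = (1 + \<xi>) * (\<Sum>\<tau>\<in>T. \<rho> \<tau>)" by (simp add: sum_distrib_left mult.commute)
    finally show ?thesis .
  qed
  define w where "w x = (if x \<in> X then min 1 (v x / (1 - \<xi>)) else 0)" for x
  have w01: "0 \<le> w x \<and> w x \<le> 1" for x using v0[of x] \<xi> by (auto simp: w_def)
  have cover: "1 \<le> (\<Sum>x\<in>\<tau>. w x)" if \<tau>: "\<tau> \<in> T" for \<tau>
  proof (cases "\<exists>x\<in>\<tau>. w x = 1")
    case True
    then obtain x where x: "x \<in> \<tau>" "w x = 1" by blast
    have "w x \<le> (\<Sum>x\<in>\<tau>. w x)" using T[OF \<tau>] finX w01 x(1) by (intro member_le_sum) (auto intro: finite_subset)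
    then show ?thesis using x by simp
  next
    case False
    then have "w x = v x / (1 - \<xi>)" if "x \<in> \<tau>" for x using that T[OF \<tau>] by (auto simp: w_def min_def split: if_splits)
    then have "(\<Sum>x\<in>\<tau>. w x) = (\<Sum>x\<in>\<tau>. v x) / (1 - \<xi>)" by (simp add: sum_divide_distrib)
    then show ?thesis using lower[OF \<tau>] \<xi> by (simp add: le_divide_eq)
  qed
  have "(\<Sum>x\<in>X. p x * w x) \<le> (\<Sum>x\<in>X. p x * (v x / (1 - \<xi>)))"
    using p by (intro sum_mono mult_left_mono) (auto simp: w_def intro: less_imp_le)
  also have "\<dots> = (\<Sum>x\<in>X. p x * v x) / (1 - \<xi>)" by (simp add: sum_divide_distrib)
  also have "\<dots> \<le> (1 + \<xi>) * (\<Sum>\<tau>\<in>T. \<rho> \<tau>) / (1 - \<xi>)" using tot \<xi> by (intro divide_right_mono) auto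
  also have "\<dots> = (1 + \<xi>) / (1 - \<xi>) * (\<Sum>\<tau>\<in>T. \<rho> \<tau>)" by simp
  also have "\<dots> \<le> (1 + \<epsilon>) * (\<Sum>\<tau>\<in>T. \<rho> \<tau>)"
  proof (rule mult_right_mono)
    have "\<epsilon> * \<epsilon> \<le> 1 * \<epsilon>" using \<epsilon> by (intro mult_right_mono) auto
    moreover have e: "(1 + \<epsilon>) * (1 - \<xi>) = 1 + 2/3 * \<epsilon> - \<epsilon> * \<epsilon> / 3" by (simp add: \<xi>_def field_simps)
    ultimately have "1 + \<xi> \<le> (1 + \<epsilon>) * (1 - \<xi>)" unfolding e \<xi>_def using \<epsilon> by linarith
    then show "(1 + \<xi>) / (1 - \<xi>) \<le> 1 + \<epsilon>" using \<xi> by (simp add: divide_le_eq)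
    show "0 \<le> (\<Sum>\<tau>\<in>T. \<rho> \<tau>)" using h by (simp add: \<rho>_def sum_nonneg)
  qed
  finally have "(\<Sum>x\<in>X. p x * w x) \<le> (1 + \<epsilon>) * (\<Sum>\<tau>\<in>T. \<rho> \<tau>)" .
  then show ?thesis using w01 cover loads[unfolded Lsum] h
    by (intro exI[of _ \<rho>] exI[of _ w] conjI) (auto simp: \<rho>_def)
qed

section \<open>Random samples\<close>

text \<open>On [0,1] the exponential is at most 1 + x + x^2, and squares of \<open>W\<close> are at
  most \<open>W\<close>, which makes the bound linear in \<open>W\<close>.\<close>

lemma exp_sum_bound:
  fixes W :: "'v \<Rightarrow> real" and \<theta> s :: real
  assumes V: "finite V" and W: "\<And>v. v \<in> V \<Longrightarrow> 0 \<le> W v \<and> W v \<le> 1" and avg: "(\<Sum>v\<in>V. W v) \<le> \<theta> * card V"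
    and s: "0 \<le> s" "s \<le> 1"
  shows "(\<Sum>v\<in>V. exp (s * W v)) \<le> card V * exp (\<theta> * (s + s\<^sup>2))"
proof -
  have "exp (s * W v) \<le> 1 + W v * (s + s\<^sup>2)" if v: "v \<in> V" for v
  proof -
    have "s * W v \<le> 1 * 1" using s W[OF v] by (intro mult_mono) auto
    then have "exp (s * W v) \<le> 1 + s * W v + (s * W v)\<^sup>2" using s W[OF v] by (intro exp_bound) auto
    moreover have "W v * W v \<le> W v * 1" using W[OF v] by (intro mult_left_mono) auto
    then have "s\<^sup>2 * (W v * W v) \<le> s\<^sup>2 * W v" by (intro mult_left_mono) auto
    ultimately show ?thesis by (simp add: power2_eq_square algebra_simps)
  qed
  then have "(\<Sum>v\<in>V. exp (s * W v)) \<le> (\<Sum>v\<in>V. 1 + W v * (s + s\<^sup>2))" by (rule sum_mono)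
  also have "\<dots> = card V + (\<Sum>v\<in>V. W v) * (s + s\<^sup>2)" by (simp add: sum.distrib sum_distrib_right)
  also have "\<dots> \<le> card V + \<theta> * card V * (s + s\<^sup>2)" using avg s by (intro add_left_mono mult_right_mono) auto
  also have "\<dots> = card V * (1 + \<theta> * (s + s\<^sup>2))" by (simp add: algebra_simps)
  also have "\<dots> \<le> card V * exp (\<theta> * (s + s\<^sup>2))" by (intro mult_left_mono exp_ge_add_one_self) auto
  finally show ?thesis .
qed

text \<open>The label depends on the coordinates in \<open>D\<close> alone. Once these are fixed the
  other coordinates are independent; summing over all ways h to fix them turns the integrand into
  products over coordinates.\<close>

lemma exponential_moment:
  fixes W :: "'l \<Rightarrow> 'v \<Rightarrow> real" and lab :: "(nat \<Rightarrow> 'v) \<Rightarrow> 'l" and \<theta> s :: real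
  assumes V: "finite V" and D: "D \<subseteq> {..<K}" and W: "\<And>l v. v \<in> V \<Longrightarrow> 0 \<le> W l v \<and> W l v \<le> 1"
    and lab: "\<And>f. f \<in> {..<K} \<rightarrow>\<^sub>E V \<Longrightarrow> lab f = lab (restrict f D)"
    and avg: "\<And>h. h \<in> D \<rightarrow>\<^sub>E V \<Longrightarrow> (\<Sum>v\<in>V. W (lab h) v) \<le> \<theta> * card V" and \<theta>: "0 \<le> \<theta>"
    and s: "0 \<le> s" "s \<le> 1"
  shows "(\<Sum>f\<in>{..<K} \<rightarrow>\<^sub>E V. \<Prod>k\<in>{..<K} - D. exp (s * W (lab f) (f k))) \<le> real (card V) ^ K * exp (K * (\<theta> * (s + s\<^sup>2)))"
proof -
  \<comment> \<open>On \<open>D\<close> the factor is the indicator of agreement with h, so the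
    product vanishes unless h is the restriction of the sample.\<close>
  define g where "g h k y = (if k \<in> D then of_bool (y = h k) else exp (s * W (lab h) y))" for h k y
  have g0: "0 \<le> g h k y" for h k y by (simp add: g_def)
  have finD: "finite D" using D finite_subset by blast
  have finP: "finite ({..<K} \<rightarrow>\<^sub>E V)" "finite (D \<rightarrow>\<^sub>E V)" using V finD by (auto intro: finite_PiE)
  have "(\<Prod>k\<in>{..<K} - D. exp (s * W (lab f) (f k))) \<le> (\<Sum>h\<in>D \<rightarrow>\<^sub>E V. \<Prod>k\<in>{..<K}. g h k (f k))"
    if f: "f \<in> {..<K} \<rightarrow>\<^sub>E V" for f
  proof -
    let ?h = "restrict f D"
    have h: "?h \<in> D \<rightarrow>\<^sub>E V" using f D by (auto simp: PiE_iff)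
    have "(\<Prod>k\<in>{..<K}. g ?h k (f k)) = (\<Prod>k\<in>{..<K} - D. g ?h k (f k)) * (\<Prod>k\<in>D. g ?h k (f k))"
      using prod.subset_diff[OF D, of "\<lambda>k. g ?h k (f k)"] by simp
    also have "(\<Prod>k\<in>D. g ?h k (f k)) = 1" by (intro prod.neutral) (auto simp: g_def)
    also have "(\<Prod>k\<in>{..<K} - D. g ?h k (f k)) = (\<Prod>k\<in>{..<K} - D. exp (s * W (lab f) (f k)))"
      using lab[OF f] by (intro prod.cong) (auto simp: g_def)
    finally have "(\<Prod>k\<in>{..<K} - D. exp (s * W (lab f) (f k))) = (\<Prod>k\<in>{..<K}. g ?h k (f k))"
      by (simp only: mult_1_right)
    also have "\<dots> \<le> (\<Sum>h\<in>D \<rightarrow>\<^sub>E V. \<Prod>k\<in>{..<K}. g h k (f k))"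
      using h finP g0 by (intro member_le_sum[where f = "\<lambda>h. \<Prod>k\<in>{..<K}. g h k (f k)"]) (auto intro: prod_nonneg)
    finally show ?thesis .
  qed
  then have "(\<Sum>f\<in>{..<K} \<rightarrow>\<^sub>E V. \<Prod>k\<in>{..<K} - D. exp (s * W (lab f) (f k)))
     \<le> (\<Sum>f\<in>{..<K} \<rightarrow>\<^sub>E V. \<Sum>h\<in>D \<rightarrow>\<^sub>E V. \<Prod>k\<in>{..<K}. g h k (f k))" by (rule sum_mono)
  also have "\<dots> = (\<Sum>h\<in>D \<rightarrow>\<^sub>E V. \<Sum>f\<in>{..<K} \<rightarrow>\<^sub>E V. \<Prod>k\<in>{..<K}. g h k (f k))" by (rule sum.swap)
  also have "\<dots> = (\<Sum>h\<in>D \<rightarrow>\<^sub>E V. \<Prod>k\<in>{..<K}. \<Sum>y\<in>V. g h k y)"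
    using V by (intro sum.cong refl prod_sum_PiE[symmetric]) auto
  also have "\<dots> \<le> (\<Sum>h\<in>D \<rightarrow>\<^sub>E V. (card V * exp (\<theta> * (s + s\<^sup>2))) ^ (K - card D))"
  proof (rule sum_mono)
    fix h assume h: "h \<in> D \<rightarrow>\<^sub>E V"
    have "(\<Prod>k\<in>{..<K}. \<Sum>y\<in>V. g h k y) = (\<Prod>k\<in>{..<K} - D. \<Sum>y\<in>V. g h k y) * (\<Prod>k\<in>D. \<Sum>y\<in>V. g h k y)"
      using prod.subset_diff[OF D, of "\<lambda>k. \<Sum>y\<in>V. g h k y"] by simp
    also have "(\<Prod>k\<in>D. \<Sum>y\<in>V. g h k y) = 1"
    proof (rule prod.neutral, rule ballI)
      fix k assume k: "k \<in> D"
      then have "h k \<in> V" using h by auto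
      then show "(\<Sum>y\<in>V. g h k y) = 1" using k V by (simp add: g_def of_bool_def sum.delta)
    qed
    also have "(\<Prod>k\<in>{..<K} - D. \<Sum>y\<in>V. g h k y) = (\<Prod>k\<in>{..<K} - D. \<Sum>y\<in>V. exp (s * W (lab h) y))"
      by (intro prod.cong) (auto simp: g_def)
    also have "\<dots> = (\<Sum>y\<in>V. exp (s * W (lab h) y)) ^ (K - card D)"
      using D finD by (simp add: card_Diff_subset)
    also have "\<dots> \<le> (card V * exp (\<theta> * (s + s\<^sup>2))) ^ (K - card D)"
      using exp_sum_bound[OF V W avg[OF h] s] by (intro power_mono) (auto intro: sum_nonneg)
    finally show "(\<Prod>k\<in>{..<K}. \<Sum>y\<in>V. g h k y) \<le> (card V * exp (\<theta> * (s + s\<^sup>2))) ^ (K - card D)" by simp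
  qed
  also have "\<dots> = real (card V) ^ card D * (card V * exp (\<theta> * (s + s\<^sup>2))) ^ (K - card D)"
    using finD by (simp add: card_PiE)
  also have "\<dots> = real (card V) ^ (card D + (K - card D)) * exp (\<theta> * (s + s\<^sup>2)) ^ (K - card D)"
    by (simp add: power_mult_distrib power_add)
  also have "card D + (K - card D) = K" using card_mono[OF _ D] by simp
  also have "real (card V) ^ K * exp (\<theta> * (s + s\<^sup>2)) ^ (K - card D) \<le> real (card V) ^ K * exp (\<theta> * (s + s\<^sup>2)) ^ K"
    using \<theta> s by (intro mult_left_mono power_increasing) (auto simp: one_le_exp_iff)
  finally show ?thesis by (simp add: exp_of_nat_mult)
qed

text \<open>Markov's inequality for the exponential moment, followed by a union bound over the pairs
  a, b whose class may be the expensive one. The at most two coordinates defining the class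
  contribute at most 2 to the sum; this costs the factor exp (8 \<tau>).\<close>

lemma sampling:
  fixes W :: "'l \<Rightarrow> 'v \<Rightarrow> real" and L :: "'v \<Rightarrow> 'v \<Rightarrow> 'l" and \<tau> :: real
  assumes V: "finite V" and W: "\<And>l v. v \<in> V \<Longrightarrow> 0 \<le> W l v \<and> W l v \<le> 1"
    and avg: "\<And>u v. u \<in> V \<Longrightarrow> v \<in> V \<Longrightarrow> (\<Sum>x\<in>V. W (L u v) x) \<le> (1/9 - \<tau>) * card V"
    and \<tau>: "0 < \<tau>" "\<tau> \<le> 1/9"
    and Good: "Good \<subseteq> {..<K} \<rightarrow>\<^sub>E V"
    and core: "\<And>f. f \<in> Good \<Longrightarrow> \<exists>a<K. \<exists>b<K. K / 9 \<le> (\<Sum>k<K. W (L (f a) (f b)) (f k))"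
  shows "card Good \<le> K\<^sup>2 * exp (8 * \<tau> - 2 * \<tau>\<^sup>2 * K) * card V ^ K"
proof -
  let ?P = "{..<K} \<rightarrow>\<^sub>E V"
  \<comment> \<open>With this s the exponent per sampled vertex is -(20/9) \<tau>^2 - 16 \<tau>^3,
    which is at most -2 \<tau>^2.\<close>
  define s where "s = 4 * \<tau>"
  have s: "0 \<le> s" "s \<le> 1" using \<tau> by (auto simp: s_def)
  have finP: "finite ?P" using V by (auto intro: finite_PiE)
  define Ev where "Ev a b = {f\<in>?P. K / 9 \<le> (\<Sum>k<K. W (L (f a) (f b)) (f k))}" for a b
  have ev: "card (Ev a b) \<le> exp (8 * \<tau> - 2 * \<tau>\<^sup>2 * K) * card V ^ K" if ab: "a < K" "b < K" for a b
  proof -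
    define D where "D = {a,b}"
    define lab where "lab f = L (f a) (f b)" for f
    have D: "D \<subseteq> {..<K}" "finite D" "card D \<le> 2" using ab by (auto simp: D_def card_insert_if)
    have "exp (s * (K / 9) - 2 * s) * of_bool (f \<in> Ev a b) \<le> (\<Prod>k\<in>{..<K} - D. exp (s * W (lab f) (f k)))" if f: "f \<in> ?P" for f
    proof (cases "f \<in> Ev a b")
      case True
      have fV: "f k \<in> V" if "k < K" for k using f that by auto
      have "(\<Sum>k\<in>D. W (lab f) (f k)) \<le> real (card D) * 1" using W fV D by (intro sum_bounded_above) auto
      then have "(\<Sum>k\<in>D. W (lab f) (f k)) \<le> 2" using D(3) by simp
      moreover have "(\<Sum>k<K. W (lab f) (f k)) = (\<Sum>k\<in>{..<K} - D. W (lab f) (f k)) + (\<Sum>k\<in>D. W (lab f) (f k))"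
        using sum.subset_diff[OF D(1), of "\<lambda>k. W (lab f) (f k)"] by simp
      moreover have "K / 9 \<le> (\<Sum>k<K. W (lab f) (f k))" using True by (simp add: Ev_def lab_def)
      ultimately have "K / 9 - 2 \<le> (\<Sum>k\<in>{..<K} - D. W (lab f) (f k))" by linarith
      then have "s * (K / 9 - 2) \<le> s * (\<Sum>k\<in>{..<K} - D. W (lab f) (f k))" using s by (intro mult_left_mono)
      then have "exp (s * (K / 9) - 2 * s) \<le> exp (\<Sum>k\<in>{..<K} - D. s * W (lab f) (f k))"
        by (simp add: sum_distrib_left algebra_simps)
      then show ?thesis using True by (simp add: exp_sum)
    qed (auto intro: prod_nonneg)
    then have "(\<Sum>f\<in>?P. exp (s * (K / 9) - 2 * s) * of_bool (f \<in> Ev a b)) \<le> (\<Sum>f\<in>?P. \<Prod>k\<in>{..<K} - D. exp (s * W (lab f) (f k)))"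
      by (rule sum_mono)
    also have "\<dots> \<le> real (card V) ^ K * exp (K * ((1/9 - \<tau>) * (s + s\<^sup>2)))"
    proof (rule exponential_moment[where D = D and lab = lab and W = W and \<theta> = "1/9 - \<tau>" and s = s, OF V D(1)])
      show "lab f = lab (restrict f D)" for f by (simp add: lab_def D_def)
      show "(\<Sum>v\<in>V. W (lab h) v) \<le> (1/9 - \<tau>) * card V" if "h \<in> D \<rightarrow>\<^sub>E V" for h
        using that avg by (auto simp: lab_def D_def PiE_iff)
    qed (use \<tau> s W in auto)
    also have "(\<Sum>f\<in>?P. exp (s * (K / 9) - 2 * s) * of_bool (f \<in> Ev a b)) = exp (s * (K / 9) - 2 * s) * card (Ev a b)"
    proof -
      have "?P \<inter> {f. f \<in> Ev a b} = Ev a b" by (auto simp: Ev_def)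
      then show ?thesis using finP by (simp add: sum_distrib_left[symmetric] of_bool_def sum.If_cases)
    qed
    finally have "card (Ev a b) \<le> real (card V) ^ K * exp (K * ((1/9 - \<tau>) * (s + s\<^sup>2))) / exp (s * (K / 9) - 2 * s)"
      by (simp add: field_simps)
    also have "\<dots> = real (card V) ^ K * exp (K * ((1/9 - \<tau>) * (s + s\<^sup>2)) - (s * (K / 9) - 2 * s))" by (simp add: exp_diff)
    also have "\<dots> \<le> real (card V) ^ K * exp (8 * \<tau> - 2 * \<tau>\<^sup>2 * K)"
    proof (intro mult_left_mono)
      have "(1/9 - \<tau>) * (s + s\<^sup>2) - s / 9 = - (20/9) * \<tau>\<^sup>2 - 16 * \<tau>\<^sup>2 * \<tau>" by (simp add: s_def power2_eq_square algebra_simps)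
      moreover have "0 \<le> \<tau>\<^sup>2 * \<tau>" using \<tau> by simp
      ultimately have "(1/9 - \<tau>) * (s + s\<^sup>2) - s / 9 \<le> - 2 * \<tau>\<^sup>2" using zero_le_power2[of \<tau>] by linarith
      then have "K * ((1/9 - \<tau>) * (s + s\<^sup>2) - s / 9) \<le> K * (- 2 * \<tau>\<^sup>2)" by (intro mult_left_mono) auto
      then show "exp (K * ((1/9 - \<tau>) * (s + s\<^sup>2)) - (s * (K / 9) - 2 * s)) \<le> exp (8 * \<tau> - 2 * \<tau>\<^sup>2 * K)"
        by (simp add: s_def algebra_simps)
    qed auto
    finally show ?thesis by (simp add: mult.commute)
  qed
  have "Good \<subseteq> (\<Union>ab\<in>{..<K}\<times>{..<K}. Ev (fst ab) (snd ab))" using core Good by (fastforce simp: Ev_def)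
  moreover have "finite (\<Union>ab\<in>{..<K}\<times>{..<K}. Ev (fst ab) (snd ab))" using finP by (auto simp: Ev_def)
  ultimately have "card Good \<le> card (\<Union>ab\<in>{..<K}\<times>{..<K}. Ev (fst ab) (snd ab))" by (rule card_mono[rotated])
  also have "\<dots> \<le> (\<Sum>ab\<in>{..<K}\<times>{..<K}. card (Ev (fst ab) (snd ab)))" by (rule card_UN_le) auto
  finally have "real (card Good) \<le> (\<Sum>ab\<in>{..<K}\<times>{..<K}. real (card (Ev (fst ab) (snd ab))))" by (simp flip: of_nat_sum)
  also have "\<dots> \<le> real (card ({..<K}\<times>{..<K})) * (exp (8 * \<tau> - 2 * \<tau>\<^sup>2 * K) * card V ^ K)"
    using ev by (intro sum_bounded_above) auto
  finally show ?thesis by (simp add: card_cartesian_product power2_eq_square mult_ac)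
qed

text \<open>The cube of x <= exp x at x = c K / 3 gives cubic growth against the factor quadratic in
  K.\<close>

lemma sample_size:
  fixes \<tau> :: real
  assumes "0 < \<tau>" shows "\<exists>K::nat>0. K\<^sup>2 * exp (8 * \<tau> - 2 * \<tau>\<^sup>2 * K) < 1/2"
proof -
  define c where "c = 2 * \<tau>\<^sup>2"
  have c: "0 < c" using assms by (simp add: c_def)
  define M where "M = 54 * exp (8 * \<tau>) / c ^ 3"
  have M: "0 < M" using c by (simp add: M_def)
  obtain K :: nat where K: "M < K" using reals_Archimedean2 by blast
  then have K0: "0 < real K" using M by linarith
  have "c * K / 3 \<le> exp (c * K / 3)" using exp_ge_add_one_self[of "c * K / 3"] by linarith
  then have "(c * K / 3) ^ 3 \<le> exp (c * K / 3) ^ 3" using c by (intro power_mono) auto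
  also have "\<dots> = exp (c * K)" by (simp flip: exp_of_nat_mult)
  finally have e: "c ^ 3 * K ^ 3 / 27 \<le> exp (c * K)" by (simp add: power_mult_distrib power_divide)
  have "54 * exp (8 * \<tau>) < c ^ 3 * K" using K c by (simp add: M_def divide_less_eq mult.commute)
  then have "54 * exp (8 * \<tau>) * (real K)\<^sup>2 < c ^ 3 * K * (real K)\<^sup>2" using K0 by (intro mult_strict_right_mono) auto
  also have "c ^ 3 * K * (real K)\<^sup>2 = 27 * (c ^ 3 * K ^ 3 / 27)" by (simp add: power2_eq_square power3_eq_cube)
  also have "\<dots> \<le> 27 * exp (c * K)" using e by (intro mult_left_mono) auto
  finally have "(real K)\<^sup>2 * exp (8 * \<tau>) / exp (c * K) < 1/2" by (simp add: divide_less_eq)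
  then have "K\<^sup>2 * exp (8 * \<tau> - 2 * \<tau>\<^sup>2 * K) < 1/2" by (simp add: exp_diff c_def)
  then show ?thesis using K0 by (intro exI[of _ K]) auto
qed

section \<open>Assigning intervals to triangles\<close>

lemma weighted_exists_le:
  fixes q f :: "'a \<Rightarrow> real"
  assumes "finite T" "\<And>\<tau>. \<tau> \<in> T \<Longrightarrow> 0 \<le> q \<tau>" "sum q T = 1" "(\<Sum>\<tau>\<in>T. q \<tau> * f \<tau>) \<le> c"
  shows "\<exists>\<tau>\<in>T. f \<tau> \<le> c"
proof (rule ccontr)
  assume "\<not> ?thesis"
  then have gt: "c < f \<tau>" if "\<tau> \<in> T" for \<tau> using that by auto
  have "\<exists>\<tau>\<in>T. q \<tau> \<noteq> 0" using assms(3) by (metis sum.neutral zero_neq_one)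
  then obtain \<tau> where \<tau>: "\<tau> \<in> T" "0 < q \<tau>" using assms(2) by force
  have "c = (\<Sum>\<tau>\<in>T. q \<tau> * c)" using assms(3) by (simp add: sum_distrib_right[symmetric])
  also have "\<dots> < (\<Sum>\<tau>\<in>T. q \<tau> * f \<tau>)"
  proof (rule sum_strict_mono_ex1[OF assms(1)])
    show "\<forall>x\<in>T. q x * c \<le> q x * f x" using assms(2) gt by (intro ballI mult_left_mono) (auto intro: less_imp_le)
    show "\<exists>x\<in>T. q x * c < q x * f x" using \<tau> gt by (intro bexI[of _ \<tau>]) auto
  qed
  finally show False using assms(4) by simp
qed

text \<open>Derandomization: if every interval is sent to \<open>\<tau>\<close> with probability \<open>q \<tau>\<close>, the expected sum of the
  squared deviations grows by at most the sum of the squared counts.\<close>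

lemma balanced_choice:
  fixes q :: "'a \<Rightarrow> real" and cnt :: "nat \<Rightarrow> nat \<Rightarrow> real"
  assumes T: "finite T" "\<And>\<tau>. \<tau> \<in> T \<Longrightarrow> 0 \<le> q \<tau>" "sum q T = 1"
  shows "\<exists>k :: nat \<Rightarrow> 'a. (\<forall>h. k h \<in> T) \<and>
    (\<Sum>\<tau>\<in>T. \<Sum>c<3. (\<Sum>h<N. cnt h c * (of_bool (k h = \<tau>) - q \<tau>))\<^sup>2) \<le> (\<Sum>h<N. \<Sum>c<3. (cnt h c)\<^sup>2)"
proof (induction N)
  case 0
  have "T \<noteq> {}" using T(3) by auto
  then obtain \<tau> where "\<tau> \<in> T" by blast
  then show ?case by (intro exI[of _ "\<lambda>_. \<tau>"]) simp
next
  case (Suc N)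
  then obtain k where k: "\<And>h. k h \<in> T" and
    le: "(\<Sum>\<tau>\<in>T. \<Sum>c<3. (\<Sum>h<N. cnt h c * (of_bool (k h = \<tau>) - q \<tau>))\<^sup>2) \<le> (\<Sum>h<N. \<Sum>c<3. (cnt h c)\<^sup>2)" by blast
  define d where "d \<tau> c = (\<Sum>h<N. cnt h c * (of_bool (k h = \<tau>) - q \<tau>))" for \<tau> c
  define f where "f \<sigma> = (\<Sum>\<tau>\<in>T. \<Sum>c<3. (d \<tau> c + cnt N c * (of_bool (\<sigma> = \<tau>) - q \<tau>))\<^sup>2)" for \<sigma>
  have q1: "q \<tau> \<le> 1" if "\<tau> \<in> T" for \<tau> using member_le_sum[of \<tau> T q] T that by auto
  have trm: "(\<Sum>\<sigma>\<in>T. q \<sigma> * (d \<tau> c + cnt N c * (of_bool (\<sigma> = \<tau>) - q \<tau>))\<^sup>2) \<le> (d \<tau> c)\<^sup>2 + q \<tau> * (cnt N c)\<^sup>2" if \<tau>: "\<tau> \<in> T" for \<tau> c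
  proof -
    have m1: "(\<Sum>\<sigma>\<in>T. q \<sigma> * (of_bool (\<sigma> = \<tau>) - q \<tau>)) = 0"
    proof -
      have "(\<Sum>\<sigma>\<in>T. q \<sigma> * of_bool (\<sigma> = \<tau>)) = q \<tau>" using T(1) \<tau> by (simp add: of_bool_def if_distrib sum.delta cong: if_cong)
      then show ?thesis using T(3) by (simp add: right_diff_distrib sum_subtractf sum_distrib_right[symmetric])
    qed
    have m2: "(\<Sum>\<sigma>\<in>T. q \<sigma> * (of_bool (\<sigma> = \<tau>) - q \<tau>)\<^sup>2) \<le> q \<tau>"
    proof -
      have "(\<Sum>\<sigma>\<in>T. q \<sigma> * (of_bool (\<sigma> = \<tau>) - q \<tau>)\<^sup>2) = (\<Sum>\<sigma>\<in>T. q \<sigma> * (of_bool (\<sigma> = \<tau>) - q \<tau>) * of_bool (\<sigma> = \<tau>)) - q \<tau> * (\<Sum>\<sigma>\<in>T. q \<sigma> * (of_bool (\<sigma> = \<tau>) - q \<tau>))"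
        by (simp add: sum_distrib_left sum_subtractf[symmetric] power2_eq_square algebra_simps)
      also have "\<dots> = (\<Sum>\<sigma>\<in>T. q \<sigma> * (of_bool (\<sigma> = \<tau>) - q \<tau>) * of_bool (\<sigma> = \<tau>))" by (simp add: m1)
      also have "\<dots> = q \<tau> * (1 - q \<tau>)" using T(1) \<tau> by (simp add: of_bool_def if_distrib sum.delta cong: if_cong)
      also have "\<dots> \<le> q \<tau> * 1" using T(2)[OF \<tau>] by (intro mult_left_mono) auto
      finally show ?thesis by simp
    qed
    have "(\<Sum>\<sigma>\<in>T. q \<sigma> * (d \<tau> c + cnt N c * (of_bool (\<sigma> = \<tau>) - q \<tau>))\<^sup>2) =
      (\<Sum>\<sigma>\<in>T. q \<sigma> * (d \<tau> c)\<^sup>2 + 2 * d \<tau> c * cnt N c * (q \<sigma> * (of_bool (\<sigma> = \<tau>) - q \<tau>)) + (cnt N c)\<^sup>2 * (q \<sigma> * (of_bool (\<sigma> = \<tau>) - q \<tau>)\<^sup>2))"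
      by (intro sum.cong refl) (simp add: power2_eq_square algebra_simps)
    also have "\<dots> = (d \<tau> c)\<^sup>2 + 2 * d \<tau> c * cnt N c * (\<Sum>\<sigma>\<in>T. q \<sigma> * (of_bool (\<sigma> = \<tau>) - q \<tau>)) + (cnt N c)\<^sup>2 * (\<Sum>\<sigma>\<in>T. q \<sigma> * (of_bool (\<sigma> = \<tau>) - q \<tau>)\<^sup>2)"
      by (simp add: sum.distrib sum_distrib_left[symmetric] sum_distrib_right[symmetric] T(3))
    also have "\<dots> \<le> (d \<tau> c)\<^sup>2 + (cnt N c)\<^sup>2 * q \<tau>" unfolding m1 using m2 by (simp add: mult_left_mono)
    finally show ?thesis by (simp add: mult.commute)
  qed
  have "(\<Sum>\<sigma>\<in>T. q \<sigma> * f \<sigma>) = (\<Sum>\<tau>\<in>T. \<Sum>c<3. \<Sum>\<sigma>\<in>T. q \<sigma> * (d \<tau> c + cnt N c * (of_bool (\<sigma> = \<tau>) - q \<tau>))\<^sup>2)"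
  proof -
    have "(\<Sum>\<sigma>\<in>T. q \<sigma> * f \<sigma>) = (\<Sum>\<sigma>\<in>T. \<Sum>\<tau>\<in>T. \<Sum>c<3. q \<sigma> * (d \<tau> c + cnt N c * (of_bool (\<sigma> = \<tau>) - q \<tau>))\<^sup>2)"
      by (simp add: f_def sum_distrib_left)
    also have "\<dots> = (\<Sum>\<tau>\<in>T. \<Sum>\<sigma>\<in>T. \<Sum>c<3. q \<sigma> * (d \<tau> c + cnt N c * (of_bool (\<sigma> = \<tau>) - q \<tau>))\<^sup>2)" by (rule sum.swap)
    also have "\<dots> = (\<Sum>\<tau>\<in>T. \<Sum>c<3. \<Sum>\<sigma>\<in>T. q \<sigma> * (d \<tau> c + cnt N c * (of_bool (\<sigma> = \<tau>) - q \<tau>))\<^sup>2)"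
      by (intro sum.cong refl sum.swap)
    finally show ?thesis .
  qed
  also have "\<dots> \<le> (\<Sum>\<tau>\<in>T. \<Sum>c<3. (d \<tau> c)\<^sup>2 + q \<tau> * (cnt N c)\<^sup>2)" using trm by (intro sum_mono) auto
  also have "\<dots> = (\<Sum>\<tau>\<in>T. \<Sum>c<3. (d \<tau> c)\<^sup>2) + (\<Sum>c<3. (cnt N c)\<^sup>2)"
    by (simp only: sum.distrib sum_distrib_left[symmetric] sum_distrib_right[symmetric] T(3) mult_1_left)
  also have "\<dots> \<le> (\<Sum>h<Suc N. \<Sum>c<3. (cnt h c)\<^sup>2)" using le by (simp add: d_def)
  finally obtain \<sigma> where \<sigma>: "\<sigma> \<in> T" "f \<sigma> \<le> (\<Sum>h<Suc N. \<Sum>c<3. (cnt h c)\<^sup>2)"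
    using weighted_exists_le[OF T] by blast
  define k' where "k' = k(N := \<sigma>)"
  have "(\<Sum>h<Suc N. cnt h c * (of_bool (k' h = \<tau>) - q \<tau>)) = d \<tau> c + cnt N c * (of_bool (\<sigma> = \<tau>) - q \<tau>)" for \<tau> c
  proof -
    have "(\<Sum>h<N. cnt h c * (of_bool (k' h = \<tau>) - q \<tau>)) = d \<tau> c" unfolding d_def k'_def by (intro sum.cong) auto
    then show ?thesis by (simp add: k'_def)
  qed
  then have "(\<Sum>\<tau>\<in>T. \<Sum>c<3. (\<Sum>h<Suc N. cnt h c * (of_bool (k' h = \<tau>) - q \<tau>))\<^sup>2) = f \<sigma>" by (simp only: f_def)
  moreover have "k' h \<in> T" for h using k \<sigma> by (simp add: k'_def)
  ultimately show ?case using \<sigma>(2) by (intro exI[of _ k']) auto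
qed

text \<open>An interval consists of G blocks. The first D are reserved for walking from the previous
  target, and the target is held afterwards; reflexivity lets a shorter walk wait.\<close>

lemma walk_sequence:
  fixes st :: "('o \<times> 'o) set" and target :: "nat \<Rightarrow> 'o"
  assumes refl: "\<And>h. (target h, target h) \<in> st"
    and conn: "\<And>h. \<exists>n\<le>D. (target h, target (Suc h)) \<in> st ^^ n" and G: "D < G"
  shows "\<exists>\<sigma>. (\<forall>g. (\<sigma> g, \<sigma> (Suc g)) \<in> st) \<and> (\<forall>g. D \<le> g mod G \<longrightarrow> \<sigma> g = target (g div G))"
proof -
  \<comment> \<open>For h = 0 truncated subtraction makes the previous target equal to the present
    one, so the first walk is trivial.\<close>
  define prev where "prev h = target (h - 1)" for h
  have "\<exists>W. W 0 = prev h \<and> (\<forall>i\<ge>D. W i = target h) \<and> (\<forall>i. (W i, W (Suc i)) \<in> st)" for h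
  proof -
    have "\<exists>n\<le>D. (prev h, target h) \<in> st ^^ n"
    proof (cases h)
      case 0
      then show ?thesis by (intro exI[of _ 0]) (simp add: prev_def)
    next
      case (Suc h')
      then show ?thesis using conn[of h'] by (simp add: prev_def)
    qed
    then obtain n f where n: "n \<le> D" "f 0 = prev h" "f n = target h" "\<And>i. i < n \<Longrightarrow> (f i, f (Suc i)) \<in> st"
      by (metis relpow_fun_conv)
    have "(f (min i n), f (min (Suc i) n)) \<in> st" for i
      using n refl[of h] by (cases "i < n") (auto simp: min_def)
    then show ?thesis using n by (intro exI[of _ "\<lambda>i. f (min i n)"]) auto
  qed
  then obtain W where W: "\<And>h. W h 0 = prev h" "\<And>h i. D \<le> i \<Longrightarrow> W h i = target h" "\<And>h i. (W h i, W h (Suc i)) \<in> st"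
    by metis
  define \<sigma> where "\<sigma> g = W (g div G) (g mod G)" for g
  have "(\<sigma> g, \<sigma> (Suc g)) \<in> st" for g
  proof (cases "Suc (g mod G) = G")
    case True
    then have "Suc g mod G = 0" "Suc g div G = Suc (g div G)" by (auto simp: mod_Suc div_Suc)
    then show ?thesis using W(2)[of "g mod G" "g div G"] W(1)[of "Suc (g div G)"] True G refl
      by (simp add: \<sigma>_def prev_def)
  next
    case False
    then have "Suc g mod G = Suc (g mod G)" "Suc g div G = g div G" by (auto simp: mod_Suc div_Suc)
    then show ?thesis using W(3) by (simp add: \<sigma>_def)
  qed
  moreover have "\<sigma> g = target (g div G)" if "D \<le> g mod G" for g using W(2)[OF that] by (simp add: \<sigma>_def)
  ultimately show ?thesis by blast
qed

lemma card_transit: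
  assumes "0 < b" "0 < G"
  shows "card {x. x < m \<and> (x div b) mod G < D} \<le> (m div (b * G) + 1) * (D * b)"
proof -
  let ?q = "m div (b * G) + 1"
  have "{x. x < m \<and> (x div b) mod G < D} \<subseteq> (\<lambda>(h,i). h * (b * G) + i) ` ({..<?q} \<times> {..<D * b})"
  proof
    fix x assume "x \<in> {x. x < m \<and> (x div b) mod G < D}"
    then have x: "x < m" "(x div b) mod G < D" by auto
    have h: "x div (b * G) < ?q" using x(1) div_le_mono[of x m "b * G"] by simp
    have "x mod (b * G) = b * (x div b mod G) + x mod b" by (simp add: mod_mult2_eq)
    moreover have "b * (x div b mod G) + x mod b < b * (x div b mod G) + b" using assms by simp
    moreover have "b * (x div b mod G) + b \<le> D * b" using mult_le_mono2[of "Suc (x div b mod G)" D b] x(2) by (simp add: mult.commute)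
    ultimately have i: "x mod (b * G) < D * b" by linarith
    have "x = (x div (b * G)) * (b * G) + x mod (b * G)" by (rule div_mult_mod_eq[symmetric])
    then show "x \<in> (\<lambda>(h,i). h * (b * G) + i) ` ({..<?q} \<times> {..<D * b})" using h i
      by (intro image_eqI[of _ _ "(x div (b * G), x mod (b * G))"]) auto
  qed
  then have "card {x. x < m \<and> (x div b) mod G < D} \<le> card ((\<lambda>(h,i). h * (b * G) + i) ` ({..<?q} \<times> {..<D * b}))"
    by (intro card_mono) auto
  also have "\<dots> \<le> card ({..<?q} \<times> {..<D * b})" by (intro card_image_le) auto
  finally show ?thesis by (simp add: card_cartesian_product)
qed

lemma card_interval: "card {x. x < m \<and> x div l = h} \<le> l" if "0 < (l::nat)"
proof -
  have "{x. x < m \<and> x div l = h} \<subseteq> {h * l..<h * l + l}"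
    using that by (auto simp: div_nat_eqI dividend_less_times_div) (metis add.commute dividend_less_times_div mult.commute)
  then have "card {x. x < m \<and> x div l = h} \<le> card {h * l..<h * l + l}" by (intro card_mono) auto
  then show ?thesis by simp
qed

text \<open>Triangles with numbered corners, the number being the colour class of \<open>H\<close>
  sent there; extensional functions keep the set finite for finite \<open>X\<close>.\<close>

definition otris :: "('k \<Rightarrow> 'k \<Rightarrow> bool) \<Rightarrow> 'k set \<Rightarrow> (nat \<Rightarrow> 'k) set" where
  "otris E X = {u \<in> {..<3} \<rightarrow>\<^sub>E X. \<forall>c<3. \<forall>d<3. c \<noteq> d \<longrightarrow> E (u c) (u d)}"

text \<open>Corners with equal numbers are left free, since vertices of \<open>H\<close> in the same
  colour class are never adjacent.\<close>

definition ostep :: "('k \<Rightarrow> 'k \<Rightarrow> bool) \<Rightarrow> 'k set \<Rightarrow> ((nat \<Rightarrow> 'k) \<times> (nat \<Rightarrow> 'k)) set" where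
  "ostep E X = {(u,v). u \<in> otris E X \<and> v \<in> otris E X \<and> (\<forall>c<3. \<forall>d<3. c \<noteq> d \<longrightarrow> E (u c) (v d))}"

lemma card_fibres:
  fixes P :: "nat \<Rightarrow> bool"
  assumes "0 < l"
  shows "real (card {x. x < m \<and> P x}) = (\<Sum>h<m div l + 1. real (card {x. x < m \<and> x div l = h \<and> P x}))"
proof -
  have "real (card {x. x < m \<and> P x}) = (\<Sum>x<m. of_bool (P x))"
    by (simp add: of_bool_def sum.If_cases Int_def)
  also have "\<dots> = (\<Sum>x<m. \<Sum>h<m div l + 1. of_bool (x div l = h \<and> P x))"
  proof (rule sum.cong[OF refl])
    fix x assume "x \<in> {..<m}"
    then have "x div l < m div l + 1" using div_le_mono[of x m l] by simp
    then show "(of_bool (P x) :: real) = (\<Sum>h<m div l + 1. of_bool (x div l = h \<and> P x))"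
      by (cases "P x") (auto simp: of_bool_def)
  qed
  also have "\<dots> = (\<Sum>h<m div l + 1. \<Sum>x<m. of_bool (x div l = h \<and> P x))" by (rule sum.swap)
  also have "\<dots> = (\<Sum>h<m div l + 1. real (card {x. x < m \<and> x div l = h \<and> P x}))"
    by (intro sum.cong refl) (simp add: of_bool_def sum.If_cases Int_def)
  finally show ?thesis .
qed

text \<open>In blocks of length b, adjacent vertices lie in equal or consecutive blocks, so a walk
  along \<open>ostep\<close> respects all edges. The load of a cluster has three sources: its fair
  share under \<rho>, a deviation of at most the square root of b G m for each triangle, and the
  vertices met in transit.\<close>

lemma cluster_assignment:
  fixes E :: "'k \<Rightarrow> 'k \<Rightarrow> bool" and X :: "'k set" and \<rho> :: "'k set \<Rightarrow> real" and \<chi> :: "nat \<Rightarrow> nat"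
    and b m n D G :: nat
  assumes E: "\<And>x y. E x y \<Longrightarrow> E y x" "\<And>x. \<not> E x x"
    and finT: "finite T"
    and ord: "\<And>\<tau>. \<tau> \<in> T \<Longrightarrow> ord \<tau> \<in> otris E X \<and> ord \<tau> ` {..<3} = \<tau>"
    and conn: "\<And>\<tau> \<tau>'. \<tau> \<in> T \<Longrightarrow> \<tau>' \<in> T \<Longrightarrow> \<exists>n\<le>D. (ord \<tau>, ord \<tau>') \<in> ostep E X ^^ n"
    and \<rho>: "\<And>\<tau>. \<tau> \<in> T \<Longrightarrow> 0 \<le> \<rho> \<tau>" "0 < sum \<rho> T"
    and \<chi>: "\<And>x. x < m \<Longrightarrow> \<chi> x < 3" "\<And>c. c < 3 \<Longrightarrow> card {x. x < m \<and> \<chi> x = c} \<le> n"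
    and b: "0 < b" "D < G"
  shows "\<exists>\<phi>. (\<forall>x<m. \<phi> x \<in> X) \<and>
    (\<forall>x<m. \<forall>y<m. \<chi> x \<noteq> \<chi> y \<longrightarrow> x \<le> y + b \<longrightarrow> y \<le> x + b \<longrightarrow> E (\<phi> x) (\<phi> y)) \<and>
    (\<forall>s\<in>X. card {x. x < m \<and> \<phi> x = s} \<le> n / sum \<rho> T * sum \<rho> {\<tau>\<in>T. s \<in> \<tau>}
        + card T * sqrt (b * G * m) + (m div (b * G) + 1) * (D * b))"
proof -
  define l where "l = b * G"
  have "0 < G" using b by linarith
  then have l: "0 < l" using b by (simp add: l_def)
  define N where "N = m div l + 1"
  define \<Lambda> where "\<Lambda> = sum \<rho> T"
  define q where "q \<tau> = \<rho> \<tau> / \<Lambda>" for \<tau>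
  have \<Lambda>: "0 < \<Lambda>" using \<rho> by (simp add: \<Lambda>_def)
  have q: "\<And>\<tau>. \<tau> \<in> T \<Longrightarrow> 0 \<le> q \<tau>" "sum q T = 1" using \<rho> \<Lambda> by (auto simp: q_def \<Lambda>_def sum_divide_distrib[symmetric])
  define cnt where "cnt h c = real (card {x. x < m \<and> x div l = h \<and> \<chi> x = c})" for h c
  obtain k :: "nat \<Rightarrow> 'k set" where kT: "\<And>h. k h \<in> T" and
    dev: "(\<Sum>\<tau>\<in>T. \<Sum>c<3. (\<Sum>h<N. cnt h c * (of_bool (k h = \<tau>) - q \<tau>))\<^sup>2) \<le> (\<Sum>h<N. \<Sum>c<3. (cnt h c)\<^sup>2)"
    using balanced_choice[OF finT q, where cnt = cnt and N = N] by blast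
  define target where "target h = ord (k h)" for h
  have "\<exists>\<sigma>. (\<forall>g. (\<sigma> g, \<sigma> (Suc g)) \<in> ostep E X) \<and> (\<forall>g. D \<le> g mod G \<longrightarrow> \<sigma> g = target (g div G))"
  proof (rule walk_sequence[OF _ _ b(2)])
    show "(target h, target h) \<in> ostep E X" for h
      using ord[OF kT[of h]] by (auto simp: target_def ostep_def otris_def)
    show "\<exists>n\<le>D. (target h, target (Suc h)) \<in> ostep E X ^^ n" for h
      unfolding target_def using conn kT by blast
  qed
  then obtain \<sigma> where \<sigma>: "\<And>g. (\<sigma> g, \<sigma> (Suc g)) \<in> ostep E X" "\<And>g. D \<le> g mod G \<Longrightarrow> \<sigma> g = target (g div G)" by blast
  define \<phi> where "\<phi> x = \<sigma> (x div b) (\<chi> x)" for x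
  have \<sigma>O: "\<sigma> g \<in> otris E X" for g using \<sigma>(1)[of g] by (auto simp: ostep_def)
  have 1: "\<phi> x \<in> X" if "x < m" for x
    using \<sigma>O[of "x div b"] \<chi>(1)[OF that] by (auto simp: otris_def \<phi>_def)
  have 2: "E (\<phi> x) (\<phi> y)" if xy: "x < m" "y < m" "\<chi> x \<noteq> \<chi> y" "x \<le> y + b" "y \<le> x + b" for x y
  proof -
    have sg: "E (\<phi> x) (\<phi> y)" if "x < m" "y < m" "\<chi> x \<noteq> \<chi> y" "x \<le> y" "y \<le> x + b" for x y
    proof -
      have "x div b \<le> y div b" "y div b \<le> (x + b) div b" using that by (auto intro: div_le_mono)
      then consider "y div b = x div b" | "y div b = Suc (x div b)" using b by fastforce
      then show ?thesis
      proof cases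
        case 1
        then show ?thesis using \<sigma>O[of "x div b"] \<chi>(1) that by (auto simp: otris_def \<phi>_def)
      next
        case 2
        then show ?thesis using \<sigma>(1)[of "x div b"] \<chi>(1) that by (auto simp: ostep_def \<phi>_def)
      qed
    qed
    show ?thesis
    proof (cases "x \<le> y")
      case True then show ?thesis using sg[of x y] xy by auto
    next
      case False then show ?thesis using sg[of y x] xy E(1) by auto
    qed
  qed
  have cnt_le: "cnt h c \<le> l" for h c
  proof -
    have "card {x. x < m \<and> x div l = h \<and> \<chi> x = c} \<le> card {x. x < m \<and> x div l = h}" by (intro card_mono) auto
    then show ?thesis using card_interval[OF l, of m h] by (simp add: cnt_def)
  qed
  have cnt_sum: "(\<Sum>h<N. cnt h c) = card {x. x < m \<and> \<chi> x = c}" for c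
    unfolding cnt_def N_def using card_fibres[OF l, of m "\<lambda>x. \<chi> x = c"] by simp
  \<comment> \<open>Every count is at most l and all counts add up to m. Together with
    \<open>dev\<close> this bounds each single deviation by the square root of l m.\<close>
  have tot: "(\<Sum>h<N. \<Sum>c<3. (cnt h c)\<^sup>2) \<le> l * m"
  proof -
    have "(\<Sum>h<N. \<Sum>c<3. (cnt h c)\<^sup>2) \<le> (\<Sum>h<N. \<Sum>c<3. l * cnt h c)"
      using cnt_le by (intro sum_mono) (auto simp: power2_eq_square cnt_def intro!: mult_right_mono)
    also have "\<dots> = l * (\<Sum>c<3. \<Sum>h<N. cnt h c)"
      by (subst sum.swap) (simp add: sum_distrib_left)
    also have "(\<Sum>c<3. \<Sum>h<N. cnt h c) = card (\<Union>c<3. {x. x < m \<and> \<chi> x = c})"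
      unfolding cnt_sum by (subst card_UN_disjoint) auto
    also have "(\<Union>c<3. {x. x < m \<and> \<chi> x = c}) = {..<m}" using \<chi>(1) by auto
    finally show ?thesis by simp
  qed
  have bnd: "real (card {x. x < m \<and> k (x div l) = \<tau> \<and> \<chi> x = c}) \<le> q \<tau> * n + sqrt (l * m)" if \<tau>: "\<tau> \<in> T" "c < 3" for \<tau> c
  proof -
    let ?d = "\<Sum>h<N. cnt h c * (of_bool (k h = \<tau>) - q \<tau>)"
    have "real (card {x. x < m \<and> k (x div l) = \<tau> \<and> \<chi> x = c}) = (\<Sum>h<N. cnt h c * of_bool (k h = \<tau>))"
    proof -
      have "real (card {x. x < m \<and> x div l = h \<and> k (x div l) = \<tau> \<and> \<chi> x = c}) = cnt h c * of_bool (k h = \<tau>)" for h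
      proof (cases "k h = \<tau>")
        case True
        then have "{x. x < m \<and> x div l = h \<and> k (x div l) = \<tau> \<and> \<chi> x = c} = {x. x < m \<and> x div l = h \<and> \<chi> x = c}" by blast
        then show ?thesis using True by (simp add: cnt_def)
      next
        case False
        then have "{x. x < m \<and> x div l = h \<and> k (x div l) = \<tau> \<and> \<chi> x = c} = {}" by blast
        then show ?thesis using False by simp
      qed
      then show ?thesis using card_fibres[OF l, of m "\<lambda>x. k (x div l) = \<tau> \<and> \<chi> x = c"]
        unfolding N_def by (simp only:)
    qed
    also have "\<dots> = ?d + q \<tau> * (\<Sum>h<N. cnt h c)"
      by (simp add: right_diff_distrib sum_subtractf sum_distrib_left mult.commute)
    also have "q \<tau> * (\<Sum>h<N. cnt h c) \<le> q \<tau> * n" unfolding cnt_sum using \<chi>(2)[OF \<tau>(2)] q \<tau> by (intro mult_left_mono) auto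
    also have "?d \<le> sqrt (l * m)"
    proof (rule real_le_rsqrt)
      have "?d\<^sup>2 \<le> (\<Sum>c<3. (\<Sum>h<N. cnt h c * (of_bool (k h = \<tau>) - q \<tau>))\<^sup>2)"
        using \<tau>(2) by (intro member_le_sum[where f = "\<lambda>c. (\<Sum>h<N. cnt h c * (of_bool (k h = \<tau>) - q \<tau>))\<^sup>2"]) auto
      also have "\<dots> \<le> (\<Sum>\<tau>\<in>T. \<Sum>c<3. (\<Sum>h<N. cnt h c * (of_bool (k h = \<tau>) - q \<tau>))\<^sup>2)"
        using \<tau>(1) finT by (intro member_le_sum[where f = "\<lambda>\<tau>. \<Sum>c<3. (\<Sum>h<N. cnt h c * (of_bool (k h = \<tau>) - q \<tau>))\<^sup>2"]) (auto intro: sum_nonneg)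
      finally show "?d\<^sup>2 \<le> real (l * m)" using dev tot by simp
    qed
    finally show ?thesis by simp
  qed
  have 3: "card {x. x < m \<and> \<phi> x = s} \<le> n / \<Lambda> * sum \<rho> {\<tau>\<in>T. s \<in> \<tau>} + card T * sqrt (l * m) + (m div l + 1) * (D * b)" for s
  proof -
    let ?Ts = "{\<tau>\<in>T. s \<in> \<tau>}"
    \<comment> \<open>A triangle containing s sends exactly one colour class to s; two would give a
      loop of \<open>E\<close>.\<close>
    define col where "col \<tau> = (SOME c. c < 3 \<and> ord \<tau> c = s)" for \<tau>
    have col: "col \<tau> < 3 \<and> ord \<tau> (col \<tau>) = s" if "\<tau> \<in> ?Ts" for \<tau>
    proof -
      have "s \<in> ord \<tau> ` {..<3}" using ord[of \<tau>] that by simp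
      then have "\<exists>c. c < 3 \<and> ord \<tau> c = s" by auto
      then show ?thesis unfolding col_def by (rule someI_ex)
    qed
    let ?A = "{x. x < m \<and> (x div b) mod G < D}"
    let ?B = "\<lambda>\<tau>. {x. x < m \<and> k (x div l) = \<tau> \<and> \<chi> x = col \<tau>}"
    have "{x. x < m \<and> \<phi> x = s} \<subseteq> ?A \<union> (\<Union>\<tau>\<in>?Ts. ?B \<tau>)"
    proof
      fix x assume "x \<in> {x. x < m \<and> \<phi> x = s}"
      then have x: "x < m" "\<phi> x = s" by auto
      show "x \<in> ?A \<union> (\<Union>\<tau>\<in>?Ts. ?B \<tau>)"
      proof (cases "(x div b) mod G < D")
        case False
        let ?\<tau> = "k (x div l)"
        have "\<sigma> (x div b) = ord ?\<tau>" using \<sigma>(2)[of "x div b"] False by (simp add: target_def l_def div_mult2_eq)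
        then have os: "ord ?\<tau> (\<chi> x) = s" using x by (simp add: \<phi>_def)
        have o: "ord ?\<tau> \<in> otris E X" "ord ?\<tau> ` {..<3} = ?\<tau>" using ord kT by auto
        have c3: "\<chi> x < 3" using \<chi>(1) x by blast
        have "s \<in> ?\<tau>" using os o(2) c3 by blast
        then have \<tau>s: "?\<tau> \<in> ?Ts" using kT by blast
        have "\<chi> x = col ?\<tau>"
        proof (rule ccontr)
          assume "\<chi> x \<noteq> col ?\<tau>"
          then have "E (ord ?\<tau> (\<chi> x)) (ord ?\<tau> (col ?\<tau>))" using o(1) c3 col[OF \<tau>s] by (auto simp: otris_def)
          then show False using os col[OF \<tau>s] E(2) by simp
        qed
        then show ?thesis using \<tau>s x by blast
      qed (use x in auto)
    qed
    then have "card {x. x < m \<and> \<phi> x = s} \<le> card (?A \<union> (\<Union>\<tau>\<in>?Ts. ?B \<tau>))"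
      using finT by (intro card_mono) auto
    also have "\<dots> \<le> card ?A + card (\<Union>\<tau>\<in>?Ts. ?B \<tau>)" by (rule card_Un_le)
    also have "card (\<Union>\<tau>\<in>?Ts. ?B \<tau>) \<le> (\<Sum>\<tau>\<in>?Ts. card (?B \<tau>))" using finT by (intro card_UN_le) auto
    also have "card ?A \<le> (m div l + 1) * (D * b)" unfolding l_def using card_transit[of b G m D] b by simp
    finally have "card {x. x < m \<and> \<phi> x = s} \<le> (m div l + 1) * (D * b) + (\<Sum>\<tau>\<in>?Ts. card (?B \<tau>))" by simp
    then have "real (card {x. x < m \<and> \<phi> x = s}) \<le> real ((m div l + 1) * (D * b) + (\<Sum>\<tau>\<in>?Ts. card (?B \<tau>)))"
      by (rule of_nat_mono)
    also have "\<dots> = (m div l + 1) * (D * b) + (\<Sum>\<tau>\<in>?Ts. real (card (?B \<tau>)))" by simp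
    also have "(\<Sum>\<tau>\<in>?Ts. real (card (?B \<tau>))) \<le> (\<Sum>\<tau>\<in>?Ts. q \<tau> * n + sqrt (l * m))"
      using bnd col by (intro sum_mono) auto
    also have "\<dots> = n / \<Lambda> * sum \<rho> ?Ts + card ?Ts * sqrt (l * m)"
      by (simp add: sum.distrib q_def sum_divide_distrib[symmetric] sum_distrib_right[symmetric] mult.commute)
        (simp add: sum_distrib_left)
    also have "card ?Ts * sqrt (l * m) \<le> card T * sqrt (l * m)"
      using finT card_mono[of T ?Ts] by (intro mult_right_mono) auto
    finally show ?thesis by simp
  qed
  show ?thesis
  proof (intro exI[of _ \<phi>] conjI)
    show "\<forall>s\<in>X. card {x. x < m \<and> \<phi> x = s} \<le> n / sum \<rho> T * sum \<rho> {\<tau>\<in>T. s \<in> \<tau>}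
        + card T * sqrt (b * G * m) + (m div (b * G) + 1) * (D * b)"
      using 3 unfolding \<Lambda>_def l_def by (simp add: mult.assoc)
  qed (use 1 2 in blast)+
qed

section \<open>Triangle classes of a cluster graph\<close>

definition triangles :: "('k \<Rightarrow> 'k \<Rightarrow> bool) \<Rightarrow> 'k set \<Rightarrow> 'k set set" where
  "triangles E X = {\<tau>. \<tau> \<subseteq> X \<and> card \<tau> = 3 \<and> (\<forall>x\<in>\<tau>. \<forall>y\<in>\<tau>. x \<noteq> y \<longrightarrow> E x y)}"

definition tri_adjacent :: "('k \<Rightarrow> 'k \<Rightarrow> bool) \<Rightarrow> 'k set \<Rightarrow> ('k set \<times> 'k set) set" where
  "tri_adjacent E X = {(e,e'). card e = 2 \<and> card e' = 2 \<and> (\<exists>\<tau>\<in>triangles E X. e \<subseteq> \<tau> \<and> e' \<subseteq> \<tau>)}"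

definition edge_class :: "('k \<Rightarrow> 'k \<Rightarrow> bool) \<Rightarrow> 'k set \<Rightarrow> 'k set \<Rightarrow> 'k set set" where
  "edge_class E X e = (tri_adjacent E X)\<^sup>* `` {e}"

text \<open>If \<open>cl\<close> is an \<open>edge_class\<close>, then one edge of a triangle lies
  in it exactly when all three do.\<close>

definition class_triangles :: "('k \<Rightarrow> 'k \<Rightarrow> bool) \<Rightarrow> 'k set \<Rightarrow> 'k set set \<Rightarrow> 'k set set" where
  "class_triangles E X cl = {\<tau>\<in>triangles E X. \<exists>e\<in>cl. card e = 2 \<and> e \<subseteq> \<tau>}"

lemma tri_adjacent_sym: "sym (tri_adjacent E X)"
  by (auto simp: sym_def tri_adjacent_def)

lemma edge_class_eq: "(e,e') \<in> (tri_adjacent E X)\<^sup>* \<Longrightarrow> edge_class E X e = edge_class E X e'"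
  unfolding edge_class_def using sym_rtrancl[OF tri_adjacent_sym, of E X]
  by (auto simp: sym_def intro: rtrancl_trans)

lemma ordering_exists:
  assumes "\<tau> \<in> triangles E X"
  shows "\<exists>u\<in>otris E X. u ` {..<3} = \<tau>"
proof -
  have "finite \<tau>" "card \<tau> = 3" using assms by (auto simp: triangles_def intro: card_ge_0_finite)
  then obtain h where h: "bij_betw h {..<3::nat} \<tau>" using ex_bij_betw_nat_finite by (metis atLeast0LessThan)
  let ?u = "restrict h {..<3}"
  have im: "?u ` {..<3} = \<tau>" using h by (auto simp: bij_betw_def)
  have ne: "h c \<noteq> h d" if "c < 3" "d < 3" "c \<noteq> d" for c d using h that by (auto simp: bij_betw_def inj_on_def)
  have "h c \<in> \<tau>" if "c < 3" for c using h that by (auto simp: bij_betw_def)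
  then have "?u \<in> otris E X" using assms ne by (auto simp: otris_def triangles_def)
  then show ?thesis using im by blast
qed

text \<open>The corner opposite to e is replaced, in its slot, by the third vertex of \<tau>; the
  corners in e keep their numbers and see the new one.\<close>

lemma swap_corner:
  assumes irr: "\<And>x. \<not> E x x" and u: "u \<in> otris E X" "e \<subseteq> u ` {..<3}" and e: "card e = 2" "e \<subseteq> \<tau>" and \<tau>: "\<tau> \<in> triangles E X"
  shows "\<exists>u'. u' ` {..<3} = \<tau> \<and> (u, u') \<in> ostep E X"
proof -
  have fin: "finite \<tau>" "card \<tau> = 3" using \<tau> by (auto simp: triangles_def intro: card_ge_0_finite)
  have fe: "finite e" using e(2) fin(1) finite_subset by blast
  have "card (\<tau> - e) = 1" using fin e fe by (simp add: card_Diff_subset)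
  then obtain z where z: "\<tau> - e = {z}" by (meson card_1_singletonE)
  have inj: "u c \<noteq> u d" if "c < 3" "d < 3" "c \<noteq> d" for c d using u(1) that irr by (metis (mono_tags, lifting) otris_def mem_Collect_eq)
  then have injo: "inj_on u {..<3}" by (auto simp: inj_on_def)
  have "card (u ` {..<3}) = 3" using injo by (simp add: card_image)
  then have "card (u ` {..<3} - e) = 1" using u(2) fe e(1) by (simp add: card_Diff_subset)
  then obtain y where y: "u ` {..<3} - e = {y}" by (meson card_1_singletonE)
  then have "y \<in> u ` {..<3}" by blast
  then obtain d where d: "d < 3" "u d = y" by auto
  have ue: "u c \<in> e" if "c < 3" "c \<noteq> d" for c using y d inj[OF that(1) d(1) that(2)] that by blast
  have esub: "e \<subseteq> u ` ({..<3} - {d})" using u(2) y d by blast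
  let ?u' = "u(d := z)"
  have im: "?u' ` {..<3} = \<tau>"
  proof -
    have "?u' ` {..<3} = insert z (u ` ({..<3} - {d}))" using d(1) by auto
    also have "u ` ({..<3} - {d}) = e" using esub ue by auto
    also have "insert z e = \<tau>" using z e(2) by blast
    finally show ?thesis .
  qed
  have zt: "z \<in> \<tau>" "z \<notin> e" using z by auto
  have Ez: "E z (u c)" "E (u c) z" if "c < 3" "c \<noteq> d" for c
  proof -
    have "u c \<in> \<tau>" "u c \<noteq> z" using ue[OF that] zt e(2) by auto
    then show "E z (u c)" "E (u c) z" using \<tau> zt by (auto simp: triangles_def)
  qed
  have Eu: "E (u c) (u c')" if "c < 3" "c' < 3" "c \<noteq> c'" for c c' using u(1) that by (auto simp: otris_def)
  have "?u' \<in> {..<3} \<rightarrow>\<^sub>E X" using u(1) d(1) zt(1) \<tau> by (auto simp: otris_def triangles_def PiE_iff extensional_def)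
  then have "?u' \<in> otris E X" using Ez Eu by (auto simp: otris_def)
  then have "(u, ?u') \<in> ostep E X" using u(1) Ez Eu by (auto simp: ostep_def)
  then show ?thesis using im by blast
qed

lemma class_reachable:
  assumes irr: "\<And>x. \<not> E x x" and u: "u \<in> otris E X" "e \<subseteq> u ` {..<3}" and e: "card e = 2" and ee': "(e,e') \<in> (tri_adjacent E X)\<^sup>*"
  shows "\<tau> \<in> triangles E X \<Longrightarrow> e' \<subseteq> \<tau> \<Longrightarrow> \<exists>u'. u' ` {..<3} = \<tau> \<and> (u,u') \<in> (ostep E X)\<^sup>*"
  using ee'
proof (induction arbitrary: \<tau> rule: rtrancl_induct)
  case base
  then show ?case using swap_corner[OF irr u e] by blast
next
  case (step e1 e2)
  obtain \<tau>1 where \<tau>1: "\<tau>1 \<in> triangles E X" "e1 \<subseteq> \<tau>1" "e2 \<subseteq> \<tau>1" "card e2 = 2" using step(2) by (auto simp: tri_adjacent_def)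
  obtain u1 where u1: "u1 ` {..<3} = \<tau>1" "(u,u1) \<in> (ostep E X)\<^sup>*" using step(3)[OF \<tau>1(1,2)] by blast
  have "u1 \<in> otris E X" using u1(2) u(1) by (induction rule: rtrancl_induct) (auto simp: ostep_def)
  then obtain u2 where "u2 ` {..<3} = \<tau>" "(u1,u2) \<in> ostep E X" using swap_corner[of E u1 X e2 \<tau>] irr \<tau>1 u1 step(4,5) by blast
  then show ?case using u1(2) by (blast intro: rtrancl_into_rtrancl)
qed

lemma ostep_sym: "(\<And>x y. E x y \<Longrightarrow> E y x) \<Longrightarrow> sym (ostep E X)"
  unfolding sym_def ostep_def by blast

text \<open>A chain of triangles may return to its start with permuted corners. Therefore one
  numbering per triangle is fixed, reachable from a single start, and symmetry of the steps connects
  any two of them. The length bound counts pairs of numbered triangles.\<close>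

lemma class_orderings:
  assumes irr: "\<And>x. \<not> E x x" and sym: "\<And>x y. E x y \<Longrightarrow> E y x" and finX: "finite X"
  shows "\<exists>ord. \<forall>\<tau>\<in>class_triangles E X (edge_class E X e0). ord \<tau> \<in> otris E X \<and> ord \<tau> ` {..<3} = \<tau> \<and>
    (\<forall>\<tau>'\<in>class_triangles E X (edge_class E X e0). \<exists>n\<le>card X ^ 6. (ord \<tau>, ord \<tau>') \<in> ostep E X ^^ n)"
proof (cases "class_triangles E X (edge_class E X e0) = {}")
  case False
  let ?T = "class_triangles E X (edge_class E X e0)"
  obtain \<tau>0 e where \<tau>0: "\<tau>0 \<in> triangles E X" "e \<in> edge_class E X e0" "card e = 2" "e \<subseteq> \<tau>0"
    using False by (auto simp: class_triangles_def)
  obtain u0 where u0: "u0 \<in> otris E X" "u0 ` {..<3} = \<tau>0" using ordering_exists[OF \<tau>0(1)] by blast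
  have "\<exists>u. u ` {..<3} = \<tau> \<and> (u0,u) \<in> (ostep E X)\<^sup>*" if \<tau>: "\<tau> \<in> ?T" for \<tau>
  proof -
    obtain e' where e': "\<tau> \<in> triangles E X" "e' \<in> edge_class E X e0" "card e' = 2" "e' \<subseteq> \<tau>"
      using \<tau> by (auto simp: class_triangles_def)
    have "(e0,e) \<in> (tri_adjacent E X)\<^sup>*" "(e0,e') \<in> (tri_adjacent E X)\<^sup>*" using \<tau>0(2) e'(2) by (auto simp: edge_class_def)
    then have "(e,e') \<in> (tri_adjacent E X)\<^sup>*" using sym_rtrancl[OF tri_adjacent_sym, of E X] by (meson rtrancl_trans symD)
    then show ?thesis using class_reachable[OF irr u0(1) _ \<tau>0(3) _ e'(1,4)] u0(2) \<tau>0(4) by blast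
  qed
  then obtain ord where ord: "\<And>\<tau>. \<tau> \<in> ?T \<Longrightarrow> ord \<tau> ` {..<3} = \<tau> \<and> (u0, ord \<tau>) \<in> (ostep E X)\<^sup>*" by metis
  have finO: "finite (otris E X)" "card (otris E X) \<le> card X ^ 3"
  proof -
    have f: "finite ({..<3::nat} \<rightarrow>\<^sub>E X)" using finX by (auto intro: finite_PiE)
    show "finite (otris E X)" using f by (rule finite_subset[rotated]) (auto simp: otris_def)
    have "card (otris E X) \<le> card ({..<3::nat} \<rightarrow>\<^sub>E X)" using f by (intro card_mono) (auto simp: otris_def)
    then show "card (otris E X) \<le> card X ^ 3" by (simp add: card_PiE)
  qed
  have so: "sym ((ostep E X)\<^sup>*)" using ostep_sym[of E X] sym by (intro sym_rtrancl) blast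
  have sub: "ostep E X \<subseteq> otris E X \<times> otris E X" by (auto simp: ostep_def)
  have finS: "finite (ostep E X)" using finite_subset[OF sub] finO by simp
  have "card (ostep E X) \<le> card (otris E X \<times> otris E X)" using sub finO by (intro card_mono) auto
  also have "\<dots> \<le> card X ^ 3 * card X ^ 3" unfolding card_cartesian_product using finO by (intro mult_mono) auto
  also have "\<dots> = card X ^ 6" by (simp flip: power_add)
  finally have cS: "card (ostep E X) \<le> card X ^ 6" .
  have "ord \<tau> \<in> otris E X" if "\<tau> \<in> ?T" for \<tau>
  proof -
    have "(u0, ord \<tau>) \<in> (ostep E X)\<^sup>*" using ord[OF that] by blast
    then show ?thesis by (induction rule: rtrancl_induct) (use u0 in \<open>auto simp: ostep_def\<close>)
  qed
  moreover have "\<exists>n\<le>card X ^ 6. (ord \<tau>, ord \<tau>') \<in> ostep E X ^^ n" if "\<tau> \<in> ?T" "\<tau>' \<in> ?T" for \<tau> \<tau>'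
  proof -
    have "(ord \<tau>, ord \<tau>') \<in> (ostep E X)\<^sup>*"
      using ord[OF that(1)] ord[OF that(2)] so by (meson rtrancl_trans symD)
    then have "\<exists>n\<le>card (ostep E X). (ord \<tau>, ord \<tau>') \<in> ostep E X ^^ n" unfolding rtrancl_finite_eq_relpow[OF finS] by blast
    then show ?thesis using cS by (meson order_trans)
  qed
  ultimately show ?thesis using ord by (intro exI[of _ ord]) blast
qed auto

text \<open>An index stands for a triple of equally large clusters, joined to each other in the
  colour \<open>lc\<close>; \<open>cc\<close> is the colour between two triples and
  \<open>ok\<close> marks the pairs of triples where it may be used. The locale is combinatorial:
  density enters only when \<open>ed\<close> is compared with the coloured graph.\<close>

locale cluster_system =
  fixes V :: "'v set" and J :: "'i set" and S :: "'i \<Rightarrow> nat \<Rightarrow> 'v set" and sz :: "'i \<Rightarrow> nat"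
    and lc :: "'i \<Rightarrow> colour" and cc :: "'i \<Rightarrow> 'i \<Rightarrow> colour" and ok :: "'i \<Rightarrow> 'i \<Rightarrow> bool"
  assumes finV: "finite V" and Vne: "V \<noteq> {}" and finJ: "finite J"
    and S: "\<And>i a. i \<in> J \<Longrightarrow> a < 3 \<Longrightarrow> S i a \<subseteq> V \<and> card (S i a) = sz i" and sz: "\<And>i. i \<in> J \<Longrightarrow> 0 < sz i"
    and S_disj: "\<And>i j a b. i \<in> J \<Longrightarrow> j \<in> J \<Longrightarrow> a < 3 \<Longrightarrow> b < 3 \<Longrightarrow> (i,a) \<noteq> (j,b) \<Longrightarrow> S i a \<inter> S j b = {}"
    and cc_sym: "\<And>i j. cc i j = cc j i" and ok_sym: "\<And>i j. ok i j \<Longrightarrow> ok j i"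
begin

definition X where "X = J \<times> {..<3::nat}"
definition ed where "ed k x y \<longleftrightarrow> x \<in> X \<and> y \<in> X \<and>
  (if fst x = fst y then snd x \<noteq> snd y \<and> lc (fst x) = k else ok (fst x) (fst y) \<and> cc (fst x) (fst y) = k)"
definition kap where "kap i j = (if i = j then lc i else cc i j)"
definition std where "std i j = {(i, 0), (j, if i = j then 1 else 0 :: nat)}"
text \<open>The colour is part of the label, so that equal labels imply equal colours, as
  \<open>tri_core\<close> demands.\<close>

definition lab where "lab i j = (kap i j, edge_class (ed (kap i j)) X (std i j))"

lemma finX: "finite X" using finJ by (simp add: X_def)
lemma ed_irrefl: "\<not> ed k x x" by (simp add: ed_def)
lemma ed_sym: "ed k x y \<Longrightarrow> ed k y x"
  using ok_sym[of "fst x" "fst y"] cc_sym[of "fst x" "fst y"] by (auto simp: ed_def split: if_splits)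
lemma kap_sym: "kap i j = kap j i" using cc_sym by (auto simp: kap_def)
lemma lab_sym: "lab i j = lab j i" using kap_sym[of i j] by (cases "i = j") (auto simp: lab_def std_def insert_commute)

definition compat where "compat i j \<longleftrightarrow> i \<in> J \<and> j \<in> J \<and> (i = j \<or> ok i j)"

lemma ed_compat: "compat i j \<Longrightarrow> a < 3 \<Longrightarrow> b < 3 \<Longrightarrow> (i,a) \<noteq> (j,b) \<Longrightarrow> ed (kap i j) (i,a) (j,b)"
  by (auto simp: ed_def compat_def X_def kap_def)

definition P where "P i j l a b c = {(i,a),(j,b),(l,c)}"
definition vld where "vld i j l a b c \<longleftrightarrow> a < 3 \<and> b < 3 \<and> c < (3::nat) \<and> (i,a) \<noteq> (j,b) \<and> (j,b) \<noteq> (l,c) \<and> (i,a) \<noteq> (l,c)"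

definition mono where "mono k i j l \<longleftrightarrow> compat i j \<and> compat j l \<and> compat i l \<and> kap i j = k \<and> kap j l = k \<and> kap i l = k"

lemma P_triangle: "mono k i j l \<Longrightarrow> vld i j l a b c \<Longrightarrow> P i j l a b c \<in> triangles (ed k) X"
proof -
  assume m: "mono k i j l" and v: "vld i j l a b c"
  have "card (P i j l a b c) = 3" using v by (auto simp: P_def vld_def)
  moreover have "P i j l a b c \<subseteq> X" using m v by (auto simp: P_def vld_def mono_def compat_def X_def)
  moreover have "ed k (i,a) (j,b)" "ed k (j,b) (l,c)" "ed k (i,a) (l,c)"
    using m v ed_compat[of i j a b] ed_compat[of j l b c] ed_compat[of i l a c] by (auto simp: mono_def vld_def)
  ultimately show ?thesis using ed_sym by (fastforce simp: triangles_def P_def)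
qed

lemma linked:
  assumes "\<tau> \<in> triangles E Y" "\<tau>' \<in> triangles E Y" "x \<in> \<tau>" "y \<in> \<tau>" "x \<in> \<tau>'" "y \<in> \<tau>'" "x \<noteq> y"
    and "card e = 2" "e \<subseteq> \<tau>" "card e' = 2" "e' \<subseteq> \<tau>'"
  shows "(e,e') \<in> (tri_adjacent E Y)\<^sup>*"
proof -
  have "card {x,y} = 2" using assms(7) by simp
  then have "(e,{x,y}) \<in> tri_adjacent E Y" "({x,y},e') \<in> tri_adjacent E Y" using assms by (auto simp: tri_adjacent_def)
  then show ?thesis by (meson r_into_rtrancl rtrancl_trans)
qed

definition joined where "joined k \<tau> \<tau>' \<longleftrightarrow> (\<forall>e e'. card e = 2 \<longrightarrow> e \<subseteq> \<tau> \<longrightarrow> card e' = 2 \<longrightarrow> e' \<subseteq> \<tau>' \<longrightarrow> (e,e') \<in> (tri_adjacent (ed k) X)\<^sup>*)"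

lemma joinedI: "\<tau> \<in> triangles (ed k) X \<Longrightarrow> \<tau>' \<in> triangles (ed k) X \<Longrightarrow> x \<in> \<tau> \<inter> \<tau>' \<Longrightarrow> y \<in> \<tau> \<inter> \<tau>' \<Longrightarrow> x \<noteq> y \<Longrightarrow> joined k \<tau> \<tau>'"
  unfolding joined_def using linked[of \<tau> "ed k" X \<tau>' x y] by simp

lemma joined_trans: "\<tau>' \<in> triangles (ed k) X \<Longrightarrow> joined k \<tau> \<tau>' \<Longrightarrow> joined k \<tau>' \<tau>'' \<Longrightarrow> joined k \<tau> \<tau>''"
proof -
  assume t: "\<tau>' \<in> triangles (ed k) X" and j: "joined k \<tau> \<tau>'" "joined k \<tau>' \<tau>''"
  have "2 \<le> card \<tau>'" using t by (simp add: triangles_def)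
  then obtain e where e: "e \<subseteq> \<tau>'" "card e = 2" by (rule obtain_subset_with_card_n)
  show ?thesis
    unfolding joined_def
  proof (intro allI impI)
    fix e1 e2 assume "card e1 = 2" "e1 \<subseteq> \<tau>" "card e2 = 2" "e2 \<subseteq> \<tau>''"
    then have "(e1,e) \<in> (tri_adjacent (ed k) X)\<^sup>*" "(e,e2) \<in> (tri_adjacent (ed k) X)\<^sup>*"
      using j e by (simp_all add: joined_def)
    then show "(e1,e2) \<in> (tri_adjacent (ed k) X)\<^sup>*" by (rule rtrancl_trans)
  qed
qed

text \<open>Two pairs of corners of the same triple i always meet; a common corner together with a
  corner of l is a common edge.\<close>

lemma joined_two:
  assumes m: "mono k i i l" "i \<noteq> l" and v: "vld i i l a b c" "vld i i l a' b' c'"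
  shows "joined k (P i i l a b c) (P i i l a' b' c')"
proof -
  have ab: "a < 3" "b < 3" "a \<noteq> b" "a' < 3" "b' < 3" "a' \<noteq> b'" "c < 3" "c' < 3" using v by (auto simp: vld_def)
  have v1: "vld i i l a b c'" using ab m by (auto simp: vld_def)
  note t = P_triangle[OF m(1)]
  have 1: "joined k (P i i l a b c) (P i i l a b c')"
    using ab by (intro joinedI[OF t[OF v(1)] t[OF v1], of "(i,a)" "(i,b)"]) (auto simp: P_def)
  have "a = a' \<or> a = b' \<or> b = a' \<or> b = b'" using ab by linarith
  then obtain d where d: "d = a \<or> d = b" "d = a' \<or> d = b'" by blast
  have 2: "joined k (P i i l a b c') (P i i l a' b' c')"
    using ab d m by (intro joinedI[OF t[OF v1] t[OF v(2)], of "(i,d)" "(l,c')"]) (auto simp: P_def)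
  show ?thesis using joined_trans[OF t[OF v1] 1 2] .
qed

text \<open>This makes the class of a pair of triples independent of the corners chosen. If the
  triples are distinct, corners are changed one at a time; if exactly two coincide,
  \<open>joined_two\<close> applies; if all coincide, there is just one triangle.\<close>

lemma joined_all:
  assumes m: "mono k i j l" and v: "vld i j l a b c" "vld i j l a' b' c'"
  shows "joined k (P i j l a b c) (P i j l a' b' c')"
proof -
  note t = P_triangle[OF m]
  consider "i = j" "j = l" | "i = j" "j \<noteq> l" | "i \<noteq> j" "j = l" | "i \<noteq> j" "i = l" | "i \<noteq> j" "j \<noteq> l" "i \<noteq> l" by blast
  then show ?thesis
  proof cases
    case 1
    have "{a,b,c} = {..<3}" "{a',b',c'} = {..<3}"
      using v 1 by (auto simp: vld_def)
    then have "P i j l a b c = {i} \<times> {..<3}" "P i j l a' b' c' = {i} \<times> {..<3}" using 1 by (auto simp: P_def)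
    then have eq: "P i j l a b c = P i j l a' b' c'" by simp
    show ?thesis unfolding eq[symmetric] using v(1) by (intro joinedI[OF t[OF v(1)] t[OF v(1)], of "(i,a)" "(j,b)"]) (auto simp: P_def vld_def)
  next
    case 2
    then show ?thesis using joined_two[of k i l a b c a' b' c'] m v by simp
  next
    case 3
    have "mono k j j i" using m 3 kap_sym[of i j] ok_sym[of i j] by (auto simp: mono_def compat_def)
    then have "joined k (P j j i b c a) (P j j i b' c' a')" using joined_two[of k j i b c a b' c' a'] v 3 by (auto simp: vld_def)
    moreover have "P j j i b c a = P i j l a b c" "P j j i b' c' a' = P i j l a' b' c'" using 3 by (auto simp: P_def)
    ultimately show ?thesis by (simp only:)
  next
    case 4
    have "mono k i i j" using m 4 kap_sym[of i j] by (auto simp: mono_def)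
    then have "joined k (P i i j a c b) (P i i j a' c' b')" using joined_two[of k i j a c b a' c' b'] v 4 by (auto simp: vld_def)
    moreover have "P i i j a c b = P i j l a b c" "P i i j a' c' b' = P i j l a' b' c'" using 4 by (auto simp: P_def)
    ultimately show ?thesis by (simp only:)
  next
    case 5
    have v1: "vld i j l a' b c" "vld i j l a' b' c" using v 5 by (auto simp: vld_def)
    have 1: "joined k (P i j l a b c) (P i j l a' b c)"
      using 5 by (intro joinedI[OF t[OF v(1)] t[OF v1(1)], of "(j,b)" "(l,c)"]) (auto simp: P_def)
    have 2: "joined k (P i j l a' b c) (P i j l a' b' c)"
      using 5 by (intro joinedI[OF t[OF v1(1)] t[OF v1(2)], of "(i,a')" "(l,c)"]) (auto simp: P_def)
    have 3: "joined k (P i j l a' b' c) (P i j l a' b' c')"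
      using 5 by (intro joinedI[OF t[OF v1(2)] t[OF v(2)], of "(i,a')" "(j,b')"]) (auto simp: P_def)
    show ?thesis using joined_trans[OF t[OF v1(2)] joined_trans[OF t[OF v1(1)] 1 2] 3] .
  qed
qed

lemma std_P: "std i j \<subseteq> P i j l 0 (if i = j then 1 else 0) 2" "vld i j l 0 (if i = j then 1 else 0) 2"
   "std j l \<subseteq> P i j l 2 0 (if j = l then 1 else 0)" "vld i j l 2 0 (if j = l then 1 else 0)" "card (std i j) = 2"
  by (auto simp: std_def P_def vld_def)

lemma lab_mono:
  assumes "mono k i j l" shows "lab i j = lab j l"
proof -
  have "(std i j, std j l) \<in> (tri_adjacent (ed k) X)\<^sup>*"
    by (rule joined_all[OF assms std_P(2,4), unfolded joined_def, rule_format, OF std_P(5,1,5,3)])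
  then show ?thesis using assms edge_class_eq[of "std i j" "std j l" "ed k" X] by (simp add: lab_def mono_def)
qed

lemma P_class:
  assumes "mono k i j l" "vld i j l a b c"
  shows "P i j l a b c \<in> class_triangles (ed k) X (edge_class (ed k) X (std i j))"
proof -
  let ?e = "{(i,a),(j,b)}"
  have e: "card ?e = 2" "?e \<subseteq> P i j l a b c" using assms(2) by (auto simp: vld_def P_def)
  then have "(std i j, ?e) \<in> (tri_adjacent (ed k) X)\<^sup>*"
    by (intro joined_all[OF assms(1) std_P(2) assms(2), unfolded joined_def, rule_format, OF std_P(5,1)])
  then show ?thesis using e P_triangle[OF assms] by (auto simp: class_triangles_def edge_class_def)
qed

text \<open>Three rotations of the corners use every corner of each triple once and remain triangles
  when triples repeat. Averaging over them replaces the cover by its mean on each triple.\<close>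

lemma P_cover:
  fixes w :: "'i \<times> nat \<Rightarrow> real"
  assumes m: "mono k i j l" and w: "\<And>\<tau>. \<tau> \<in> class_triangles (ed k) X (edge_class (ed k) X (std i j)) \<Longrightarrow> 1 \<le> (\<Sum>x\<in>\<tau>. w x)"
  shows "1 \<le> (\<Sum>a<3. w (i,a)) / 3 + (\<Sum>a<3. w (j,a)) / 3 + (\<Sum>a<3. w (l,a)) / 3"
proof -
  have s: "1 \<le> w (i,a) + w (j,b) + w (l,c)" if v: "vld i j l a b c" for a b c
  proof -
    have "(\<Sum>x\<in>P i j l a b c. w x) = w (i,a) + w (j,b) + w (l,c)" using v by (auto simp: P_def vld_def)
    then show ?thesis using w[OF P_class[OF m v]] by simp
  qed
  have "1 \<le> w (i,0) + w (j,1) + w (l,2)" "1 \<le> w (i,1) + w (j,2) + w (l,0)" "1 \<le> w (i,2) + w (j,0) + w (l,1)"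
    by (rule s, simp add: vld_def)+
  moreover have "(\<Sum>a<3. f a) = f 0 + f 1 + f 2" for f :: "nat \<Rightarrow> real"
    by (simp add: eval_nat_numeral lessThan_Suc)
  ultimately show ?thesis by (simp only:) (simp add: field_simps)
qed

section \<open>From sampled vertices to the combinatorial core\<close>

definition covered where "covered v \<longleftrightarrow> (\<exists>i\<in>J. \<exists>a<3. v \<in> S i a)"
definition tr where "tr v = (SOME i. i \<in> J \<and> (\<exists>a<3. v \<in> S i a))"

lemma tr: "covered v \<Longrightarrow> tr v \<in> J \<and> (\<exists>a<3. v \<in> S (tr v) a)"
  unfolding tr_def covered_def by (rule someI_ex) blast
lemma tr_eq: "i \<in> J \<Longrightarrow> a < 3 \<Longrightarrow> v \<in> S i a \<Longrightarrow> tr v = i"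
  using tr[of v] S_disj[of "tr v" i _ a] unfolding covered_def by blast

definition samples :: "nat \<Rightarrow> (nat \<Rightarrow> 'v) set" where "samples K = {f \<in> {..<K} \<rightarrow>\<^sub>E V. (\<forall>a<K. covered (f a)) \<and> (\<forall>a<K. \<forall>b<K. a \<noteq> b \<longrightarrow> tr (f a) \<noteq> tr (f b) \<and> ok (tr (f a)) (tr (f b)))}"

definition avg where "avg w v = (if covered v then (\<Sum>a<3. w (tr v, a)) / 3 else (0::real))"

text \<open>The clusters of a triple have equal size, so averaging a cover over the triple does not
  change its cost.\<close>

lemma sum_avg: "(\<Sum>v\<in>V. avg w v) = (\<Sum>x\<in>X. real (card (S (fst x) (snd x))) * w x)"
proof -
  have sub: "(\<Union>x\<in>X. S (fst x) (snd x)) \<subseteq> V"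
  proof (rule UN_least)
    fix x assume "x \<in> X"
    then show "S (fst x) (snd x) \<subseteq> V" using S[of "fst x" "snd x"] by (auto simp: X_def)
  qed
  have fS: "finite (S (fst x) (snd x))" if "x \<in> X" for x using S[of "fst x" "snd x"] that finV finite_subset by (auto simp: X_def)
  have "(\<Sum>v\<in>V. avg w v) = (\<Sum>v\<in>(\<Union>x\<in>X. S (fst x) (snd x)). avg w v)"
    using sub finV by (intro sum.mono_neutral_right) (auto simp: avg_def covered_def X_def)
  also have "\<dots> = (\<Sum>x\<in>X. \<Sum>v\<in>S (fst x) (snd x). avg w v)"
    using finX fS S_disj by (intro sum.UNION_disjoint) (auto simp: X_def)
  also have "\<dots> = (\<Sum>x\<in>X. real (sz (fst x)) * ((\<Sum>a<3. w (fst x, a)) / 3))"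
  proof (rule sum.cong[OF refl])
    fix x assume x: "x \<in> X"
    then have i: "fst x \<in> J" "snd x < 3" by (auto simp: X_def)
    have "avg w v = (\<Sum>a<3. w (fst x, a)) / 3" if "v \<in> S (fst x) (snd x)" for v
      using tr_eq[OF i that] i that by (auto simp: avg_def covered_def)
    then have "(\<Sum>v\<in>S (fst x) (snd x). avg w v) = (\<Sum>v\<in>S (fst x) (snd x). (\<Sum>a<3. w (fst x, a)) / 3)"
      by (intro sum.cong refl)
    then show "(\<Sum>v\<in>S (fst x) (snd x). avg w v) = real (sz (fst x)) * ((\<Sum>a<3. w (fst x, a)) / 3)"
      using S[OF i] by simp
  qed
  also have "\<dots> = (\<Sum>i\<in>J. \<Sum>a<(3::nat). real (sz i) * ((\<Sum>a<3. w (i, a)) / 3))"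
    unfolding X_def sum.cartesian_product by (simp only: case_prod_unfold)
  also have "\<dots> = (\<Sum>i\<in>J. \<Sum>a<3. real (card (S i a)) * w (i,a))"
  proof (rule sum.cong[OF refl])
    fix i assume i: "i \<in> J"
    have "(\<Sum>a<3. real (card (S i a)) * w (i,a)) = (\<Sum>a<3. real (sz i) * w (i,a))" using S[OF i] by (intro sum.cong) auto
    then show "(\<Sum>a<(3::nat). real (sz i) * ((\<Sum>a<3. w (i, a)) / 3)) = (\<Sum>a<3. real (card (S i a)) * w (i,a))"
      by (simp add: sum_distrib_left[symmetric])
  qed
  also have "\<dots> = (\<Sum>x\<in>X. real (card (S (fst x) (snd x))) * w x)"
    unfolding X_def sum.cartesian_product by (simp only: case_prod_unfold prod.collapse)
  finally show ?thesis .
qed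

text \<open>All pairs of sampled triples are coloured, so the sample is a complete two-coloured
  structure; if every class were cheap on it, \<open>tri_core\<close> would give a
  contradiction.\<close>

lemma core_sample:
  assumes f: "f \<in> samples K" and K: "0 < K"
    and w: "\<And>l x. 0 \<le> w l x" and cov: "\<And>k e \<tau>. \<tau> \<in> class_triangles (ed k) X (edge_class (ed k) X e) \<Longrightarrow> 1 \<le> (\<Sum>x\<in>\<tau>. w (k, edge_class (ed k) X e) x)"
  shows "\<exists>a<K. \<exists>b<K. K / 9 \<le> (\<Sum>c<K. avg (w (lab (tr (f a)) (tr (f b)))) (f c))"
proof (rule ccontr)
  assume n: "\<not> ?thesis"
  let ?t = "\<lambda>a. tr (f a)"
  have fc: "covered (f a)" "?t a \<in> J" if "a < K" for a using f that tr by (auto simp: samples_def)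
  have cp: "compat (?t a) (?t b)" if "a < K" "b < K" for a b
    using f that fc by (cases "a = b") (auto simp: samples_def compat_def)
  have mn: "mono (kap (?t b) (?t c)) (?t a) (?t b) (?t c)"
    if "a < K" "b < K" "c < K" "kap (?t a) (?t b) = kap (?t b) (?t c)" "kap (?t a) (?t c) = kap (?t b) (?t c)" for a b c
    using that cp by (auto simp: mono_def)
  have "tri_core {..<K} (\<lambda>a b. kap (?t a) (?t b)) (\<lambda>a b. lab (?t a) (?t b)) (\<lambda>l a. avg (w l) (f a)) Red Blue"
  proof
    show "{..<K} \<noteq> {}" using K by auto
    show "lab (?t u) (?t v) = lab (?t v) (?t u)" for u v by (rule lab_sym)
    show "kap (?t u) (?t v) = kap (?t v) (?t u)" for u v by (rule kap_sym)
    show "kap (?t u) (?t v) = kap (?t x) (?t y)" if "lab (?t u) (?t v) = lab (?t x) (?t y)" for u v x y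
      using that by (simp add: lab_def)
    show "0 \<le> avg (w l) (f v)" for l v
      using sum_nonneg[of "{..<3}" "\<lambda>a. w l (tr (f v), a)"] w by (simp add: avg_def)
    fix u v x assume a: "u \<in> {..<K}" "v \<in> {..<K}" "x \<in> {..<K}" "kap (?t u) (?t v) = kap (?t v) (?t x)" "kap (?t u) (?t x) = kap (?t v) (?t x)"
    then have m: "mono (kap (?t v) (?t x)) (?t u) (?t v) (?t x)" using mn by auto
    show "lab (?t u) (?t v) = lab (?t v) (?t x)" using lab_mono[OF m] .
    have "lab (?t u) (?t v) = (kap (?t v) (?t x), edge_class (ed (kap (?t v) (?t x))) X (std (?t u) (?t v)))" using a by (simp add: lab_def)
    then show "1 \<le> avg (w (lab (?t u) (?t v))) (f u) + avg (w (lab (?t u) (?t v))) (f v) + avg (w (lab (?t u) (?t v))) (f x)"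
      using P_cover[OF m cov] fc a by (simp add: avg_def)
  next
    fix u v assume "u \<in> {..<K}" "v \<in> {..<K}"
    then show "9 * (\<Sum>x<K. avg (w (lab (?t u) (?t v))) (f x)) < card {..<K}" using n by force
  qed auto
  then show False by (rule tri_core.contradiction)
qed

text \<open>If no class has a large packing, duality gives each class a cheap cover. Then every
  member of \<open>samples K\<close> sees an expensive class, which by \<open>sampling\<close>
  happens too rarely for \<open>big\<close>.\<close>

theorem packing_class:
  fixes \<tau> \<epsilon> :: real
  assumes \<tau>: "0 < \<tau>" "\<tau> \<le> 1/9" and \<epsilon>: "0 < \<epsilon>" "\<epsilon> \<le> 1" and K: "0 < K"
    and big: "(real K)\<^sup>2 * exp (8 * \<tau> - 2 * \<tau>\<^sup>2 * K) * real (card V ^ K) < card (samples K)"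
  shows "\<exists>k e \<rho>. (\<forall>t\<in>class_triangles (ed k) X (edge_class (ed k) X e). (0::real) \<le> \<rho> t) \<and>
    (\<forall>x\<in>X. sum \<rho> {t\<in>class_triangles (ed k) X (edge_class (ed k) X e). x \<in> t} \<le> (1 + 2 * \<epsilon>) * card (S (fst x) (snd x))) \<and>
    (1/9 - \<tau>) * card V < (1 + \<epsilon>) * sum \<rho> (class_triangles (ed k) X (edge_class (ed k) X e))"
proof (rule ccontr)
  assume n: "\<not> ?thesis"
  let ?T = "\<lambda>k e. class_triangles (ed k) X (edge_class (ed k) X e)"
  let ?p = "\<lambda>x. real (card (S (fst x) (snd x)))"
  have p0: "0 < ?p x" if "x \<in> X" for x using S[of "fst x" "snd x"] sz that by (auto simp: X_def)
  \<comment> \<open>Covers are chosen for each colour and class rather than for each edge, so that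
    equal labels share one cover; only sets that are classes get the cost bound.\<close>
  define \<Phi> where "\<Phi> k cl w \<longleftrightarrow> (\<forall>x. 0 \<le> w x \<and> w x \<le> 1) \<and> (\<forall>t\<in>class_triangles (ed k) X cl. 1 \<le> (\<Sum>x\<in>t. w x)) \<and>
     ((\<exists>e. cl = edge_class (ed k) X e) \<longrightarrow> (\<Sum>x\<in>X. ?p x * w x) \<le> (1/9 - \<tau>) * card V)" for k cl and w :: "'i \<times> nat \<Rightarrow> real"
  have ex: "\<exists>w. \<Phi> k cl w" for k cl
  proof -
    have T: "t \<subseteq> X \<and> card t = 3" if "t \<in> class_triangles (ed k) X cl" for t
      using that by (auto simp: class_triangles_def triangles_def)
    let ?Tc = "class_triangles (ed k) X cl"
    have "\<exists>\<rho> w. (\<forall>t\<in>?Tc. (0::real) \<le> \<rho> t) \<and> (\<forall>x\<in>X. (\<Sum>t\<in>{t\<in>?Tc. x \<in> t}. \<rho> t) \<le> (1 + 2 * \<epsilon>) * ?p x) \<and>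
       (\<forall>x. 0 \<le> w x \<and> w x \<le> 1) \<and> (\<forall>t\<in>?Tc. 1 \<le> (\<Sum>x\<in>t. w x)) \<and>
       (\<Sum>x\<in>X. ?p x * w x) \<le> (1 + \<epsilon>) * (\<Sum>t\<in>?Tc. \<rho> t)"
      by (rule packing_cover_duality[OF finX]) (use T p0 \<epsilon> in auto)
    then obtain \<rho> w where d: "\<forall>t\<in>?Tc. (0::real) \<le> \<rho> t" "\<forall>x\<in>X. (\<Sum>t\<in>{t\<in>?Tc. x \<in> t}. \<rho> t) \<le> (1 + 2 * \<epsilon>) * ?p x"
       "\<forall>x. 0 \<le> w x \<and> w x \<le> 1" "\<forall>t\<in>?Tc. 1 \<le> (\<Sum>x\<in>t. w x)"
       "(\<Sum>x\<in>X. ?p x * w x) \<le> (1 + \<epsilon>) * (\<Sum>t\<in>?Tc. \<rho> t)" by (elim exE conjE)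
    have "(\<Sum>x\<in>X. ?p x * w x) \<le> (1/9 - \<tau>) * card V" if "cl = edge_class (ed k) X e" for e
    proof (rule ccontr)
      assume "\<not> ?thesis"
      then have "(1/9 - \<tau>) * card V < (1 + \<epsilon>) * sum \<rho> ?Tc" using d(5) by linarith
      then show False using n d(1,2) that by blast
    qed
    then show ?thesis using d(3,4) unfolding \<Phi>_def by blast
  qed
  define w where "w l = (SOME w. \<Phi> (fst l) (snd l) w)" for l
  have \<Phi>w: "\<Phi> k cl (w (k,cl))" for k cl unfolding w_def fst_conv snd_conv using ex by (rule someI_ex)
  have w: "\<And>k cl x. 0 \<le> w (k,cl) x \<and> w (k,cl) x \<le> 1"
    "\<And>k cl t. t \<in> class_triangles (ed k) X cl \<Longrightarrow> 1 \<le> (\<Sum>x\<in>t. w (k,cl) x)"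
    "\<And>k e. (\<Sum>x\<in>X. ?p x * w (k, edge_class (ed k) X e) x) \<le> (1/9 - \<tau>) * card V"
    using \<Phi>w unfolding \<Phi>_def by blast+
  have w1: "0 \<le> w l x" "w l x \<le> 1" for l x using w(1)[of "fst l" "snd l" x] by auto
  have "card (samples K) \<le> (real K)\<^sup>2 * exp (8 * \<tau> - 2 * \<tau>\<^sup>2 * K) * real (card V ^ K)"
  proof (rule sampling[OF finV _ _ \<tau>, where W = "\<lambda>l. avg (w l)" and L = "\<lambda>u v. lab (tr u) (tr v)"])
    show "0 \<le> avg (w l) v \<and> avg (w l) v \<le> 1" for l v
    proof -
      have "(\<Sum>a<3. w l (tr v, a)) \<le> (\<Sum>a<(3::nat). 1)" using w1 by (intro sum_mono)
      moreover have "0 \<le> (\<Sum>a<3. w l (tr v, a))" using w1 by (intro sum_nonneg)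
      ultimately show ?thesis by (simp add: avg_def)
    qed
    show "(\<Sum>x\<in>V. avg (w (lab (tr u) (tr v))) x) \<le> (1/9 - \<tau>) * card V" for u v
      unfolding sum_avg lab_def by (rule w(3))
    show "samples K \<subseteq> {..<K} \<rightarrow>\<^sub>E V" by (auto simp: samples_def)
    show "\<exists>a<K. \<exists>b<K. K / 9 \<le> (\<Sum>c<K. avg (w (lab (tr (f a)) (tr (f b)))) (f c))" if "f \<in> samples K" for f
      by (rule core_sample[OF that K, where w = w]) (use w1(1) w(2) in auto)
  qed
  then show False using big by simp
qed

end

section \<open>Clusters of a coloured complete graph\<close>

text \<open>A packing that covers as many points as possible cannot leave more than an \<eta> share,
  or \<open>tri\<close> would find another triple in the remainder.\<close>

lemma triple_packing:
  fixes E :: "'v \<Rightarrow> 'v \<Rightarrow> bool" and \<nu> \<eta> \<epsilon> :: real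
  assumes A: "finite A" and \<nu>: "0 < \<nu>" and \<eta>: "0 < \<eta>"
    and tri: "\<And>W. W \<subseteq> A \<Longrightarrow> \<eta> * card A < card W \<Longrightarrow>
      \<exists>t :: nat \<Rightarrow> 'v set. \<exists>m>0. (\<forall>a<3. t a \<subseteq> W \<and> card (t a) = m) \<and> \<nu> * card W \<le> m \<and>
      (\<forall>a<3. \<forall>b<3. a \<noteq> b \<longrightarrow> t a \<inter> t b = {}) \<and> good t"
    and good: "\<And>t t'. (\<And>a. a < 3 \<Longrightarrow> t a = t' a) \<Longrightarrow> good t \<Longrightarrow> good t'"
  shows "\<exists>Q. Q \<subseteq> ({..<3} \<rightarrow>\<^sub>E Pow A) \<and>
     (\<forall>t\<in>Q. good t \<and> (\<exists>m>0. (\<forall>a<3. card (t a) = m) \<and> \<nu> * \<eta> * card A \<le> m)) \<and>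
     (\<forall>t\<in>Q. \<forall>t'\<in>Q. \<forall>a<3. \<forall>b<3. (t,a) \<noteq> (t',b) \<longrightarrow> t a \<inter> t' b = {}) \<and>
     card (A - (\<Union>t\<in>Q. \<Union>a<3. t a)) \<le> \<eta> * card A"
proof -
  define U where "U Q = (\<Union>t\<in>Q. \<Union>a<(3::nat). t a)" for Q :: "(nat \<Rightarrow> 'v set) set"
  define ok where "ok Q \<longleftrightarrow> Q \<subseteq> ({..<3} \<rightarrow>\<^sub>E Pow A) \<and>
     (\<forall>t\<in>Q. good t \<and> (\<exists>m>0. (\<forall>a<3. card (t a) = m) \<and> \<nu> * \<eta> * card A \<le> m)) \<and>
     (\<forall>t\<in>Q. \<forall>t'\<in>Q. \<forall>a<3. \<forall>b<3. (t,a) \<noteq> (t',b) \<longrightarrow> t a \<inter> t' b = {})" for Q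
  have finP: "finite ({..<3::nat} \<rightarrow>\<^sub>E Pow A)" using A by (auto intro: finite_PiE)
  have finok: "finite {Q. ok Q}" by (rule finite_subset[of _ "Pow ({..<3::nat} \<rightarrow>\<^sub>E Pow A)"]) (use finP in \<open>auto simp: ok_def\<close>)
  have "ok {}" by (simp add: ok_def)
  then have ne: "{Q. ok Q} \<noteq> {}" by blast
  obtain Q where Q: "ok Q" "\<And>Q'. ok Q' \<Longrightarrow> card (U Q') \<le> card (U Q)"
    using arg_min_if_finite[OF finok ne, of "\<lambda>Q. - int (card (U Q))"] by force
  have UA: "U Q \<subseteq> A" if "ok Q" for Q using that by (fastforce simp: ok_def U_def PiE_iff)
  have "card (A - U Q) \<le> \<eta> * card A"
  proof (rule ccontr)
    assume "\<not> ?thesis"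
    then have big: "\<eta> * card A < card (A - U Q)" by simp
    obtain t m where t: "m > 0" "\<forall>a<3. t a \<subseteq> A - U Q \<and> card (t a) = m" "\<nu> * card (A - U Q) \<le> m"
      "\<forall>a<3. \<forall>b<3. a \<noteq> b \<longrightarrow> t a \<inter> t b = {}" "good t"
      using tri[OF _ big] by blast
    define t1 where "t1 = restrict t {..<3}"
    have t1: "t1 a = t a" if "a < 3" for a using that by (simp add: t1_def)
    have "\<nu> * (\<eta> * card A) \<le> \<nu> * card (A - U Q)" using big \<nu> by (intro mult_left_mono) auto
    then have sz: "\<nu> * \<eta> * card A \<le> m" using t(3) by (simp add: mult.assoc)
    have new: "t1 a \<inter> s b = {}" "s b \<inter> t1 a = {}" if "s \<in> Q" "a < 3" "b < 3" for s a b
      using t(2) that t1 by (auto simp: U_def) blast+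
    have g1: "good t1" by (rule good[OF _ t(5)]) (simp add: t1)
    have mem: "t1 \<in> {..<3} \<rightarrow>\<^sub>E Pow A" using t(2) by (auto simp: t1_def)
    have "ok (insert t1 Q)"
      unfolding ok_def
    proof (intro conjI)
      show "insert t1 Q \<subseteq> {..<3} \<rightarrow>\<^sub>E Pow A" using mem Q(1) by (simp add: ok_def)
      show "\<forall>t\<in>insert t1 Q. good t \<and> (\<exists>m>0. (\<forall>a<3. card (t a) = m) \<and> \<nu> * \<eta> * card A \<le> m)"
        using Q(1) g1 t(1,2) t1 sz by (auto simp: ok_def)
      show "\<forall>t\<in>insert t1 Q. \<forall>t'\<in>insert t1 Q. \<forall>a<3. \<forall>b<3. (t,a) \<noteq> (t',b) \<longrightarrow> t a \<inter> t' b = {}"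
      proof (intro ballI allI impI)
        fix r r' a b assume r: "r \<in> insert t1 Q" "r' \<in> insert t1 Q" "a < (3::nat)" "b < (3::nat)" "(r,a) \<noteq> (r',b)"
        consider "r = t1" "r' = t1" | "r = t1" "r' \<in> Q" | "r \<in> Q" "r' = t1" | "r \<in> Q" "r' \<in> Q" using r by blast
        then show "r a \<inter> r' b = {}"
        proof cases
          case 1 then show ?thesis using t(4) t1 r by simp
        next
          case 2 then show ?thesis using new(1) r by simp
        next
          case 3 then show ?thesis using new(2) r by simp
        next
          case 4 then show ?thesis using Q(1) r unfolding ok_def by blast
        qed
      qed
    qed
    moreover have "card (U Q) < card (U (insert t1 Q))"
    proof (rule psubset_card_mono)
      show "finite (U (insert t1 Q))" using UA[OF \<open>ok (insert t1 Q)\<close>] A finite_subset by blast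
      have "card (t 0) = m" "t 0 \<subseteq> A - U Q" using t(2) by auto
      then obtain v where v: "v \<in> t 0" "v \<notin> U Q" using t(1) by (metis Diff_iff card.empty equals0I less_irrefl subsetD)
      have "t1 0 \<subseteq> U (insert t1 Q)" by (auto simp: U_def)
      then have "v \<in> U (insert t1 Q)" using v t1[of 0] by auto
      moreover have "U Q \<subseteq> U (insert t1 Q)" by (auto simp: U_def)
      ultimately show "U Q \<subset> U (insert t1 Q)" using v by blast
    qed
    ultimately show False using Q(2) by (metis not_le)
  qed
  then have c: "card (A - (\<Union>t\<in>Q. \<Union>a<3. t a)) \<le> \<eta> * card A" by (simp only: U_def)
  show ?thesis using Q(1)[unfolded ok_def] c by (intro exI[of _ Q]) (elim conjE, intro conjI; assumption)
qed

lemma card_samples_hit: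
  assumes "finite V" "a < K" "U \<subseteq> V"
  shows "card {f \<in> {..<K} \<rightarrow>\<^sub>E V. f a \<in> U} * card V = card U * card V ^ K"
proof -
  have "{f \<in> {..<K} \<rightarrow>\<^sub>E V. f a \<in> U} = PiE {..<K} (\<lambda>i. if i = a then U else V)"
  proof (rule set_eqI)
    fix f :: "nat \<Rightarrow> 'a"
    have "(\<forall>i\<in>{..<K}. f i \<in> V) \<and> f a \<in> U \<longleftrightarrow> (\<forall>i\<in>{..<K}. f i \<in> (if i = a then U else V))"
      using assms(2,3) by (metis lessThan_iff subsetD)
    then show "f \<in> {f \<in> {..<K} \<rightarrow>\<^sub>E V. f a \<in> U} \<longleftrightarrow> f \<in> PiE {..<K} (\<lambda>i. if i = a then U else V)"
      unfolding mem_Collect_eq PiE_iff by blast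
  qed
  then have "card {f \<in> {..<K} \<rightarrow>\<^sub>E V. f a \<in> U} = (\<Prod>i<K. if i = a then card U else card V)"
    by (simp add: card_PiE if_distrib)
  also have "\<dots> = card U * card V ^ (K - 1)"
    using assms(2) by (simp add: prod.remove[of "{..<K}" a] card_Diff_singleton)
  finally show ?thesis using assms(2) by (cases K) (auto simp: mult_ac)
qed

lemma card_samples_pair:
  assumes V: "finite V" and ab: "a < K" "b < K" "a \<noteq> b" and R: "R \<subseteq> V \<times> V"
  shows "card {f \<in> {..<K} \<rightarrow>\<^sub>E V. (f a, f b) \<in> R} * (card V)\<^sup>2 \<le> card R * card V ^ K"
proof -
  have finR: "finite R" using R V finite_subset by blast
  let ?F = "\<lambda>r. PiE {..<K} (\<lambda>i. if i = a then {fst r} else if i = b then {snd r} else V)"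
  have "{f \<in> {..<K} \<rightarrow>\<^sub>E V. (f a, f b) \<in> R} \<subseteq> (\<Union>r\<in>R. ?F r)"
  proof
    fix f assume f: "f \<in> {f \<in> {..<K} \<rightarrow>\<^sub>E V. (f a, f b) \<in> R}"
    then have "f \<in> ?F (f a, f b)" by (auto simp: PiE_iff)
    then show "f \<in> (\<Union>r\<in>R. ?F r)" using f by blast
  qed
  then have "card {f \<in> {..<K} \<rightarrow>\<^sub>E V. (f a, f b) \<in> R} \<le> card (\<Union>r\<in>R. ?F r)"
    using finR V by (intro card_mono) (auto intro!: finite_PiE)
  also have "\<dots> \<le> (\<Sum>r\<in>R. card (?F r))" by (rule card_UN_le[OF finR])
  also have "\<dots> = (\<Sum>r\<in>R. card V ^ (K - 2))"
  proof (rule sum.cong[OF refl])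
    fix r
    have "card (?F r) = (\<Prod>i<K. if i = a \<or> i = b then 1 else card V)"
      by (simp add: card_PiE) (intro prod.cong, auto)
    also have "\<dots> = card V ^ card ({..<K} - {a,b})"
      by (simp add: prod.If_cases Int_def set_diff_eq conj_commute)
    also have "card ({..<K} - {a,b}) = K - 2" using ab by (simp add: card_Diff_subset)
    finally show "card (?F r) = card V ^ (K - 2)" .
  qed
  finally have "card {f \<in> {..<K} \<rightarrow>\<^sub>E V. (f a, f b) \<in> R} * (card V)\<^sup>2 \<le> card R * card V ^ (K - 2) * (card V)\<^sup>2"
    by simp
  also have "\<dots> = card R * card V ^ (K - 2 + 2)" by (simp only: power_add mult.assoc)
  also have "K - 2 + 2 = K" using ab by linarith
  finally show ?thesis .
qed

text \<open>Union bound: a coordinate falls into \<open>U\<close> with probability at most 1/(4K),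
  an ordered pair of coordinates into \<open>R\<close> with probability at most 1/(4 K^2), so at
  least half of the samples survive.\<close>

lemma many_good_samples:
  fixes V :: "'v set"
  assumes V: "finite V" "V \<noteq> {}" and U: "U \<subseteq> V" "4 * real K * card U \<le> card V"
    and R: "R \<subseteq> V \<times> V" "4 * (real K)\<^sup>2 * card R \<le> (card V)\<^sup>2"
  shows "card V ^ K \<le> 2 * card {f \<in> {..<K} \<rightarrow>\<^sub>E V. (\<forall>a<K. f a \<notin> U) \<and> (\<forall>a<K. \<forall>b<K. a \<noteq> b \<longrightarrow> (f a, f b) \<notin> R)}"
proof -
  let ?P = "{..<K} \<rightarrow>\<^sub>E V"
  let ?G = "{f \<in> ?P. (\<forall>a<K. f a \<notin> U) \<and> (\<forall>a<K. \<forall>b<K. a \<noteq> b \<longrightarrow> (f a, f b) \<notin> R)}"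
  let ?B1 = "\<lambda>a. {f \<in> ?P. f a \<in> U}" and ?B2 = "\<lambda>ab. {f \<in> ?P. fst ab \<noteq> snd ab \<and> (f (fst ab), f (snd ab)) \<in> R}"
  define n where "n = real (card V)"
  have n0: "0 < n" using V by (simp add: n_def card_gt_0_iff)
  have finP: "finite ?P" using V by (auto intro: finite_PiE)
  have "?P \<subseteq> ?G \<union> ((\<Union>a\<in>{..<K}. ?B1 a) \<union> (\<Union>ab\<in>{..<K}\<times>{..<K}. ?B2 ab))" by force
  then have "card ?P \<le> card (?G \<union> ((\<Union>a\<in>{..<K}. ?B1 a) \<union> (\<Union>ab\<in>{..<K}\<times>{..<K}. ?B2 ab)))"
    using finP by (intro card_mono) auto
  also have "\<dots> \<le> card ?G + card ((\<Union>a\<in>{..<K}. ?B1 a) \<union> (\<Union>ab\<in>{..<K}\<times>{..<K}. ?B2 ab))" by (rule card_Un_le)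
  also have "card ((\<Union>a\<in>{..<K}. ?B1 a) \<union> (\<Union>ab\<in>{..<K}\<times>{..<K}. ?B2 ab)) \<le> card (\<Union>a\<in>{..<K}. ?B1 a) + card (\<Union>ab\<in>{..<K}\<times>{..<K}. ?B2 ab)"
    by (rule card_Un_le)
  also have "card (\<Union>a\<in>{..<K}. ?B1 a) \<le> (\<Sum>a\<in>{..<K}. card (?B1 a))" by (rule card_UN_le) simp
  also have "card (\<Union>ab\<in>{..<K}\<times>{..<K}. ?B2 ab) \<le> (\<Sum>ab\<in>{..<K}\<times>{..<K}. card (?B2 ab))" by (rule card_UN_le) simp
  finally have "card ?P \<le> card ?G + ((\<Sum>a\<in>{..<K}. card (?B1 a)) + (\<Sum>ab\<in>{..<K}\<times>{..<K}. card (?B2 ab)))" by simp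
  then have "real (card ?P) \<le> real (card ?G + ((\<Sum>a\<in>{..<K}. card (?B1 a)) + (\<Sum>ab\<in>{..<K}\<times>{..<K}. card (?B2 ab))))"
    by (rule of_nat_mono)
  then have le: "n ^ K \<le> card ?G + ((\<Sum>a\<in>{..<K}. real (card (?B1 a))) + (\<Sum>ab\<in>{..<K}\<times>{..<K}. real (card (?B2 ab))))"
    using V by (simp add: card_PiE n_def)
  have B1: "real (card (?B1 a)) \<le> n ^ K * (card U / n)" if "a \<in> {..<K}" for a
  proof -
    have "real (card (?B1 a) * card V) = real (card U * card V ^ K)" using card_samples_hit[OF V(1) _ U(1), of a K] that by simp
    then have "real (card (?B1 a)) * n = card U * n ^ K" by (simp add: n_def)
    then show ?thesis using n0 by (simp add: field_simps)
  qed
  have B2: "real (card (?B2 ab)) \<le> n ^ K * (card R / n\<^sup>2)" if "ab \<in> {..<K}\<times>{..<K}" for ab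
  proof (cases "fst ab = snd ab")
    case True
    then have "?B2 ab = {}" by simp
    then show ?thesis using n0 by (metis card.empty divide_nonneg_nonneg mult_nonneg_nonneg of_nat_0 of_nat_0_le_iff less_imp_le zero_le_power)
  next
    case False
    then have "real (card (?B2 ab) * (card V)\<^sup>2) \<le> real (card R * card V ^ K)"
      using card_samples_pair[OF V(1) _ _ False R(1), of K] that by (intro of_nat_mono) (auto simp: mem_Times_iff)
    then have "real (card (?B2 ab)) * n\<^sup>2 \<le> card R * n ^ K" by (simp add: n_def)
    then show ?thesis using n0 by (simp add: field_simps)
  qed
  have "(\<Sum>a\<in>{..<K}. real (card (?B1 a))) \<le> card {..<K} * (n ^ K * (card U / n))" using B1 by (rule sum_bounded_above)
  also have "\<dots> = n ^ K * (K * card U / n)" by simp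
  also have "\<dots> \<le> n ^ K * (1/4)" using U(2) n0 by (intro mult_left_mono) (auto simp: n_def field_simps)
  finally have 1: "(\<Sum>a\<in>{..<K}. real (card (?B1 a))) \<le> n ^ K * (1/4)" .
  have "(\<Sum>ab\<in>{..<K}\<times>{..<K}. real (card (?B2 ab))) \<le> card ({..<K}\<times>{..<K}) * (n ^ K * (card R / n\<^sup>2))" using B2 by (rule sum_bounded_above)
  also have "\<dots> = n ^ K * ((real K)\<^sup>2 * card R / n\<^sup>2)" by (simp add: card_cartesian_product power2_eq_square)
  also have "\<dots> \<le> n ^ K * (1/4)" using R(2) n0 by (intro mult_left_mono) (auto simp: n_def field_simps)
  finally have 2: "(\<Sum>ab\<in>{..<K}\<times>{..<K}. real (card (?B2 ab))) \<le> n ^ K * (1/4)" .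
  have "n ^ K \<le> 2 * real (card ?G)" using le 1 2 by linarith
  then have "real (card V ^ K) \<le> real (2 * card ?G)" by (simp add: n_def)
  then show ?thesis by (simp only: of_nat_le_iff)
qed

text \<open>Starting the regularization from residues modulo k makes it rare that two sampled
  vertices fall into the same part, where no colour is assigned.\<close>

lemma card_same_part:
  fixes p :: "nat \<Rightarrow> nat"
  assumes k: "0 < k" "k \<le> N" and p: "\<forall>x\<in>{..<N}. \<forall>y\<in>{..<N}. p x = p y \<longrightarrow> x mod k = y mod k"
  shows "card {s \<in> {..<N} \<times> {..<N}. p (fst s) = p (snd s)} * k \<le> 2 * N\<^sup>2"
proof -
  have c: "card {y\<in>{..<N}. y mod k = r} \<le> N div k + 1" for r
  proof -
    have "card {y\<in>{..<N}. y mod k = r} \<le> card {..N div k}"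
    proof (rule card_inj_on_le)
      show "inj_on (\<lambda>y. y div k) {y\<in>{..<N}. y mod k = r}"
        by (rule inj_onI) (metis (mono_tags, lifting) div_mult_mod_eq mem_Collect_eq)
      show "(\<lambda>y. y div k) ` {y\<in>{..<N}. y mod k = r} \<subseteq> {..N div k}" by (auto intro!: div_le_mono)
    qed simp
    then show ?thesis by simp
  qed
  have "{s \<in> {..<N} \<times> {..<N}. p (fst s) = p (snd s)} \<subseteq> (SIGMA x:{..<N}. {y\<in>{..<N}. y mod k = x mod k})"
  proof (intro subsetI)
    fix s assume s: "s \<in> {s \<in> {..<N} \<times> {..<N}. p (fst s) = p (snd s)}"
    have "fst s mod k = snd s mod k" by (rule p[rule_format]) (use s in auto)
    then show "s \<in> (SIGMA x:{..<N}. {y\<in>{..<N}. y mod k = x mod k})" using s by (cases s) simp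
  qed
  then have "card {s \<in> {..<N} \<times> {..<N}. p (fst s) = p (snd s)} \<le> card (SIGMA x:{..<N}. {y\<in>{..<N}. y mod k = x mod k})"
    by (intro card_mono) auto
  also have "\<dots> = (\<Sum>x<N. card {y\<in>{..<N}. y mod k = x mod k})" by (subst card_SigmaI) auto
  also have "\<dots> \<le> (\<Sum>x<N. N div k + 1)" by (intro sum_mono c)
  also have "\<dots> = N * (N div k + 1)" by simp
  finally have "card {s \<in> {..<N} \<times> {..<N}. p (fst s) = p (snd s)} * k \<le> N * (N div k + 1) * k" by (rule mult_right_mono) simp
  also have "\<dots> = N * (N div k * k + k)" by (simp add: algebra_simps)
  also have "\<dots> \<le> N * (N + N)" using k by (intro mult_left_mono add_mono) auto
  finally show ?thesis by (simp add: power2_eq_square algebra_simps)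
qed

theorem cluster_structure:
  fixes \<zeta> :: real and K :: nat
  assumes \<zeta>: "0 < \<zeta>" "\<zeta> \<le> 1/4" and K: "0 < K"
  shows "\<exists>\<mu>>(0::real). \<exists>N0. \<forall>N\<ge>N0. \<forall>c :: nat set \<Rightarrow> colour.
    \<exists>J :: (nat \<Rightarrow> nat set) set. \<exists>sz lc cc ok. cluster_system {..<N} J (\<lambda>t. t) sz cc ok \<and>
      (\<forall>t\<in>J. \<mu> * N \<le> sz t) \<and>
      (\<forall>k x y. cluster_system.ed J lc cc ok k x y \<longrightarrow> bidense (\<lambda>u v. c {u,v} = k) \<zeta> (fst x (snd x)) (fst y (snd y))) \<and>
      N ^ K \<le> 2 * card (cluster_system.samples {..<N} J (\<lambda>t. t) ok K)"
proof -
  obtain \<nu> m0 where \<nu>: "(0::real) < \<nu>" and mt: "\<forall>E (W :: nat set). finite W \<longrightarrow> m0 \<le> card W \<longrightarrow> (\<forall>x y. E x y = E y x) \<longrightarrow>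
    (\<exists>t :: nat \<Rightarrow> nat set. \<exists>m>0. (\<forall>a<3. t a \<subseteq> W \<and> card (t a) = m) \<and> \<nu> * card W \<le> m \<and>
      (\<forall>a<3. \<forall>b<3. a \<noteq> b \<longrightarrow> t a \<inter> t b = {}) \<and>
      ((\<forall>a<3. \<forall>b<3. a \<noteq> b \<longrightarrow> bidense E \<zeta> (t a) (t b)) \<or>
       (\<forall>a<3. \<forall>b<3. a \<noteq> b \<longrightarrow> bidense (\<lambda>x y. \<not> E x y) \<zeta> (t a) (t b))))"
    using mono_triple[OF \<zeta>, where 'v = nat] by (elim exE conjE) (rule that)
  \<comment> \<open>Half of the waste 1/(4K) allowed by \<open>many_good_samples\<close>: one \<eta>
    for remainders inside large parts, one for all small parts.\<close>
  define \<eta> where "\<eta> = 1 / (8 * real K)"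
  have \<eta>: "0 < \<eta>" using K by (simp add: \<eta>_def)
  \<comment> \<open>A cluster is at least a \<nu> \<eta> share of its part, so density with
    parameter \<epsilon> passes to clusters with parameter \<zeta>; the second bound limits the
    irregular pairs.\<close>
  define \<epsilon> where "\<epsilon> = min (\<zeta> * \<nu> * \<eta>) (1 / (8 * (real K)\<^sup>2))"
  have \<epsilon>: "0 < \<epsilon>" "\<epsilon> \<le> \<zeta> * \<nu> * \<eta>" "\<epsilon> \<le> 1 / (8 * (real K)\<^sup>2)" using \<zeta> \<nu> \<eta> K by (auto simp: \<epsilon>_def)
  define k where "k = 16 * K\<^sup>2"
  have k: "0 < k" using K by (simp add: k_def)
  obtain T where T: "\<forall>(V :: nat set) E (p0 :: nat \<Rightarrow> nat). finite V \<longrightarrow> p0 ` V \<subseteq> {..<k} \<longrightarrow>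
    (\<exists>p :: nat \<Rightarrow> nat. p ` V \<subseteq> {..<T} \<and> (\<forall>x\<in>V. \<forall>y\<in>V. p x = p y \<longrightarrow> p0 x = p0 y) \<and>
      card {s \<in> V \<times> V. irregular E \<epsilon> (part V p (p (fst s))) (part V p (p (snd s)))} \<le> \<epsilon> * (card V)\<^sup>2)"
    using regularity[OF \<epsilon>(1), where 'v = nat and ?k0.0 = k] by (elim exE) (rule that)
  define \<mu> where "\<mu> = \<nu> * \<eta>\<^sup>2 / (real T + 1)"
  have \<mu>: "0 < \<mu>" using \<nu> \<eta> by (simp add: \<mu>_def add_nonneg_pos)
  define N0 where "N0 = nat \<lceil>real m0 * (real T + 1) / \<eta>\<^sup>2\<rceil> + k + 1"
  show ?thesis
  proof (rule exI[of _ \<mu>], rule conjI[OF \<mu>], rule exI[of _ N0], intro allI impI)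
    fix N and c :: "nat set \<Rightarrow> colour" assume N: "N0 \<le> N"
    have Nk: "k \<le> N" "0 < N" using N by (auto simp: N0_def)
    have "real m0 * (real T + 1) / \<eta>\<^sup>2 \<le> real N0" unfolding N0_def by linarith
    then have "real m0 * (real T + 1) / \<eta>\<^sup>2 \<le> real N" using N by linarith
    then have Nm: "real m0 \<le> \<eta>\<^sup>2 * N / (real T + 1)" using \<eta> by (simp add: field_simps)
    let ?E = "\<lambda>u v. c {u,v} = Red"
    have Esym: "?E u v = ?E v u" for u v by (simp add: insert_commute)
    have nE: "(\<lambda>u v. \<not> ?E u v) = (\<lambda>u v. c {u,v} = Blue)" by (metis colour.distinct(1) colour.exhaust)
    have bsym: "bidense (\<lambda>u v. c {u,v} = k) \<zeta> A B \<Longrightarrow> bidense (\<lambda>u v. c {u,v} = k) \<zeta> B A" for k A B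
      by (rule bidense_sym) (simp add: insert_commute)
    let ?V = "{..<N}"
    have modk: "(\<lambda>x. x mod k) ` ?V \<subseteq> {..<k}" using k by auto
    obtain p where p: "p ` ?V \<subseteq> {..<T}" "\<forall>x\<in>?V. \<forall>y\<in>?V. p x = p y \<longrightarrow> x mod k = y mod k"
      "card {s \<in> ?V \<times> ?V. irregular ?E \<epsilon> (part ?V p (p (fst s))) (part ?V p (p (snd s)))} \<le> \<epsilon> * (card ?V)\<^sup>2"
      using T[rule_format, OF finite_lessThan modk, of ?E] by (elim exE conjE) (rule that)
    define pp where "pp a = part ?V p a" for a
    have finpp: "finite (pp a)" "pp a \<subseteq> ?V" for a by (auto simp: pp_def part_def)
    define good where "good t \<longleftrightarrow> ((\<forall>a<3. \<forall>b<3. a \<noteq> b \<longrightarrow> bidense ?E \<zeta> (t a) (t b)) \<or>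
       (\<forall>a<3. \<forall>b<3. a \<noteq> b \<longrightarrow> bidense (\<lambda>u v. c {u,v} = Blue) \<zeta> (t a) (t b)))" for t :: "nat \<Rightarrow> nat set"
    have good_cong: "good t'" if "\<And>a. a < 3 \<Longrightarrow> t a = t' a" "good t" for t t'
      using that(2) unfolding good_def by (simp add: that(1))
    \<comment> \<open>Parts too small to contain triples are discarded; there are at most T of them,
      with at most \<eta> N vertices in total.\<close>
    define Bg where "Bg = {a. a < T \<and> \<eta> * N / (real T + 1) \<le> card (pp a)}"
    define packs where "packs a Q \<longleftrightarrow> Q \<subseteq> ({..<3} \<rightarrow>\<^sub>E Pow (pp a)) \<and>
     (\<forall>t\<in>Q. good t \<and> (\<exists>m>0. (\<forall>b<3. card (t b) = m) \<and> \<nu> * \<eta> * card (pp a) \<le> m)) \<and>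
     (\<forall>t\<in>Q. \<forall>t'\<in>Q. \<forall>b<3. \<forall>d<3. (t,b) \<noteq> (t',d) \<longrightarrow> t b \<inter> t' d = {}) \<and>
     card (pp a - (\<Union>t\<in>Q. \<Union>b<3. t b)) \<le> \<eta> * card (pp a)" for a Q
    have "\<exists>Q. packs a Q" if a: "a \<in> Bg" for a
      unfolding packs_def
    proof (rule triple_packing[OF finpp(1) \<nu> \<eta>])
      fix W assume W: "W \<subseteq> pp a" "\<eta> * card (pp a) < card W"
      have "\<eta> * (\<eta> * N / (real T + 1)) \<le> \<eta> * card (pp a)" using a \<eta> by (intro mult_left_mono) (auto simp: Bg_def)
      then have "real m0 \<le> card W" using Nm W(2) by (simp add: power2_eq_square mult.assoc)
      then have "m0 \<le> card W" by simp
      moreover have "finite W" using W(1) finpp(1) finite_subset by blast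
      ultimately show "\<exists>t :: nat \<Rightarrow> nat set. \<exists>m>0. (\<forall>a<3. t a \<subseteq> W \<and> card (t a) = m) \<and> \<nu> * card W \<le> m \<and>
        (\<forall>a<3. \<forall>b<3. a \<noteq> b \<longrightarrow> t a \<inter> t b = {}) \<and> good t"
        unfolding good_def nE[symmetric] using mt[rule_format, of W ?E] Esym by blast
    qed (rule good_cong)
    then obtain Q where Q: "\<And>a. a \<in> Bg \<Longrightarrow> packs a (Q a)" by metis
    define J where "J = (\<Union>a\<in>Bg. Q a)"
    define pl where "pl t = p (SOME v. v \<in> t 0)" for t :: "nat \<Rightarrow> nat set"
    have Qt: "good t \<and> (\<exists>m>0. (\<forall>b<3. card (t b) = m) \<and> \<nu> * \<eta> * card (pp a) \<le> m)" if "a \<in> Bg" "t \<in> Q a" for a t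
      using Q[OF that(1)] that(2) unfolding packs_def by (elim conjE) (erule bspec)
    have Qd: "t b \<inter> t' d = {}" if "a \<in> Bg" "t \<in> Q a" "t' \<in> Q a" "b < 3" "d < 3" "(t,b) \<noteq> (t',d)" for a t t' b d
      using Q[OF that(1)] that unfolding packs_def by (elim conjE) simp
    have Qin: "t b \<subseteq> pp a" if "a \<in> Bg" "t \<in> Q a" "b < 3" for a t b
      using Q[OF that(1)] that(2,3) unfolding packs_def by (auto simp: PiE_iff)
    have pl: "pl t = a" if aQ: "a \<in> Bg" "t \<in> Q a" for a t
    proof -
      obtain m where m: "0 < m" "\<forall>b<3. card (t b) = m" using Qt[OF aQ] by (elim conjE exE) (rule that)
      then have "0 < card (t 0)" by (metis zero_less_numeral)
      then have "t 0 \<noteq> {}" by auto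
      then have "(SOME v. v \<in> t 0) \<in> t 0" by (rule some_in_eq[THEN iffD2])
      then show ?thesis using Qin[OF aQ, of 0] by (auto simp: pl_def pp_def part_def)
    qed
    have JQ: "pl t \<in> Bg \<and> t \<in> Q (pl t)" if "t \<in> J" for t using that pl by (auto simp: J_def)
    have Jin: "t b \<subseteq> pp (pl t)" if "t \<in> J" "b < 3" for t b using JQ[OF that(1)] Qin that(2) by blast
    have Jp: "p v = pl t" "v < N" if "t \<in> J" "b < 3" "v \<in> t b" for t b v using Jin[OF that(1,2)] that(3) by (auto simp: pp_def part_def)
    have Jm: "\<exists>m>0. (\<forall>b<3. card (t b) = m) \<and> \<nu> * \<eta> * card (pp (pl t)) \<le> m" "good t" if "t \<in> J" for t
      using Qt[of "pl t" t] JQ[OF that] by simp_all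
    have Jd: "t b \<inter> t' d = {}" if "t \<in> J" "t' \<in> J" "b < 3" "d < 3" "(t,b) \<noteq> (t',d)" for t t' b d
    proof (cases "pl t = pl t'")
      case True
      then show ?thesis using Qd[of "pl t" t t' b d] JQ[OF that(1)] JQ[OF that(2)] that by simp
    next
      case False
      then show ?thesis using Jp(1)[OF that(1,3)] Jp(1)[OF that(2,4)] by fastforce
    qed
    define sz where "sz t = card (t 0)" for t :: "nat \<Rightarrow> nat set"
    have szJ: "card (t b) = sz t" "0 < sz t" "\<nu> * \<eta> * card (pp (pl t)) \<le> sz t" if "t \<in> J" "b < 3" for t b
      using Jm(1)[OF that(1)] that(2) by (auto simp: sz_def)
    have sz_big: "\<mu> * N \<le> sz t" if "t \<in> J" for t
    proof -
      have "\<nu> * \<eta> * (\<eta> * N / (real T + 1)) \<le> \<nu> * \<eta> * card (pp (pl t))"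
        using JQ[OF that] \<nu> \<eta> by (intro mult_left_mono) (auto simp: Bg_def)
      then show ?thesis using szJ(3)[OF that, of 0] by (simp add: \<mu>_def power2_eq_square mult_ac)
    qed
    define lc where "lc t = (if \<forall>a<3. \<forall>b<3. a \<noteq> b \<longrightarrow> bidense ?E \<zeta> (t a) (t b) then Red else Blue)" for t :: "nat \<Rightarrow> nat set"
    have lcb: "bidense (\<lambda>u v. c {u,v} = lc t) \<zeta> (t a) (t b)" if ab: "t \<in> J" "a < 3" "b < 3" "a \<noteq> b" for t a b
    proof (cases "\<forall>a<3. \<forall>b<3. a \<noteq> b \<longrightarrow> bidense ?E \<zeta> (t a) (t b)")
      case True
      then have "lc t = Red" unfolding lc_def by (rule if_P)
      then show ?thesis using True[rule_format, OF ab(2,3,4)] by simp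
    next
      case False
      then have l: "lc t = Blue" unfolding lc_def by (rule if_not_P)
      have "\<forall>a<3. \<forall>b<3. a \<noteq> b \<longrightarrow> bidense (\<lambda>u v. c {u,v} = Blue) \<zeta> (t a) (t b)"
        using Jm(2)[OF ab(1)] False unfolding good_def by (elim disjE) (erule notE, assumption)+
      then show ?thesis using ab unfolding l by simp
    qed
    define bd where "bd k A B \<longleftrightarrow> bidense (\<lambda>u v. c {u,v} = k) \<epsilon> A B" for k A B
    have bd_sym: "bd k A B = bd k B A" for k A B
      unfolding bd_def using bidense_sym[of "\<lambda>u v. c {u,v} = k" \<epsilon>] by (auto simp: insert_commute)
    \<comment> \<open>Different triples from one part have no guaranteed colour between them and are
      excluded.\<close>
    define ok where "ok t t' \<longleftrightarrow> pl t \<noteq> pl t' \<and> (bd Red (pp (pl t)) (pp (pl t')) \<or> bd Blue (pp (pl t)) (pp (pl t')))" for t t'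
    define cc where "cc t t' = (if bd Red (pp (pl t)) (pp (pl t')) then Red else Blue)" for t t'
    have finJ: "finite J"
    proof (rule finite_subset)
      show "J \<subseteq> {..<3} \<rightarrow>\<^sub>E Pow ?V" using Q finpp(2) unfolding J_def packs_def by (fastforce simp: PiE_iff)
      show "finite ({..<3::nat} \<rightarrow>\<^sub>E Pow ?V)" by (auto intro: finite_PiE)
    qed
    interpret cs: cluster_system ?V J "\<lambda>t. t" sz lc cc ok
    proof
      show "finite J" by (rule finJ)
      show "?V \<noteq> {}" using Nk by auto
      show "i a \<subseteq> ?V \<and> card (i a) = sz i" if "i \<in> J" "a < 3" for i a using Jp(2) szJ that by blast
      show "0 < sz i" if "i \<in> J" for i using szJ(2)[OF that, of 0] by simp
      show "i a \<inter> j b = {}" if "i \<in> J" "j \<in> J" "a < 3" "b < 3" "(i,a) \<noteq> (j,b)" for i j a b using Jd that by blast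
      show "cc i j = cc j i" for i j unfolding cc_def using bd_sym by simp
      show "ok j i" if "ok i j" for i j using that unfolding ok_def using bd_sym by metis
    qed simp_all
    have edge: "bidense (\<lambda>u v. c {u,v} = k) \<zeta> (fst x (snd x)) (fst y (snd y))" if e: "cs.ed k x y" for k x y
    proof -
      obtain t a t' b where xy: "x = (t,a)" "y = (t',b)" by fastforce
      have J: "t \<in> J" "t' \<in> J" "a < 3" "b < 3" using e xy by (auto simp: cs.ed_def cs.X_def)
      show ?thesis
      proof (cases "t = t'")
        case True
        then have "a \<noteq> b" "lc t = k" using e xy by (auto simp: cs.ed_def)
        then have "bidense (\<lambda>u v. c {u,v} = k) \<zeta> (t a) (t b)" using lcb[OF J(1,3,4)] by simp
        then show ?thesis using True xy by simp
      next
        case False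
        then have okc: "ok t t'" "cc t t' = k" using e xy by (auto simp: cs.ed_def)
        have "bd (cc t t') (pp (pl t)) (pp (pl t'))" using okc(1) by (auto simp: ok_def cc_def)
        then have b1: "bidense (\<lambda>u v. c {u,v} = k) \<epsilon> (pp (pl t)) (pp (pl t'))"
          unfolding okc(2) bd_def .
        have b2: "\<epsilon> * card (pp (pl t)) \<le> \<zeta> * card (t a)" if "t \<in> J" "a < 3" for t a
        proof -
          have "\<epsilon> * card (pp (pl t)) \<le> \<zeta> * \<nu> * \<eta> * card (pp (pl t))" using \<epsilon>(2) by (intro mult_right_mono) auto
          also have "\<dots> = \<zeta> * (\<nu> * \<eta> * card (pp (pl t)))" by simp
          also have "\<dots> \<le> \<zeta> * sz t" using szJ(3)[OF that] \<zeta> by (intro mult_left_mono) auto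
          finally show ?thesis using szJ(1)[OF that] by simp
        qed
        show ?thesis unfolding xy fst_conv snd_conv
          by (rule bidense_subset[OF b1 Jin[OF J(1,3)] Jin[OF J(2,4)] b2[OF J(1,3)] b2[OF J(2,4)]])
      qed
    qed
    define U where "U = {v\<in>?V. \<not> cs.covered v}"
    define R where "R = {s \<in> ?V \<times> ?V. p (fst s) = p (snd s)} \<union>
      {s \<in> ?V \<times> ?V. irregular ?E \<epsilon> (part ?V p (p (fst s))) (part ?V p (p (snd s)))}"
    have cardU: "4 * real K * card U \<le> card ?V"
    proof -
      let ?f = "\<lambda>a. pp a - (if a \<in> Bg then (\<Union>t\<in>Q a. \<Union>b<3. t b) else {})"
      have "U \<subseteq> (\<Union>a<T. ?f a)"
      proof
        fix v assume v: "v \<in> U"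
        then have "p v < T" using p(1) by (auto simp: U_def)
        moreover have "v \<notin> t b" if "p v \<in> Bg" "t \<in> Q (p v)" "b < 3" for t b
        proof -
          have "t \<in> J" using that by (auto simp: J_def)
          then show ?thesis using v that(3) by (auto simp: U_def cs.covered_def)
        qed
        then have "v \<in> ?f (p v)" using v by (auto simp: U_def pp_def part_def)
        ultimately show "v \<in> (\<Union>a<T. ?f a)" by (intro UN_I[of "p v"]) simp_all
      qed
      then have "card U \<le> card (\<Union>a<T. ?f a)" using finpp by (intro card_mono) auto
      also have "\<dots> \<le> (\<Sum>a<T. card (?f a))" by (rule card_UN_le) simp
      finally have le: "card U \<le> (\<Sum>a<T. card (?f a))" .
      have "real (card U) \<le> (\<Sum>a<T. real (card (?f a)))" using of_nat_mono[OF le, where 'a = real] unfolding of_nat_sum .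
      also have "\<dots> \<le> (\<Sum>a<T. \<eta> * card (pp a) + \<eta> * N / (real T + 1))"
      proof (rule sum_mono)
        fix a assume a: "a \<in> {..<T}"
        have "0 \<le> \<eta> * card (pp a)" "0 \<le> \<eta> * N / (real T + 1)" using \<eta> by auto
        then show "real (card (?f a)) \<le> \<eta> * card (pp a) + \<eta> * N / (real T + 1)"
          using Q[of a] a unfolding packs_def Bg_def by (cases "a \<in> Bg") (auto simp: Bg_def)
      qed
      also have "\<dots> = \<eta> * (\<Sum>a<T. real (card (pp a))) + real T * (\<eta> * N / (real T + 1))"
        by (simp add: sum.distrib sum_distrib_left)
      also have "(\<Sum>a<T. real (card (pp a))) = card (\<Union>a<T. pp a)"
        by (subst card_UN_disjoint) (use finpp in \<open>auto simp: pp_def part_def\<close>)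
      also have "real (card (\<Union>a<T. pp a)) \<le> N" using card_mono[of ?V "\<Union>a<T. pp a"] finpp(2) by auto
      also have "real T * (\<eta> * N / (real T + 1)) \<le> \<eta> * N"
      proof -
        have "real T * (\<eta> * N) \<le> (real T + 1) * (\<eta> * N)" using \<eta> by (intro mult_right_mono) auto
        then show ?thesis by (simp add: field_simps)
      qed
      finally have "real (card U) \<le> \<eta> * N + \<eta> * N" using \<eta> by simp
      then show ?thesis using K by (simp add: \<eta>_def field_simps)
    qed
    have cardR: "4 * (real K)\<^sup>2 * card R \<le> (card ?V)\<^sup>2"
    proof -
      have "card R \<le> card {s \<in> ?V \<times> ?V. p (fst s) = p (snd s)} +
        card {s \<in> ?V \<times> ?V. irregular ?E \<epsilon> (part ?V p (p (fst s))) (part ?V p (p (snd s)))}"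
        unfolding R_def by (rule card_Un_le)
      then have "real (card R) \<le> card {s \<in> ?V \<times> ?V. p (fst s) = p (snd s)} +
        real (card {s \<in> ?V \<times> ?V. irregular ?E \<epsilon> (part ?V p (p (fst s))) (part ?V p (p (snd s)))})" by linarith
      also have "\<dots> \<le> card {s \<in> ?V \<times> ?V. p (fst s) = p (snd s)} + \<epsilon> * (real N)\<^sup>2" using p(3) by simp
      also have "\<epsilon> * (real N)\<^sup>2 \<le> 1 / (8 * (real K)\<^sup>2) * (real N)\<^sup>2" using \<epsilon>(3) by (intro mult_right_mono) auto
      finally have 1: "real (card R) \<le> card {s \<in> ?V \<times> ?V. p (fst s) = p (snd s)} + 1 / (8 * (real K)\<^sup>2) * (real N)\<^sup>2" by simp
      have "real (card {s \<in> ?V \<times> ?V. p (fst s) = p (snd s)} * k) \<le> real (2 * N\<^sup>2)"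
        using card_same_part[OF k Nk(1) p(2)] by (rule of_nat_mono)
      then have "4 * (real K)\<^sup>2 * card {s \<in> ?V \<times> ?V. p (fst s) = p (snd s)} \<le> (real N)\<^sup>2 / 2" by (simp add: k_def field_simps)
      moreover have "4 * (real K)\<^sup>2 * card R \<le> 4 * (real K)\<^sup>2 * (card {s \<in> ?V \<times> ?V. p (fst s) = p (snd s)} + 1 / (8 * (real K)\<^sup>2) * (real N)\<^sup>2)"
        using 1 by (intro mult_left_mono) auto
      moreover have "\<dots> = 4 * (real K)\<^sup>2 * card {s \<in> ?V \<times> ?V. p (fst s) = p (snd s)} + (real N)\<^sup>2 / 2"
        using K by (simp add: field_simps)
      ultimately show ?thesis by simp
    qed
    have "card ?V ^ K \<le> 2 * card {f \<in> {..<K} \<rightarrow>\<^sub>E ?V. (\<forall>a<K. f a \<notin> U) \<and> (\<forall>a<K. \<forall>b<K. a \<noteq> b \<longrightarrow> (f a, f b) \<notin> R)}"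
      by (rule many_good_samples[OF _ _ _ cardU _ cardR]) (use Nk in \<open>auto simp: U_def R_def\<close>)
    also have "card {f \<in> {..<K} \<rightarrow>\<^sub>E ?V. (\<forall>a<K. f a \<notin> U) \<and> (\<forall>a<K. \<forall>b<K. a \<noteq> b \<longrightarrow> (f a, f b) \<notin> R)} \<le> card (cs.samples K)"
    proof (rule card_mono)
      show "finite (cs.samples K)"
        by (rule finite_subset[of _ "{..<K} \<rightarrow>\<^sub>E ?V"]) (auto simp: cs.samples_def intro: finite_PiE)
      show "{f \<in> {..<K} \<rightarrow>\<^sub>E ?V. (\<forall>a<K. f a \<notin> U) \<and> (\<forall>a<K. \<forall>b<K. a \<noteq> b \<longrightarrow> (f a, f b) \<notin> R)} \<subseteq> cs.samples K"
      proof
        fix f assume f: "f \<in> {f \<in> {..<K} \<rightarrow>\<^sub>E ?V. (\<forall>a<K. f a \<notin> U) \<and> (\<forall>a<K. \<forall>b<K. a \<noteq> b \<longrightarrow> (f a, f b) \<notin> R)}"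
        have fV: "f a \<in> ?V" if "a < K" for a using f that by (auto simp: PiE_iff)
        have cov: "cs.covered (f a)" if "a < K" for a using f fV[OF that] that by (auto simp: U_def)
        have plt: "pl (cs.tr (f a)) = p (f a)" if "a < K" for a using cs.tr[OF cov[OF that]] Jp(1) by metis
        have "cs.tr (f a) \<noteq> cs.tr (f b) \<and> ok (cs.tr (f a)) (cs.tr (f b))" if ab: "a < K" "b < K" "a \<noteq> b" for a b
        proof -
          have "(f a, f b) \<notin> R" using f ab by blast
          then have "p (f a) \<noteq> p (f b)" "\<not> irregular ?E \<epsilon> (pp (p (f a))) (pp (p (f b)))"
            using fV ab by (auto simp: R_def pp_def)
          then have "ok (cs.tr (f a)) (cs.tr (f b))"
            unfolding ok_def plt[OF ab(1)] plt[OF ab(2)] irregular_def nE bd_def by blast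
          then show ?thesis by (auto simp: ok_def)
        qed
        then show "f \<in> cs.samples K" using f cov by (auto simp: cs.samples_def)
      qed
    qed
    finally have smp: "N ^ K \<le> 2 * card (cs.samples K)" by simp
    show "\<exists>J :: (nat \<Rightarrow> nat set) set. \<exists>sz lc cc ok. cluster_system ?V J (\<lambda>t. t) sz cc ok \<and>
      (\<forall>t\<in>J. \<mu> * N \<le> sz t) \<and>
      (\<forall>k x y. cluster_system.ed J lc cc ok k x y \<longrightarrow> bidense (\<lambda>u v. c {u,v} = k) \<zeta> (fst x (snd x)) (fst y (snd y))) \<and>
      N ^ K \<le> 2 * card (cluster_system.samples ?V J (\<lambda>t. t) ok K)"
    proof (rule exI[of _ J], rule exI[of _ sz], rule exI[of _ lc], rule exI[of _ cc], rule exI[of _ ok], intro conjI)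
      show "cluster_system ?V J (\<lambda>t. t) sz cc ok" by (rule cs.cluster_system_axioms)
      show "\<forall>t\<in>J. \<mu> * N \<le> sz t" using sz_big by blast
      show "\<forall>k x y. cs.ed k x y \<longrightarrow> bidense (\<lambda>u v. c {u,v} = k) \<zeta> (fst x (snd x)) (fst y (snd y))" using edge by blast
      show "N ^ K \<le> 2 * card (cs.samples K)" by (rule smp)
    qed
  qed
qed

section \<open>Ramsey numbers of graphs of small bandwidth\<close>

text \<open>Everything the embedding uses of the colouring. The bounds \<open>M\<close> and
  \<open>D\<close> on the number of triangles and on walk lengths are parameters, so that they can
  be fixed before N.\<close>

locale triangle_packing =
  fixes c :: "nat set \<Rightarrow> colour" and N :: nat and \<zeta> \<mu> \<epsilon> \<tau> :: real and M D :: nat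
    and k :: colour and X :: "'k set" and S :: "'k \<Rightarrow> nat set" and E :: "'k \<Rightarrow> 'k \<Rightarrow> bool"
    and T :: "'k set set" and ord :: "'k set \<Rightarrow> nat \<Rightarrow> 'k" and \<rho> :: "'k set \<Rightarrow> real"
  assumes N: "0 < N" and \<mu>: "0 < \<mu>"
    and S: "\<And>x. x \<in> X \<Longrightarrow> S x \<subseteq> {..<N} \<and> \<mu> * N \<le> card (S x)"
    and S_disj: "\<And>x y. x \<in> X \<Longrightarrow> y \<in> X \<Longrightarrow> x \<noteq> y \<Longrightarrow> S x \<inter> S y = {}"
    and E_sym: "\<And>x y. E x y \<Longrightarrow> E y x" and E_irrefl: "\<And>x. \<not> E x x"
    and E_dense: "\<And>x y. E x y \<Longrightarrow> bidense (\<lambda>u v. c {u,v} = k) \<zeta> (S x) (S y)"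
    and finT: "finite T" and cardT: "card T \<le> M"
    and ord: "\<And>t. t \<in> T \<Longrightarrow> ord t \<in> otris E X \<and> ord t ` {..<3} = t"
    and conn: "\<And>t t'. t \<in> T \<Longrightarrow> t' \<in> T \<Longrightarrow> \<exists>n\<le>D. (ord t, ord t') \<in> ostep E X ^^ n"
    and \<rho>: "\<And>t. t \<in> T \<Longrightarrow> 0 \<le> \<rho> t"
    and \<rho>_load: "\<And>x. x \<in> X \<Longrightarrow> sum \<rho> {t\<in>T. x \<in> t} \<le> (1 + 2 * \<epsilon>) * card (S x)"
    and \<rho>_total: "(1/9 - \<tau>) * N < (1 + \<epsilon>) * sum \<rho> T"
begin

text \<open>Of the slack 2\<eta> in \<open>main\<close>, one \<eta> absorbs the error terms of the
  cluster assignment and the other is the free share used by the greedy embedding.\<close>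

lemma embedding:
  fixes \<chi> :: "nat \<Rightarrow> nat" and adj :: "nat \<Rightarrow> nat \<Rightarrow> bool" and b m n G \<Delta> :: nat and \<eta> :: real
  assumes par: "0 < \<zeta>" "0 \<le> \<epsilon>" "\<tau> < 1/9" "0 \<le> \<eta>" "0 < b" "D < G"
    and adj: "\<And>x y. adj x y \<Longrightarrow> adj y x" "\<And>x y. adj x y \<Longrightarrow> \<chi> x \<noteq> \<chi> y" "\<And>x y. adj x y \<Longrightarrow> x \<le> y + b"
      "\<And>x. x < m \<Longrightarrow> card {y. y < m \<and> adj x y} \<le> \<Delta>"
    and \<chi>: "\<And>x. x < m \<Longrightarrow> \<chi> x < 3" "\<And>i. i < 3 \<Longrightarrow> card {x. x < m \<and> \<chi> x = i} \<le> n"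
    and main: "n * ((1 + \<epsilon>) * (1 + 2 * \<epsilon>)) \<le> (1 - 2 * \<eta>) * ((1/9 - \<tau>) * N)"
    and err: "M * sqrt (b * G * m) + (m div (b * G) + 1) * (D * b) \<le> \<eta> * (\<mu> * N)"
    and room: "b < ((1/4) ^ \<Delta> * \<eta> - (\<Delta> + 1) * \<zeta>) * (\<mu> * N)"
  shows "\<exists>\<psi>. inj_on \<psi> {..<m} \<and> (\<forall>x<m. \<psi> x < N) \<and> (\<forall>x<m. \<forall>y<m. adj x y \<longrightarrow> c {\<psi> x, \<psi> y} = k)"
proof -
  have \<mu>N: "0 < \<mu> * N" using N \<mu> by simp
  have \<Lambda>: "0 < (1/9 - \<tau>) * N" using N par(3) by simp
  then have "0 < (1 + \<epsilon>) * sum \<rho> T" using \<rho>_total by linarith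
  then have s0: "0 < sum \<rho> T" using par(2) by (simp add: zero_less_mult_iff)
  have "\<exists>\<phi>. (\<forall>x<m. \<phi> x \<in> X) \<and>
    (\<forall>x<m. \<forall>y<m. \<chi> x \<noteq> \<chi> y \<longrightarrow> x \<le> y + b \<longrightarrow> y \<le> x + b \<longrightarrow> E (\<phi> x) (\<phi> y)) \<and>
    (\<forall>s\<in>X. card {x. x < m \<and> \<phi> x = s} \<le> n / sum \<rho> T * sum \<rho> {\<tau>\<in>T. s \<in> \<tau>}
        + card T * sqrt (b * G * m) + (m div (b * G) + 1) * (D * b))"
    by (rule cluster_assignment[where ord = ord and E = E])
      (erule E_sym | rule E_irrefl | rule finT | erule ord | erule (1) conn | erule \<rho> | rule s0 | erule \<chi> | rule par(5,6))+
  then obtain \<phi> where \<phi>: "\<forall>x<m. \<phi> x \<in> X"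
    "\<forall>x<m. \<forall>y<m. \<chi> x \<noteq> \<chi> y \<longrightarrow> x \<le> y + b \<longrightarrow> y \<le> x + b \<longrightarrow> E (\<phi> x) (\<phi> y)"
    "\<forall>s\<in>X. card {x. x < m \<and> \<phi> x = s} \<le> n / sum \<rho> T * sum \<rho> {\<tau>\<in>T. s \<in> \<tau>}
        + card T * sqrt (b * G * m) + (m div (b * G) + 1) * (D * b)"
    by (elim exE conjE) (rule that)
  have load: "card {x. x < m \<and> \<phi> x = s} \<le> (1 - \<eta>) * card (S s)" if s: "s \<in> X" for s
  proof -
    have "(n * (1 + 2 * \<epsilon>)) * ((1/9 - \<tau>) * N) \<le> (n * (1 + 2 * \<epsilon>)) * ((1 + \<epsilon>) * sum \<rho> T)"
      using \<rho>_total par(2) by (intro mult_left_mono) auto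
    also have "\<dots> = (n * ((1 + \<epsilon>) * (1 + 2 * \<epsilon>))) * sum \<rho> T" by simp
    also have "\<dots> \<le> ((1 - 2 * \<eta>) * ((1/9 - \<tau>) * N)) * sum \<rho> T" using main s0 by (intro mult_right_mono) auto
    also have "\<dots> = ((1 - 2 * \<eta>) * sum \<rho> T) * ((1/9 - \<tau>) * N)" by simp
    finally have "n * (1 + 2 * \<epsilon>) \<le> (1 - 2 * \<eta>) * sum \<rho> T" using \<Lambda> by (simp only: mult_le_cancel_right_pos)
    then have 1: "n / sum \<rho> T * (1 + 2 * \<epsilon>) \<le> 1 - 2 * \<eta>" using s0 by (simp add: field_simps)
    have "n / sum \<rho> T * sum \<rho> {\<tau>\<in>T. s \<in> \<tau>} \<le> n / sum \<rho> T * ((1 + 2 * \<epsilon>) * card (S s))"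
      using \<rho>_load[OF s] s0 by (intro mult_left_mono) auto
    also have "\<dots> = (n / sum \<rho> T * (1 + 2 * \<epsilon>)) * card (S s)" by simp
    also have "\<dots> \<le> (1 - 2 * \<eta>) * card (S s)" using 1 by (intro mult_right_mono) auto
    finally have 2: "n / sum \<rho> T * sum \<rho> {\<tau>\<in>T. s \<in> \<tau>} \<le> (1 - 2 * \<eta>) * card (S s)" .
    have 3: "card T * sqrt (b * G * m) \<le> M * sqrt (b * G * m)" using cardT by (intro mult_right_mono) auto
    have 4: "\<eta> * (\<mu> * N) \<le> \<eta> * card (S s)" using S[OF s] par(4) by (intro mult_left_mono) auto
    have "card {x. x < m \<and> \<phi> x = s} \<le> n / sum \<rho> T * sum \<rho> {\<tau>\<in>T. s \<in> \<tau>}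
        + card T * sqrt (b * G * m) + (m div (b * G) + 1) * (D * b)" using \<phi>(3) s by blast
    then have "card {x. x < m \<and> \<phi> x = s} \<le> (1 - 2 * \<eta>) * card (S s) + \<eta> * card (S s)" using 2 3 4 err by linarith
    then show ?thesis by (simp add: algebra_simps)
  qed
  interpret embedding_problem "\<lambda>u v. c {u,v} = k" S \<phi> adj m b \<Delta> \<zeta> \<eta>
  proof
    show "adj x y \<Longrightarrow> adj y x" for x y by (rule adj(1))
    show "\<not> adj x x" for x using adj(2) by blast
    show "adj x y \<Longrightarrow> x \<le> y + b" for x y by (rule adj(3))
    show "card {y. y < m \<and> adj x y} \<le> \<Delta>" if "x < m" for x by (rule adj(4)[OF that])
    show "c {v,u} = k" if "c {u,v} = k" for u v using that by (simp add: insert_commute)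
    show "finite (S (\<phi> x))" if "x < m" for x using S \<phi>(1) that finite_subset by blast
    show "S (\<phi> x) \<inter> S (\<phi> y) = {}" if "x < m" "y < m" "\<phi> x \<noteq> \<phi> y" for x y using S_disj \<phi>(1) that by blast
    show "bidense (\<lambda>u v. c {u,v} = k) \<zeta> (S (\<phi> x)) (S (\<phi> y))" if "x < m" "y < m" "adj x y" for x y
      using \<phi>(2) that adj by (intro E_dense) blast
    show "card {y. y < m \<and> \<phi> y = \<phi> x} \<le> (1 - \<eta>) * card (S (\<phi> x))" if "x < m" for x using load \<phi>(1) that by blast
    show "b + (\<Delta> + 1) * \<zeta> * card (S (\<phi> x)) < (1/4) ^ \<Delta> * \<eta> * card (S (\<phi> x))" if "x < m" for x
    proof -
      have "0 < ((1/4) ^ \<Delta> * \<eta> - (\<Delta> + 1) * \<zeta>) * (\<mu> * N)" using room par(5) by linarith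
      then have "0 < (1/4) ^ \<Delta> * \<eta> - (\<Delta> + 1) * \<zeta>" using \<mu>N by (simp only: zero_less_mult_pos2)
      then have "((1/4) ^ \<Delta> * \<eta> - (\<Delta> + 1) * \<zeta>) * (\<mu> * N) \<le> ((1/4) ^ \<Delta> * \<eta> - (\<Delta> + 1) * \<zeta>) * card (S (\<phi> x))"
        using S \<phi>(1) that by (intro mult_left_mono) auto
      then have "b < ((1/4) ^ \<Delta> * \<eta> - (\<Delta> + 1) * \<zeta>) * card (S (\<phi> x))" using room by linarith
      then show ?thesis by (simp add: left_diff_distrib)
    qed
  qed (use par in auto)
  obtain \<psi> where \<psi>: "inj_on \<psi> {..<m}" "\<forall>x<m. \<psi> x \<in> S (\<phi> x)" "\<forall>x<m. \<forall>y<m. adj x y \<longrightarrow> c {\<psi> x, \<psi> y} = k"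
    using embedding_exists by blast
  have "\<psi> x < N" if "x < m" for x using \<psi>(2) S \<phi>(1) that by blast
  then show ?thesis using \<psi> by blast
qed

end

lemma card_le_of_disjoint:
  fixes \<mu> :: real and N :: nat
  assumes finX: "finite X" and N: "0 < N" and \<mu>: "0 < \<mu>"
    and S: "\<And>x. x \<in> X \<Longrightarrow> S x \<subseteq> {..<N} \<and> \<mu> * N \<le> card (S x)"
    and d: "\<And>x y. x \<in> X \<Longrightarrow> y \<in> X \<Longrightarrow> x \<noteq> y \<Longrightarrow> S x \<inter> S y = {}"
  shows "card X \<le> nat \<lfloor>1 / \<mu>\<rfloor>"
proof -
  have fin: "finite (S x)" if "x \<in> X" for x by (rule finite_subset[OF conjunct1[OF S[OF that]] finite_lessThan])
  have cU: "card (\<Union>x\<in>X. S x) = (\<Sum>x\<in>X. card (S x))"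
  proof (rule card_UN_disjoint[OF finX])
    show "\<forall>x\<in>X. finite (S x)" using fin by simp
    show "\<forall>x\<in>X. \<forall>y\<in>X. x \<noteq> y \<longrightarrow> S x \<inter> S y = {}" using d by simp
  qed
  have sub: "(\<Union>x\<in>X. S x) \<subseteq> {..<N}" using S by (intro UN_least) simp
  have "card X * (\<mu> * N) \<le> (\<Sum>x\<in>X. real (card (S x)))" using S by (intro sum_bounded_below) simp
  also have "\<dots> = card (\<Union>x\<in>X. S x)" unfolding cU of_nat_sum ..
  also have "\<dots> \<le> N" using card_mono[OF finite_lessThan sub] by simp
  finally have "card X \<le> 1 / \<mu>" using N \<mu> by (simp add: field_simps)
  then show ?thesis using \<mu> by (simp add: le_nat_iff le_floor_iff)
qed

theorem triangle_packing_exists: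
  fixes \<tau> \<epsilon> \<zeta> :: real
  assumes \<tau>: "0 < \<tau>" "\<tau> \<le> 1/9" and \<epsilon>: "0 < \<epsilon>" "\<epsilon> \<le> 1" and \<zeta>: "0 < \<zeta>" "\<zeta> \<le> 1/4"
  shows "\<exists>\<mu>>0. \<exists>M D N0. \<forall>N\<ge>N0. \<forall>c. \<exists>k. \<exists>X :: ((nat \<Rightarrow> nat set) \<times> nat) set. \<exists>E T ord \<rho>.
    triangle_packing c N \<zeta> \<mu> \<epsilon> \<tau> M D k X (\<lambda>x. fst x (snd x)) E T ord \<rho>"
proof -
  obtain K :: nat where K: "0 < K" "(real K)\<^sup>2 * exp (8 * \<tau> - 2 * \<tau>\<^sup>2 * K) < 1/2" using sample_size[OF \<tau>(1)] by auto
  obtain \<mu> N0 where \<mu>: "(0::real) < \<mu>" and str: "\<forall>N\<ge>N0. \<forall>c :: nat set \<Rightarrow> colour.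
    \<exists>J :: (nat \<Rightarrow> nat set) set. \<exists>sz lc cc ok. cluster_system {..<N} J (\<lambda>t. t) sz cc ok \<and>
      (\<forall>t\<in>J. \<mu> * N \<le> sz t) \<and>
      (\<forall>k x y. cluster_system.ed J lc cc ok k x y \<longrightarrow> bidense (\<lambda>u v. c {u,v} = k) \<zeta> (fst x (snd x)) (fst y (snd y))) \<and>
      N ^ K \<le> 2 * card (cluster_system.samples {..<N} J (\<lambda>t. t) ok K)"
    using cluster_structure[OF \<zeta> K(1)] by (elim exE conjE) (rule that)
  \<comment> \<open>At most P disjoint clusters of size \<mu> N exist, hence at most
    \<open>2 ^ P\<close> triangles and walks of length at most \<open>P ^ 6\<close>.\<close>
  define P where "P = nat \<lfloor>1 / \<mu>\<rfloor>"
  show ?thesis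
  proof (rule exI[of _ \<mu>], rule conjI[OF \<mu>], rule exI[of _ "2 ^ P"], rule exI[of _ "P ^ 6"], rule exI[of _ "N0 + 1"], intro allI impI)
    fix N and c :: "nat set \<Rightarrow> colour" assume N: "N0 + 1 \<le> N"
    then have N0: "N0 \<le> N" "0 < N" by auto
    obtain J :: "(nat \<Rightarrow> nat set) set" and sz lc cc ok where cs: "cluster_system {..<N} J (\<lambda>t. t) sz cc ok"
      and szb: "\<forall>t\<in>J. \<mu> * N \<le> sz t"
      and dense: "\<forall>k x y. cluster_system.ed J lc cc ok k x y \<longrightarrow> bidense (\<lambda>u v. c {u,v} = k) \<zeta> (fst x (snd x)) (fst y (snd y))"
      and smp: "N ^ K \<le> 2 * card (cluster_system.samples {..<N} J (\<lambda>t. t) ok K)"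
      using str[rule_format, OF N0(1), of c] by (elim exE conjE) (rule that)
    interpret cs: cluster_system "{..<N}" J "\<lambda>t. t" sz lc cc ok by (rule cs)
    have "real (N ^ K) \<le> real (2 * card (cs.samples K))" using smp by (rule of_nat_mono)
    moreover have "(real K)\<^sup>2 * exp (8 * \<tau> - 2 * \<tau>\<^sup>2 * K) * real (N ^ K) < 1/2 * real (N ^ K)"
      using K(2) N0(2) by (intro mult_strict_right_mono) auto
    ultimately have big: "(real K)\<^sup>2 * exp (8 * \<tau> - 2 * \<tau>\<^sup>2 * K) * real (card {..<N} ^ K) < card (cs.samples K)" by simp
    obtain k e \<rho> where pk: "\<forall>t\<in>class_triangles (cs.ed k) cs.X (edge_class (cs.ed k) cs.X e). (0::real) \<le> \<rho> t"
      "\<forall>x\<in>cs.X. sum \<rho> {t\<in>class_triangles (cs.ed k) cs.X (edge_class (cs.ed k) cs.X e). x \<in> t} \<le> (1 + 2 * \<epsilon>) * card (fst x (snd x))"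
      "(1/9 - \<tau>) * card {..<N} < (1 + \<epsilon>) * sum \<rho> (class_triangles (cs.ed k) cs.X (edge_class (cs.ed k) cs.X e))"
      using cs.packing_class[OF \<tau> \<epsilon> K(1) big] by (elim exE conjE) (rule that)
    let ?E = "cs.ed k"
    let ?T = "class_triangles ?E cs.X (edge_class ?E cs.X e)"
    obtain ord where ord: "\<forall>t\<in>?T. ord t \<in> otris ?E cs.X \<and> ord t ` {..<3} = t \<and>
      (\<forall>t'\<in>?T. \<exists>n\<le>card cs.X ^ 6. (ord t, ord t') \<in> ostep ?E cs.X ^^ n)"
      using class_orderings[of ?E cs.X e] cs.ed_irrefl cs.ed_sym cs.finX by blast
    have Sx: "fst x (snd x) \<subseteq> {..<N} \<and> \<mu> * N \<le> card (fst x (snd x))" if "x \<in> cs.X" for x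
    proof -
      have "fst x \<in> J" "snd x < 3" using that by (auto simp: cs.X_def)
      then show ?thesis using cs.S[of "fst x" "snd x"] szb by simp
    qed
    have Sd: "fst x (snd x) \<inter> fst y (snd y) = {}" if "x \<in> cs.X" "y \<in> cs.X" "x \<noteq> y" for x y
      using that cs.S_disj[of "fst x" "fst y" "snd x" "snd y"] by (auto simp: cs.X_def)
    have cX: "card cs.X \<le> P"
      unfolding P_def by (rule card_le_of_disjoint[OF cs.finX N0(2) \<mu> Sx Sd])
    have sub: "?T \<subseteq> Pow cs.X" by (auto simp: class_triangles_def triangles_def)
    have finT: "finite ?T" using sub cs.finX finite_subset by blast
    have "card ?T \<le> card (Pow cs.X)" using sub cs.finX by (intro card_mono) auto
    also have "\<dots> \<le> 2 ^ P" using cX cs.finX by (simp add: card_Pow)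
    finally have cT: "card ?T \<le> 2 ^ P" .
    have D: "card cs.X ^ 6 \<le> P ^ 6" using cX by (rule power_mono) simp
    have "triangle_packing c N \<zeta> \<mu> \<epsilon> \<tau> (2 ^ P) (P ^ 6) k cs.X (\<lambda>x. fst x (snd x)) ?E ?T ord \<rho>"
    proof
      show "\<exists>n\<le>P ^ 6. (ord t, ord t') \<in> ostep ?E cs.X ^^ n" if "t \<in> ?T" "t' \<in> ?T" for t t'
      proof -
        have "\<exists>n\<le>card cs.X ^ 6. (ord t, ord t') \<in> ostep ?E cs.X ^^ n" using ord that by blast
        then show ?thesis using D by (meson order_trans)
      qed
      show "\<And>t. t \<in> ?T \<Longrightarrow> ord t \<in> otris ?E cs.X \<and> ord t ` {..<3} = t" using ord by blast
      show "(1/9 - \<tau>) * N < (1 + \<epsilon>) * sum \<rho> ?T" using pk(3) by simp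
      show "\<And>x y. ?E x y \<Longrightarrow> bidense (\<lambda>u v. c {u,v} = k) \<zeta> (fst x (snd x)) (fst y (snd y))" using dense by blast
      show "\<And>t. t \<in> ?T \<Longrightarrow> 0 \<le> \<rho> t" using pk(1) by (rule bspec)
      show "\<And>x. x \<in> cs.X \<Longrightarrow> sum \<rho> {t\<in>?T. x \<in> t} \<le> (1 + 2 * \<epsilon>) * card (fst x (snd x))" using pk(2) by (rule bspec)
    qed (rule N0 \<mu> cs.ed_irrefl finT cT | erule cs.ed_sym Sx | erule (2) Sd)+
    then show "\<exists>k. \<exists>X :: ((nat \<Rightarrow> nat set) \<times> nat) set. \<exists>E T ord \<rho>.
      triangle_packing c N \<zeta> \<mu> \<epsilon> \<tau> (2 ^ P) (P ^ 6) k X (\<lambda>x. fst x (snd x)) E T ord \<rho>"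
      by (intro exI)
  qed
qed

text \<open>Transports \<open>H\<close> to an initial segment of the naturals along an ordering that
  attains the bandwidth; the last clause carries an embedding back to \<open>H\<close>.\<close>

lemma bandwidth_layout:
  fixes H :: "'a sgraph"
  assumes H: "finite_simple_graph H" and col: "proper_colouring H 3 col" "\<forall>i<3. card {v \<in> verts H. col v = i} \<le> n"
  shows "\<exists>m \<chi> adj. m \<le> 3 * n \<and>
    (\<forall>x y. adj x y \<longrightarrow> adj y x \<and> \<chi> x \<noteq> (\<chi> y :: nat) \<and> x \<le> y + bandwidth H) \<and>
    (\<forall>x<m. card {y. y < m \<and> adj x y} \<le> max_degree H) \<and>
    (\<forall>x<m. \<chi> x < 3) \<and> (\<forall>i<3. card {x. x < m \<and> \<chi> x = i} \<le> n) \<and>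
    (\<forall>N c k \<psi>. inj_on \<psi> {..<m} \<longrightarrow> (\<forall>x<m. \<psi> x < N) \<longrightarrow> (\<forall>x<m. \<forall>y<m. adj x y \<longrightarrow> c {\<psi> x, \<psi> y} = k) \<longrightarrow>
      contains_copy (colour_graph N c k) H)"
proof -
  let ?V = "verts H"
  define m where "m = card ?V"
  have fin: "finite ?V" and E: "edges H \<subseteq> [?V]\<^bsup>2\<^esup>" using H by (auto simp: finite_simple_graph_def)
  have finE: "finite (edges H)" using E fin finite_imp_finite_nsets finite_subset by blast
  obtain f where f: "inj_on f ?V" "f ` ?V \<subseteq> {..<m}" "\<forall>e\<in>edges H. f ` e \<in> edges (path_power m (bandwidth H))"
    using bandwidth_attained[OF H] unfolding contains_copy_def m_def path_power_def by auto
  have "card (f ` ?V) = m" using f(1) by (simp add: card_image m_def)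
  then have im: "f ` ?V = {..<m}" using f(2) by (intro card_subset_eq) auto
  define h where "h = inv_into ?V f"
  have h: "h x \<in> ?V" "f (h x) = x" if "x < m" for x
    using that im inv_into_into[of x f ?V] f_inv_into_f[of x f ?V] by (auto simp: h_def)
  have hf: "h (f v) = v" if "v \<in> ?V" for v using f(1) that by (simp add: h_def)
  have fm: "f v < m" if "v \<in> ?V" for v using im that by auto
  have hinj: "h x = h y \<Longrightarrow> x = y" if "x < m" "y < m" for x y using h(2) that by metis
  define adj where "adj x y \<longleftrightarrow> x < m \<and> y < m \<and> {h x, h y} \<in> edges H" for x y
  define \<chi> where "\<chi> x = col (h x)" for x
  have adj_sym: "adj y x" if "adj x y" for x y using that by (simp add: adj_def insert_commute)
  have adj_col: "\<chi> x \<noteq> \<chi> y" if "adj x y" for x y using that col(1) by (auto simp: adj_def \<chi>_def proper_colouring_def)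
  have adj_near: "x \<le> y + bandwidth H" if "adj x y" for x y
  proof -
    have "f ` {h x, h y} \<in> edges (path_power m (bandwidth H))" by (rule f(3)[rule_format]) (use that in \<open>simp add: adj_def\<close>)
    then have "{x, y} \<in> edges (path_power m (bandwidth H))" using h(2) that by (simp add: adj_def)
    then show ?thesis by (auto simp: path_power_def doubleton_eq_iff)
  qed
  have adj_deg: "card {y. y < m \<and> adj x y} \<le> max_degree H" if "x < m" for x
  proof -
    have "card {y. y < m \<and> adj x y} \<le> card {e \<in> edges H. h x \<in> e}"
    proof (rule card_inj_on_le)
      show "inj_on (\<lambda>y. {h x, h y}) {y. y < m \<and> adj x y}"
        by (rule inj_onI) (auto simp: doubleton_eq_iff intro: hinj)
      show "(\<lambda>y. {h x, h y}) ` {y. y < m \<and> adj x y} \<subseteq> {e \<in> edges H. h x \<in> e}" by (auto simp: adj_def)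
    qed (use finE in simp)
    also have "\<dots> \<le> max_degree H"
      unfolding max_degree_def degree_def[symmetric] using fin h(1)[OF that] by (intro Max_ge) auto
    finally show ?thesis .
  qed
  have \<chi>3: "\<chi> x < 3" if "x < m" for x using col(1) h(1)[OF that] by (auto simp: \<chi>_def proper_colouring_def)
  have cls: "card {x. x < m \<and> \<chi> x = i} \<le> n" if "i < 3" for i
  proof -
    have "card {x. x < m \<and> \<chi> x = i} \<le> card {v \<in> ?V. col v = i}"
      by (rule card_inj_on_le[of h]) (use h(1) fin in \<open>auto simp: \<chi>_def intro!: inj_onI hinj\<close>)
    then show ?thesis using col(2) that by (meson order_trans)
  qed
  have m3: "m \<le> 3 * n"
  proof -
    have "{..<m} \<subseteq> (\<Union>i<3. {x. x < m \<and> \<chi> x = i})" using \<chi>3 by auto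
    then have "card {..<m} \<le> card (\<Union>i<3. {x. x < m \<and> \<chi> x = i})" by (intro card_mono) auto
    also have "\<dots> \<le> (\<Sum>i<3. card {x. x < m \<and> \<chi> x = i})" by (rule card_UN_le) simp
    also have "\<dots> \<le> (\<Sum>i<(3::nat). n)" using cls by (intro sum_mono) simp
    finally show ?thesis by simp
  qed
  have copy: "contains_copy (colour_graph N c k) H"
    if \<psi>: "inj_on \<psi> {..<m}" "\<forall>x<m. \<psi> x < N" "\<forall>x<m. \<forall>y<m. adj x y \<longrightarrow> c {\<psi> x, \<psi> y} = k" for N c k \<psi>
    unfolding contains_copy_def
  proof (rule exI[of _ "\<psi> \<circ> f"], intro conjI ballI)
    show inj: "inj_on (\<psi> \<circ> f) ?V" using f(1) \<psi>(1) im by (simp add: comp_inj_on)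
    show "(\<psi> \<circ> f) ` ?V \<subseteq> verts (colour_graph N c k)" using \<psi>(2) fm by (auto simp: colour_graph_def)
    fix e assume e: "e \<in> edges H"
    obtain u v where uv: "e = {u, v}" "u \<in> ?V" "v \<in> ?V" "u \<noteq> v" using nsets2_E[OF subsetD[OF E e]] by metis
    have "adj (f u) (f v)" using uv e fm hf by (simp add: adj_def)
    then have "c {\<psi> (f u), \<psi> (f v)} = k" using \<psi>(3) fm uv by blast
    moreover have "\<psi> (f u) \<noteq> \<psi> (f v)" using inj uv by (auto simp: inj_on_def)
    moreover have "\<psi> (f u) < N" "\<psi> (f v) < N" using \<psi>(2) fm uv by auto
    ultimately show "(\<psi> \<circ> f) ` e \<in> edges (colour_graph N c k)" using uv(1) by (simp add: colour_graph_def)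
  qed
  show ?thesis
    by (rule exI[of _ m], rule exI[of _ \<chi>], rule exI[of _ adj])
      (intro conjI allI impI; (rule m3 copy | erule adj_sym adj_col adj_near adj_deg \<chi>3 cls); assumption)
qed

text \<open>The interval length b G is kept near \<xi> n with \<xi> small against \<open>M\<close>,
  which controls the square root. Then b, about \<beta> n, is taken so small that an interval has
  more than D blocks and the share of about D/G in transit is negligible.\<close>

lemma error_parameters:
  fixes \<delta> \<kappa> :: real and M D :: nat
  assumes \<delta>: "0 < \<delta>" and \<kappa>: "0 < \<kappa>"
  shows "\<exists>\<beta>>0. \<exists>n1. \<forall>n\<ge>n1. \<exists>b G. 0 < b \<and> D < G \<and> (\<forall>w::nat. real w \<le> \<beta> * real n \<longrightarrow> w \<le> b) \<and> real b < \<kappa> * real n \<and>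
    (\<forall>m\<le>3 * n. M * sqrt (b * G * m) + (m div (b * G) + 1) * (D * b) \<le> \<delta> * real n)"
proof -
  define \<xi> where "\<xi> = (\<delta> / (2 * (real M + 1)))\<^sup>2 / 3"
  have \<xi>: "0 < \<xi>" using \<delta> by (simp add: \<xi>_def add_nonneg_pos)
  have s\<xi>: "sqrt (3 * \<xi>) = \<delta> / (2 * (real M + 1))" using \<delta> by (simp add: \<xi>_def)
  \<comment> \<open>The three bounds serve the transit term, the inequality \<open>D < G\<close>,
    and b < \<kappa> n.\<close>
  define \<beta> where "\<beta> = Min {\<delta> / (2 * ((D + 1) * (6 / \<xi> + 1))), \<xi> / (D + 2), \<kappa> / 2}"
  have c1: "0 < \<delta> / (2 * ((D + 1) * (6 / \<xi> + 1)))" using \<delta> \<xi> by (intro divide_pos_pos mult_pos_pos add_pos_pos) auto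
  have \<beta>: "0 < \<beta>" "\<beta> \<le> \<delta> / (2 * ((D + 1) * (6 / \<xi> + 1)))" "\<beta> \<le> \<xi> / (D + 2)" "\<beta> \<le> \<kappa> / 2"
    unfolding \<beta>_def using c1 \<xi> \<kappa> by (simp_all only: Min_gr_iff Min_le finite.intros insert_iff empty_iff insert_not_empty simp_thms ball_simps) (auto intro!: divide_pos_pos add_nonneg_pos)
  show ?thesis
  proof (rule exI[of _ \<beta>], rule conjI[OF \<beta>(1)], rule exI[of _ "nat \<lceil>1 / \<beta>\<rceil> + 1"], intro allI impI)
    fix n assume n: "nat \<lceil>1 / \<beta>\<rceil> + 1 \<le> n"
    have n0: "0 < real n" using n by simp
    have "1 / \<beta> \<le> real n" using n by linarith
    then have \<beta>n: "1 \<le> \<beta> * n" using \<beta>(1) by (simp add: field_simps)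
    define b where "b = nat \<lfloor>\<beta> * n\<rfloor>"
    have b: "0 < b" "real b \<le> \<beta> * n" using \<beta>n by (auto simp: b_def)
    define G where "G = nat \<lfloor>\<xi> * n / b\<rfloor>"
    have "\<beta> * (D + 2) \<le> \<xi>" using \<beta>(3) by (simp add: field_simps)
    then have "\<beta> * (D + 2) * n \<le> \<xi> * n" using n0 by (intro mult_right_mono) auto
    moreover have "real b * (D + 2) \<le> \<beta> * n * (D + 2)" using b by (intro mult_right_mono) auto
    moreover have "\<beta> * n * (D + 2) = \<beta> * (D + 2) * n" by simp
    ultimately have bD: "real b * (D + 2) \<le> \<xi> * n" by linarith
    then have "real D + 2 \<le> \<xi> * n / b" using b by (simp add: field_simps)
    then have "D < G" unfolding G_def by linarith
    have q0: "0 \<le> \<xi> * n / b" using \<xi> by simp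
    have "real G \<le> \<xi> * n / b" using q0 by (simp add: G_def)
    then have bG: "real b * real G \<le> \<xi> * n" using b by (simp add: field_simps)
    have "\<xi> * n / b \<le> real G + 1" using q0 unfolding G_def by linarith
    then have "\<xi> * n \<le> (real G + 1) * b" using b by (simp add: field_simps)
    moreover have "real b * 2 \<le> real b * (D + 2)" by (intro mult_left_mono) auto
    then have "real b * 2 \<le> \<xi> * n" using bD by linarith
    ultimately have bG2: "\<xi> * n / 2 \<le> real b * real G" by (simp add: algebra_simps)
    have err: "M * sqrt (b * G * m) + (m div (b * G) + 1) * (D * b) \<le> \<delta> * real n" if m: "m \<le> 3 * n" for m
    proof -
      have m': "real m \<le> 3 * real n" using m by linarith
      have "real (b * G * m) \<le> (\<xi> * n) * (3 * n)" using mult_mono[OF bG m'] \<xi> by simp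
      also have "\<dots> = (3 * \<xi>) * (real n)\<^sup>2" by (simp add: power2_eq_square)
      finally have "sqrt (b * G * m) \<le> sqrt ((3 * \<xi>) * (real n)\<^sup>2)" by (rule real_sqrt_le_mono)
      also have "\<dots> = \<delta> / (2 * (real M + 1)) * n" unfolding real_sqrt_mult[of "3 * \<xi>"] s\<xi> by simp
      finally have "M * sqrt (b * G * m) \<le> M * (\<delta> / (2 * (real M + 1)) * n)" by (intro mult_left_mono) auto
      also have "\<dots> \<le> (real M + 1) * (\<delta> / (2 * (real M + 1)) * n)" using \<delta> by (intro mult_right_mono) auto
      also have "\<dots> = \<delta> * n / 2" by (simp add: field_simps)
      finally have 1: "M * sqrt (b * G * m) \<le> \<delta> * n / 2" .
      have bGp: "0 < real b * real G" using b \<open>D < G\<close> by simp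
      have "real (m div (b * G)) \<le> real m / (real b * real G)" by (metis of_nat_div_le_of_nat of_nat_mult)
      also have "\<dots> \<le> (3 * n) / (\<xi> * n / 2)" using m' bG2 \<xi> n0 by (intro frac_le) auto
      also have "\<dots> = 6 / \<xi>" using \<xi> n0 by (simp add: field_simps)
      finally have a1: "real (m div (b * G)) + 1 \<le> 6 / \<xi> + 1" by simp
      have a2: "real D * real b \<le> (real D + 1) * (\<beta> * n)" using b by (intro mult_mono) auto
      have "(real (m div (b * G)) + 1) * (real D * real b) \<le> (6 / \<xi> + 1) * ((real D + 1) * (\<beta> * n))"
        using \<xi> by (intro mult_mono[OF a1 a2]) auto
      also have "\<dots> = \<beta> * ((D + 1) * (6 / \<xi> + 1)) * n" by (simp add: mult_ac)
      also have "\<dots> \<le> \<delta> / (2 * ((D + 1) * (6 / \<xi> + 1))) * ((D + 1) * (6 / \<xi> + 1)) * n"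
        using \<beta>(2) \<xi> by (intro mult_right_mono) auto
      also have "\<dots> = \<delta> * n / 2"
      proof -
        have "(D + 1) * (6 / \<xi> + 1) \<noteq> 0" using \<xi> by (simp add: add_pos_pos less_imp_neq[symmetric])
        then show ?thesis by simp
      qed
      finally have "(real (m div (b * G)) + 1) * (real D * real b) \<le> \<delta> * n / 2" .
      then show ?thesis using 1 by (simp add: algebra_simps)
    qed
    have "w \<le> b" if "real w \<le> \<beta> * n" for w using that by (simp add: b_def le_nat_floor)
    moreover have "real b < \<kappa> * n"
    proof -
      have "\<beta> * n \<le> \<kappa> / 2 * n" using \<beta>(4) by (intro mult_right_mono) auto
      moreover have "\<kappa> / 2 * n < \<kappa> * n" using \<kappa> n0 by simp
      ultimately show ?thesis using b(2) by linarith
    qed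
    ultimately show "\<exists>b G. 0 < b \<and> D < G \<and> (\<forall>w::nat. real w \<le> \<beta> * real n \<longrightarrow> w \<le> b) \<and> real b < \<kappa> * real n \<and>
      (\<forall>m\<le>3 * n. M * sqrt (b * G * m) + (m div (b * G) + 1) * (D * b) \<le> \<delta> * real n)"
      using b(1) \<open>D < G\<close> err by (intro exI[of _ b] exI[of _ G]) simp
  qed
qed

text \<open>To first order the extra vertices gain g/18 on the right, from which \<tau> takes g/200
  and the factor 1 - 2\<eta> takes 2g/200, while the left side costs 3g/200.\<close>

lemma density_arithmetic:
  fixes g :: real
  assumes "0 < g" "g \<le> 1"
  shows "(1 + g/200) * (1 + 2 * (g/200)) \<le> (1 - 2 * (g/200)) * ((1/9 - g/1800) * (9 + g/2))"
proof -
  have "g * g * g \<ge> 0" "g * g \<le> g" using assms by (simp_all add: mult_left_le)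
  then show ?thesis by (simp add: field_simps) (use assms in linarith)
qed

theorem theorem1p2:
  fixes \<gamma> :: real and \<Delta> :: nat
  assumes "\<gamma> > 0"
  shows "\<exists>(\<beta>::real) (n\<^sub>0::nat). \<beta> > 0 \<and>
    (\<forall>n\<ge>n\<^sub>0. \<forall>H :: 'a sgraph.
       finite_simple_graph H \<and>
       max_degree H \<le> \<Delta> \<and>
       real (bandwidth H) \<le> \<beta> * real n \<and>
       (\<exists>c. proper_colouring H 3 c \<and> (\<forall>i<3. card {v \<in> verts H. c v = i} \<le> n))
       \<longrightarrow> real (ramsey_number H H) \<le> (9 + \<gamma>) * real n)"
proof -
  define g where "g = min \<gamma> 1"
  have g: "0 < g" "g \<le> 1" "g \<le> \<gamma>" using assms by (auto simp: g_def)
  define \<eta> where "\<eta> = g / 200"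
  have \<eta>: "0 < \<eta>" "\<eta> \<le> 1" using g by (auto simp: \<eta>_def)
  define \<tau> where "\<tau> = g / 1800"
  have \<tau>: "0 < \<tau>" "\<tau> \<le> 1/9" "\<tau> < 1/9" using g by (auto simp: \<tau>_def)
  \<comment> \<open>Chosen so that exceptional vertices take exactly half of the share
    (1/4)^\<Delta> \<eta> left to the greedy embedding.\<close>
  define \<zeta> where "\<zeta> = (1/4) ^ \<Delta> * \<eta> / (2 * (real \<Delta> + 1))"
  have p4: "0 < (1/4::real) ^ \<Delta>" "(1/4::real) ^ \<Delta> \<le> 1" by (auto intro: power_le_one)
  have cancel: "q * (a / (2 * q)) = a / 2" if "q \<noteq> 0" for a q :: real using that by simp
  have "(real \<Delta> + 1) * \<zeta> = (1/4) ^ \<Delta> * \<eta> / 2" unfolding \<zeta>_def by (rule cancel) linarith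
  moreover have "0 < \<zeta>" unfolding \<zeta>_def using p4 \<eta> by (intro divide_pos_pos mult_pos_pos) auto
  ultimately have \<zeta>: "0 < \<zeta>" "(\<Delta> + 1) * \<zeta> = (1/4) ^ \<Delta> * \<eta> / 2" by (simp_all add: add.commute)
  have "\<zeta> \<le> (\<Delta> + 1) * \<zeta>" using \<zeta>(1) by (simp add: algebra_simps)
  moreover have "(1/4) ^ \<Delta> * \<eta> \<le> 1 * (1/200)" using p4 g by (intro mult_mono) (auto simp: \<eta>_def)
  ultimately have \<zeta>4: "\<zeta> \<le> 1/4" using \<zeta>(2) by linarith
  obtain \<mu> M D N0 where \<mu>: "0 < \<mu>" and tp: "\<forall>N\<ge>N0. \<forall>c. \<exists>k. \<exists>X :: ((nat \<Rightarrow> nat set) \<times> nat) set. \<exists>E T ord \<rho>.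
    triangle_packing c N \<zeta> \<mu> \<eta> \<tau> M D k X (\<lambda>x. fst x (snd x)) E T ord \<rho>"
    using triangle_packing_exists[OF \<tau>(1,2) \<eta> \<zeta>(1) \<zeta>4] by (elim exE conjE) (rule that)
  have "0 < \<eta> * \<mu>" "0 < (1/4) ^ \<Delta> * \<eta> / 2 * \<mu>" using \<eta> \<mu> p4 by auto
  from error_parameters[OF this, of D M]
  obtain \<beta> n1 where \<beta>: "0 < \<beta>" and par: "\<forall>n\<ge>n1. \<exists>b G. 0 < b \<and> D < G \<and> (\<forall>w::nat. real w \<le> \<beta> * real n \<longrightarrow> w \<le> b) \<and>
      real b < (1/4) ^ \<Delta> * \<eta> / 2 * \<mu> * real n \<and>
      (\<forall>m\<le>3 * n. M * sqrt (b * G * m) + (m div (b * G) + 1) * (D * b) \<le> \<eta> * \<mu> * real n)"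
    by (elim exE conjE) (rule that)
  \<comment> \<open>The last summand absorbs rounding: once g n is at least 2, N is still at least
    (9 + g/2) n.\<close>
  define n2 where "n2 = n1 + N0 + nat \<lceil>2 / g\<rceil>"
  show ?thesis
  proof (rule exI[of _ \<beta>], rule exI[of _ n2], rule conjI[OF \<beta>], intro allI impI, elim conjE exE)
    fix n and H :: "'a sgraph" and col
    assume n: "n2 \<le> n" and H: "finite_simple_graph H" "max_degree H \<le> \<Delta>" "real (bandwidth H) \<le> \<beta> * real n"
      and col: "proper_colouring H 3 col" "\<forall>i<3. card {v \<in> verts H. col v = i} \<le> n"
    have nn: "n1 \<le> n" "N0 \<le> n" using n by (auto simp: n2_def)
    have "2 / g \<le> n" using n unfolding n2_def by linarith
    then have n2g: "2 \<le> g * n" using g by (simp add: field_simps)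
    define N where "N = nat \<lfloor>(9 + g) * n\<rfloor>"
    have N: "N \<le> (9 + g) * n" using g by (simp add: N_def)
    have "(9 + g) * n - 1 \<le> N" unfolding N_def by linarith
    then have N9: "(9 + g / 2) * n \<le> N" using n2g by (simp add: algebra_simps)
    have "0 \<le> (8 + g / 2) * n" using g by simp
    then have nN: "real n \<le> N" using N9 by (simp add: algebra_simps)
    then have N0: "N0 \<le> N" using nn by simp
    obtain b G where bG: "0 < b" "D < G" "\<forall>w::nat. real w \<le> \<beta> * real n \<longrightarrow> w \<le> b"
      "real b < (1/4) ^ \<Delta> * \<eta> / 2 * \<mu> * real n"
      "\<forall>m\<le>3 * n. M * sqrt (b * G * m) + (m div (b * G) + 1) * (D * b) \<le> \<eta> * \<mu> * real n"
      using par[rule_format, OF nn(1)] by (elim exE conjE) (rule that)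
    have bw: "bandwidth H \<le> b" using bG(3) H(3) by blast
    obtain m and \<chi> :: "nat \<Rightarrow> nat" and adj where m: "m \<le> 3 * n"
      and adj: "\<forall>x y. adj x y \<longrightarrow> adj y x \<and> \<chi> x \<noteq> \<chi> y \<and> x \<le> y + bandwidth H"
        "\<forall>x<m. card {y. y < m \<and> adj x y} \<le> max_degree H"
      and \<chi>: "\<forall>x<m. \<chi> x < 3" "\<forall>i<3. card {x. x < m \<and> \<chi> x = i} \<le> n"
      and copy: "\<forall>N c k \<psi>. inj_on \<psi> {..<m} \<longrightarrow> (\<forall>x<m. \<psi> x < N) \<longrightarrow>
        (\<forall>x<m. \<forall>y<m. adj x y \<longrightarrow> c {\<psi> x, \<psi> y} = k) \<longrightarrow> contains_copy (colour_graph N c k) H"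
      using bandwidth_layout[OF H(1) col] by (elim exE conjE) (rule that)
    have "n * ((1 + \<eta>) * (1 + 2 * \<eta>)) \<le> n * ((1 - 2 * \<eta>) * ((1/9 - \<tau>) * (9 + g/2)))"
      unfolding \<eta>_def \<tau>_def using density_arithmetic[OF g(1,2)] by (intro mult_left_mono) auto
    also have "\<dots> = (1 - 2 * \<eta>) * ((1/9 - \<tau>) * ((9 + g/2) * n))" by (simp add: mult_ac)
    also have "\<dots> \<le> (1 - 2 * \<eta>) * ((1/9 - \<tau>) * N)" using N9 \<tau> g by (intro mult_left_mono) (auto simp: \<eta>_def)
    finally have main: "n * ((1 + \<eta>) * (1 + 2 * \<eta>)) \<le> (1 - 2 * \<eta>) * ((1/9 - \<tau>) * N)" .
    have "\<eta> * \<mu> * n \<le> \<eta> * \<mu> * N" using nN \<eta> \<mu> by (intro mult_left_mono) auto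
    then have err: "M * sqrt (b * G * m) + (m div (b * G) + 1) * (D * b) \<le> \<eta> * (\<mu> * N)"
      using bG(5)[rule_format, OF m] by (simp add: mult.assoc)
    have req: "((1/4) ^ \<Delta> * \<eta> - (\<Delta> + 1) * \<zeta>) * (\<mu> * N) = (1/4) ^ \<Delta> * \<eta> / 2 * \<mu> * N"
      unfolding \<zeta>(2) by (simp add: algebra_simps)
    have "(1/4) ^ \<Delta> * \<eta> / 2 * \<mu> * n \<le> (1/4) ^ \<Delta> * \<eta> / 2 * \<mu> * N" using nN \<eta> \<mu> p4 by (intro mult_left_mono) auto
    then have room: "b < ((1/4) ^ \<Delta> * \<eta> - (\<Delta> + 1) * \<zeta>) * (\<mu> * N)" unfolding req using bG(4) by linarith
    have mono: "\<exists>k. contains_copy (colour_graph N c k) H" for c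
    proof -
      obtain k and X :: "((nat \<Rightarrow> nat set) \<times> nat) set" and E T ord \<rho>
        where "triangle_packing c N \<zeta> \<mu> \<eta> \<tau> M D k X (\<lambda>x. fst x (snd x)) E T ord \<rho>"
        using tp[rule_format, OF N0, of c] by (elim exE) (rule that)
      then interpret triangle_packing c N \<zeta> \<mu> \<eta> \<tau> M D k X "\<lambda>x. fst x (snd x)" E T ord \<rho> .
      have "\<exists>\<psi>. inj_on \<psi> {..<m} \<and> (\<forall>x<m. \<psi> x < N) \<and> (\<forall>x<m. \<forall>y<m. adj x y \<longrightarrow> c {\<psi> x, \<psi> y} = k)"
      proof (rule embedding[OF \<zeta>(1) _ \<tau>(3) _ bG(1,2) _ _ _ _ _ _ main err room])
        show "x \<le> y + b" if "adj x y" for x y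
        proof -
          have "x \<le> y + bandwidth H" using adj(1) that by blast
          then show ?thesis using bw by linarith
        qed
        show "card {y. y < m \<and> adj x y} \<le> \<Delta>" if "x < m" for x using adj(2) that H(2) by (meson order_trans)
      qed (use \<eta> adj(1) \<chi> in auto)
      then show ?thesis using copy by blast
    qed
    have "arrows N H H" unfolding arrows_def
    proof
      fix c
      obtain k where k: "contains_copy (colour_graph N c k) H" using mono[of c] by (rule exE)
      show "contains_copy (colour_graph N c Red) H \<or> contains_copy (colour_graph N c Blue) H"
        using k by (cases k) auto
    qed
    then have "ramsey_number H H \<le> N" unfolding ramsey_number_def by (rule Least_le)
    then have "real (ramsey_number H H) \<le> N" by simp
    also have "\<dots> \<le> (9 + g) * n" by (rule N)
    also have "\<dots> \<le> (9 + \<gamma>) * n" using g by (intro mult_right_mono) auto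
    finally show "real (ramsey_number H H) \<le> (9 + \<gamma>) * real n" .
  qed
qed

end
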